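(* Assume that $\beta>\frac43$, $\gamma>1$, and that $K$ is a smooth, symmetric, positive semi-definite $3\times3$ axisymmetric matrix-valued function (on $\partial\Omega$) such that $K+2D(n)$ is positive definite on some subset $\Sigma\subset\partial\Omega$ with $|\Sigma|>0$. Suppose that, for some $q>3$, $0\le\rho_0\in W^{1,q}$, $\mathbf u_0\in\tilde H^1$, $\mathbf m_0=\rho_0\mathbf u_0$, and that $\rho_0,\mathbf u_0$ are axisymmetric and periodic in $x_3$ with period $1$. Assume further that there exists some point $x_0\in\Omega$ such that $\rho_0(x_0)=0$. Let $(\rho,\mathbf u)$ be the unique global strong solution in the axisymmetric class, in the regularity class recalled in the context, of $$\begin{cases}\rho_t+\operatorname{div}(\rho\mathbf u)=0,\\ (\rho\mathbf u)_t+\operatorname{div}(\rho\mathbf u\otimes\mathbf u)-\mu\Delta\mathbf u-\nabla((\mu+\lambda)\operatorname{div}\mathbf u)+\nabla P=0,\end{cases}$$ with $P=\rho^\gamma$, $\mu>0$ constant, $\lambda=\rho^\beta$, initial conditions $\rho(x,0)=\rho_0(x)$, $\rho\mathbf u(x,0)=\mathbf m_0(x)$, and boundary conditions $\mathbf u\cdot n=0$, $\operatorname{curl}\mathbf u\times n=-K\mathbf u$ on $\partial\Omega$, and let $\alpha_0>0$ be the exponential decay rate recalled in the context. Then for any $r>2$ there exists a positive constant $C$ depending only on $r,\gamma,\beta,\mu,\|\mathbf u_0\|_{H^1},\|\rho_0\|_{L^1\cap L^\infty}$ and $K$ such that for any $t\ge1$, $$\|\nabla\rho(\cdot,t)\|_{L^r}\ge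 Ce^{\alpha_0\frac{r-2}{r}t}.$$
   Context: Domain: $\Omega=A\times\mathbb T$, $A=\{(x_1,x_2)\in\mathbb R^2:1<x_1^2+x_2^2<4\}$, $\mathbb T=\mathbb R/\mathbb Z$ (the flow is periodic in $x_3$ with period 1), so $\partial\Omega=\{r=1\}\cup\{r=2\}$ with $r=\sqrt{x_1^2+x_2^2}$. $n$ is the unit outer normal to $\partial\Omega$, extended to a neighbourhood of $\partial\Omega$ as $n=\mathbf e_r$ near $r=2$ and $n=-\mathbf e_r$ near $r=1$; for a vector field $v$, $D(v)=\frac12(\nabla v+(\nabla v)^{\mathrm{tr}})$. Cylindrical coordinates $x_1=r\cos\theta,\ x_2=r\sin\theta,\ x_3=z$; $\mathbf e_r=(x_1,x_2,0)/r$, $\mathbf e_\theta=(-x_2,x_1,0)/r$, $\mathbf e_z=(0,0,1)$. A scalar function $g$, or a vector function $\mathbf f=f_r\mathbf e_r+f_\theta\mathbf e_\theta+f_z\mathbf e_z$, is axisymmetric if $g$, respectively $f_r,f_\theta,f_z$, are independent of $\theta$ (for matrices: the components in the basis $\mathbf e_r,\mathbf e_\theta,\mathbf e_z$ are independent of $\theta$). $L^r,W^{s,r},H^s=W^{s,2}$ denote the Lebesgue and Sobolev spaces on $\Omega$; $\tilde H^1=\{v\in H^1(\Omega): v\cdot n=0,\ \operatorname{curl}v\times n=-Kv\text{ on }\partial\Omega\}$; $\overline f=\frac1{|\Omega|}\int_\Omega f\,dx$. A strong solution in the axisymmetric class is a pair $(\rho,\mathbf u)$, axisymmetric and 1-periodic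 in $x_3$, satisfying the system in the sense of distributions, such that all derivatives involved are regular distributions and the system holds almost everywhere in $\Omega\times(0,T)$. Regularity class: for any $0<T<\infty$, $\rho\in C([0,T];W^{1,q})$, $\rho_t\in L^\infty(0,T;L^2)$, $\mathbf u\in L^\infty(0,T;H^1)\cap L^{(q+1)/q}(0,T;W^{2,q})$, $t^{1/2}\mathbf u\in L^2(0,T;W^{2,q})\cap L^\infty(0,T;H^2)$, $t^{1/2}\mathbf u_t\in L^2(0,T;H^1)$, $\rho\mathbf u\in C([0,T];L^2)$, $\sqrt\rho\,\mathbf u_t\in L^2(\Omega\times(0,T))$. Under the stated hypotheses (without the vacuum point) the paper shows that a unique such solution exists, that $\sup_{t\ge0}\|\rho(\cdot,t)\|_{L^\infty}\le C$, and that for any $p\in[1,\infty)$ there are positive constants $C,\alpha_0$ depending only on $p,\gamma,\beta,\mu,\|\rho_0\|_{L^\infty},\|\mathbf u_0\|_{H^1},K$ with $\|\rho(\cdot,t)-\overline{\rho_0}\|_{L^p}+\|\nabla\mathbf u(\cdot,t)\|_{L^p}\le Ce^{-\alpha_0t}$ for all $t\ge1$. The $\alpha_0$ in the claim is the rate in this estimate for $p=2$.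
   Formalization: The initial density is additionally assumed not to vanish almost everywhere: for density identically zero and zero velocity all hypotheses hold, but the solution is zero and the claimed positive lower bound on the density gradient fails. *)

theory Defs
  imports "HOL-Analysis.Analysis"
begin

text \<open>
  The domain is \<open>A \<times> \<real>/\<int>\<close> with \<open>A\<close> the annulus \<open>1 < r < 2\<close>. A function on it is represented by a
  function on the covering \<open>A \<times> \<real>\<close> that is 1-periodic in \<open>x\<^sub>3\<close>. Distributional derivatives are taken
  on the (open) covering, which for periodic functions is the same as on the quotient; norms, means
  and integrals are taken over the fundamental cell \<open>0 \<le> x\<^sub>3 < 1\<close>.
\<close>

definition radius :: "real^3 \<Rightarrow> real" where
  "radius x = sqrt ((x$1)^2 + (x$2)^2)"

definition Omega :: "(real^3) set" where
  "Omega = {x. 1 < (x$1)^2 + (x$2)^2 \<and> (x$1)^2 + (x$2)^2 < 4}"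

definition bdry :: "(real^3) set" where
  "bdry = {x. radius x = 1 \<or> radius x = 2}"

definition Cell :: "(real^3) set" where
  "Cell = {x \<in> Omega. 0 \<le> x$3 \<and> x$3 < 1}"

definition periodic_z :: "(real^3 \<Rightarrow> 'b) \<Rightarrow> bool" where
  "periodic_z f \<longleftrightarrow> (\<forall>x\<in>Omega. f (x + axis 3 1) = f x)"

definition e_r :: "real^3 \<Rightarrow> real^3" where
  "e_r x = vector [x$1 / radius x, x$2 / radius x, 0]"

definition e_th :: "real^3 \<Rightarrow> real^3" where
  "e_th x = vector [- x$2 / radius x, x$1 / radius x, 0]"

definition e_z :: "real^3 \<Rightarrow> real^3" where
  "e_z x = vector [0, 0, 1]"

text \<open>Axisymmetry of functions that are only determined almost everywhere.\<close>

definition axisymmetric :: "(real^3 \<Rightarrow> real) \<Rightarrow> bool" where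
  "axisymmetric g \<longleftrightarrow> (\<exists>G. AE x in lebesgue_on Omega. g x = G (radius x) (x$3))"

definition axisymmetric_vec :: "(real^3 \<Rightarrow> real^3) \<Rightarrow> bool" where
  "axisymmetric_vec f \<longleftrightarrow> (\<forall>e\<in>{e_r, e_th, e_z}. axisymmetric (\<lambda>x. f x \<bullet> e x))"


section \<open>Smooth functions and weak derivatives\<close>

fun C_k :: "nat \<Rightarrow> 'a::euclidean_space set \<Rightarrow> ('a \<Rightarrow> 'b::real_normed_vector) \<Rightarrow> bool" where
  "C_k 0 U f \<longleftrightarrow> continuous_on U f"
| "C_k (Suc k) U f \<longleftrightarrow> (\<forall>x\<in>U. f differentiable (at x)) \<and>
     (\<forall>b\<in>Basis. C_k k U (\<lambda>x. frechet_derivative f (at x) b))"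

definition smooth :: "'a::euclidean_space set \<Rightarrow> ('a \<Rightarrow> 'b::real_normed_vector) \<Rightarrow> bool" where
  "smooth U f \<longleftrightarrow> (\<forall>k. C_k k U f)"

definition test_fun :: "'a::euclidean_space set \<Rightarrow> ('a \<Rightarrow> real) \<Rightarrow> bool" where
  "test_fun U \<phi> \<longleftrightarrow> smooth UNIV \<phi> \<and> compact (closure {x. \<phi> x \<noteq> 0}) \<and> closure {x. \<phi> x \<noteq> 0} \<subseteq> U"

definition locally_integrable ::
    "'a::euclidean_space set \<Rightarrow> ('a \<Rightarrow> 'b::euclidean_space) \<Rightarrow> bool" where
  "locally_integrable U f \<longleftrightarrow> (\<forall>S. compact S \<and> S \<subseteq> U \<longrightarrow> f absolutely_integrable_on S)"

definition weak_deriv ::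
    "'a::euclidean_space set \<Rightarrow> 'a \<Rightarrow> ('a \<Rightarrow> 'b::euclidean_space) \<Rightarrow> ('a \<Rightarrow> 'b) \<Rightarrow> bool" where
  "weak_deriv U b f g \<longleftrightarrow> locally_integrable U f \<and> locally_integrable U g \<and>
     (\<forall>\<phi>. test_fun U \<phi> \<longrightarrow>
        (LINT x:U|lebesgue. frechet_derivative \<phi> (at x) b *\<^sub>R f x) = - (LINT x:U|lebesgue. \<phi> x *\<^sub>R g x))"

definition weakly_diff :: "'a::euclidean_space set \<Rightarrow> 'a \<Rightarrow> ('a \<Rightarrow> 'b::euclidean_space) \<Rightarrow> bool" where
  "weakly_diff U b f \<longleftrightarrow> (\<exists>g. weak_deriv U b f g)"

text \<open>
  A representative of the weak derivative, which is unique up to null sets when it exists. It is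
  meaningful only together with \<^const>\<open>weakly_diff\<close>.
\<close>

definition wd :: "'a::euclidean_space set \<Rightarrow> 'a \<Rightarrow> ('a \<Rightarrow> 'b::euclidean_space) \<Rightarrow> 'a \<Rightarrow> 'b" where
  "wd U b f = (SOME g. weak_deriv U b f g)"

abbreviation pd :: "3 \<Rightarrow> (real^3 \<Rightarrow> 'b::euclidean_space) \<Rightarrow> real^3 \<Rightarrow> 'b" where
  "pd i f \<equiv> wd Omega (axis i 1) f"

definition grad :: "(real^3 \<Rightarrow> real) \<Rightarrow> real^3 \<Rightarrow> real^3" where
  "grad f x = (\<chi> i. pd i f x)"

definition jacobian :: "(real^3 \<Rightarrow> real^3) \<Rightarrow> real^3 \<Rightarrow> real^3^3" where
  "jacobian v x = (\<chi> i j. pd j v x $ i)"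

definition curl :: "(real^3 \<Rightarrow> real^3) \<Rightarrow> real^3 \<Rightarrow> real^3" where
  "curl v x = vector [pd 2 v x $ 3 - pd 3 v x $ 2, pd 3 v x $ 1 - pd 1 v x $ 3,
                      pd 1 v x $ 2 - pd 2 v x $ 1]"


section \<open>Lebesgue, Sobolev and Bochner norms\<close>

definition epowr :: "ennreal \<Rightarrow> real \<Rightarrow> ennreal" where
  "epowr a p = (if a = \<infinity> then \<infinity> else ennreal (enn2real a powr p))"

text \<open>
  All norms take values in \<open>[0,\<infinity>]\<close> and equal \<open>\<infinity>\<close> exactly outside the space in question, so that
  membership in a space is finiteness of its norm.
\<close>

definition Lnorm :: "real \<Rightarrow> (real^3 \<Rightarrow> 'b::euclidean_space) \<Rightarrow> ennreal" where
  "Lnorm p f = (if f \<in> borel_measurable (lebesgue_on Cell)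
     then epowr (\<integral>\<^sup>+ x. ennreal (norm (f x) powr p) \<partial>(lebesgue_on Cell)) (1/p) else \<infinity>)"

definition Linf_norm :: "(real^3 \<Rightarrow> 'b::euclidean_space) \<Rightarrow> ennreal" where
  "Linf_norm f = (if f \<in> borel_measurable (lebesgue_on Cell)
     then Inf {c. AE x in lebesgue_on Cell. ennreal (norm (f x)) \<le> c} else \<infinity>)"

text \<open>The \<open>p\<close>-th power of the \<open>W\<^sup>k\<^sup>,\<^sup>p\<close> norm, i.e. the sum of the \<open>p\<close>-th powers of the \<open>L\<^sup>p\<close> norms
  of all partial derivatives of order at most \<open>k\<close>.\<close>

fun W_power :: "nat \<Rightarrow> real \<Rightarrow> (real^3 \<Rightarrow> 'b::euclidean_space) \<Rightarrow> ennreal" where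
  "W_power 0 p f = epowr (Lnorm p f) p"
| "W_power (Suc k) p f = epowr (Lnorm p f) p +
     (\<Sum>i\<in>UNIV. if weakly_diff Omega (axis i 1) f then W_power k p (pd i f) else \<infinity>)"

definition Wnorm :: "nat \<Rightarrow> real \<Rightarrow> (real^3 \<Rightarrow> 'b::euclidean_space) \<Rightarrow> ennreal" where
  "Wnorm k p f = epowr (W_power k p f) (1/p)"

definition mean :: "(real^3 \<Rightarrow> real) \<Rightarrow> real" where
  "mean f = (LINT x|lebesgue_on Cell. f x) / measure lebesgue Cell"

text \<open>
  \<open>C([0,T];X)\<close>, \<open>L\<^sup>p(0,T;X)\<close> and \<open>L\<^sup>\<infinity>(0,T;X)\<close> for the space \<open>X\<close> with extended norm \<open>N\<close>. The spaces \<open>X\<close>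
  used are separable \<open>L\<^sup>p\<close> and \<open>W\<^sup>k\<^sup>,\<^sup>p\<close> spaces with \<open>1 < p < \<infinity>\<close>, for which strong measurability in time is
  joint measurability.
\<close>

definition in_C :: "real \<Rightarrow> ((real^3 \<Rightarrow> 'b) \<Rightarrow> ennreal) \<Rightarrow> (real \<Rightarrow> real^3 \<Rightarrow> 'b::euclidean_space) \<Rightarrow> bool" where
  "in_C T N f \<longleftrightarrow> (\<forall>t\<in>{0..T}. N (f t) < \<infinity> \<and>
     ((\<lambda>s. N (\<lambda>x. f s x - f t x)) \<longlongrightarrow> 0) (at t within {0..T}))"

definition in_L ::
    "real \<Rightarrow> real \<Rightarrow> ((real^3 \<Rightarrow> 'b) \<Rightarrow> ennreal) \<Rightarrow> (real \<Rightarrow> real^3 \<Rightarrow> 'b::euclidean_space) \<Rightarrow> bool" where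
  "in_L p T N f \<longleftrightarrow> (\<lambda>(t, x). f t x) \<in> borel_measurable (lebesgue_on ({0<..<T} \<times> Omega)) \<and>
     (\<integral>\<^sup>+ t. epowr (N (f t)) p \<partial>(lebesgue_on {0<..<T})) < \<infinity>"

definition in_Linf ::
    "real \<Rightarrow> ((real^3 \<Rightarrow> 'b) \<Rightarrow> ennreal) \<Rightarrow> (real \<Rightarrow> real^3 \<Rightarrow> 'b::euclidean_space) \<Rightarrow> bool" where
  "in_Linf T N f \<longleftrightarrow> (\<lambda>(t, x). f t x) \<in> borel_measurable (lebesgue_on ({0<..<T} \<times> Omega)) \<and>
     (\<exists>M::real. AE t in lebesgue_on {0<..<T}. N (f t) \<le> ennreal M)"


section \<open>Boundary conditions\<close>

text \<open>The outer normal, extended to a neighbourhood of the boundary.\<close>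

definition normal :: "real^3 \<Rightarrow> real^3" where
  "normal x = (if radius x < 3/2 then - e_r x else e_r x)"

text \<open>The nearest boundary point.\<close>

definition to_bdry :: "real^3 \<Rightarrow> real^3" where
  "to_bdry x = (let R = (if radius x < 3/2 then 1 else 2) in
     vector [R * x$1 / radius x, R * x$2 / radius x, x$3])"

text \<open>
  Equality on the boundary in the sense of traces: the averages of \<open>|F - G|\<close> over the boundary
  layer of width \<open>s\<close> tend to 0. For functions in \<open>W\<^sup>1\<^sup>,\<^sup>1\<close> this is equality of the Sobolev traces; it
  also makes sense for the curl of an \<open>H\<^sup>1\<close> field, which has no Sobolev trace in general.
\<close>

definition eq_on_bdry :: "(real^3 \<Rightarrow> 'b::euclidean_space) \<Rightarrow> (real^3 \<Rightarrow> 'b) \<Rightarrow> bool" where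
  "eq_on_bdry F G \<longleftrightarrow>
     ((\<lambda>s. (\<integral>\<^sup>+ x. ennreal (norm (F x - G x))
              \<partial>(lebesgue_on {x\<in>Cell. radius x < 1 + s \<or> 2 - s < radius x})) / ennreal s)
        \<longlongrightarrow> 0) (at_right 0)"

definition slip_conditions :: "(real^3 \<Rightarrow> real^3^3) \<Rightarrow> (real^3 \<Rightarrow> real^3) \<Rightarrow> bool" where
  "slip_conditions K v \<longleftrightarrow> eq_on_bdry (\<lambda>x. v x \<bullet> normal x) (\<lambda>x. 0) \<and>
     eq_on_bdry (\<lambda>x. cross3 (curl v x) (normal x)) (\<lambda>x. - (K (to_bdry x) *v v x))"

definition sym_grad :: "(real^3 \<Rightarrow> real^3) \<Rightarrow> real^3 \<Rightarrow> real^3^3" where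
  "sym_grad v x = (\<chi> i j. (frechet_derivative v (at x) (axis j 1) $ i +
                          frechet_derivative v (at x) (axis i 1) $ j) / 2)"

text \<open>Surface area on the two boundary cylinders (one period in \<open>x\<^sub>3\<close>), in the parameters \<open>(\<theta>, z)\<close>.\<close>

definition surface_area :: "(real^3) set \<Rightarrow> ennreal" where
  "surface_area S = (\<Sum>R\<in>{1, 2}. ennreal R * emeasure lebesgue
     {(\<theta>::real, z::real). 0 \<le> \<theta> \<and> \<theta> < 2 * pi \<and> 0 \<le> z \<and> z < 1 \<and>
        (vector [R * cos \<theta>, R * sin \<theta>, z] :: real^3) \<in> S})"

definition pos_def :: "real^3^3 \<Rightarrow> bool" where
  "pos_def M \<longleftrightarrow> (\<forall>v. v \<noteq> 0 \<longrightarrow> v \<bullet> (M *v v) > 0)"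

definition pos_semidef :: "real^3^3 \<Rightarrow> bool" where
  "pos_semidef M \<longleftrightarrow> (\<forall>v. v \<bullet> (M *v v) \<ge> 0)"

definition axisymmetric_mat_on_bdry :: "(real^3 \<Rightarrow> real^3^3) \<Rightarrow> bool" where
  "axisymmetric_mat_on_bdry K \<longleftrightarrow>
     (\<forall>a\<in>{e_r, e_th, e_z}. \<forall>b\<in>{e_r, e_th, e_z}. \<forall>x\<in>bdry. \<forall>y\<in>bdry.
        radius x = radius y \<and> x$3 = y$3 \<longrightarrow> a x \<bullet> (K x *v b x) = a y \<bullet> (K y *v b y))"

text \<open>Only the boundary values of \<open>K\<close> matter; smooth means extendable to a smooth function near the boundary.\<close>

definition friction_matrix :: "(real^3 \<Rightarrow> real^3^3) \<Rightarrow> bool" where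
  "friction_matrix K \<longleftrightarrow>
     (\<exists>U K'. open U \<and> bdry \<subseteq> U \<and> smooth U K' \<and> (\<forall>x\<in>bdry. K' x = K x)) \<and>
     (\<forall>x\<in>bdry. K (x + axis 3 1) = K x) \<and>
     (\<forall>x\<in>bdry. transpose (K x) = K x \<and> pos_semidef (K x)) \<and>
     axisymmetric_mat_on_bdry K \<and>
     (\<exists>S\<subseteq>bdry. surface_area S > 0 \<and> (\<forall>x\<in>S. pos_def (K x + 2 *\<^sub>R sym_grad normal x)))"


section \<open>Initial data and strong solutions\<close>

definition in_Htilde1 :: "(real^3 \<Rightarrow> real^3^3) \<Rightarrow> (real^3 \<Rightarrow> real^3) \<Rightarrow> bool" where
  "in_Htilde1 K v \<longleftrightarrow> Wnorm 1 2 v < \<infinity> \<and> slip_conditions K v"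

definition initial_data ::
    "(real^3 \<Rightarrow> real^3^3) \<Rightarrow> real \<Rightarrow> (real^3 \<Rightarrow> real) \<Rightarrow> (real^3 \<Rightarrow> real^3) \<Rightarrow> bool" where
  "initial_data K q \<rho>0 u0 \<longleftrightarrow>
     (AE x in lebesgue_on Omega. 0 \<le> \<rho>0 x) \<and> Wnorm 1 q \<rho>0 < \<infinity> \<and> in_Htilde1 K u0 \<and>
     axisymmetric \<rho>0 \<and> axisymmetric_vec u0 \<and> periodic_z \<rho>0 \<and> periodic_z u0"

text \<open>A \<open>W\<^sup>1\<^sup>,\<^sup>q\<close> function with \<open>q > 3\<close> is evaluated at a point through its continuous representative.\<close>

definition vanishes_at :: "(real^3 \<Rightarrow> real) \<Rightarrow> real^3 \<Rightarrow> bool" where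
  "vanishes_at f x0 \<longleftrightarrow>
     (\<exists>g. continuous_on Omega g \<and> (AE x in lebesgue_on Omega. g x = f x) \<and> g x0 = 0)"

abbreviation SpaceTime :: "(real \<times> (real^3)) set" where
  "SpaceTime \<equiv> {0<..} \<times> Omega"

abbreviation e_t :: "real \<times> (real^3)" where "e_t \<equiv> (1, 0)"

abbreviation e_x :: "3 \<Rightarrow> real \<times> (real^3)" where "e_x j \<equiv> (0, axis j 1)"

abbreviation Dt :: "(real \<times> (real^3) \<Rightarrow> 'b::euclidean_space) \<Rightarrow> real \<times> (real^3) \<Rightarrow> 'b" where
  "Dt f \<equiv> wd SpaceTime e_t f"

abbreviation Dx :: "3 \<Rightarrow> (real \<times> (real^3) \<Rightarrow> 'b::euclidean_space) \<Rightarrow> real \<times> (real^3) \<Rightarrow> 'b" where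
  "Dx j f \<equiv> wd SpaceTime (e_x j) f"

definition divergence :: "(real \<times> (real^3) \<Rightarrow> real^3) \<Rightarrow> real \<times> (real^3) \<Rightarrow> real" where
  "divergence u z = (\<Sum>j\<in>UNIV. Dx j u z $ j)"

definition continuity_equation :: "(real \<times> (real^3) \<Rightarrow> real) \<Rightarrow> (real \<times> (real^3) \<Rightarrow> real^3) \<Rightarrow> bool" where
  "continuity_equation \<rho> u \<longleftrightarrow>
     weakly_diff SpaceTime e_t \<rho> \<and>
     (\<forall>j. weakly_diff SpaceTime (e_x j) (\<lambda>z. \<rho> z * u z $ j)) \<and>
     (AE z in lebesgue_on SpaceTime. Dt \<rho> z + (\<Sum>j\<in>UNIV. Dx j (\<lambda>z. \<rho> z * u z $ j) z) = 0)"

definition momentum_equation ::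
    "real \<Rightarrow> real \<Rightarrow> real \<Rightarrow> (real \<times> (real^3) \<Rightarrow> real) \<Rightarrow> (real \<times> (real^3) \<Rightarrow> real^3) \<Rightarrow> bool" where
  "momentum_equation \<gamma> \<beta> \<mu> \<rho> u \<longleftrightarrow>
     (let lam = (\<lambda>z. \<rho> z powr \<beta>); P = (\<lambda>z. \<rho> z powr \<gamma>) in
       weakly_diff SpaceTime e_t (\<lambda>z. \<rho> z *\<^sub>R u z) \<and>
       (\<forall>j. weakly_diff SpaceTime (e_x j) (\<lambda>z. (\<rho> z * u z $ j) *\<^sub>R u z) \<and>
            weakly_diff SpaceTime (e_x j) u \<and>
            weakly_diff SpaceTime (e_x j) (Dx j u) \<and>
            weakly_diff SpaceTime (e_x j) (\<lambda>z. (\<mu> + lam z) * divergence u z) \<and>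
            weakly_diff SpaceTime (e_x j) P) \<and>
       (AE z in lebesgue_on SpaceTime.
          Dt (\<lambda>z. \<rho> z *\<^sub>R u z) z + (\<Sum>j\<in>UNIV. Dx j (\<lambda>z. (\<rho> z * u z $ j) *\<^sub>R u z) z)
          - \<mu> *\<^sub>R (\<Sum>j\<in>UNIV. Dx j (Dx j u) z)
          - (\<chi> i. Dx i (\<lambda>z. (\<mu> + lam z) * divergence u z) z) + (\<chi> i. Dx i P z) = 0))"

definition regularity_class ::
    "real \<Rightarrow> (real \<Rightarrow> real^3 \<Rightarrow> real) \<Rightarrow> (real \<Rightarrow> real^3 \<Rightarrow> real^3) \<Rightarrow> bool" where
  "regularity_class q \<rho> u \<longleftrightarrow>
     (let \<rho>t = (\<lambda>t x. Dt (\<lambda>(t, x). \<rho> t x) (t, x)); ut = (\<lambda>t x. Dt (\<lambda>(t, x). u t x) (t, x)) in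
       weakly_diff SpaceTime e_t (\<lambda>(t, x). \<rho> t x) \<and> weakly_diff SpaceTime e_t (\<lambda>(t, x). u t x) \<and>
       (\<forall>T>0.
          in_C T (Wnorm 1 q) \<rho> \<and>
          in_Linf T (Lnorm 2) \<rho>t \<and>
          in_Linf T (Wnorm 1 2) u \<and> in_L ((q + 1) / q) T (Wnorm 2 q) u \<and>
          in_L 2 T (Wnorm 2 q) (\<lambda>t x. sqrt t *\<^sub>R u t x) \<and>
          in_Linf T (Wnorm 2 2) (\<lambda>t x. sqrt t *\<^sub>R u t x) \<and>
          in_L 2 T (Wnorm 1 2) (\<lambda>t x. sqrt t *\<^sub>R ut t x) \<and>
          (\<integral>\<^sup>+ z. ennreal ((norm (sqrt (\<rho> (fst z) (snd z)) *\<^sub>R ut (fst z) (snd z)))\<^sup>2)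
             \<partial>(lebesgue_on ({0<..<T} \<times> Cell))) < \<infinity>))"

text \<open>
  The velocity is determined only up to null sets of times (and not at all at time 0 where the density
  vanishes), so \<open>\<rho>u \<in> C([0,T];L\<^sup>2)\<close> and \<open>\<rho>u(0) = m\<^sub>0\<close> refer to the continuous representative \<open>m\<close> of
  the momentum.
\<close>

definition momentum_continuous_from ::
    "(real^3 \<Rightarrow> real^3) \<Rightarrow> (real \<Rightarrow> real^3 \<Rightarrow> real) \<Rightarrow> (real \<Rightarrow> real^3 \<Rightarrow> real^3) \<Rightarrow> bool" where
  "momentum_continuous_from m0 \<rho> u \<longleftrightarrow>
     (\<exists>m. (\<forall>T>0. in_C T (Lnorm 2) m) \<and>
          (AE t in lebesgue_on {0<..}. AE x in lebesgue_on Omega. m t x = \<rho> t x *\<^sub>R u t x) \<and>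
          (AE x in lebesgue_on Omega. m 0 x = m0 x))"

definition strong_solution ::
    "real \<Rightarrow> real \<Rightarrow> real \<Rightarrow> (real^3 \<Rightarrow> real^3^3) \<Rightarrow> real \<Rightarrow> (real^3 \<Rightarrow> real) \<Rightarrow> (real^3 \<Rightarrow> real^3) \<Rightarrow>
     (real \<Rightarrow> real^3 \<Rightarrow> real) \<Rightarrow> (real \<Rightarrow> real^3 \<Rightarrow> real^3) \<Rightarrow> bool" where
  "strong_solution \<gamma> \<beta> \<mu> K q \<rho>0 m0 \<rho> u \<longleftrightarrow>
     (\<forall>t\<ge>0. periodic_z (\<rho> t) \<and> axisymmetric (\<rho> t) \<and> (AE x in lebesgue_on Omega. 0 \<le> \<rho> t x)) \<and>
     (\<forall>t>0. periodic_z (u t)) \<and> (AE t in lebesgue_on {0<..}. axisymmetric_vec (u t)) \<and>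
     regularity_class q \<rho> u \<and>
     continuity_equation (\<lambda>(t, x). \<rho> t x) (\<lambda>(t, x). u t x) \<and>
     momentum_equation \<gamma> \<beta> \<mu> (\<lambda>(t, x). \<rho> t x) (\<lambda>(t, x). u t x) \<and>
     (AE x in lebesgue_on Omega. \<rho> 0 x = \<rho>0 x) \<and>
     momentum_continuous_from m0 \<rho> u \<and>
     (AE t in lebesgue_on {0<..}. slip_conditions K (u t))"

text \<open>
  \<open>\<alpha>\<close> is an admissible rate in the exponential decay estimate in \<open>L\<^sup>p\<close>: rate and constant serve all
  solutions whose data have \<open>L\<^sup>\<infinity>\<close> norm \<open>Ninf\<close> (density) and \<open>H\<^sup>1\<close> norm \<open>Nu\<close> (velocity), with no vacuum
  assumption. The estimate is read for almost every \<open>t\<close> because \<open>u\<close> is determined only up to null sets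
  of times; for the density, which is continuous in time, this is every \<open>t\<close>.
\<close>

definition decay_rate ::
    "real \<Rightarrow> real \<Rightarrow> real \<Rightarrow> real \<Rightarrow> (real^3 \<Rightarrow> real^3^3) \<Rightarrow> ennreal \<Rightarrow> ennreal \<Rightarrow> real \<Rightarrow> bool" where
  "decay_rate p \<gamma> \<beta> \<mu> K Ninf Nu \<alpha> \<longleftrightarrow> \<alpha> > 0 \<and>
     (\<exists>C::real. C > 0 \<and> (\<forall>q \<rho>0 u0 \<rho> u.
        q > 3 \<and> initial_data K q \<rho>0 u0 \<and> Linf_norm \<rho>0 = Ninf \<and> Wnorm 1 2 u0 = Nu \<and>
        strong_solution \<gamma> \<beta> \<mu> K q \<rho>0 (\<lambda>x. \<rho>0 x *\<^sub>R u0 x) \<rho> u \<longrightarrow>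
        (AE t in lebesgue_on {1..}.
           Lnorm p (\<lambda>x. \<rho> t x - mean \<rho>0) + Lnorm p (jacobian (u t)) \<le> ennreal (C * exp (- \<alpha> * t)))))"

end

theory Submission
  imports Defs "HOL-Computational_Algebra.Polynomial"
begin

text \<open>
  Axisymmetric functions are functions of \<open>(R, z) = (x\<^sub>1\<^sup>2 + x\<^sub>2\<^sup>2, x\<^sub>3)\<close>, and the push-forward of Lebesgue
  measure on the cell under \<open>(R, z)\<close> is a multiple of Lebesgue measure on a rectangle, so no polar
  coordinates are needed. In two dimensions Morrey's inequality holds for every exponent \<open>r > 2\<close>: on a
  dyadic rectangle of side \<open>2\<^sup>-\<^sup>k\<close> an axisymmetric function oscillates by at most
  \<open>C 2\<^sup>-\<^sup>k\<^sup>(\<^sup>1\<^sup>-\<^sup>2\<^sup>/\<^sup>r\<^sup>)\<close> times the \<open>L\<^sup>r\<close> norm of its gradient.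

  Vacuum persists: renormalizing the continuity equation with \<open>H(\<rho>) = (\<rho> + \<epsilon>)\<^sup>-\<^sup>p\<close> and bounding the
  angular average of \<open>div u\<close> by the \<open>W\<^sup>2\<^sup>,\<^sup>q\<close> norm of \<open>u\<close>, Gronwall's inequality gives
  \<open>\<integral>H(\<rho>(0)) \<le> e\<^sup>(\<^sup>p\<^sup>+\<^sup>1\<^sup>)\<^sup>L \<integral>H(\<rho>(t))\<close> with \<open>L\<close> independent of \<open>p\<close> and \<open>\<epsilon>\<close>; as \<open>p\<close> tends to infinity, a
  positive lower bound of \<open>\<rho>(t)\<close> yields one of \<open>\<rho>(0)\<close>.

  Hence at every time and every scale \<open>2\<^sup>-\<^sup>k\<close> there is a dyadic rectangle on which the mean of \<open>\<rho>(t)\<close> is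
  bounded by the oscillation, while it differs from the mean \<open>c\<close> of \<open>\<rho>(0)\<close> by at most
  \<open>C 2\<^sup>k e\<^sup>-\<^sup>\<alpha>\<^sup>t\<close>. Choosing \<open>2\<^sup>k\<close> comparable to \<open>e\<^sup>\<alpha>\<^sup>t\<close> gives the growth of the gradient.
\<close>

text \<open>For 2 < r <= 3 an L^r bound on a gradient gives no pointwise control in three
  dimensions, so every estimate is made for functions of (R, z). The angle drops out because a test
  function A(R) B(z) has horizontal gradient 2 A'(R) B(z) (x1, x2): of the horizontal velocity only
  the flux 2 (x1 u1 + x2 u2), which is u . grad R, is ever tested. Angular averages are then
  absolutely continuous along almost every coordinate line, and on a line the product and chain
  rules are exact; this is what makes the renormalization of the weak equation possible.

  The factor p + 1 in the exponent comes from |H(y) - y H'(y)| <= (p + 1) H(y). Being linear in p,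
  it survives p-th roots, which turn the integrals of H into suprema of 1/rho. The number L is
  finite because the W^{2,q} norm of u is integrable in time.

  The factor 2^k in the comparison of means is the inverse square root of the area of a rectangle,
  the price of a decay known in L^2. Weighed against the gain 2^(-k (1 - 2/r)) of the oscillation,
  it produces the exponent (r - 2)/r.\<close>

abbreviation cellM :: "(real^3) measure" where "cellM \<equiv> lebesgue_on Cell"
abbreviation "idc \<equiv> indicator"
abbreviation "bmeas \<equiv> borel_measurable"
abbreviation "frd \<equiv> frechet_derivative"
lemmas integrable_bd = Bochner_Integration.integrable_bound
lemmas integrable_plus = Bochner_Integration.integrable_add
lemmas bmeas_contI = borel_measurable_continuous_onI

section \<open>Smooth functions: sums, products, compositions and flat functions\<close>

lemma C_k_Suc_imp: "C_k (Suc k) UNIV f ==> C_k k UNIV f"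
proof (induction k arbitrary: f)
 case 0
 then show ?case
  by (auto simp: continuous_on_eq_continuous_at differentiable_imp_continuous_within)
next
 case (Suc k)
 from Suc.prems have "\<forall>x. f differentiable (at x)"
  "\<forall>b\<in>Basis. C_k (Suc k) UNIV (%x. frd f (at x) b)"
  by (auto simp del: C_k.simps(2) simp: C_k.simps(2)[of "Suc k"])
 then show ?case using Suc.IH by (auto simp only: C_k.simps(2))
qed

lemma smooth_C_k: "smooth UNIV f ==> C_k k UNIV f"
 by (simp add: smooth_def)

lemma C_k_const: "C_k k UNIV (%x. c)"
 by (induction k arbitrary: c) (auto simp: frechet_derivative_const)

lemma C_k_linear:
 fixes L :: "'a::euclidean_space => 'b::real_normed_vector"
 assumes "bounded_linear L"
 shows "C_k k UNIV L"
proof (cases k)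
 case 0
 then show ?thesis using assms by (simp add: linear_continuous_on)
next
 case (Suc j)
 have "frd L (at x) = L" for x
  using assms by (metis bounded_linear_imp_has_derivative frechet_derivative_at)
 then show ?thesis using Suc assms by (simp add: C_k_const bounded_linear_imp_differentiable)
qed

lemma C_k_add:
 fixes f g :: "'a::euclidean_space => 'b::real_normed_vector"
 shows "C_k k UNIV f ==> C_k k UNIV g ==> C_k k UNIV (%x. f x + g x)"
proof (induction k arbitrary: f g)
 case 0
 then show ?case by (simp add: continuous_on_add)
next
 case (Suc k)
 have "frd (%x. f x + g x) (at x) = (%b. frd f (at x) b + frd g (at x) b)" for x
  using Suc.prems
  by (intro frechet_derivative_at[symmetric] derivative_intros) (auto simp: frechet_derivative_works[symmetric])
 then show ?case using Suc by simp
qed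

lemma C_k_mult:
 fixes f g :: "'a::euclidean_space => real"
 shows "C_k k UNIV f ==> C_k k UNIV g ==> C_k k UNIV (%x. f x * g x)"
proof (induction k arbitrary: f g)
 case 0
 then show ?case by (simp add: continuous_on_mult)
next
 case (Suc k)
 have "frd (%x. f x * g x) (at x) =
   (%b. f x * frd g (at x) b + frd f (at x) b * g x)" for x
  using Suc.prems
  by (intro frechet_derivative_at[symmetric] derivative_intros) (auto simp: frechet_derivative_works[symmetric])
 moreover have "C_k k UNIV (%x. f x * frd g (at x) b + frd f (at x) b * g x)"
  if "b : Basis" for b
  using Suc that C_k_Suc_imp[OF Suc.prems(1)] C_k_Suc_imp[OF Suc.prems(2)]
  by (intro C_k_add Suc.IH) auto
 ultimately show ?case using Suc.prems by simp
qed

lemma C_k_prod: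
 fixes f :: "'i => 'a::euclidean_space => real"
 assumes "!!i. i : I ==> C_k k UNIV (f i)"
 shows "C_k k UNIV (%x. \<Prod>i\<in>I. f i x)"
 using assms by (induction I rule: infinite_finite_induct) (auto simp: C_k_const intro!: C_k_mult)

text \<open>The outer function is real, so the derivative in a direction b is the single product of
  \<open>frd h (at (p x)) 1\<close> and \<open>frd p (at x) b\<close>; the induction runs over
  \<open>h\<close> with \<open>p\<close> fixed and needs only \<open>C_k_mult\<close>.\<close>

lemma C_k_compose:
 fixes h :: "real => real" and p :: "'a::euclidean_space => real"
 shows "C_k k UNIV h ==> C_k k UNIV p ==> C_k k UNIV (%x. h (p x))"
proof (induction k arbitrary: h)
 case 0
 then show ?case by (auto intro: continuous_on_compose2)
next
 case (Suc k)
 have "frd (%x. h (p x)) (at x) =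
   (%b. frd h (at (p x)) 1 * frd p (at x) b)" for x
 proof -
  have h: "(h has_derivative frd h (at (p x))) (at (p x))"
   and p: "(p has_derivative frd p (at x)) (at x)"
   using Suc.prems by (auto simp: frechet_derivative_works[symmetric])
  have *: "frd h (at (p x)) v = frd h (at (p x)) 1 * v" for v
  proof -
   have "linear (frd h (at (p x)))"
    using h has_derivative_linear by blast
   from linear_cmul[OF this, of v 1] show ?thesis by simp
  qed
  have "((%x. h (p x)) has_derivative
    (%b. frd h (at (p x)) 1 * frd p (at x) b)) (at x)"
   by (rule has_derivative_eq_rhs[OF has_derivative_compose[OF p h]]) (rule ext, rule * )
  then show ?thesis by (rule frechet_derivative_at[symmetric])
 qed
 moreover have "C_k k UNIV (%x. frd h (at (p x)) 1 * frd p (at x) b)"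
  if "b : Basis" for b
 proof (rule C_k_mult)
  show "C_k k UNIV (%x. frd h (at (p x)) 1)"
   by (rule Suc.IH[of "%y. frd h (at y) 1"]) (use Suc.prems C_k_Suc_imp in auto)
  show "C_k k UNIV (%x. frd p (at x) b)"
   using Suc.prems that by simp
 qed
 moreover have "(%x. h (p x)) differentiable at x" for x
  using Suc.prems by (auto intro!: differentiable_compose[of h p])
 ultimately show ?case by simp
qed

lemma smooth_compose:
 fixes h :: "real => real" and p :: "'a::euclidean_space => real"
 shows "smooth UNIV h ==> smooth UNIV p ==> smooth UNIV (%x. h (p x))"
 unfolding smooth_def using C_k_compose by blast

lemma smooth_mult:
 fixes f g :: "'a::euclidean_space => real"
 shows "smooth UNIV f ==> smooth UNIV g ==> smooth UNIV (%x. f x * g x)"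
 unfolding smooth_def using C_k_mult by blast

lemma smooth_add:
 fixes f g :: "'a::euclidean_space => real"
 shows "smooth UNIV f ==> smooth UNIV g ==> smooth UNIV (%x. f x + g x)"
 unfolding smooth_def using C_k_add by blast

lemma smooth_linear:
 fixes L :: "'a::euclidean_space => 'b::real_normed_vector"
 shows "bounded_linear L ==> smooth UNIV L"
 unfolding smooth_def using C_k_linear by blast

lemma smooth_const: "smooth UNIV (%x. c)"
 unfolding smooth_def using C_k_const by blast

lemma smooth_imp_DERIV:
 fixes h :: "real => real"
 assumes "smooth UNIV h"
 shows "(h has_real_derivative deriv h x) (at x)"
proof -
 have "C_k (Suc 0) UNIV h" using assms smooth_def by blast
 then have "h differentiable (at x)" by simp
 then show ?thesis by (simp add: DERIV_deriv_iff_real_differentiable)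
qed

lemma C_k_real_Suc:
 fixes h h' :: "real => real"
 assumes "!!x. (h has_real_derivative h' x) (at x)" "C_k k UNIV h'"
 shows "C_k (Suc k) UNIV h"
proof -
 have "frd h (at x) = (*) (h' x)" for x
  using assms(1)[of x] by (metis frechet_derivative_at has_field_derivative_def)
 then show ?thesis using assms by (auto simp: real_differentiable_def differentiable_def has_field_derivative_def)
qed

lemma smooth_deriv:
 fixes h :: "real => real"
 assumes "smooth UNIV h"
 shows "smooth UNIV (deriv h)"
 unfolding smooth_def
proof
 fix k
 have "C_k (Suc k) UNIV h" using assms smooth_def by blast
 moreover have "frd h (at x) = (*) (deriv h x)" for x
  using smooth_imp_DERIV[OF assms, of x] by (metis frechet_derivative_at has_field_derivative_def)
 ultimately show "C_k k UNIV (deriv h)" by simp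
qed

text \<open>The classical flat function exp(-1/x), multiplied by a polynomial in 1/x. The family is
  closed under differentiation, so smoothness of every order follows from one computation of a first
  derivative.\<close>

definition flat_poly :: "real poly => real => real" where
 "flat_poly p x = (if x > 0 then poly p (inverse x) * exp (- inverse x) else 0)"

lemma poly_exp_tendsto_0: "((%y. poly p y * exp (- y)) \<longlongrightarrow> (0::real)) at_top"
proof -
 have "((%y. \<Sum>i\<le>degree p. coeff p i * (y ^ i / exp y)) \<longlongrightarrow> (\<Sum>i\<le>degree p. coeff p i * 0)) at_top"
  by (intro tendsto_intros tendsto_power_div_exp_0)
 then show ?thesis
  by (simp add: poly_altdef sum_distrib_right exp_minus divide_inverse mult.assoc)
qed

text \<open>With y = 1/x the derivative of p(y) exp(-y) is y^2 (p - p')(y) exp(-y), whence the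
  factor \<open>[:0,0,1:]\<close>. At the origin the right difference quotient is y p(y) exp(-y),
  which tends to 0 as y grows.\<close>

lemma flat_poly_DERIV:
 "(flat_poly p has_real_derivative flat_poly ([:0,0,1:] * (p - pderiv p)) x) (at x)"
proof -
 let ?q = "[:0,0,1:] * (p - pderiv p)"
 consider "x > 0" | "x < 0" | "x = 0" by linarith
 then show ?thesis
 proof cases
  case 1
  have "((%x. poly p (inverse x) * exp (- inverse x)) has_real_derivative flat_poly ?q x) (at x)"
   using 1 by (auto intro!: derivative_eq_intros DERIV_chain2[OF poly_DERIV]
     simp: flat_poly_def algebra_simps power2_eq_square)
  then show ?thesis
   by (rule has_field_derivative_transform_within_open[where S="{0<..}"]) (use 1 in \<open>auto simp: flat_poly_def\<close>)
 next
  case 2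
  have "((%x. 0) has_real_derivative flat_poly ?q x) (at x)"
   using 2 by (simp add: flat_poly_def)
  then show ?thesis
   by (rule has_field_derivative_transform_within_open[where S="{..<0}"]) (use 2 in \<open>auto simp: flat_poly_def\<close>)
 next
  case 3
  have "((%h. flat_poly p h / h) \<longlongrightarrow> 0) (at_right 0)"
  proof -
   have "((%h. poly ([:0,1:] * p) (inverse h) * exp (- inverse h)) \<longlongrightarrow> 0) (at_right 0)"
    by (rule filterlim_compose[OF poly_exp_tendsto_0 filterlim_inverse_at_top_right])
   then show ?thesis
    by (rule Lim_transform_eventually)
      (auto simp: eventually_at_right_less flat_poly_def field_simps eventually_at_filter)
  qed
  moreover have "((%h. flat_poly p h / h) \<longlongrightarrow> 0) (at_left 0)"
   by (rule tendsto_eventually) (auto simp: eventually_at_filter flat_poly_def)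
  ultimately have "((%h. flat_poly p h / h) \<longlongrightarrow> 0) (at 0)"
   by (simp add: filterlim_split_at)
  then show ?thesis using 3 by (simp add: DERIV_def flat_poly_def)
 qed
qed

lemma smooth_flat_poly: "smooth UNIV (flat_poly p)"
 unfolding smooth_def
proof
 fix k show "C_k k UNIV (flat_poly p)"
 proof (induction k arbitrary: p)
  case 0
  then show ?case
   by (auto simp: continuous_on_eq_continuous_at intro!: DERIV_isCont flat_poly_DERIV)
 next
  case (Suc k)
  then show ?case using C_k_real_Suc[OF flat_poly_DERIV] by blast
 qed
qed

section \<open>Bump functions, test functions and their primitives\<close>

definition flat_step :: "real => real" where
 "flat_step = flat_poly 1"

lemma flat_step_eq: "flat_step x = (if x > 0 then exp (- inverse x) else 0)"
 by (simp add: flat_step_def flat_poly_def)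

lemma flat_step_bounds: "0 <= flat_step x" "flat_step x <= 1"
 by (auto simp: flat_step_eq)

text \<open>The factor \<open>n\<close> steepens the sides, so the bumps approximate the indicator
  of the open box from below (\<open>bump_tendsto\<close>) while each of them is an admissible test
  function. The product form makes a bump on a product space a product of bumps.\<close>

definition bump :: "nat => 'a::euclidean_space => 'a => 'a => real" where
 "bump n c d y = (\<Prod>i\<in>Basis. flat_step (real n * (y \<bullet> i - c \<bullet> i)) * flat_step (real n * (d \<bullet> i - y \<bullet> i)))"

lemma bump_bounds: "0 <= bump n c d y" "bump n c d y <= 1"
 by (auto simp: bump_def flat_step_bounds intro!: prod_nonneg prod_le_1 mult_le_one)

lemma bump_outside: "y ~: box c d ==> bump n c d y = 0"
 by (force simp: bump_def box_def flat_step_eq zero_less_mult_iff)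

lemma bump_pos: "y : box c d ==> n > 0 ==> bump n c d y > 0"
 by (auto simp: bump_def box_def flat_step_eq intro!: prod_pos)

lemma bump_tendsto: "(%n. bump n c d y) \<longlonglongrightarrow> idc (box c d) y"
proof (cases "y : box c d")
 case True
 have *: "(%n. flat_step (real n * x)) \<longlonglongrightarrow> 1" if "x > 0" for x :: real
 proof -
  have "(%n. exp (- (inverse (real n) * inverse x))) \<longlonglongrightarrow> exp (- (0 * inverse x))"
   by (intro tendsto_intros tendsto_inverse_0_at_top filterlim_real_sequentially)
  then have "(%n. exp (- inverse (real n * x))) \<longlonglongrightarrow> 1" by simp
  then show ?thesis
  proof (rule Lim_transform_eventually)
   show "\<forall>\<^sub>F n in sequentially. exp (- inverse (real n * x)) = flat_step (real n * x)"
    using eventually_gt_at_top[of 0] by eventually_elim (use that in \<open>simp add: flat_step_eq\<close>)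
  qed
 qed
 have "(%n. bump n c d y) \<longlonglongrightarrow> (\<Prod>i\<in>(Basis::'a set). 1 * 1)"
  unfolding bump_def using True by (intro tendsto_intros * ) (auto simp: box_def)
 then show ?thesis using True by simp
next
 case False
 then show ?thesis by (simp add: bump_outside)
qed

lemma smooth_bump: 
 fixes L :: "'b::euclidean_space => 'a::euclidean_space"
 assumes "bounded_linear L"
 shows "smooth UNIV (%x. bump n c d (L x))"
proof -
 have "C_k k UNIV (%x. bump n c d (L x))" for k
  unfolding bump_def flat_step_def
 proof (rule C_k_prod, rule C_k_mult; rule C_k_compose[OF smooth_C_k[OF smooth_flat_poly]])
  fix i :: 'a
  have l: "C_k k UNIV (%x. L x \<bullet> i)"
   by (intro C_k_linear bounded_linear_inner_left_comp assms)
  show "C_k k UNIV (%x. real n * (L x \<bullet> i - c \<bullet> i))"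
   using C_k_mult[OF C_k_const C_k_add[OF l C_k_const], of "real n" "- (c \<bullet> i)"] by simp
  show "C_k k UNIV (%x. real n * (d \<bullet> i - L x \<bullet> i))"
   using C_k_mult[OF C_k_const C_k_add[OF l C_k_const], of "- real n" "- (d \<bullet> i)"]
   by (simp add: algebra_simps)
 qed
 then show ?thesis by (simp add: smooth_def)
qed

lemma smooth_bump_id: "smooth UNIV (bump n c (d :: 'a::euclidean_space))"
 using smooth_bump[OF bounded_linear_ident[where 'a='a], of n c d] by (simp add: eta_contract_eq)

lemma test_funI:
 assumes "smooth UNIV phh" "compact K" "K <= U" "!!x. x ~: K ==> phh x = 0"
 shows "test_fun U phh"
proof -
 have "closure {x. phh x ~= 0} <= K"
  using assms by (intro closure_minimal) (auto simp: compact_imp_closed)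
 then show ?thesis using assms unfolding test_fun_def
  by (metis (no_types, lifting) closed_closure compact_Int_closed inf.absorb_iff2 order_trans)
qed

lemma test_fun_support:
 assumes "test_fun U phh"
 obtains K where "compact K" "K <= U" "!!x. x ~: K ==> phh x = 0"
proof
 show "compact (closure {x. phh x ~= 0})" "closure {x. phh x ~= 0} <= U"
  using assms by (auto simp: test_fun_def)
 show "phh x = 0" if "x ~: closure {x. phh x ~= 0}" for x
  using that closure_subset[of "{x. phh x ~= 0}"] by blast
qed

lemma test_fun_bump: "cbox c d <= U ==> test_fun U (bump n c d)"
 by (rule test_funI[of _ "cbox c d"])
   (use box_subset_cbox[of c d] bump_outside[of _ c d n] in \<open>auto simp: smooth_bump_id\<close>)

lemma test_fun_smooth: "test_fun U phh ==> smooth UNIV phh"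
 by (simp add: test_fun_def)

text \<open>A primitive of \<open>v\<close> is constant on either side of the support of
  \<open>v\<close>, and the vanishing integral makes the two constants equal; subtracting them
  leaves compact support. It serves the du Bois-Reymond argument in
  \<open>AC_on_lines\<close>.\<close>

lemma test_fun_primitive:
 fixes v :: "real => real"
 assumes v: "smooth UNIV v" and supp: "!!s. s ~: {c..d} ==> v s = 0" and cd: "a < c" "c <= d" "d < b"
  and int: "(v has_integral 0) {c..d}"
 obtains ps where "test_fun {a<..<b} ps" "!!s. (ps has_real_derivative v s) (at s)"
proof -
 have cont: "isCont v s" for s
  using smooth_C_k[OF v, of 0] by (simp add: continuous_on_eq_continuous_at)
 obtain F where F: "!!s. (F has_real_derivative v s) (at s)"
  using einterval_antiderivative[of "-\<infinity>" "\<infinity>" v] cont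
  by (auto simp: has_real_derivative_iff_has_vector_derivative)
 have 1: "F s = F c" if "s <= c" for s
 proof (cases "s < c")
  case True
  then obtain z where "s < z" "z < c" "F c - F s = (c - s) * v z"
   using MVT2[of s c F v] F by blast
  then show ?thesis using supp[of z] by auto
 qed (use that in auto)
 have 2: "F s = F d" if "s >= d" for s
 proof (cases "s > d")
  case True
  then obtain z where "d < z" "z < s" "F s - F d = (s - d) * v z"
   using MVT2[of d s F v] F by blast
  then show ?thesis using supp[of z] by auto
 qed (use that in auto)
 have "(v has_integral (F d - F c)) {c..d}"
 proof (rule fundamental_theorem_of_calculus)
  show "(F has_vector_derivative v x) (at x within {c..d})" for x
   using F[of x] has_field_derivative_at_within has_real_derivative_iff_has_vector_derivative by blast
 qed (rule cd)
 then have "F d - F c = 0" using int by (rule has_integral_unique)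
 then have 3: "F d = F c" by simp
 have D: "((%s. F s - F c) has_real_derivative v s) (at s)" for s
  using F[of s] by (auto intro!: derivative_eq_intros)
 show thesis
 proof (rule that[of "%s. F s - F c"])
  have "C_k k UNIV (%s. F s - F c)" for k
   using C_k_real_Suc[OF D, of k] smooth_C_k[OF v] C_k_Suc_imp by blast
  then have "smooth UNIV (%s. F s - F c)" by (simp add: smooth_def)
  then show "test_fun {a<..<b} (%s. F s - F c)"
  proof (rule test_funI)
   show "F s - F c = 0" if "s ~: {c..d}" for s
    using that 1[of s] 2[of s] 3 by (cases "s <= c") auto
  qed (use cd in auto)
 qed (rule D)
qed

section \<open>Absolutely continuous functions of one variable, up to null sets\<close>

definition primitive_ae :: "real => real => (real => real) => (real => real) => real => bool" where
 "primitive_ae a b f g k \<longleftrightarrow> g absolutely_integrable_on {a..b} \<and>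
   (AE s in lebesgue. s : {a<..<b} --> f s = k + integral {a..s} g)"

text \<open>Weak derivatives determine \<open>f\<close> only up to null sets, so absolute continuity
  is a property of the representative \<open>k + integral {a..s} g\<close>. Its end values
  \<open>k\<close> and \<open>k + integral {a..b} g\<close> stand for the boundary values of
  \<open>f\<close>, which is why \<open>primitive_ae\<close> displays \<open>k\<close>.\<close>

definition AC :: "real => real => (real => real) => (real => real) => bool" where
 "AC a b f g \<longleftrightarrow> (\<exists>k. primitive_ae a b f g k)"

lemma abs_integrable_mult_continuous:
 fixes g :: "real => real"
 assumes "g absolutely_integrable_on {a..b}" "continuous_on {a..b} h"
 shows "(%s. h s * g s) absolutely_integrable_on {a..b}"
proof -
 have "h : bmeas (lebesgue_on {a..b})"
  using assms(2) by (simp add: continuous_imp_measurable_on_sets_lebesgue)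
 moreover have "bounded (h ` {a..b})"
  using assms(2) compact_continuous_image compact_imp_bounded by blast
 ultimately show ?thesis
  using absolutely_integrable_bounded_measurable_product_real[of h "{a..b}" g] assms(1) by auto
qed

lemma integral_diff_real:
 fixes g :: "real => real"
 assumes "g absolutely_integrable_on {a..b}" "a <= x" "x <= y" "y <= b"
 shows "integral {a..y} g - integral {a..x} g = integral {x..y} g"
proof -
 have "g integrable_on {a..y}"
  using assms set_lebesgue_integral_eq_integral(1) integrable_on_subinterval by (metis atLeastatMost_subset_iff order_refl)
 from Henstock_Kurzweil_Integration.integral_combine[OF assms(2,3) this] show ?thesis by simp
qed

text \<open>The right-hand side is additive over adjacent intervals, so estimates on steps of length
  at most \<open>et\<close> add up to the same estimate on any interval.\<close>

lemma uniform_local_chain: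
 fixes G V :: "real => real"
 assumes loc: "!!x y. a <= x ==> x <= y ==> y <= b ==> y - x <= et ==> \<bar>G y - G x\<bar> <= ep * (V y - V x)"
  and "et > 0" and xy: "a <= x" "x <= y" "y <= b"
 shows "\<bar>G y - G x\<bar> <= ep * (V y - V x)"
proof -
 have "\<bar>G y - G x\<bar> <= ep * (V y - V x)" if "y - x <= real n * et" "a <= x" "x <= y" "y <= b" for n y
  using that
 proof (induction n arbitrary: y)
  case 0
  then have "y = x" by simp
  then show ?case by simp
 next
  case (Suc n)
  show ?case
  proof (cases "y - et <= x")
   case True
   then show ?thesis using loc Suc.prems by simp
  next
   case False
   then have "\<bar>G (y - et) - G x\<bar> <= ep * (V (y - et) - V x)"
    using Suc \<open>et > 0\<close> by (intro Suc.IH) (auto simp: algebra_simps)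
   moreover have "\<bar>G y - G (y - et)\<bar> <= ep * (V y - V (y - et))"
    using loc[of "y - et" y] False Suc.prems \<open>et > 0\<close> by simp
   ultimately show ?thesis by (simp add: algebra_simps)
  qed
 qed
 moreover obtain n :: nat where "y - x <= real n * et"
  using \<open>et > 0\<close> by (metis reals_Archimedean3 less_imp_le)
 ultimately show ?thesis using xy by blast
qed

text \<open>As \<open>F\<close> need not be differentiable at every point, the chain rule is proved
  through increments. Let \<open>G\<close> be H(F) minus its expected primitive and \<open>V\<close>
  the integral of |g|. Uniform continuity of \<open>H'\<close> on the compact range of
  \<open>F\<close> gives |G y - G x| <= ep (V y - V x) on short intervals, hence on all intervals;
  as \<open>ep\<close> is arbitrary, \<open>G\<close> is constant.\<close>

lemma primitive_chain:
 fixes F g H H' :: "real => real"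
 assumes g: "g absolutely_integrable_on {a..b}" and F: "!!s. s : {a..b} ==> F s = k + integral {a..s} g"
  and J: "!!s. s : {a..b} ==> F s : J"
  and H: "!!y. y : J ==> (H has_real_derivative H' y) (at y)" and H': "continuous_on J H'"
  and x: "x : {a..b}"
 shows "H (F x) = H (F a) + integral {a..x} (%s. H' (F s) * g s)"
proof -
 have gi: "g integrable_on {a..b}" using g set_lebesgue_integral_eq_integral(1) by blast
 have contF: "continuous_on {a..b} F"
  using continuous_on_add[OF continuous_on_const indefinite_integral_continuous_1[OF gi], of k] F
  by (auto intro: continuous_on_cong[THEN iffD2])
 have imJ: "F ` {a..b} <= J" using J by blast
 have contH': "continuous_on (F ` {a..b}) H'" using H' imJ continuous_on_subset by blast
 have cK: "compact (F ` {a..b})" using contF compact_continuous_image by blast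
 have contH'F: "continuous_on {a..b} (%s. H' (F s))"
  using continuous_on_compose[OF contF contH'] by (simp add: o_def)
 have int: "(%s. H' (F s) * g s) absolutely_integrable_on {a..b}"
  by (rule abs_integrable_mult_continuous[OF g contH'F])
 define G where "G x = H (F x) - integral {a..x} (%s. H' (F s) * g s)" for x
 define V where "V x = integral {a..x} (%s. \<bar>g s\<bar>)" for x
 have absg: "(%s. \<bar>g s\<bar>) absolutely_integrable_on {a..b}"
  using g by (simp add: set_integrable_abs)
 have sub: "f absolutely_integrable_on {c..d}" if "f absolutely_integrable_on {a..b}" "a <= c" "d <= b"
  for f :: "real => real" and c d
  by (rule absolutely_integrable_on_subinterval[OF that(1)]) (use that in auto)
 have hk: "f integrable_on {c..d}" if "f absolutely_integrable_on {c..d}" for f :: "real => real" and c d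
  using that set_lebesgue_integral_eq_integral(1) by blast
 have bound: "\<bar>G x - G a\<bar> <= ep * (V x - V a)" if "ep > 0" for ep
 proof -
  have "uniformly_continuous_on (F ` {a..b}) H'"
   using compact_uniformly_continuous[OF contH' cK] .
  then obtain de where de: "de > 0" "!!u v. u : F ` {a..b} ==> v : F ` {a..b} ==> dist v u < de ==> dist (H' v) (H' u) < ep"
   unfolding uniformly_continuous_on_def using \<open>ep > 0\<close> by (elim allE[of _ ep] impE exE conjE) auto
  have "uniformly_continuous_on {a..b} F"
   using compact_uniformly_continuous[OF contF] by blast
  then obtain et where et: "et > 0" "!!u v. u : {a..b} ==> v : {a..b} ==> dist v u < et ==> dist (F v) (F u) < de"
   unfolding uniformly_continuous_on_def using de(1) by (elim allE[of _ de] impE exE conjE) auto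
  show ?thesis
  proof (rule uniform_local_chain[where et = "et/2" and b = b])
   fix x y assume xy: "a <= x" "x <= y" "y <= b" "y - x <= et / 2"
   \<comment> \<open>A point of the interval is wanted, not just a value between \<open>F x\<close>
     and \<open>F y\<close>: the mean value theorem for \<open>H\<close> gives the value, the
     intermediate value theorem for \<open>F\<close> a point where it is attained. Then closeness of
     \<open>sg\<close> and \<open>s\<close> controls the difference of \<open>H' (F sg)\<close> and
     \<open>H' (F s)\<close>.\<close>
   obtain sg where sg: "sg : {x..y}" "H (F y) - H (F x) = H' (F sg) * (F y - F x)"
   proof (cases "F x = F y")
    case True then show ?thesis using that[of x] xy by simp
   next
    case False
    have cF: "continuous_on {x..y} F" using contF continuous_on_subset xy by fastforce
    define l u where "l = min (F x) (F y)" and "u = max (F x) (F y)"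
    have lu: "l < u" using False by (auto simp: l_def u_def)
    have ivt: "\<exists>sg\<in>{x..y}. F sg = w" if "l <= w" "w <= u" for w
    proof (cases "F x <= F y")
     case True
     then show ?thesis using IVT'[of F x w y] that cF xy by (auto simp: l_def u_def)
    next
     case False
     then show ?thesis using IVT2'[of F y w x] that cF xy by (auto simp: l_def u_def)
    qed
    have "\<exists>z>l. z < u & H u - H l = (u - l) * H' z"
    proof (rule MVT2[OF lu])
     fix w assume "l <= w" "w <= u"
     then have "w : J" using ivt[of w] J xy by fastforce
     then show "DERIV H w :> H' w" by (rule H)
    qed
    then obtain z where z: "l < z" "z < u" "H u - H l = (u - l) * H' z" by blast
    obtain sg where "sg : {x..y}" "F sg = z" using ivt[of z] z by auto
    then show ?thesis using that[of sg] z(3) by (auto simp: l_def u_def min_def max_def algebra_simps split: if_splits)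
   qed
   have Fxy: "F y - F x = integral {x..y} g"
    using F[of y] F[of x] integral_diff_real[OF g, of x y] xy by simp
   have igxy: "g integrable_on {x..y}" and iHxy: "(%s. H' (F s) * g s) integrable_on {x..y}"
    and iaxy: "(%s. \<bar>g s\<bar>) integrable_on {x..y}"
    using hk sub g int absg xy by blast+
   have "G y - G x = H' (F sg) * integral {x..y} g - integral {x..y} (%s. H' (F s) * g s)"
    using sg(2) integral_diff_real[OF int, of x y] xy unfolding G_def Fxy by simp
   also have "... = integral {x..y} (%s. H' (F sg) * g s - H' (F s) * g s)"
    using igxy iHxy by (simp add: integral_diff integrable_on_mult_right)
   finally have eq: "G y - G x = integral {x..y} (%s. H' (F sg) * g s - H' (F s) * g s)" .
   have "norm (integral {x..y} (%s. H' (F sg) * g s - H' (F s) * g s)) <= integral {x..y} (%s. ep * \<bar>g s\<bar>)"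
   proof (rule integral_norm_bound_integral)
    fix s assume s: "s : {x..y}"
    have "dist (F sg) (F s) < de"
     using sg(1) s xy et(1) by (intro et(2)) (auto simp: dist_real_def)
    then have "dist (H' (F sg)) (H' (F s)) < ep"
     using sg(1) s xy by (intro de(2)) auto
    then have "\<bar>H' (F sg) - H' (F s)\<bar> * \<bar>g s\<bar> <= ep * \<bar>g s\<bar>"
     by (intro mult_right_mono) (auto simp: dist_real_def)
    then show "norm (H' (F sg) * g s - H' (F s) * g s) <= ep * \<bar>g s\<bar>"
     by (simp add: left_diff_distrib[symmetric] abs_mult)
   qed (use igxy iHxy iaxy in \<open>auto intro!: integrable_diff integrable_on_mult_right\<close>)
   also have "... = ep * (V y - V x)"
    unfolding V_def using integral_diff_real[OF absg, of x y] xy by simp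
   finally show "\<bar>G y - G x\<bar> <= ep * (V y - V x)" using eq by simp
  qed (use x et(1) in auto)
 qed
 have Vnn: "V x - V a >= 0"
  using integral_diff_real[OF absg, of a x] x Henstock_Kurzweil_Integration.integral_nonneg[OF hk[OF sub[OF absg]]]
  unfolding V_def by auto
 have "\<bar>G x - G a\<bar> <= 0 + e" if "e > 0" for e
 proof (cases "V x - V a = 0")
  case True then show ?thesis using bound[of 1] that by simp
 next
  case False
  then have "V x - V a > 0" using Vnn by simp
  then show ?thesis using bound[of "e / (V x - V a)"] that by simp
 qed
 then have "G x = G a" using field_le_epsilon[of "\<bar>G x - G a\<bar>" 0] by auto
 then show ?thesis by (simp add: G_def)
qed

lemma AE_lebesgue_negligible:
 assumes "AE x in lebesgue. P x"
 shows "negligible {x. ~ P x}"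
proof -
 obtain N where "N : null_sets lebesgue" "{x. ~ P x} <= N"
  using assms by (auto simp: eventually_ae_filter)
 then show ?thesis using negligible_iff_null_sets negligible_subset by blast
qed

text \<open>The set where a continuous function leaves a closed set is relatively open, so if
  nonempty it meets the open interval in a set of positive measure. This upgrades information valid
  almost everywhere to every point, the endpoints included.\<close>

lemma AE_interval_continuous_closed:
 fixes F :: "real => real"
 assumes "AE s in lebesgue. s : {a<..<b} --> F s : J" "closed J" "continuous_on {a..b} F" "a < b" "s : {a..b}"
 shows "F s : J"
proof (rule ccontr)
 assume "F s ~: J"
 then have "s : {a..b} \<inter> F -` (- J)" using assms by auto
 moreover obtain A where A: "open A" "A \<inter> {a..b} = F -` (- J) \<inter> {a..b}"
  using iffD1[OF continuous_on_open_invariant assms(3), rule_format, OF open_Compl[OF assms(2)]] by (elim exE conjE)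
 ultimately have "s : A" by blast
 have "s : closure {a<..<b}" using assms by simp
 then have "A \<inter> {a<..<b} ~= {}" using open_Int_closure_eq_empty[OF A(1)] \<open>s : A\<close> by blast
 then have "~ negligible (A \<inter> {a<..<b})" by (intro open_not_negligible open_Int A(1)) auto
 moreover have "negligible (A \<inter> {a<..<b})"
 proof -
  have "A \<inter> {a<..<b} <= {s. ~ (s : {a<..<b} --> F s : J)}"
  proof
   fix x assume x: "x : A \<inter> {a<..<b}"
   then have "x : A \<inter> {a..b}" by simp
   then have "x : F -` (- J) \<inter> {a..b}" by (simp only: A(2))
   then show "x : {s. ~ (s : {a<..<b} --> F s : J)}" using x by simp
  qed
  then show ?thesis using AE_lebesgue_negligible[OF assms(1)] negligible_subset by blast
 qed
 ultimately show False by blast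
qed

lemma primitive_continuous:
 fixes g :: "real => real"
 assumes "g absolutely_integrable_on {a..b}"
 shows "continuous_on {a..b} (%s. k + integral {a..s} g)"
 using indefinite_integral_continuous_1[OF set_lebesgue_integral_eq_integral(1)[OF assms]]
 by (intro continuous_intros) auto

lemma integral_cong_AE_real:
 fixes g h :: "real => real"
 assumes "AE s in lebesgue. s : {a<..<b} --> g s = h s" and "s <= b"
 shows "integral {a..s} g = integral {a..s} h"
proof -
 have "negligible ({s. ~ (s : {a<..<b} --> g s = h s)} \<union> {a,b})"
  using AE_lebesgue_negligible[OF assms(1)] by simp
 then show ?thesis
  by (rule integral_spike) (use assms(2) in fastforce)
qed

lemma abs_integrable_cong_AE_real:
 fixes g h :: "real => real"
 assumes "AE s in lebesgue. s : {a<..<b} --> g s = h s" and "g absolutely_integrable_on {a..b}"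
 shows "h absolutely_integrable_on {a..b}"
proof -
 have "negligible ({s. ~ (s : {a<..<b} --> g s = h s)} \<union> {a,b})"
  using AE_lebesgue_negligible[OF assms(1)] by simp
 from absolutely_integrable_spike[OF assms(2) this, of h] show ?thesis
  by fastforce
qed

lemma primitive_ae_cong:
 assumes "primitive_ae a b f g k"
  and "AE s in lebesgue. s : {a<..<b} --> f s = f' s" "AE s in lebesgue. s : {a<..<b} --> g s = g' s"
 shows "primitive_ae a b f' g' k"
 unfolding primitive_ae_def
proof
 show "g' absolutely_integrable_on {a..b}"
  using abs_integrable_cong_AE_real assms unfolding primitive_ae_def by blast
 have *: "integral {a..s} g = integral {a..s} g'" if "s : {a<..<b}" for s
  using integral_cong_AE_real[OF assms(3), of s] that by simp
 show "AE s in lebesgue. s : {a<..<b} --> f' s = k + integral {a..s} g'"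
  using assms(1)[unfolded primitive_ae_def, THEN conjunct2] assms(2) by eventually_elim (use * in auto)
qed

lemma AC_cong:
 assumes "AC a b f g"
  and "AE s in lebesgue. s : {a<..<b} --> f s = f' s" "AE s in lebesgue. s : {a<..<b} --> g s = g' s"
 shows "AC a b f' g'"
 using assms primitive_ae_cong unfolding AC_def by blast

lemma primitive_ae_chain:
 assumes f: "primitive_ae a b f g k" and "a < b"
  and fJ: "AE s in lebesgue. s : {a<..<b} --> f s : J" and J: "closed J"
  and H: "!!y. y : J ==> (H has_real_derivative H' y) (at y)" and H': "continuous_on J H'"
 shows "primitive_ae a b (%s. H (f s)) (%s. H' (f s) * g s) (H k)"
proof -
 have g: "g absolutely_integrable_on {a..b}" 
  and fe: "AE s in lebesgue. s : {a<..<b} --> f s = k + integral {a..s} g"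
  using f by (auto simp: primitive_ae_def)
 define F where "F s = k + integral {a..s} g" for s
 have contF: "continuous_on {a..b} F" unfolding F_def by (rule primitive_continuous[OF g])
 have "AE s in lebesgue. s : {a<..<b} --> F s : J"
  using fe fJ by eventually_elim (auto simp: F_def)
 then have FJ: "F s : J" if "s : {a..b}" for s
  using AE_interval_continuous_closed[OF _ J contF \<open>a < b\<close> that] by blast
 have ch: "H (F s) = H (F a) + integral {a..s} (%s. H' (F s) * g s)" if "s : {a..b}" for s
  by (rule primitive_chain[OF g _ FJ H H' that]) (auto simp: F_def)
 have "continuous_on {a..b} (%s. H' (F s))"
  by (rule continuous_on_compose2[OF H' contF]) (use FJ in auto)
 then have "(%s. H' (F s) * g s) absolutely_integrable_on {a..b}"
  by (rule abs_integrable_mult_continuous[OF g])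
 moreover have "F a = k" by (simp add: F_def)
 ultimately have "primitive_ae a b (%s. H (F s)) (%s. H' (F s) * g s) (H k)"
  unfolding primitive_ae_def using ch by auto
 then show ?thesis
  by (rule primitive_ae_cong) (use fe in \<open>eventually_elim, auto simp: F_def\<close>)+
qed

lemma AC_chain:
 assumes "AC a b f g" and "a < b"
  and "AE s in lebesgue. s : {a<..<b} --> f s : J" "closed J"
  and "!!y. y : J ==> (H has_real_derivative H' y) (at y)" "continuous_on J H'"
 shows "AC a b (%s. H (f s)) (%s. H' (f s) * g s)"
 using assms primitive_ae_chain unfolding AC_def by blast

lemma primitive_ae_add:
 assumes "primitive_ae a b f1 g1 k1" "primitive_ae a b f2 g2 k2"
 shows "primitive_ae a b (%s. f1 s + f2 s) (%s. g1 s + g2 s) (k1 + k2)"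
proof -
 have g: "g1 absolutely_integrable_on {a..b}" "g2 absolutely_integrable_on {a..b}"
  using assms by (auto simp: primitive_ae_def)
 have "integral {a..s} (%s. g1 s + g2 s) = integral {a..s} g1 + integral {a..s} g2" if "s : {a<..<b}" for s
  using that g[THEN absolutely_integrable_on_subinterval, of a s]
  by (intro Henstock_Kurzweil_Integration.integral_add set_lebesgue_integral_eq_integral(1)) auto
 moreover have "AE s in lebesgue. s : {a<..<b} --> f1 s = k1 + integral {a..s} g1"
  "AE s in lebesgue. s : {a<..<b} --> f2 s = k2 + integral {a..s} g2"
  using assms by (auto simp: primitive_ae_def)
 then have "AE s in lebesgue. s : {a<..<b} --> f1 s + f2 s = k1 + k2 + (integral {a..s} g1 + integral {a..s} g2)"
  by eventually_elim auto
 ultimately show ?thesis using g unfolding primitive_ae_def by (auto elim!: AE_mp)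
qed

lemma primitive_ae_cmult:
 assumes "primitive_ae a b f g k"
 shows "primitive_ae a b (%s. c * f s) (%s. c * g s) (c * k)"
 using assms unfolding primitive_ae_def
 by (auto elim!: AE_mp simp: algebra_simps)

text \<open>Polarization: the product rule follows from the chain rule for the square, applied to
  \<open>f1 + f2\<close> and \<open>f1 - f2\<close>.\<close>

lemma primitive_ae_mult:
 assumes "primitive_ae a b f1 g1 k1" "primitive_ae a b f2 g2 k2" "a < b"
 shows "primitive_ae a b (%s. f1 s * f2 s) (%s. f1 s * g2 s + g1 s * f2 s) (k1 * k2)"
proof -
 have sq: "primitive_ae a b (%s. (f s)^2) (%s. (2 * f s) * g s) (k^2)" if "primitive_ae a b f g k" for f g k
  by (rule primitive_ae_chain[OF that \<open>a < b\<close>, of UNIV "%y. y^2"])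
    (auto intro!: derivative_eq_intros continuous_intros)
 have p: "primitive_ae a b (%s. (f1 s + f2 s)^2) (%s. (2 * (f1 s + f2 s)) * (g1 s + g2 s)) ((k1 + k2)^2)"
  by (rule sq[OF primitive_ae_add[OF assms(1,2)]])
 have m: "primitive_ae a b (%s. (f1 s + (-1) * f2 s)^2) (%s. (2 * (f1 s + (-1) * f2 s)) * (g1 s + (-1) * g2 s)) ((k1 + (-1) * k2)^2)"
  by (rule sq[OF primitive_ae_add[OF assms(1) primitive_ae_cmult[OF assms(2)]]])
 have "primitive_ae a b 
   (%s. (1/4) * (f1 s + f2 s)^2 + (-1/4) * (f1 s + (-1) * f2 s)^2)
   (%s. (1/4) * ((2 * (f1 s + f2 s)) * (g1 s + g2 s)) + (-1/4) * ((2 * (f1 s + (-1) * f2 s)) * (g1 s + (-1) * g2 s)))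
   ((1/4) * (k1 + k2)^2 + (-1/4) * (k1 + (-1) * k2)^2)"
  by (rule primitive_ae_add[OF primitive_ae_cmult[OF p] primitive_ae_cmult[OF m]])
 moreover have "(1/4) * (u + v)^2 + (-1/4) * (u + (-1) * v)^2 = u * v" for u v :: real
  by (simp add: power2_eq_square field_simps)
 moreover have "(1/4) * ((2 * (u + v)) * (u' + v')) + (-1/4) * ((2 * (u + (-1) * v)) * (u' + (-1) * v')) = u * v' + u' * v" 
  for u v u' v' :: real
  by (simp add: field_simps)
 ultimately show ?thesis by simp
qed

lemma AC_mult:
 assumes "AC a b f1 g1" "AC a b f2 g2" "a < b"
 shows "AC a b (%s. f1 s * f2 s) (%s. f1 s * g2 s + g1 s * f2 s)"
 using assms primitive_ae_mult unfolding AC_def by blast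

lemma AC_C1:
 assumes "!!s. (h has_real_derivative h' s) (at s)" "continuous_on UNIV h'" "a <= b"
 shows "primitive_ae a b h h' (h a)"
proof -
 have *: "(h' has_integral (h s - h a)) {a..s}" if "a <= s" for s
 proof (rule fundamental_theorem_of_calculus)
  show "(h has_vector_derivative h' x) (at x within {a..s})" for x
   using assms(1)[of x] has_field_derivative_at_within has_real_derivative_iff_has_vector_derivative by blast
 qed (rule that)
 have "h' absolutely_integrable_on {a..b}"
  using assms(2) absolutely_integrable_continuous_real continuous_on_subset by blast
 then show ?thesis unfolding primitive_ae_def using integral_unique[OF *] by (auto intro!: AE_I2)
qed

lemma primitive_ae_vanish_right:
 assumes f: "primitive_ae a b f g k" and "a < d" "d < b"
  and z: "!!s. s : {d<..<b} ==> f s = 0"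
 shows "k + integral {a..b} g = 0"
proof -
 have g: "g absolutely_integrable_on {a..b}"
  and fe: "AE s in lebesgue. s : {a<..<b} --> f s = k + integral {a..s} g"
  using f by (auto simp: primitive_ae_def)
 have cont: "continuous_on {d..b} (%s. k + integral {a..s} g)"
  using continuous_on_subset[OF primitive_continuous[OF g]] assms by simp
 have "AE s in lebesgue. s : {d<..<b} --> k + integral {a..s} g : {0}"
  using fe by eventually_elim (use z assms in force)
 from AE_interval_continuous_closed[OF this _ cont, of b] show ?thesis using assms by simp
qed

text \<open>The product of \<open>ps\<close> and \<open>f\<close> has starting value 0 and vanishes
  near \<open>b\<close>, so the integral of its derivative is 0.\<close>

lemma integrate_by_parts_test:
 assumes f: "AC a b f g" and ps: "test_fun {a<..<b} ps" and "a < b"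
 shows "integral {a..b} (%s. ps s * g s + deriv ps s * f s) = 0"
proof -
 obtain K where K: "compact K" "K <= {a<..<b}" "!!x. x ~: K ==> ps x = 0"
  using test_fun_support[OF ps] by metis
 obtain c d where cd: "a < c" "c < b" "a < d" "d < b" "K <= {c..d}"
 proof (cases "K = {}")
  case True
  then show ?thesis using that[of "(a+b)/2" "(a+b)/2"] \<open>a < b\<close> by auto
 next
  case False
  obtain s where "s : K" "\<forall>x\<in>K. s <= x" using compact_attains_inf[OF K(1) False] by blast
  moreover obtain t where "t : K" "\<forall>x\<in>K. x <= t" using compact_attains_sup[OF K(1) False] by blast
  ultimately show ?thesis using that[of s t] K(2) by force
 qed
 have sm: "smooth UNIV ps" using ps test_fun_smooth by blast
 have p1: "primitive_ae a b ps (deriv ps) (ps a)"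
  using smooth_imp_DERIV[OF sm] smooth_C_k[OF smooth_deriv[OF sm], of 0] \<open>a < b\<close> by (intro AC_C1) auto
 obtain k where p2: "primitive_ae a b f g k" using f by (auto simp: AC_def)
 have p: "primitive_ae a b (%s. ps s * f s) (%s. ps s * g s + deriv ps s * f s) (ps a * k)"
  by (rule primitive_ae_mult[OF p1 p2 \<open>a < b\<close>])
 have "ps a * k = 0"
  using K(3)[of a] K(2) by force
 moreover have "ps a * k + integral {a..b} (%s. ps s * g s + deriv ps s * f s) = 0"
  by (rule primitive_ae_vanish_right[OF p cd(3,4)]) (use K(3) cd(5) in force)
 ultimately show ?thesis by linarith
qed

section \<open>Functions determined by their integrals over rational boxes or against bumps\<close>

definition rat_pt :: "'a::euclidean_space => bool" where
 "rat_pt c \<longleftrightarrow> (\<forall>i\<in>Basis. c \<bullet> i : \<rat>)"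

lemma countable_rat_pts: "countable {c::'a::euclidean_space. rat_pt c}"
proof -
 have "{c::'a. rat_pt c} <= (%f. \<Sum>i\<in>Basis. f i *\<^sub>R i) ` (Basis \<rightarrow>\<^sub>E \<rat>)"
 proof
  fix c :: 'a assume "c : {c. rat_pt c}"
  then show "c : (%f. \<Sum>i\<in>Basis. f i *\<^sub>R i) ` (Basis \<rightarrow>\<^sub>E \<rat>)"
   by (intro image_eqI[of _ _ "\<lambda>i\<in>Basis. c \<bullet> i"]) (auto simp: rat_pt_def euclidean_representation)
 qed
 moreover have "countable (Basis \<rightarrow>\<^sub>E \<rat> :: ('a => real) set)"
  by (intro countable_PiE) (auto simp: countable_rat)
 ultimately show ?thesis by (rule countable_subset[OF _ countable_image])
qed

lemma open_rational_boxes: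
 fixes M :: "'a::euclidean_space set"
 assumes "open M" "x : M"
 obtains c d where "rat_pt c" "rat_pt d" "x : box c d" "cbox c d <= M"
proof -
 obtain e where e: "e > 0" "ball x e <= M" using assms openE by blast
 obtain a b where ab: "x : box a b" "\<forall>i\<in>Basis. a \<bullet> i : \<rat>" "\<forall>i\<in>Basis. b \<bullet> i : \<rat>" "box a b <= ball x (e/2)"
  using rational_boxes[of "e/2" x] e by auto
 have "cbox a b = closure (box a b)" using ab(1) by (metis closure_box empty_iff)
 also have "... <= closure (ball x (e/2))" using ab(4) closure_mono by blast
 also have "... <= M" using e by (auto simp: subset_iff)
 finally show thesis using that ab by (auto simp: rat_pt_def)
qed

lemma enn2real_eqD: "a ~= \<infinity> ==> b ~= \<infinity> ==> enn2real a = enn2real b ==> a = b"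
 by (cases a; cases b) auto

lemma mult_indicator_ennreal: "ennreal (f x) * idc A x = ennreal (idc A x * f x)"
 "ennreal (- f x) * idc A x = ennreal (- (idc A x * f x))"
 by (auto simp: indicator_def)

text \<open>The positive and the negative part of \<open>f\<close> define finite measures that agree
  on the rational boxes, an intersection-stable generator of the Borel sets, so the two densities
  coincide. Rational corners keep the family countable: later one null set of times has to serve all
  test functions.\<close>

lemma AE_zero_of_box_integrals_UNIV:
 fixes f :: "'a::euclidean_space => real"
 assumes f: "integrable lborel f"
  and z: "!!c d. rat_pt c ==> rat_pt d ==> (LBINT x. idc (box c d) x * f x) = 0"
 shows "AE x in lborel. f x = 0"
proof -
 have [measurable]: "f : bmeas borel" using f by auto
 let ?p = "%x. ennreal (f x)" and ?n = "%x. ennreal (- f x)"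
 let ?E = "{box c d | c d :: 'a. rat_pt c & rat_pt d}"
 have fin: "(\<integral>\<^sup>+x. ?p x \<partial>lborel) ~= \<infinity>" "(\<integral>\<^sup>+x. ?n x \<partial>lborel) ~= \<infinity>"
  using f by (auto simp: real_integrable_def)
 have "density lborel ?p = density lborel ?n"
 proof (rule measure_eqI_generator_eq[where E = ?E and \<Omega> = UNIV])
  show "Int_stable ?E"
  proof (rule Int_stableI, safe)
   fix a b c d :: 'a assume r: "rat_pt a" "rat_pt b" "rat_pt c" "rat_pt d"
   let ?l = "\<Sum>i\<in>Basis. max (a \<bullet> i) (c \<bullet> i) *\<^sub>R i" and ?u = "\<Sum>i\<in>Basis. min (b \<bullet> i) (d \<bullet> i) *\<^sub>R i"
   have "box a b \<inter> box c d = box ?l ?u"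
    by (auto simp: box_def)
   moreover have "rat_pt ?l" "rat_pt ?u"
    using r by (auto simp: rat_pt_def max_def min_def)
   ultimately show "\<exists>e f. box a b \<inter> box c d = box e f & rat_pt e & rat_pt f" by blast
  qed
  show "emeasure (density lborel ?p) X = emeasure (density lborel ?n) X" if XE: "X : ?E" for X
  proof -
   obtain c d where X: "X = box c d" "rat_pt c" "rat_pt d" using XE by blast
   have i: "integrable lborel (%x. idc X x * f x)"
    using integrable_mult_indicator[of X lborel f] f X by simp
   have "(\<integral>\<^sup>+x. ennreal (idc X x * f x) \<partial>lborel) ~= \<infinity>" "(\<integral>\<^sup>+x. ennreal (- (idc X x * f x)) \<partial>lborel) ~= \<infinity>"
    using i by (auto simp: real_integrable_def)
   moreover have "enn2real (\<integral>\<^sup>+x. ennreal (idc X x * f x) \<partial>lborel) = enn2real (\<integral>\<^sup>+x. ennreal (- (idc X x * f x)) \<partial>lborel)"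
    using real_lebesgue_integral_def[OF i] z[OF X(2,3)] X(1) by simp
   ultimately have "(\<integral>\<^sup>+x. ennreal (idc X x * f x) \<partial>lborel) = (\<integral>\<^sup>+x. ennreal (- (idc X x * f x)) \<partial>lborel)"
    by (rule enn2real_eqD)
   moreover have "X : sets lborel" using X by simp
   ultimately show ?thesis
    by (simp add: emeasure_density mult_indicator_ennreal)
  qed
  have B1: "M : sigma_sets UNIV ?E" if M: "open M" for M :: "'a set"
   proof -
    let ?C = "{(c, d). rat_pt c & rat_pt d & box c d <= M}"
    have "countable ?C"
     by (rule countable_subset[of _ "{c. rat_pt c} \<times> {c. rat_pt c}"])
       (auto intro: countable_rat_pts countable_SIGMA)
    moreover have "M = (\<Union>(c,d)\<in>?C. box c d)"
    proof safe
     fix x assume "x : M"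
     then obtain c d where "rat_pt c" "rat_pt d" "x : box c d" "cbox c d <= M"
      using open_rational_boxes[OF M] by metis
     moreover have "box c d <= cbox c d" by (rule box_subset_cbox)
     ultimately show "x : (\<Union>(c,d)\<in>?C. box c d)"
      by (intro UN_I[of "(c,d)"]) auto
    qed blast
    moreover have "(\<Union>(c,d)\<in>?C. box c d) : sets (sigma UNIV ?E)"
     using \<open>countable ?C\<close> by (rule sets.countable_UN') auto
    then have "(\<Union>(c,d)\<in>?C. box c d) : sigma_sets UNIV ?E" by (simp add: sets_measure_of)
    ultimately show ?thesis by (simp only:)
   qed
  have "sigma_sets UNIV {S :: 'a set. open S} = sigma_sets UNIV ?E"
  proof (rule sigma_sets_eqI)
   show "a : sigma_sets UNIV ?E" if "a : {S. open S}" for a using B1 that by simp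
   show "b : sigma_sets UNIV {S. open S}" if "b : ?E" for b
    using that by (auto intro!: sigma_sets.Basic)
  qed
  then have "sets (borel :: 'a measure) = sigma_sets UNIV ?E"
   by (simp add: borel_def sets_measure_of)
  then show "sets (density lborel ?p) = sigma_sets UNIV ?E" "sets (density lborel ?n) = sigma_sets UNIV ?E"
   by simp_all
  let ?A = "%n::nat. box (- real n *\<^sub>R One) (real n *\<^sub>R One :: 'a)"
  show "range ?A <= ?E"
  proof clarify
   fix n
   have "rat_pt (- real n *\<^sub>R One :: 'a)" "rat_pt (real n *\<^sub>R One :: 'a)"
    by (auto simp: rat_pt_def)
   then show "\<exists>c d. ?A n = box c d & rat_pt c & rat_pt d" by blast
  qed
  show "(\<Union>i. ?A i) = UNIV" using UN_box_eq_UNIV by simp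
  show "emeasure (density lborel ?p) (?A i) ~= \<infinity>" for i
  proof -
   have "emeasure (density lborel ?p) (?A i) <= (\<integral>\<^sup>+x. ?p x \<partial>lborel)"
    by (simp add: emeasure_density) (auto intro!: nn_integral_mono simp: indicator_def)
   then show ?thesis using fin(1) by (auto simp: top_unique)
  qed
 qed auto
 then have "AE x in lborel. ?p x = ?n x"
  using finite_density_unique[of ?p lborel ?n] fin by auto
 then show ?thesis
  by eventually_elim (metis ennreal_eq_0_iff ennreal_neg le_cases neg_0_le_iff_le neg_le_0_iff_le order_antisym)
qed

text \<open>Localization: cut off by the indicator of a rational box with closure in
  \<open>Y\<close>, the function satisfies the global criterion, because two rational boxes meet in
  a rational box. Countably many such boxes cover \<open>Y\<close>.\<close>

lemma AE_zero_of_box_integrals: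
 fixes f :: "'a::euclidean_space => real"
 assumes f: "integrable lborel f" and Y: "open Y"
  and z: "!!c d. rat_pt c ==> rat_pt d ==> cbox c d <= Y ==> (LBINT x. idc (box c d) x * f x) = 0"
 shows "AE x in lborel. x : Y --> f x = 0"
proof -
 let ?C = "{(c, d). rat_pt c & rat_pt d & cbox c d <= Y}"
 have cC: "countable ?C"
  by (rule countable_subset[of _ "{c. rat_pt c} \<times> {c. rat_pt c}"])
    (auto intro: countable_rat_pts countable_SIGMA)
 have 1: "AE x in lborel. idc (box a b) x * f x = 0" if ab: "(a, b) : ?C" for a b
 proof (rule AE_zero_of_box_integrals_UNIV)
  show "integrable lborel (%x. idc (box a b) x * f x)"
   using integrable_mult_indicator[of "box a b" lborel f] f by simp
  fix c d :: 'a assume r: "rat_pt c" "rat_pt d"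
  let ?l = "\<Sum>i\<in>Basis. max (a \<bullet> i) (c \<bullet> i) *\<^sub>R i" and ?u = "\<Sum>i\<in>Basis. min (b \<bullet> i) (d \<bullet> i) *\<^sub>R i"
  have "box a b \<inter> box c d = box ?l ?u" by (auto simp: box_def)
  moreover have "rat_pt ?l" "rat_pt ?u"
   using r ab by (auto simp: rat_pt_def max_def min_def)
  moreover have "cbox ?l ?u <= cbox a b" by (auto simp: cbox_def)
  then have "cbox ?l ?u <= Y" using ab by blast
  ultimately have "(LBINT x. idc (box a b \<inter> box c d) x * f x) = 0" using z[of ?l ?u] by simp
  then show "(LBINT x. idc (box c d) x * (idc (box a b) x * f x)) = 0"
   by (simp add: indicator_inter_arith mult_ac)
 qed
 have "AE x in lborel. \<forall>z\<in>?C. idc (box (fst z) (snd z)) x * f x = 0"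
  unfolding AE_ball_countable[OF cC] using 1 by auto
 then show ?thesis
 proof eventually_elim
  case (elim x)
  show ?case
  proof
   assume "x : Y"
   then obtain c d where "rat_pt c" "rat_pt d" "x : box c d" "cbox c d <= Y"
    using open_rational_boxes[OF Y] by metis
   then show "f x = 0" using bspec[OF elim, of "(c,d)"] by simp
  qed
 qed
qed

lemma bump_Pair: "bump n (c1, c) (d1, d) (s, y) = bump n c1 d1 (s::real) * bump n c d (y::'y::euclidean_space)"
proof -
 have "(Basis :: (real \<times> 'y) set) = (%u. (u, 0)) ` Basis \<union> (%v. (0, v)) ` Basis"
  by (auto simp: Basis_prod_def)
 moreover have "(%u. (u, 0)) ` Basis \<inter> ((%v. (0, v)) ` Basis :: (real \<times> 'y) set) = {}"
  by auto
 ultimately have "(\<Prod>i\<in>(Basis :: (real \<times> 'y) set). h i) =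
   prod h ((%u. (u, 0)) ` Basis) * prod h ((%v. (0, v)) ` Basis)"
  for h :: "real \<times> 'y => real"
  by (metis (no_types, lifting) finite_Basis finite_imageI prod.union_disjoint)
 moreover have "prod h ((%v. (0, v)) ` Basis) = (\<Prod>v\<in>(Basis::'y set). h (0, v))" for h :: "real \<times> 'y => real"
  by (simp add: prod.reindex inj_on_def)
 ultimately have "(\<Prod>i\<in>(Basis :: (real \<times> 'y) set). h i) = (\<Prod>u\<in>(Basis::real set). h (u, 0)) * (\<Prod>v\<in>Basis. h (0, v))" 
  for h :: "real \<times> 'y => real"
  by simp
 then show ?thesis unfolding bump_def by simp
qed

lemma bump_measurable [measurable]: "bump n c d : bmeas borel"
 using smooth_C_k[OF smooth_bump_id, of 0] by (intro bmeas_contI) simp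

lemma integrable_bounded_mult:
 fixes f g :: "'a => real"
 assumes "integrable M f" "g : bmeas M" "!!x. \<bar>g x\<bar> <= B"
 shows "integrable M (%x. g x * f x)"
proof (rule integrable_bd)
 show "integrable M (%x. B * f x)" using assms(1) by simp
 show "AE x in M. norm (g x * f x) <= norm (B * f x)"
 proof (intro AE_I2)
  fix x
  have "\<bar>g x\<bar> <= \<bar>B\<bar>" using assms(3)[of x] by linarith
  then show "norm (g x * f x) <= norm (B * f x)" by (simp add: abs_mult mult_right_mono)
 qed
qed (use assms in auto)

lemma AE_zero_of_bump_integrals:
 fixes f :: "'a::euclidean_space => real"
 assumes f: "integrable lborel f" and Y: "open Y"
  and z: "!!n c d. rat_pt c ==> rat_pt d ==> cbox c d <= Y ==> (LBINT x. bump n c d x * f x) = 0"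
 shows "AE x in lborel. x : Y --> f x = 0"
proof (rule AE_zero_of_box_integrals[OF f Y])
 fix c d :: 'a assume cd: "rat_pt c" "rat_pt d" "cbox c d <= Y"
 have "(%n. \<integral>x. bump n c d x * f x \<partial>lborel) \<longlonglongrightarrow> (LBINT x. idc (box c d) x * f x)"
 proof (rule integral_dominated_convergence[where w = "%x. \<bar>f x\<bar>"])
  show "AE x in lborel. (%n. bump n c d x * f x) \<longlonglongrightarrow> idc (box c d) x * f x"
   by (intro AE_I2 tendsto_intros bump_tendsto)
  show "AE x in lborel. norm (bump n c d x * f x) <= \<bar>f x\<bar>" for n
   by (intro AE_I2) (auto simp: abs_mult bump_bounds intro!: mult_left_le_one_le)
 qed (use f in auto)
 then show "(LBINT x. idc (box c d) x * f x) = 0"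
  using z[OF cd] by (simp add: LIMSEQ_const_iff)
qed

section \<open>Fubini's theorem and weak derivatives along lines\<close>

lemma lborel_Fubini_snd:
 fixes f :: "'x::euclidean_space \<times> 'y::euclidean_space => real"
 assumes "integrable lborel f"
 shows "AE y in lborel. integrable lborel (%s. f (s, y))"
  and "integrable lborel (%y. \<integral>s. f (s, y) \<partial>lborel)"
  and "(LBINT y. (LBINT s. f (s, y))) = integral\<^sup>L lborel f"
proof -
 have *: "integrable (lborel \<Otimes>\<^sub>M lborel) (case_prod (%s y. f (s, y)))"
  using assms by (simp add: lborel_prod)
 show "AE y in lborel. integrable lborel (%s. f (s, y))"
  and "integrable lborel (%y. \<integral>s. f (s, y) \<partial>lborel)"
  by (rule lborel_pair.AE_integrable_snd[OF *] lborel_pair.integrable_snd[OF *])+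
 show "(LBINT y. (LBINT s. f (s, y))) = integral\<^sup>L lborel f"
  using lborel_pair.integral_snd[OF *] by (simp add: lborel_prod)
qed

lemma lborel_Fubini_fst:
 fixes f :: "'x::euclidean_space \<times> 'y::euclidean_space => real"
 assumes "integrable lborel f"
 shows "AE s in lborel. integrable lborel (%y. f (s, y))"
  and "integrable lborel (%s. \<integral>y. f (s, y) \<partial>lborel)"
  and "(LBINT s. (LBINT y. f (s, y))) = integral\<^sup>L lborel f"
proof -
 have *: "integrable (lborel \<Otimes>\<^sub>M lborel) (case_prod (%s y. f (s, y)))"
  using assms by (simp add: lborel_prod)
 show "AE s in lborel. integrable lborel (%y. f (s, y))"
  and "integrable lborel (%s. \<integral>y. f (s, y) \<partial>lborel)"
  by (rule lborel_pair.AE_integrable_fst[OF *] lborel_pair.integrable_fst[OF *])+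
 show "(LBINT s. (LBINT y. f (s, y))) = integral\<^sup>L lborel f"
  using lborel_pair.integral_fst[OF *] by (simp add: lborel_prod)
qed

lemma AE_lborel_prod_snd:
 assumes "AE p in (lborel :: ('x::euclidean_space \<times> 'y::euclidean_space) measure). Q p"
 shows "AE y in lborel. AE s in lborel. Q (s, y)"
proof -
 obtain N where N: "N : null_sets lborel" "{p. ~ Q p} <= N"
  using assms by (auto simp: eventually_ae_filter)
 then have [measurable]: "N : sets (borel \<Otimes>\<^sub>M borel)"
  unfolding borel_prod by auto
 have "AE p in lborel. p ~: N" using N(1) AE_not_in by blast
 then have "AE p in (lborel :: 'x measure) \<Otimes>\<^sub>M (lborel :: 'y measure). p ~: N"
  unfolding lborel_prod .
 from lborel_pair.AE_pair[OF this] have "AE y in lborel. AE s in lborel. (s, y) ~: N"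
 proof (subst lborel_pair.AE_commute[symmetric])
  have "{x : space (lborel \<Otimes>\<^sub>M lborel). (fst x, snd x) ~: N} = - N" by (auto simp: space_pair_measure)
  moreover have "- N : sets borel" using N(1) by (intro borel_comp) auto
  ultimately show "{x : space (lborel \<Otimes>\<^sub>M lborel). (fst x, snd x) ~: N} : sets (lborel \<Otimes>\<^sub>M lborel)"
   unfolding lborel_prod by simp
 qed
 then show ?thesis
  by (elim eventually_mono) (use N(2) in blast)
qed

lemma AE_lborel_prod_sndI:
 assumes "AE y in lborel. AE s in lborel. Q (s, y)"
  and "{p :: 'x::euclidean_space \<times> 'y::euclidean_space. Q p} : sets borel"
 shows "AE p in lborel. Q p"
proof -
 have *: "{x : space (lborel \<Otimes>\<^sub>M lborel). Q (fst x, snd x)} : sets ((lborel :: 'x measure) \<Otimes>\<^sub>M (lborel :: 'y measure))"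
  unfolding lborel_prod using assms(2) by simp
 have "AE s in (lborel :: 'x measure). AE y in (lborel :: 'y measure). Q (s, y)"
  using assms(1) by (subst lborel_pair.AE_commute[OF *])
 then have "AE p in (lborel :: 'x measure) \<Otimes>\<^sub>M (lborel :: 'y measure). Q p"
  using * by (intro lborel_pair.AE_pair_measure) auto
 then show ?thesis unfolding lborel_prod .
qed

lemma integrable_lborel_absolutely_integrable:
 fixes f :: "'a::euclidean_space => real"
 assumes "integrable lborel f" "S : sets lebesgue"
 shows "f absolutely_integrable_on S"
 unfolding set_integrable_def
 using assms by (intro integrable_mult_indicator integrable_completion[THEN iffD2]) auto

lemma integral_lborel_eq_integral:
 fixes g :: "real => real"
 assumes "integrable lborel g"
 shows "(LBINT sg. idc {a..s} sg * g sg) = integral {a..s} g"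
proof -
 have "set_integrable lborel {a..s} g"
  unfolding set_integrable_def using assms by (intro integrable_mult_indicator) auto
 from set_borel_integral_eq_integral(2)[OF this] show ?thesis
  by (simp add: set_lebesgue_integral_def)
qed

text \<open>A du Bois-Reymond lemma with a parameter. \<open>F\<close> minus the primitive of
  \<open>G\<close> along each line is orthogonal to all products of a derivative
  \<open>deriv ps\<close> in s and a bump in y. Any bump in s becomes such a derivative after a
  multiple of a fixed bump is subtracted, so the difference depends on y alone. Products suffice as
  test functions because a bump on a box of the product space is a product of bumps.\<close>

lemma AC_on_lines:
 fixes F G :: "real \<times> 'y::euclidean_space => real"
 assumes F: "integrable lborel F" and G: "integrable lborel G" and Y: "open Y" and ab: "a < b"
  and weak: "!!ps n c d. test_fun {a<..<b} ps ==> cbox c d <= Y ==>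
   (LBINT p. deriv ps (fst p) * bump n c d (snd p) * F p) = - (LBINT p. ps (fst p) * bump n c d (snd p) * G p)"
 shows "AE y in lborel. y : Y --> AC a b (%s. F (s, y)) (%s. G (s, y))"
proof -
 have [measurable]: "F : bmeas borel" "G : bmeas borel" using F G by auto
 have [measurable]: "G : bmeas (borel \<Otimes>\<^sub>M borel)" unfolding borel_prod by simp
 have [measurable]: "(fst :: real \<times> 'y => real) : bmeas borel" "(snd :: real \<times> 'y => 'y) : bmeas borel"
  by (auto intro!: bmeas_contI continuous_intros)
 define I :: "real => real" where "I = idc {a<..<b}"
 have I_meas [measurable]: "I : bmeas borel" by (simp add: I_def)
 have intI: "integrable lborel I" unfolding I_def by (rule integrable_real_indicator) (use ab in auto)
 \<comment> \<open>The primitive of \<open>G\<close> on each line. Writing it with an indicator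
   gives measurability jointly in s and y.\<close>
 define Gm where "Gm p = (LBINT sg. idc {a..fst p} sg * G (sg, snd p))" for p
 have [measurable]: "Gm : bmeas borel"
 proof -
  have "(%p. (LBINT sg. (if a <= sg & sg <= fst p then G (sg, snd p) else 0))) : bmeas borel"
   by (rule lborel.borel_measurable_lebesgue_integral) (simp add: split_beta)
  moreover have "Gm = (%p. (LBINT sg. (if a <= sg & sg <= fst p then G (sg, snd p) else 0)))"
   by (intro ext) (auto simp: Gm_def indicator_def intro!: Bochner_Integration.integral_cong)
  ultimately show ?thesis by simp
 qed
 have absG: "integrable lborel (%p. \<bar>G p\<bar>)" using G by simp
 define g where "g y = (LBINT sg. \<bar>G (sg, y)\<bar>)" for y
 have intg: "integrable lborel g" using lborel_Fubini_snd(2)[OF absG] by (simp add: g_def[abs_def])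
 have AEG: "AE y in lborel. integrable lborel (%s. G (s, y))" by (rule lborel_Fubini_snd(1)[OF G])
 have Gm_eq: "Gm (s, y) = integral {a..s} (%sg. G (sg, y))" if "integrable lborel (%s. G (s, y))" for s y
  using integral_lborel_eq_integral[OF that] by (simp add: Gm_def)
 have prodI: "integrable lborel (%p. I (fst p) * k (snd p))" if "integrable lborel k" for k :: "'y => real"
 proof -
  have [measurable]: "k : bmeas borel" using that by auto
  have "integrable (lborel \<Otimes>\<^sub>M lborel) (%p. I (fst p) * k (snd p))"
  proof (rule lborel_pair.Fubini_integrable)
   show "integrable lborel (%x. \<integral>y. norm (I (fst (x, y)) * k (snd (x, y))) \<partial>lborel)"
    using intI by (simp add: abs_mult)
   show "AE x in lborel. integrable lborel (%y. I (fst (x, y)) * k (snd (x, y)))"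
    using that by simp
  qed simp
  then show ?thesis by (simp add: lborel_prod)
 qed
 have intGm: "integrable lborel (%p. I (fst p) * Gm p)"
 proof (rule integrable_bd[OF prodI[OF intg]])
  show "AE p in lborel. norm (I (fst p) * Gm p) <= norm (I (fst p) * g (snd p))"
  proof (rule AE_lborel_prod_sndI)
   have "AE y in lborel. \<forall>x. norm (I x * Gm (x, y)) <= norm (I x * g y)"
    using AEG
   proof eventually_elim
    case (elim y)
    show ?case
    proof
     fix x
     have "\<bar>Gm (x, y)\<bar> <= (LBINT sg. \<bar>indicator {a..x} sg * G (sg, y)\<bar>)"
      unfolding Gm_def fst_conv snd_conv by (rule integral_abs_bound)
     also have "... <= g y"
      unfolding g_def
      using integrable_mult_indicator[of "{a..x}" lborel "%s. G (s, y)"] elim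
      by (intro integral_mono) (auto simp: indicator_def)
     finally have "\<bar>Gm (x, y)\<bar> <= \<bar>g y\<bar>" by simp
     then show "norm (I x * Gm (x, y)) <= norm (I x * g y)"
      by (simp add: abs_mult mult_left_mono)
    qed
   qed
   then show "AE y in lborel. AE x in lborel. norm (I (fst (x, y)) * Gm (x, y)) <= norm (I (fst (x, y)) * g (snd (x, y)))"
    by (rule eventually_mono) simp
   have [measurable]: "g : bmeas borel" using intg by auto
   show "{p. norm (I (fst p) * Gm p) <= norm (I (fst p) * g (snd p))} : sets borel"
    using borel_measurable_le[of "%p. norm (I (fst p) * Gm p)" borel "%p. norm (I (fst p) * g (snd p))"] by simp
  qed
 qed simp
 have intF: "integrable lborel (%p. I (fst p) * F p)"
  by (rule integrable_bounded_mult[OF F, of _ 1]) (auto simp: I_def indicator_def)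
 \<comment> \<open>\<open>D0\<close> below says that the weak derivative of \<open>D\<close> in the
   first variable is zero.\<close>
 define D where "D p = I (fst p) * F p - I (fst p) * Gm p" for p
 have intD: "integrable lborel D" unfolding D_def using intF intGm by simp
 have bdd: "\<exists>B. \<forall>s. \<bar>ps s\<bar> <= B" if "continuous_on UNIV ps" "!!s. s ~: {a<..<b} ==> ps s = 0" for ps :: "real => real"
 proof -
  have "bounded (ps ` {a..b})"
   using that(1) by (intro compact_imp_bounded compact_continuous_image) (auto intro: continuous_on_subset)
  then obtain B where "\<forall>s\<in>{a..b}. \<bar>ps s\<bar> <= B" by (auto simp: bounded_iff)
  then have B: "!!s. s : {a..b} ==> \<bar>ps s\<bar> <= B" by blast
  have "\<bar>ps s\<bar> <= \<bar>B\<bar>" for s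
   using B[of s] that(2)[of s] by (cases "s : {a..b}") auto
  then show ?thesis by blast
 qed
 have D0: "(LBINT p. deriv ps (fst p) * bump n c d (snd p) * D p) = 0"
  if ps: "test_fun {a<..<b} ps" and cd: "cbox c d <= Y" for ps n c d
 proof -
  have sm: "smooth UNIV ps" using ps test_fun_smooth by blast
  have cont: "continuous_on UNIV ps" "continuous_on UNIV (deriv ps)"
   using smooth_C_k[OF sm, of 0] smooth_C_k[OF smooth_deriv[OF sm], of 0] by auto
  have [measurable]: "ps : bmeas borel" "deriv ps : bmeas borel"
   using cont by (auto intro: bmeas_contI)
  obtain K where K: "compact K" "K <= {a<..<b}" "!!x. x ~: K ==> ps x = 0" using test_fun_support[OF ps] by metis
  have der0: "deriv ps s = 0" if "s ~: {a<..<b}" for s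
  proof -
   have "((%s. 0) has_real_derivative 0) (at s)" by simp
   then have "(ps has_real_derivative 0) (at s)"
    by (rule has_field_derivative_transform_within_open[where S = "- K"])
      (use K compact_imp_closed that in auto)
   then show ?thesis by (rule DERIV_imp_deriv)
  qed
  have z0: "ps s = 0" if "s ~: {a<..<b}" for s using K that by blast
  obtain B1 where B1: "!!s. \<bar>ps s\<bar> <= B1" using bdd[OF cont(1) z0] by auto
  obtain B2 where B2: "!!s. \<bar>deriv ps s\<bar> <= B2" using bdd[OF cont(2) der0] by auto
  have b1: "\<bar>u * bump n c d y\<bar> <= B" if "\<bar>u\<bar> <= B" for u y and B :: real
   using mult_mono[OF that bump_bounds(2)[of n c d y]] bump_bounds(1)[of n c d y] that by (simp add: abs_mult)
  have int1: "integrable lborel (%p. deriv ps (fst p) * bump n c d (snd p) * f p)" if "integrable lborel f" for f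
   by (rule integrable_bounded_mult[OF that, of _ B2]) (auto intro: b1 B2)
  have int2: "integrable lborel (%p. ps (fst p) * bump n c d (snd p) * f p)" if "integrable lborel f" for f
   by (rule integrable_bounded_mult[OF that, of _ B1]) (auto intro: b1 B1)
  let ?h = "%p. ps (fst p) * bump n c d (snd p) * G p + deriv ps (fst p) * bump n c d (snd p) * (I (fst p) * Gm p)"
  have inth: "integrable lborel ?h" by (intro integrable_plus int1 int2 G intGm)
  have "AE y in lborel. (LBINT s. ?h (s, y)) = 0"
   using AEG lborel_Fubini_snd(1)[OF intGm]
  proof eventually_elim
   case (elim y)
   have "primitive_ae a b (%s. Gm (s, y)) (%s. G (s, y)) 0"
    unfolding primitive_ae_def using Gm_eq[OF elim(1)] integrable_lborel_absolutely_integrable[OF elim(1)] by simp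
   then have "AC a b (%s. Gm (s, y)) (%s. G (s, y))" by (auto simp: AC_def)
   from integrate_by_parts_test[OF this ps ab]
   have z: "integral {a..b} (%s. ps s * G (s, y) + deriv ps s * Gm (s, y)) = 0" .
   have i: "integrable lborel (%s. ps s * G (s, y) + deriv ps s * (I s * Gm (s, y)))"
   proof (rule integrable_plus)
    show "integrable lborel (%s. ps s * G (s, y))"
     by (rule integrable_bounded_mult[OF elim(1) _ B1]) simp
    show "integrable lborel (%s. deriv ps s * (I s * Gm (s, y)))"
     using elim(2) by (intro integrable_bounded_mult[OF _ _ B2]) auto
   qed
   have "(LBINT s. ?h (s, y)) = (LBINT s. bump n c d y * (ps s * G (s, y) + deriv ps s * (I s * Gm (s, y))))"
    by (intro Bochner_Integration.integral_cong) (auto simp: algebra_simps)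
   also have "... = bump n c d y * (LBINT s. idc {a..b} s * (ps s * G (s, y) + deriv ps s * (I s * Gm (s, y))))"
    using z0 by (subst integral_mult_right_zero) (auto intro!: Bochner_Integration.integral_cong simp: I_def indicator_def)
   also have "(LBINT s. idc {a..b} s * (ps s * G (s, y) + deriv ps s * (I s * Gm (s, y)))) =
     integral {a..b} (%s. ps s * G (s, y) + deriv ps s * (I s * Gm (s, y)))"
    by (rule integral_lborel_eq_integral[OF i])
   also have "... = integral {a..b} (%s. ps s * G (s, y) + deriv ps s * Gm (s, y))"
    using der0 by (intro integral_cong) (auto simp: I_def indicator_def)
   finally show ?case using z by simp
  qed
  then have "(LBINT p. ?h p) = 0"
   using lborel_Fubini_snd(3)[OF inth] by (simp add: integral_eq_zero_AE)
  then have e1: "(LBINT p. ps (fst p) * bump n c d (snd p) * G p) +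
    (LBINT p. deriv ps (fst p) * bump n c d (snd p) * (I (fst p) * Gm p)) = 0"
   using int1[OF intGm] int2[OF G] by simp
  have "(LBINT p. deriv ps (fst p) * bump n c d (snd p) * (I (fst p) * F p)) =
    (LBINT p. deriv ps (fst p) * bump n c d (snd p) * F p)"
   using der0 by (intro Bochner_Integration.integral_cong) (auto simp: I_def indicator_def)
  then have e2: "(LBINT p. deriv ps (fst p) * bump n c d (snd p) * (I (fst p) * F p)) =
    - (LBINT p. ps (fst p) * bump n c d (snd p) * G p)"
   using weak[OF ps cd] by simp
  show ?thesis
   using e1 e2 int1[OF intF] int1[OF intGm] by (simp add: D_def right_diff_distrib)
 qed
 \<comment> \<open>The middle third of the interval carries a fixed weight \<open>thh\<close>, whose
   positive integral \<open>T\<close> normalizes weighted means along the lines.\<close>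
 define c0 d0 where "c0 = (2 * a + b) / 3" and "d0 = (a + 2 * b) / 3"
 have cd0: "a < c0" "c0 < d0" "d0 < b" using ab by (auto simp: c0_def d0_def)
 define thh where "thh = bump 1 c0 d0"
 have intom: "integrable lborel (bump n c1 d1)" for n and c1 d1 :: real
 proof (rule integrable_bd[of lborel "idc {c1..d1} :: real => real"])
  show "AE x in lborel. norm (bump n c1 d1 x) <= norm (idc {c1..d1} x :: real)"
   using bump_outside[of _ c1 d1 n] by (intro AE_I2) (auto simp: indicator_def bump_bounds box_real)
  show "integrable lborel (idc {c1..d1} :: real => real)"
   by (rule integrable_real_indicator[OF _ emeasure_bounded_finite]) auto
 qed auto
 have intthh: "integrable lborel thh" by (simp add: thh_def intom)
 define T where "T = (LBINT s. thh s)"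
 have "T > 0"
 proof -
  have "T >= 0" unfolding T_def thh_def by (simp add: bump_bounds)
  moreover have "T ~= 0"
  proof
   assume "T = 0"
   then have "AE s in lborel. thh s = 0"
    using integral_nonneg_eq_0_iff_AE[OF intthh] by (simp add: T_def thh_def bump_bounds)
   then have "AE s in lebesgue. s : {c0<..<d0} --> thh s : {0}"
    by (intro AE_completion) auto
   moreover have "continuous_on {c0..d0} thh"
    using smooth_C_k[OF smooth_bump_id, of 0 1 c0 d0] unfolding thh_def by (auto intro: continuous_on_subset)
   ultimately have "thh ((c0 + d0) / 2) : {0}"
    using cd0 by (intro AE_interval_continuous_closed[of c0 d0 thh "{0}"]) auto
   moreover have "thh ((c0 + d0) / 2) > 0"
    unfolding thh_def by (rule bump_pos) (use cd0 in \<open>auto simp: box_real\<close>)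
   ultimately show False by simp
  qed
  ultimately show ?thesis by simp
 qed
 \<comment> \<open>The weighted mean of \<open>D\<close> over the line through y. If
   \<open>D\<close> does not depend on s, this mean is its value, so the difference \<open>E\<close>
   has to vanish.\<close>
 define k where "k y = (LBINT s. thh s * D (s, y)) / T" for y
 have intthhD: "integrable lborel (%p. thh (fst p) * D p)"
  by (rule integrable_bounded_mult[OF intD, of _ 1]) (auto simp: thh_def bump_bounds)
 have intk: "integrable lborel k"
  using lborel_Fubini_snd(2)[OF intthhD] by (simp add: k_def[abs_def])
 define E where "E p = D p - I (fst p) * k (snd p)" for p
 have intE: "integrable lborel E" unfolding E_def using intD prodI[OF intk] by simp
 have "AE p in lborel. p : {a<..<b} \<times> Y --> E p = 0"
 proof (rule AE_zero_of_bump_integrals[OF intE])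
  show "open ({a<..<b} \<times> Y)" using Y by (intro open_Times) auto
  fix n and cc dd :: "real \<times> 'y" assume sub: "cbox cc dd <= {a<..<b} \<times> Y"
  obtain c1 c d1 d where cd: "cc = (c1, c)" "dd = (d1, d)" by (cases cc; cases dd) auto
  show "(LBINT p. bump n cc dd p * E p) = 0"
  proof (cases "cbox cc dd = {}")
   case True
   then have "bump n cc dd p = 0" for p
    using box_subset_cbox[of cc dd] by (intro bump_outside) blast
   then show ?thesis by simp
  next
   case False
   then have c1d1: "c1 <= d1" "cbox c d ~= {}"
    by (auto simp: cd cbox_Pair_eq)
   then have "c1 : {a<..<b}" "d1 : {a<..<b}" "cbox c d <= Y"
    using sub unfolding cd cbox_Pair_eq by (auto simp: subset_iff)
   note ab1 = this
   define om where "om = bump n c1 d1"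
   \<comment> \<open>This multiple of \<open>thh\<close> makes the integral of \<open>v\<close>
     zero, so \<open>v\<close> is the derivative of a test function and \<open>D0\<close> applies:
     integrals against the arbitrary bump \<open>om\<close> become integrals against the fixed
     weight.\<close>
   define w where "w = (LBINT s. om s) / T"
   define v where "v s = om s + (- w) * thh s" for s
   have smv: "smooth UNIV v"
    unfolding v_def om_def thh_def by (intro smooth_add smooth_mult smooth_const smooth_bump_id)
   define c2 d2 where "c2 = min c0 c1" and "d2 = max d0 d1"
   have v0: "v s = 0" if "s ~: {c2..d2}" for s
    using that bump_outside[of s c1 d1 n] bump_outside[of s c0 d0 1]
    by (auto simp: v_def om_def thh_def box_real c2_def d2_def min_def max_def split: if_splits)
   have intv: "integrable lborel v" unfolding v_def om_def using intom intthh by simp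
   have "(LBINT s. idc {c2..d2} s * v s) = (LBINT s. v s)"
    using v0 by (intro Bochner_Integration.integral_cong) (auto simp: indicator_def)
   also have "... = 0"
    unfolding v_def om_def using intom intthh \<open>T > 0\<close> by (simp add: w_def om_def T_def[symmetric])
   finally have "integral {c2..d2} v = 0" using integral_lborel_eq_integral[OF intv, of c2 d2] by simp
   moreover have "v integrable_on {c2..d2}"
    using integrable_lborel_absolutely_integrable[OF intv, of "{c2..d2}"] set_lebesgue_integral_eq_integral(1) by auto
   ultimately have "(v has_integral 0) {c2..d2}" by (simp add: has_integral_iff)
   moreover have "a < c2" "c2 <= d2" "d2 < b" using ab1 cd0 c1d1 by (auto simp: c2_def d2_def)
   ultimately obtain ps where ps: "test_fun {a<..<b} ps" "!!s. (ps has_real_derivative v s) (at s)"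
    using test_fun_primitive[OF smv v0, of c2 d2 a b] by metis
   have [simp]: "deriv ps = v" using ps(2) DERIV_imp_deriv by blast
   let ?b = "bump n c d"
   have bb: "\<bar>u * ?b y\<bar> <= 1" if "\<bar>u\<bar> <= 1" for u y
    using mult_mono[OF that bump_bounds(2)[of n c d y]] bump_bounds(1)[of n c d y] by (simp add: abs_mult)
   have i1: "integrable lborel (%p. om (fst p) * ?b (snd p) * D p)"
    by (rule integrable_bounded_mult[OF intD _ bb]) (auto simp: om_def bump_bounds)
   have i2: "integrable lborel (%p. thh (fst p) * ?b (snd p) * D p)"
    by (rule integrable_bounded_mult[OF intD _ bb]) (auto simp: thh_def bump_bounds)
   have i3: "integrable lborel (%p. om (fst p) * ?b (snd p) * (I (fst p) * k (snd p)))"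
    by (rule integrable_bounded_mult[OF prodI[OF intk] _ bb]) (auto simp: om_def bump_bounds)
   have "(LBINT p. om (fst p) * ?b (snd p) * D p + (- w) * (thh (fst p) * ?b (snd p) * D p)) = 0"
    using D0[OF ps(1) ab1(3), of n] by (simp add: v_def algebra_simps)
   then have e1: "(LBINT p. om (fst p) * ?b (snd p) * D p) = w * (LBINT p. thh (fst p) * ?b (snd p) * D p)"
    using i1 i2 by simp
   have "(LBINT p. thh (fst p) * ?b (snd p) * D p) = (LBINT y. (LBINT s. thh s * ?b y * D (s, y)))"
    using lborel_Fubini_snd(3)[OF i2] by simp
   also have "... = (LBINT y. T * (?b y * k y))"
   proof (intro Bochner_Integration.integral_cong refl)
    fix y
    have "(LBINT s. thh s * ?b y * D (s, y)) = (LBINT s. ?b y * (thh s * D (s, y)))"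
     by (simp add: mult_ac)
    also have "... = ?b y * (T * k y)" using \<open>T > 0\<close> by (simp add: k_def)
    finally show "(LBINT s. thh s * ?b y * D (s, y)) = T * (?b y * k y)" by simp
   qed
   also have "... = T * (LBINT y. ?b y * k y)" by simp
   finally have e2: "(LBINT p. thh (fst p) * ?b (snd p) * D p) = T * (LBINT y. ?b y * k y)" .
   have "(LBINT p. om (fst p) * ?b (snd p) * (I (fst p) * k (snd p))) = 
     (LBINT y. (LBINT s. om s * ?b y * (I s * k y)))"
    using lborel_Fubini_snd(3)[OF i3] by simp
   also have "... = (LBINT y. (w * T) * (?b y * k y))"
   proof (intro Bochner_Integration.integral_cong refl)
    fix y
    have "om s * I s = om s" for s
     using ab1(1,2) bump_outside[of s c1 d1 n] unfolding I_def om_def indicator_def box_real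
     by (cases "c1 < s & s < d1") auto
    then have "(LBINT s. om s * ?b y * (I s * k y)) = (LBINT s. (?b y * k y) * om s)"
     by (intro Bochner_Integration.integral_cong refl) (metis mult.assoc mult.commute)
    also have "... = (w * T) * (?b y * k y)" using \<open>T > 0\<close> by (simp add: w_def)
    finally show "(LBINT s. om s * ?b y * (I s * k y)) = (w * T) * (?b y * k y)" .
   qed
   also have "... = (w * T) * (LBINT y. ?b y * k y)" by simp
   finally have e3: "(LBINT p. om (fst p) * ?b (snd p) * (I (fst p) * k (snd p))) = (w * T) * (LBINT y. ?b y * k y)" .
   have "(LBINT p. bump n cc dd p * E p) = 
     (LBINT p. om (fst p) * ?b (snd p) * D p - om (fst p) * ?b (snd p) * (I (fst p) * k (snd p)))"
    by (intro Bochner_Integration.integral_cong) (auto simp: cd bump_Pair om_def E_def right_diff_distrib)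
   also have "... = 0" using i1 i3 e1 e2 e3 by simp
   finally show ?thesis .
  qed
 qed
 from AE_lborel_prod_snd[OF this] AEG show ?thesis
 proof eventually_elim
  case (elim y)
  show ?case
  proof
   assume y: "y : Y"
   have "AE s in lborel. s : {a<..<b} --> F (s, y) = k y + integral {a..s} (%sg. G (sg, y))"
    using elim(1)
    by eventually_elim (use y in \<open>auto simp: E_def D_def I_def Gm_eq[OF elim(2)]\<close>)
   then have "AE s in lebesgue. s : {a<..<b} --> F (s, y) = k y + integral {a..s} (%sg. G (sg, y))"
    by (rule AE_completion)
   then show "AC a b (%s. F (s, y)) (%s. G (s, y))"
    unfolding AC_def primitive_ae_def using integrable_lborel_absolutely_integrable[OF elim(2), of "{a..b}"] by auto
  qed
 qed
qed

section \<open>The cylindrical variables, the push-forward of the cell, and angular averages\<close>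

definition cyl :: "real^3 => real \<times> real" where
 "cyl x = ((x$1)^2 + (x$2)^2, x$3)"

definition Rect :: "(real \<times> real) set" where
 "Rect = {1<..<4} \<times> {0<..<1}"

text \<open>The volume of the unit cylinder, that is pi. Only its positivity and the scaling of
  volumes enter below.\<close>

definition cyl_const :: real where
 "cyl_const = measure lebesgue {x::real^3. (x$1)^2 + (x$2)^2 < 1 & 0 < x$3 & x$3 < 1}"

lemma continuous_cyl: "continuous_on A cyl"
 unfolding cyl_def by (intro continuous_intros)

lemma cyl_measurable [measurable]: "cyl : bmeas borel"
 by (intro bmeas_contI continuous_cyl)

lemma cyl_measurable_lebesgue: "cyl : lebesgue_on S \<rightarrow>\<^sub>M borel"
 by (rule measurable_restrict_space1, rule measurable_completion) simp

lemma Rect_borel [measurable]: "Rect : sets borel"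
 unfolding Rect_def by (intro borel_open open_Times) auto

lemma open_Omega: "open Omega"
 unfolding Omega_def by (intro open_Collect_conj open_Collect_less continuous_intros)

lemma Cell_borel: "Cell : sets borel"
proof -
 have "Cell = Omega \<inter> {x. 0 <= x$3} \<inter> {x. x$3 < 1}" by (auto simp: Cell_def)
 moreover have "closed {x::real^3. 0 <= x$3}" by (intro closed_Collect_le continuous_intros)
 moreover have "open {x::real^3. x$3 < 1}" by (intro open_Collect_less continuous_intros)
 ultimately show ?thesis
  using open_Omega by (metis sets.Int borel_open borel_closed)
qed

lemma Cell_lebesgue [simp]: "Cell : sets lebesgue"
 using Cell_borel by auto

lemma cyl_slab_base:
 "{x::real^3. (x$1)^2 + (x$2)^2 < 1 & 0 < x$3 & x$3 < 1} : lmeasurable" (is "?U : _")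
 and cyl_const_pos: "cyl_const > 0"
proof -
 have o: "open ?U" by (intro open_Collect_conj open_Collect_less continuous_intros)
 have "?U <= cbox (-1) 1"
 proof
  fix x assume "x : ?U"
  then have a: "(x$1)^2 + (x$2)^2 < 1" "0 < x$3" "x$3 < 1" by auto
  then have "(x$1)^2 < 1" "(x$2)^2 < 1"
   using zero_le_power2[of "x$1"] zero_le_power2[of "x$2"] by linarith+
  then have "\<bar>x$1\<bar> < 1" "\<bar>x$2\<bar> < 1" by (simp_all add: abs_square_less_1)
  then show "x : cbox (-1) 1" using a by (auto simp: mem_box_cart forall_3)
 qed
 then have "bounded ?U" using bounded_cbox bounded_subset by blast
 then show m: "?U : lmeasurable" using o lmeasurable_open by blast
 have "(\<chi> i. 1/2) : ?U" by (simp add: power2_eq_square)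
 then have "~ negligible ?U" using o open_not_negligible by blast
 then show "cyl_const > 0"
  unfolding cyl_const_def using negligible_iff_measure0[OF m] measure_nonneg[of lebesgue ?U] by linarith
qed

text \<open>The diagonal map with entries sqrt b, sqrt b, d - c, followed by a vertical shift,
  carries the unit slab onto this one, and its determinant is b (d - c). Volume is linear in
  \<open>b\<close> because \<open>b\<close> bounds the squared radius.\<close>

lemma cyl_slab:
 assumes "0 <= b" "c <= d"
 shows "{x::real^3. (x$1)^2 + (x$2)^2 < b & c < x$3 & x$3 < d} : lmeasurable" (is "?A : _")
  and "measure lebesgue {x::real^3. (x$1)^2 + (x$2)^2 < b & c < x$3 & x$3 < d} = cyl_const * b * (d - c)"
proof -
 let ?U = "{x::real^3. (x$1)^2 + (x$2)^2 < 1 & 0 < x$3 & x$3 < 1}"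
 define m :: "3 => real" where "m k = (if k = 3 then d - c else sqrt b)" for k
 let ?S = "(%x. \<chi> k. m k * x$k) ` ?U"
 have sq: "(sqrt b * u)^2 + (sqrt b * v)^2 = b * (u^2 + v^2)" for u v
  using assms(1) by (simp add: power_mult_distrib algebra_simps)
 have 1: "?A = (%x. axis 3 c + x) ` ?S" if pos: "b > 0" "d > c"
 proof safe
  fix x :: "real^3" assume x: "(x$1)^2 + (x$2)^2 < b" "c < x$3" "x$3 < d"
  define y :: "real^3" where "y = vector [x$1 / sqrt b, x$2 / sqrt b, (x$3 - c) / (d - c)]"
  have "y : ?U" using x pos by (auto simp: y_def power_divide add_divide_distrib[symmetric])
  moreover have "x = axis 3 c + (\<chi> k. m k * y$k)"
   using pos by (auto simp: vec_eq_iff forall_3 y_def m_def axis_def)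
  ultimately show "x : (%x. axis 3 c + x) ` ?S" by blast
 next
  fix x y :: "real^3" assume y: "(y$1)^2 + (y$2)^2 < 1" "0 < y$3" "y$3 < 1"
  show "((axis 3 c + (\<chi> k. m k * y$k))$1)^2 + ((axis 3 c + (\<chi> k. m k * y$k))$2)^2 < b"
   using y pos by (simp add: m_def axis_def sq)
  have "0 < (d - c) * y$3" "(d - c) * y$3 < (d - c) * 1"
   using y pos by (auto intro!: mult_pos_pos mult_strict_left_mono)
  moreover have "(axis 3 c + (\<chi> k. m k * y$k))$3 = c + (d - c) * y$3"
   by (simp add: m_def axis_def)
  moreover have "(d - c) * 1 = d - c" by simp
  ultimately show "c < (axis 3 c + (\<chi> k. m k * y$k))$3" "(axis 3 c + (\<chi> k. m k * y$k))$3 < d"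
   by linarith+
 qed
 have "?A : lmeasurable & measure lebesgue ?A = cyl_const * b * (d - c)"
 proof (cases "b > 0 & d > c")
  case True
  have "?S : lmeasurable" by (rule measurable_stretch[OF cyl_slab_base])
  moreover have "measure lebesgue ?S = \<bar>prod m UNIV\<bar> * cyl_const"
   unfolding cyl_const_def by (rule measure_stretch[OF cyl_slab_base])
  moreover have "\<bar>prod m UNIV\<bar> = b * (d - c)"
  proof -
   have "prod m UNIV = sqrt b * sqrt b * (d - c)"
    unfolding UNIV_3 by (simp add: m_def)
   then show ?thesis using True by simp
  qed
  ultimately show ?thesis
   unfolding 1[OF conjunct1[OF True] conjunct2[OF True]]
   using measurable_translation[of ?S "axis 3 c"] measure_translation[of "axis 3 c" ?S] by simp
 next
  case False
  then have bd: "b = 0 | d = c" using assms by auto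
  have e: "?A = {}"
  proof safe
   fix x :: "real^3" assume "(x$1)^2 + (x$2)^2 < b" "c < x$3" "x$3 < d"
   then show "x : {}" using bd sum_power2_ge_zero[of "x$1" "x$2"] by linarith
  qed
  have "cyl_const * b * (d - c) = 0" using bd by auto
  then show ?thesis unfolding e by simp
 qed
 then show "?A : lmeasurable" "measure lebesgue ?A = cyl_const * b * (d - c)" by auto
qed

text \<open>The surface lies in the shells a <= R < a + h, whose volumes are proportional to
  h.\<close>

lemma cyl_circle_negligible:
 "negligible {x::real^3. (x$1)^2 + (x$2)^2 = a & c < x$3 & x$3 < d}" (is "negligible ?A")
proof (cases "0 <= a & c <= d")
 case True
 show ?thesis
  unfolding negligible_outer
 proof (intro allI impI)
  fix e :: real assume "e > 0"
  define K where "K = cyl_const * (d - c)"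
  have K: "K >= 0" using cyl_const_pos True by (simp add: K_def)
  define h where "h = e / (K + 1)"
  have "h > 0" using K \<open>e > 0\<close> by (simp add: h_def)
  have "K * h < e" using K \<open>e > 0\<close> by (simp add: h_def field_simps)
  then have h: "h > 0" "cyl_const * h * (d - c) < e" using \<open>h > 0\<close> by (simp_all add: K_def mult_ac)
  let ?L = "{x::real^3. (x$1)^2 + (x$2)^2 < a & c < x$3 & x$3 < d}"
   and ?H = "{x::real^3. (x$1)^2 + (x$2)^2 < a + h & c < x$3 & x$3 < d}"
  have L: "?L : lmeasurable" "measure lebesgue ?L = cyl_const * a * (d - c)"
   and H: "?H : lmeasurable" "measure lebesgue ?H = cyl_const * (a + h) * (d - c)"
   using cyl_slab[of a c d] cyl_slab[of "a + h" c d] True h by auto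
  have "measure lebesgue (?H - ?L) = measure lebesgue ?H - measure lebesgue ?L"
   by (rule measurable_measure_Diff) (use L H h in auto)
  also have "... < e" using h(2) unfolding L H by (simp add: algebra_simps)
  finally show "\<exists>T. ?A <= T & T : lmeasurable & measure lebesgue T < e"
   using L(1) H(1) h(1) by (intro exI[of _ "?H - ?L"]) auto
 qed
next
 case False
 have "?A = {}"
 proof safe
  fix x :: "real^3" assume "a = (x$1)^2 + (x$2)^2" "c < x$3" "x$3 < d"
  then show "x : {}" using False sum_power2_ge_zero[of "x$1" "x$2"] by linarith
 qed
 then show ?thesis by (simp only: negligible_empty)
qed

lemma cyl_shell:
 assumes "0 <= a" "a <= b" "c <= d"
 shows "emeasure lebesgue {x. cyl x : {a<..<b} \<times> {c<..<d}} = ennreal (cyl_const * (b - a) * (d - c))"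
proof -
 let ?L = "{x::real^3. (x$1)^2 + (x$2)^2 < a & c < x$3 & x$3 < d}"
  and ?H = "{x::real^3. (x$1)^2 + (x$2)^2 < b & c < x$3 & x$3 < d}"
  and ?C = "{x::real^3. (x$1)^2 + (x$2)^2 = a & c < x$3 & x$3 < d}"
 have L: "?L : lmeasurable" "measure lebesgue ?L = cyl_const * a * (d - c)"
  and H: "?H : lmeasurable" "measure lebesgue ?H = cyl_const * b * (d - c)"
  using cyl_slab[of a c d] cyl_slab[of b c d] assms by auto
 have eq: "{x. cyl x : {a<..<b} \<times> {c<..<d}} = (?H - ?L) - ?C"
  by (auto simp: cyl_def)
 have HL: "?H - ?L : lmeasurable" "measure lebesgue (?H - ?L) = cyl_const * (b - a) * (d - c)"
 proof -
  have "measure lebesgue (?H - ?L) = measure lebesgue ?H - measure lebesgue ?L"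
   by (rule measurable_measure_Diff) (use L H assms in auto)
  then show "measure lebesgue (?H - ?L) = cyl_const * (b - a) * (d - c)"
   unfolding L H by (simp add: algebra_simps)
 qed (use L H in auto)
 have C: "?C : null_sets lebesgue" using cyl_circle_negligible negligible_iff_null_sets by blast
 have "emeasure lebesgue ((?H - ?L) - ?C) = emeasure lebesgue (?H - ?L)"
  using C HL(1) by (intro emeasure_Diff_null_set) (auto simp: fmeasurableD)
 then show ?thesis unfolding eq using HL by (simp add: emeasure_eq_measure2)
qed

lemma hyperplane_negligible: "negligible {x::real^3. x$3 = c}"
 using negligible_standard_hyperplane[of "axis 3 1 :: real^3" c] by (simp add: inner_axis axis_in_Basis_iff)

lemma box_real_Pair: "box (a, c) (b, d) = {a<..<b} \<times> {c<..<(d::real)}" for a b :: real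
 by (auto simp: box_def Basis_prod_def)

lemma bounded_Cell: "bounded Cell"
proof (rule bounded_subset[OF bounded_cbox])
 show "Cell <= cbox (-2) 2"
 proof
  fix x assume "x : Cell"
  then have a: "(x$1)^2 + (x$2)^2 < 2^2" "0 <= x$3" "x$3 < 1" by (auto simp: Cell_def Omega_def)
  then have "(x$1)^2 < 2^2" "(x$2)^2 < 2^2"
   using zero_le_power2[of "x$1"] zero_le_power2[of "x$2"] by linarith+
  then have "\<bar>x$1\<bar> < 2" "\<bar>x$2\<bar> < 2" using abs_le_square_iff[of 2 "x$1"] abs_le_square_iff[of 2 "x$2"] by (simp_all add: not_le[symmetric])
  then show "x : cbox (-2) 2" using a by (auto simp: mem_box_cart forall_3)
 qed
qed

lemma Cell_lmeasurable: "Cell : lmeasurable"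
 using bounded_set_imp_lmeasurable[OF bounded_Cell] by simp

lemma finite_measure_Cell: "finite_measure (cellM)"
 using Cell_lmeasurable finite_measure_lebesgue_on by blast

lemma distr_cyl: "distr (cellM) borel cyl = density lborel (%p. ennreal cyl_const * idc Rect p)"
proof (rule measure_eqI_generator_eq[where \<Omega> = UNIV and E = "range (%(a,b). box a b)"])
 show "Int_stable (range (%(a, b). box a (b::real \<times> real)))"
  by (auto simp: Int_stable_def box_Int_box)
 show "sets (distr (cellM) borel cyl) = sigma_sets UNIV (range (%(a, b). box a b))"
  "sets (density lborel (%p. ennreal cyl_const * idc Rect p)) = sigma_sets UNIV (range (%(a, b). box a b))"
  by (simp_all add: borel_eq_box)
 fix X :: "(real \<times> real) set" assume "X : range (%(a, b). box a b)"
 then obtain a c b d where X: "X = {a<..<b} \<times> {c<..<d}"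
  by (auto simp: box_real_Pair)
 \<comment> \<open>The box clipped to \<open>Rect\<close>. The nested maxima keep the ends of the
   intervals in order, so \<open>cyl_shell\<close> also covers an empty intersection.\<close>
 let ?a = "max a 1" and ?b = "max (max a 1) (min b 4)" and ?c = "max c 0" and ?d = "max (max c 0) (min d 1)"
 have XR: "X \<inter> Rect = {?a<..<?b} \<times> {?c<..<?d}" by (auto simp: X Rect_def)
 have "emeasure (distr (cellM) borel cyl) X = emeasure (cellM) (cyl -` X \<inter> Cell)"
  using cyl_measurable_lebesgue[of Cell] by (subst emeasure_distr) (auto simp: X borel_open open_Times)
 also have "... = emeasure lebesgue (cyl -` X \<inter> Cell)"
 proof (rule emeasure_restrict_space)
 qed auto
 also have "... = emeasure lebesgue {x. cyl x : {?a<..<?b} \<times> {?c<..<?d}}"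
 proof (rule emeasure_eq_AE)
  \<comment> \<open>The face x3 = 0 belongs to \<open>Cell\<close> but has no counterpart in
    \<open>Rect\<close>; it is a null set.\<close>
  have "AE x in lebesgue. x ~: {x::real^3. x$3 = 0}"
   using hyperplane_negligible negligible_iff_null_sets AE_not_in by blast
  then show "AE x in lebesgue. x : cyl -` X \<inter> Cell \<longleftrightarrow> x : {x. cyl x : {?a<..<?b} \<times> {?c<..<?d}}"
   unfolding XR[symmetric] by eventually_elim (auto simp: Rect_def cyl_def Cell_def Omega_def)
  show "cyl -` X \<inter> Cell : sets lebesgue"
  proof -
   have "X : sets borel" by (simp add: X borel_open open_Times)
   from measurable_sets[OF cyl_measurable_lebesgue[of Cell] this] show ?thesis
    by (simp add: sets_restrict_space_iff)
  qed
  have "{x. cyl x : {?a<..<?b} \<times> {?c<..<?d}} = cyl -` (X \<inter> Rect) \<inter> space borel" unfolding XR by auto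
  also have "... : sets borel" by (rule measurable_sets[OF cyl_measurable]) (simp add: XR borel_open open_Times)
  finally show "{x. cyl x : {?a<..<?b} \<times> {?c<..<?d}} : sets lebesgue" by auto
 qed
 also have "... = ennreal (cyl_const * (?b - ?a) * (?d - ?c))"
  by (rule cyl_shell) auto
 also have "... = ennreal cyl_const * emeasure lborel ({?a<..<?b} \<times> {?c<..<?d})"
 proof -
  have "emeasure lborel ({?a<..<?b} \<times> {?c<..<?d}) = emeasure lborel {?a<..<?b} * emeasure lborel {?c<..<?d}"
   unfolding lborel_prod[symmetric] by (rule lborel.emeasure_pair_measure_Times) auto
  then show ?thesis using cyl_const_pos by (simp add: ennreal_mult mult.assoc)
 qed
 also have "... = emeasure (density lborel (%p. ennreal cyl_const * idc Rect p)) X"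
 proof -
  have "emeasure (density lborel (%p. ennreal cyl_const * idc Rect p)) X =
    (\<integral>\<^sup>+p. ennreal cyl_const * idc (X \<inter> Rect) p \<partial>lborel)"
   by (subst emeasure_density) (auto simp: X borel_open open_Times indicator_def intro!: nn_integral_cong)
  also have "... = ennreal cyl_const * emeasure lborel (X \<inter> Rect)"
   by (rule nn_integral_cmult_indicator) (auto simp: XR borel_open open_Times)
  finally show ?thesis unfolding XR by simp
 qed
 finally show "emeasure (distr (cellM) borel cyl) X = emeasure (density lborel (%p. ennreal cyl_const * idc Rect p)) X" .
next
 let ?A = "%n::nat. box (- real n *\<^sub>R One) (real n *\<^sub>R One :: real \<times> real)"
 show "range ?A <= range (%(a, b). box a b)" by auto
 show "(\<Union>i. ?A i) = UNIV" using UN_box_eq_UNIV by simp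
 show "emeasure (distr (cellM) borel cyl) (?A i) ~= \<infinity>" for i
  using finite_measure.emeasure_finite[OF finite_measure.finite_measure_distr[OF finite_measure_Cell cyl_measurable_lebesgue]] by simp
qed auto

text \<open>\<open>F\<close> is the average of \<open>f\<close> over the angle, as a function of \<open>(r^2, z)\<close>.\<close>

definition cyl_avg :: "(real^3 => real) => (real \<times> real => real) => bool" where
 "cyl_avg f F \<longleftrightarrow> F : bmeas borel \<and>
   (\<forall>k\<in>borel_measurable borel. integrable (cellM) (%x. k (cyl x) * f x) -->
    integrable lborel (%p. idc Rect p * (k p * F p)) \<and>
    (LINT x|cellM. k (cyl x) * f x) = cyl_const * (LBINT p. idc Rect p * (k p * F p)))"

lemma cyl_avgD:
 assumes "cyl_avg f F" "k : bmeas borel" "integrable (cellM) (%x. k (cyl x) * f x)"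
 shows "integrable lborel (%p. idc Rect p * (k p * F p))"
  and "(LINT x|cellM. k (cyl x) * f x) = cyl_const * (LBINT p. idc Rect p * (k p * F p))"
 using assms unfolding cyl_avg_def by blast+

lemma integral_cyl:
 fixes k :: "real \<times> real => real"
 assumes k [measurable]: "k : bmeas borel"
 shows "integrable (cellM) (%x. k (cyl x)) \<longleftrightarrow> integrable lborel (%p. idc Rect p * k p)"
  and "(LINT x|cellM. k (cyl x)) = cyl_const * (LBINT p. idc Rect p * k p)"
proof -
 have ind: "ennreal cyl_const * idc Rect p = ennreal (cyl_const * idc Rect p)" for p
  by (simp add: indicator_def)
 have c: "cyl_const > 0" by (rule cyl_const_pos)
 have "integrable (cellM) (%x. k (cyl x)) \<longleftrightarrow> integrable (distr (cellM) borel cyl) k"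
  by (rule integrable_distr_eq[OF cyl_measurable_lebesgue k, symmetric])
 also have "... \<longleftrightarrow> integrable lborel (%p. (cyl_const * idc Rect p) *\<^sub>R k p)"
  unfolding distr_cyl ind using c by (subst integrable_density) auto
 also have "... \<longleftrightarrow> integrable lborel (%p. idc Rect p * k p)"
  using c integrable_mult_left_iff[of lborel cyl_const "%p. idc Rect p * k p"] by (simp add: mult.assoc)
 finally show "integrable (cellM) (%x. k (cyl x)) \<longleftrightarrow> integrable lborel (%p. idc Rect p * k p)" .
 have "(LINT x|cellM. k (cyl x)) = integral\<^sup>L (distr (cellM) borel cyl) k"
  by (rule integral_distr[OF cyl_measurable_lebesgue k, symmetric])
 also have "... = (LBINT p. (cyl_const * idc Rect p) *\<^sub>R k p)"
  unfolding distr_cyl ind using c by (subst integral_density) auto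
 also have "... = cyl_const * (LBINT p. idc Rect p * k p)"
  by (simp add: mult.assoc)
 finally show "(LINT x|cellM. k (cyl x)) = cyl_const * (LBINT p. idc Rect p * k p)" .
qed

text \<open>The angular average is a conditional expectation: the Radon-Nikodym density of the
  push-forward of f dx with respect to the push-forward of dx. Absolute continuity holds since sets
  with null preimage are null for both.\<close>

lemma cyl_avg_ex_nonneg:
 assumes f: "integrable (cellM) f" and nn: "!!x. 0 <= f x"
 shows "\<exists>F. cyl_avg f F"
proof -
 let ?M = "cellM"
 have fm [measurable]: "f : bmeas ?M" using f by auto
 define N1 where "N1 = distr ?M borel cyl"
 define nnn where "nnn = distr (density ?M (%x. ennreal (f x))) borel cyl"
 have cm: "cyl : ?M \<rightarrow>\<^sub>M borel" "cyl : density ?M (%x. ennreal (f x)) \<rightarrow>\<^sub>M borel"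
  using cyl_measurable_lebesgue by auto
 have "finite_measure N1" unfolding N1_def
  by (rule finite_measure.finite_measure_distr[OF finite_measure_Cell cm(1)])
 then interpret N1: finite_measure N1 .
 have "absolutely_continuous N1 nnn"
  unfolding absolutely_continuous_def
 proof
  fix A assume A: "A : null_sets N1"
  then have As: "A : sets borel" by (auto simp: N1_def null_sets_def)
  have "emeasure ?M (cyl -` A \<inter> space ?M) = 0"
   using A emeasure_distr[OF cm(1) As] by (auto simp: N1_def null_sets_def)
  then have "cyl -` A \<inter> space ?M : null_sets ?M" using measurable_sets[OF cm(1) As] by auto
  then have "cyl -` A \<inter> space ?M : null_sets (density ?M (%x. ennreal (f x)))"
   using absolutely_continuousI_density[of "%x. ennreal (f x)" ?M] by (auto simp: absolutely_continuous_def)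
  then show "A : null_sets nnn"
   using As emeasure_distr[OF cm(2) As] by (auto simp: nnn_def null_sets_def)
 qed
 moreover have "sets nnn = sets N1" by (simp add: nnn_def N1_def)
 ultimately obtain g where g: "g : bmeas N1" "density N1 g = nnn"
  using N1.Radon_Nikodym by blast
 have gb [measurable]: "g : bmeas borel" using g(1) by (simp add: N1_def)
 have "(\<integral>\<^sup>+p. g p \<partial>N1) = emeasure nnn UNIV"
  unfolding g(2)[symmetric] using g(1) by (subst emeasure_density) (auto simp: N1_def)
 also have "... = emeasure (density ?M (%x. ennreal (f x))) (space ?M)"
  unfolding nnn_def using cm(2) by (subst emeasure_distr) auto
 also have "... = (\<integral>\<^sup>+x. ennreal (f x) \<partial>?M)"
  by (subst emeasure_density) (auto intro!: nn_integral_cong)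
 also have "... < \<infinity>" using f nn by (simp add: integrable_iff_bounded)
 finally have "AE p in N1. g p ~= \<infinity>"
  using g(1) by (intro nn_integral_PInf_AE) auto
 define F where "F p = enn2real (g p)" for p
 have Fm [measurable]: "F : bmeas borel" unfolding F_def[abs_def] by measurable
 have Fnn: "0 <= F p" for p by (simp add: F_def)
 have nnneq: "nnn = density N1 (%p. ennreal (F p))"
  unfolding g(2)[symmetric]
 proof (rule density_cong[OF g(1)])
  show "AE p in N1. g p = ennreal (F p)"
   using \<open>AE p in N1. g p ~= \<infinity>\<close> by eventually_elim (simp add: F_def less_top)
 qed (simp add: N1_def)
 have "cyl_avg f F"
  unfolding cyl_avg_def
 proof (intro conjI ballI impI)
  fix k :: "real \<times> real => real" assume k [measurable]: "k : bmeas borel"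
   and int: "integrable ?M (%x. k (cyl x) * f x)"
  have kc: "(%x. k (cyl x)) : bmeas ?M" using measurable_compose[OF cm(1) k] .
  have kF: "(%p. F p * k p) : bmeas borel" by measurable
  have "integrable nnn k"
   unfolding nnn_def using int kc nn
   by (subst integrable_distr_eq[OF cm(2) k], subst integrable_density) (auto simp: mult.commute)
  then have "integrable N1 (%p. F p * k p)"
   unfolding nnneq using Fnn by (subst (asm) integrable_density) (auto simp: N1_def)
  then have "integrable ?M (%x. F (cyl x) * k (cyl x))"
   unfolding N1_def by (subst (asm) integrable_distr_eq[OF cm(1) kF])
  then show "integrable lborel (%p. idc Rect p * (k p * F p))"
   using integral_cyl(1)[OF kF] by (simp add: mult_ac)
  have "(LINT x|?M. k (cyl x) * f x) = integral\<^sup>L nnn k"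
   unfolding nnn_def using kc nn
   by (subst integral_distr[OF cm(2) k], subst integral_density) (auto simp: mult.commute)
  also have "... = (\<integral>p. F p * k p \<partial>N1)"
   unfolding nnneq using Fnn by (subst integral_density) (auto simp: N1_def)
  also have "... = (LINT x|?M. F (cyl x) * k (cyl x))"
   unfolding N1_def by (rule integral_distr[OF cm(1) kF])
  also have "... = cyl_const * (LBINT p. idc Rect p * (k p * F p))"
   using integral_cyl(2)[OF kF] by (simp add: mult_ac)
  finally show "(LINT x|?M. k (cyl x) * f x) = cyl_const * (LBINT p. idc Rect p * (k p * F p))" .
 qed measurable
 then show ?thesis by blast
qed

lemma cyl_avg_ex:
 assumes f: "integrable (cellM) f"
 shows "\<exists>F. cyl_avg f F"
proof -
 let ?M = "cellM"
 obtain P where P: "cyl_avg (%x. max (f x) 0) P" using cyl_avg_ex_nonneg[of "%x. max (f x) 0"] f by auto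
 obtain N where N: "cyl_avg (%x. max (- f x) 0) N" using cyl_avg_ex_nonneg[of "%x. max (- f x) 0"] f by auto
 have "cyl_avg f (%p. P p - N p)"
  unfolding cyl_avg_def
 proof (intro conjI ballI impI)
  show "(%p. P p - N p) : bmeas borel" using P N by (auto simp: cyl_avg_def)
  fix k :: "real \<times> real => real" assume k: "k : bmeas borel"
   and int: "integrable ?M (%x. k (cyl x) * f x)"
  have kc: "(%x. k (cyl x)) : bmeas ?M" using measurable_compose[OF cyl_measurable_lebesgue k] .
  have fm: "f : bmeas ?M" using f by auto
  have ip: "integrable ?M (%x. k (cyl x) * max (f x) 0)"
   by (rule integrable_bd[OF int]) (use kc fm in \<open>auto simp: abs_mult intro!: mult_left_mono\<close>)
  have im: "integrable ?M (%x. k (cyl x) * max (- f x) 0)"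
   by (rule integrable_bd[OF int]) (use kc fm in \<open>auto simp: abs_mult intro!: mult_left_mono\<close>)
  have eq: "idc Rect p * (k p * (P p - N p)) = idc Rect p * (k p * P p) - idc Rect p * (k p * N p)" for p
   by (simp add: algebra_simps)
  show "integrable lborel (%p. idc Rect p * (k p * (P p - N p)))"
   unfolding eq using cyl_avgD(1)[OF P k ip] cyl_avgD(1)[OF N k im] by simp
  have "(LINT x|?M. k (cyl x) * f x) = (LINT x|?M. k (cyl x) * max (f x) 0 - k (cyl x) * max (- f x) 0)"
   by (intro Bochner_Integration.integral_cong) (auto simp: max_def)
  also have "... = cyl_const * (LBINT p. idc Rect p * (k p * P p)) - cyl_const * (LBINT p. idc Rect p * (k p * N p))"
   using ip im cyl_avgD(2)[OF P k ip] cyl_avgD(2)[OF N k im] by simp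
  also have "... = cyl_const * (LBINT p. idc Rect p * (k p * (P p - N p)))"
   unfolding eq using cyl_avgD(1)[OF P k ip] cyl_avgD(1)[OF N k im] by (simp add: algebra_simps)
  finally show "(LINT x|?M. k (cyl x) * f x) = cyl_const * (LBINT p. idc Rect p * (k p * (P p - N p)))" .
 qed
 then show ?thesis by blast
qed

lemma cyl_avg_measurable: "cyl_avg f F ==> F : bmeas borel"
 by (simp add: cyl_avg_def)

lemma cyl_avg_mult:
 assumes "cyl_avg f F" "m : bmeas borel"
 shows "cyl_avg (%x. m (cyl x) * f x) (%p. m p * F p)"
 unfolding cyl_avg_def
proof (intro conjI ballI impI)
 show "(%p. m p * F p) : bmeas borel" using assms by (auto simp: cyl_avg_def)
 fix k :: "real \<times> real => real" assume k: "k : bmeas borel"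
  and int: "integrable (cellM) (%x. k (cyl x) * (m (cyl x) * f x))"
 have km: "(%p. k p * m p) : bmeas borel" using k assms(2) by auto
 show "integrable lborel (%p. idc Rect p * (k p * (m p * F p)))"
  "(LINT x|cellM. k (cyl x) * (m (cyl x) * f x)) = cyl_const * (LBINT p. idc Rect p * (k p * (m p * F p)))"
  using cyl_avgD[OF assms(1) km] int by (simp_all add: mult.assoc)
qed

lemma AE_lebesgue_on_negligible:
 assumes "S : sets lebesgue" "AE x in lebesgue_on S. P x"
 shows "negligible {x\<in>S. ~ P x}"
proof -
 have "AE x in lebesgue. x : S --> P x" using assms by (simp add: AE_restrict_space_iff)
 from AE_lebesgue_negligible[OF this] show ?thesis by (rule negligible_subset) auto
qed

text \<open>Completeness of Lebesgue measure: the two functions differ on a null set, all of whose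
  subsets are measurable.\<close>

lemma bmeas_cong_AE:
 fixes f g :: "'a::euclidean_space => 'b::topological_space"
 assumes S: "S : sets lebesgue" and f: "f : bmeas (lebesgue_on S)" and fg: "AE x in lebesgue_on S. f x = g x"
 shows "g : bmeas (lebesgue_on S)"
proof (rule measurableI)
 fix A :: "'b set" assume A: "A : sets borel"
 let ?Z = "{x\<in>S. f x ~= g x}"
 have Z: "negligible ?Z" by (rule AE_lebesgue_on_negligible[OF S fg])
 have "f -` A \<inter> S : sets lebesgue"
  using measurable_sets[OF f A] S by (auto simp: sets_restrict_space_iff)
 moreover have "?Z : sets lebesgue" "g -` A \<inter> ?Z : sets lebesgue"
  using Z negligible_subset[OF Z, of "g -` A \<inter> ?Z"] by (auto intro: negligible_imp_sets)
 moreover have "g -` A \<inter> S = ((f -` A \<inter> S) - ?Z) \<union> (g -` A \<inter> ?Z)" by auto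
 ultimately show "g -` A \<inter> space (lebesgue_on S) : sets (lebesgue_on S)"
  using S by (auto simp: sets_restrict_space_iff)
qed auto

lemma cyl_avg_cong_AE:
 assumes F: "cyl_avg f F" and fg: "AE x in cellM. f x = g x" and fm: "f : bmeas (cellM)"
 shows "cyl_avg g F"
 unfolding cyl_avg_def
proof (intro conjI ballI impI)
 show "F : bmeas borel" using F by (rule cyl_avg_measurable)
 have gm: "g : bmeas (cellM)"
  by (rule bmeas_cong_AE[OF _ fm fg]) simp
 fix k :: "real \<times> real => real" assume k: "k : bmeas borel"
  and int: "integrable (cellM) (%x. k (cyl x) * g x)"
 have kc: "(%x. k (cyl x)) : bmeas (cellM)" using measurable_compose[OF cyl_measurable_lebesgue k] .
 have ae: "AE x in cellM. k (cyl x) * g x = k (cyl x) * f x"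
  using fg by eventually_elim simp
 have int': "integrable (cellM) (%x. k (cyl x) * f x)"
  by (rule integrable_cong_AE_imp[OF int]) (use kc fm ae in \<open>auto elim: eventually_mono\<close>)
 show "integrable lborel (%p. idc Rect p * (k p * F p))" by (rule cyl_avgD(1)[OF F k int'])
 have "(LINT x|cellM. k (cyl x) * g x) = (LINT x|cellM. k (cyl x) * f x)"
  by (rule integral_cong_AE) (use kc fm gm ae in auto)
 then show "(LINT x|cellM. k (cyl x) * g x) = cyl_const * (LBINT p. idc Rect p * (k p * F p))"
  using cyl_avgD(2)[OF F k int'] by simp
qed

lemma cyl_avg_one: "cyl_avg (%x. 1) (%p. 1)"
 unfolding cyl_avg_def using integral_cyl by auto

lemma cyl_avg_integrable:
 assumes "cyl_avg f F" "integrable (cellM) f"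
 shows "integrable lborel (%p. idc Rect p * F p)"
 using cyl_avgD(1)[OF assms(1), of "%_. 1"] assms(2) by simp

text \<open>Averaging contracts L^1, also locally: the test function \<open>idc S\<close> times
  \<open>sgn F\<close> depends on \<open>cyl x\<close> only and has modulus at most
  \<open>idc S\<close>.\<close>

lemma cyl_avg_abs_le:
 assumes F: "cyl_avg f F" and f: "integrable (cellM) f" and S: "S : sets borel"
 shows "cyl_const * (LBINT p. idc Rect p * (idc S p * \<bar>F p\<bar>)) <= (LINT x|cellM. idc S (cyl x) * \<bar>f x\<bar>)"
proof -
 have [measurable]: "F : bmeas borel" "S : sets borel" using cyl_avg_measurable[OF F] S by auto
 define k where "k p = idc S p * sgn (F p)" for p
 have k [measurable]: "k : bmeas borel" unfolding k_def[abs_def] by measurable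
 have kb: "\<bar>k p\<bar> <= idc S p" for p by (auto simp: k_def indicator_def sgn_if)
 have kb1: "\<bar>k p\<bar> <= 1" for p by (auto simp: k_def indicator_def sgn_if)
 have kc: "(%x. k (cyl x)) : bmeas (cellM)" using measurable_compose[OF cyl_measurable_lebesgue k] .
 have Sc: "(%x. idc S (cyl x) :: real) : bmeas (cellM)"
  by (rule measurable_compose[OF cyl_measurable_lebesgue]) measurable
 have i: "integrable (cellM) (%x. k (cyl x) * f x)"
  by (rule integrable_bounded_mult[OF f kc kb1])
 have i2: "integrable (cellM) (%x. idc S (cyl x) * \<bar>f x\<bar>)"
  by (rule integrable_bounded_mult[of _ _ _ 1]) (use f Sc in \<open>auto simp: indicator_def\<close>)
 have "cyl_const * (LBINT p. idc Rect p * (idc S p * \<bar>F p\<bar>)) = cyl_const * (LBINT p. idc Rect p * (k p * F p))"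
 proof -
  have "idc S p * \<bar>F p\<bar> = k p * F p" for p by (auto simp: k_def sgn_if)
  then show ?thesis by simp
 qed
 also have "... = (LINT x|cellM. k (cyl x) * f x)" by (rule cyl_avgD(2)[OF F k i, symmetric])
 also have "... <= (LINT x|cellM. idc S (cyl x) * \<bar>f x\<bar>)"
 proof (rule integral_mono[OF i i2])
  fix x
  have "k (cyl x) * f x <= \<bar>k (cyl x)\<bar> * \<bar>f x\<bar>" by (metis abs_ge_self abs_mult)
  also have "... <= idc S (cyl x) * \<bar>f x\<bar>" using kb by (intro mult_right_mono) auto
  finally show "k (cyl x) * f x <= idc S (cyl x) * \<bar>f x\<bar>" .
 qed
 finally show ?thesis .
qed

text \<open>Averaging contracts L^2. The average is tested with its own truncation
  \<open>k n\<close>, for which the product of \<open>k n\<close> and \<open>F\<close> equals (k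
  n)^2; Young's inequality absorbs half of the left-hand side, and monotone convergence removes the
  truncation.\<close>

lemma cyl_avg_square_integrable:
 assumes F: "cyl_avg f F" and f: "f : bmeas (cellM)" and f2: "integrable (cellM) (%x. (f x)^2)"
 shows "integrable lborel (%p. idc Rect p * (F p)^2)"
proof -
 let ?M = "cellM"
 interpret M: finite_measure ?M by (rule finite_measure_Cell)
 have Fm [measurable]: "F : bmeas borel" using cyl_avg_measurable[OF F] .
 define k where "k n p = (if \<bar>F p\<bar> <= real n then F p else 0)" for n p
 have k [measurable]: "k n : bmeas borel" for n unfolding k_def[abs_def] by measurable
 have kb: "\<bar>k n p\<bar> <= real n" for n p by (simp add: k_def)
 have kc: "(%x. k n (cyl x)) : bmeas ?M" for n using measurable_compose[OF cyl_measurable_lebesgue k] .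
 have k2: "integrable ?M (%x. (k n (cyl x))^2)" for n
 proof (rule M.integrable_const_bound[of _ "(real n)^2"])
  show "AE x in ?M. norm ((k n (cyl x))^2) <= (real n)^2"
   using kb by (intro AE_I2) (simp add: abs_le_square_iff[symmetric])
 qed (use kc in measurable)
 have ikf: "integrable ?M (%x. k n (cyl x) * f x)" for n
 proof (rule integrable_bd[OF integrable_plus[OF k2[of n] f2]])
  show "AE x in ?M. norm (k n (cyl x) * f x) <= norm ((k n (cyl x))^2 + (f x)^2)"
  proof (intro AE_I2)
   fix x
   have "2 * (\<bar>k n (cyl x)\<bar> * \<bar>f x\<bar>) <= (k n (cyl x))^2 + (f x)^2"
    using sum_squares_bound[of "\<bar>k n (cyl x)\<bar>" "\<bar>f x\<bar>"] by simp
   moreover have "0 <= \<bar>k n (cyl x)\<bar> * \<bar>f x\<bar>" by simp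
   ultimately have "\<bar>k n (cyl x)\<bar> * \<bar>f x\<bar> <= (k n (cyl x))^2 + (f x)^2" by linarith
   then show "norm (k n (cyl x) * f x) <= norm ((k n (cyl x))^2 + (f x)^2)"
    by (simp add: abs_mult)
  qed
 qed (use kc f in measurable)
 have eq: "idc Rect p * (k n p * F p) = idc Rect p * (k n p)^2" for n p
  by (simp add: k_def power2_eq_square)
 let ?I = "%n. \<integral>p. idc Rect p * (k n p)^2 \<partial>lborel"
 have int: "integrable lborel (%p. idc Rect p * (k n p)^2)" for n
  using cyl_avgD(1)[OF F k ikf] unfolding eq .
 have bound: "?I n <= (LINT x|?M. (f x)^2) / cyl_const" for n
 proof -
  have "cyl_const * ?I n = (LINT x|?M. k n (cyl x) * f x)"
   using cyl_avgD(2)[OF F k ikf, of n] unfolding eq by simp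
  also have "... <= (LINT x|?M. (1/2) * (k n (cyl x))^2 + (1/2) * (f x)^2)"
  proof (rule integral_mono[OF ikf])
   show "k n (cyl x) * f x <= (1/2) * (k n (cyl x))^2 + (1/2) * (f x)^2" for x
    using sum_squares_bound[of "k n (cyl x)" "f x"] by simp
  qed (use k2 f2 in auto)
  also have "... = (1/2) * (cyl_const * ?I n) + (1/2) * (LINT x|?M. (f x)^2)"
   using k2 f2 integral_cyl(2)[of "%p. (k n p)^2"] by simp
  finally have "cyl_const * ?I n <= (LINT x|?M. (f x)^2)" by simp
  then show ?thesis using cyl_const_pos by (simp add: field_simps)
 qed
 have "integrable lborel (%p. idc Rect p * (F p)^2)"
 proof (rule integrableI_bounded)
  have "(\<integral>\<^sup>+p. ennreal (norm (idc Rect p * (F p)^2)) \<partial>lborel) =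
    (\<integral>\<^sup>+p. (SUP n. ennreal (idc Rect p * (k n p)^2)) \<partial>lborel)"
  proof (intro nn_integral_cong)
   fix p
   obtain n0 :: nat where n0: "\<bar>F p\<bar> <= real n0" using real_arch_simple by blast
   have "(SUP n. ennreal (idc Rect p * (k n p)^2)) = ennreal (idc Rect p * (F p)^2)"
   proof (rule antisym)
    show "(SUP n. ennreal (idc Rect p * (k n p)^2)) <= ennreal (idc Rect p * (F p)^2)"
     by (intro SUP_least ennreal_leI) (auto simp: k_def)
    show "ennreal (idc Rect p * (F p)^2) <= (SUP n. ennreal (idc Rect p * (k n p)^2))"
     by (rule SUP_upper2[of n0]) (use n0 in \<open>auto simp: k_def\<close>)
   qed
   then show "ennreal (norm (idc Rect p * (F p)^2)) = (SUP n. ennreal (idc Rect p * (k n p)^2))"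
    by simp
  qed
  also have "... = (SUP n. (\<integral>\<^sup>+p. ennreal (idc Rect p * (k n p)^2) \<partial>lborel))"
  proof (rule nn_integral_monotone_convergence_SUP)
   show "incseq (%n p. ennreal (idc Rect p * (k n p)^2))"
    by (auto simp: incseq_def le_fun_def k_def intro!: ennreal_leI)
  qed simp
  also have "... <= ennreal ((LINT x|?M. (f x)^2) / cyl_const)"
  proof (rule SUP_least)
   fix n
   have "(\<integral>\<^sup>+p. ennreal (idc Rect p * (k n p)^2) \<partial>lborel) = ennreal (?I n)"
    by (rule nn_integral_eq_integral[OF int]) auto
   then show "(\<integral>\<^sup>+p. ennreal (idc Rect p * (k n p)^2) \<partial>lborel) <= ennreal ((LINT x|?M. (f x)^2) / cyl_const)"
    using bound[of n] by (simp add: ennreal_leI)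
  qed
  also have "... < \<infinity>" by simp
  finally show "(\<integral>\<^sup>+p. ennreal (norm (idc Rect p * (F p)^2)) \<partial>lborel) < \<infinity>" .
 qed measurable
 then show ?thesis .
qed

lemma AE_cyl:
 assumes "AE p in lborel. p : Rect --> Q p"
 shows "AE x in cellM. Q (cyl x)"
proof -
 obtain N where N: "N : null_sets lborel" "{p. ~ (p : Rect --> Q p)} <= N"
  using assms by (auto simp: eventually_ae_filter)
 let ?B = "N \<union> (- Rect)"
 have B: "?B : sets borel" using N(1) Rect_borel by (auto intro: borel_comp)
 have "emeasure (distr (cellM) borel cyl) ?B = (\<integral>\<^sup>+p. ennreal cyl_const * idc Rect p * idc ?B p \<partial>lborel)"
  unfolding distr_cyl using B by (subst emeasure_density) auto
 also have "... = 0"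
 proof (subst nn_integral_0_iff_AE)
  show "AE p in lborel. ennreal cyl_const * idc Rect p * idc ?B p = 0"
   using AE_not_in[OF N(1)] by eventually_elim (auto simp: indicator_def)
  show "(%p. ennreal cyl_const * idc Rect p * idc ?B p) : bmeas lborel"
   using B by measurable
 qed
 finally have "emeasure (cellM) (cyl -` ?B \<inter> space (cellM)) = 0"
  using emeasure_distr[OF cyl_measurable_lebesgue B] by simp
 then have "cyl -` ?B \<inter> space (cellM) : null_sets (cellM)"
  using measurable_sets[OF cyl_measurable_lebesgue B] by auto
 then show ?thesis by (rule AE_I') (use N(2) in auto)
qed

lemma AE_lborel_not_in_negligible:
 fixes N :: "'a::euclidean_space set"
 assumes "negligible N"
 shows "AE x in lborel. x ~: N"
proof -
 have "N : null_sets lebesgue" using assms negligible_iff_null_sets by blast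
 then obtain N' where N': "N' : null_sets lborel" "N <= N'"
  by (auto simp: null_sets_completion_iff2)
 show ?thesis by (rule AE_I'[OF N'(1)]) (use N'(2) in auto)
qed

lemma AE_lebesgue_imp_lborel: "AE x in lebesgue. P x ==> AE x in lborel. P x"
 using AE_lborel_not_in_negligible[OF AE_lebesgue_negligible[of P]] by simp

lemma AE_Omega_Cell: "AE x in lebesgue_on Omega. P x ==> AE x in cellM. P x"
 by (auto simp: AE_restrict_space_iff open_Omega borel_open Cell_def elim: eventually_mono)

lemma AE_lborel_ex_open:
 fixes U :: "'a::euclidean_space set"
 assumes "AE x in lborel. P x" "open U" "U ~= {}"
 obtains x where "x : U" "P x"
proof (rule ccontr)
 assume "~ thesis"
 then have "U <= {x. ~ P x}" using that by blast
 moreover have "negligible {x. ~ P x}"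
  by (intro AE_lebesgue_negligible AE_completion assms)
 ultimately show False using open_not_negligible[OF assms(2,3)] negligible_subset by blast
qed

text \<open>The profile in \<open>axisymmetric\<close> is an arbitrary function, so a Borel profile
  has to be extracted from \<open>X\<close> itself. The differentiable map \<open>La\<close>,
  sending x to (x2, cyl x), carries the exceptional null set to a null set of a three-dimensional
  space; hence for almost every c the slice x2 = c meets it only over a null set of (R, z), and a
  Borel version of \<open>X\<close> can be read off on such a slice.\<close>

lemma axisymmetric_rep:
 assumes ax: "axisymmetric X" and Xm: "X : bmeas (cellM)"
 obtains Gm where "Gm : bmeas borel" "AE x in cellM. X x = Gm (cyl x)"
proof -
 obtain G where G: "AE x in lebesgue_on Omega. X x = G (radius x) (x$3)"
  using ax by (auto simp: axisymmetric_def)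
 have NO: "negligible {x\<in>Omega. X x ~= G (radius x) (x$3)}"
  by (rule AE_lebesgue_on_negligible[OF _ G]) (simp add: open_Omega borel_open)
 have "(%x. if x : Cell then X x else 0) : bmeas lebesgue"
  using Xm borel_measurable_if[of Cell X] by simp
 then obtain X' where X': "X' : bmeas lborel" "AE x in lborel. (if x : Cell then X x else 0) = X' x"
  using completion_ex_borel_measurable_real by blast
 have NX: "negligible {x. ~ ((if x : Cell then X x else 0) = X' x)}"
  by (rule AE_lebesgue_negligible[OF AE_completion[OF X'(2)]])
 define N where "N = {x\<in>Cell. X' x ~= G (radius x) (x$3)}"
 have "N <= {x\<in>Omega. X x ~= G (radius x) (x$3)} \<union> {x. ~ ((if x : Cell then X x else 0) = X' x)}"
  by (auto simp: N_def Cell_def)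
 then have negN: "negligible N" using NO NX negligible_Un negligible_subset by blast
 define La where "La x = (x$2, cyl x)" for x :: "real^3"
 have "La differentiable_on N"
 proof (intro differentiable_at_imp_differentiable_on)
  fix x
  have nth: "((%x::real^3. x$i) has_derivative (%h. h$i)) (at x)" for i
   by (rule bounded_linear_imp_has_derivative) (rule bounded_linear_vec_nth)
  have "(La has_derivative (%h. (h$2, (2 * (h$1 * x$1) + 2 * (h$2 * x$2), h$3)))) (at x)"
   unfolding La_def cyl_def
   by (intro has_derivative_Pair nth has_derivative_eq_rhs[OF has_derivative_add[OF has_derivative_power[OF nth] has_derivative_power[OF nth]]])
     (auto simp: algebra_simps)
  then show "La differentiable (at x)" unfolding differentiable_def by blast
 qed
 then have "negligible (La ` N)"
  by (intro negligible_differentiable_image_negligible negN) auto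
 from AE_lborel_not_in_negligible[OF this]
 have "AE p in (lborel :: real measure) \<Otimes>\<^sub>M (lborel :: (real \<times> real) measure). p ~: La ` N"
  unfolding lborel_prod .
 from lborel_pair.AE_pair[OF this]
 have "AE c in lborel. AE p in lborel. (c, p) ~: La ` N" .
 \<comment> \<open>With c < 1/2 and R > 1 the quantity R - c^2 is positive, so the slice x2 = c
   passes over every point of \<open>Rect\<close>.\<close>
 then obtain c :: real where c: "c : {0<..<1/2}" "AE p in lborel. (c, p) ~: La ` N"
  by (rule AE_lborel_ex_open[where U = "{0<..<1/2}"]) auto
 define Gm where "Gm p = X' (\<chi> i. if i = 1 then sqrt (fst p - c^2) else if i = 2 then c else snd p)" for p
 have [measurable]: "X' : bmeas borel" using X'(1) by simp
 have "(%p. \<chi> i. if i = (1::3) then sqrt (fst p - c^2) else if i = 2 then c else snd p) : bmeas (borel :: (real \<times> real) measure)"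
 proof (rule bmeas_contI, rule continuous_on_vec_lambda)
  fix i :: 3
  show "continuous_on UNIV (%p. if i = (1::3) then sqrt (fst p - c^2) else if i = 2 then c else snd p)"
   by (cases "i = 1"; cases "i = 2") (auto intro!: continuous_intros)
 qed
 then have Gmm: "Gm : bmeas borel" unfolding Gm_def[abs_def] by measurable
 have "AE p in lborel. p : Rect --> Gm p = G (sqrt (fst p)) (snd p)"
  using c(2)
 proof eventually_elim
  case (elim p)
  show ?case
  proof
   assume p: "p : Rect"
   define x :: "real^3" where "x = (\<chi> i. if i = 1 then sqrt (fst p - c^2) else if i = 2 then c else snd p)"
   have "c^2 < 1" using c(1) by (simp add: power_less_one_iff)
   then have s: "(x$1)^2 + (x$2)^2 = fst p" "x$2 = c" "x$3 = snd p"
    using p by (auto simp: x_def Rect_def)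
   have "La x = (c, p)" using s by (simp add: La_def cyl_def)
   then have "x ~: N" using elim by (metis imageI)
   moreover have "x : Cell" using p s by (auto simp: Cell_def Omega_def Rect_def)
   ultimately have "X' x = G (radius x) (x$3)" by (simp add: N_def)
   then show "Gm p = G (sqrt (fst p)) (snd p)"
    using s by (simp add: Gm_def x_def[symmetric] radius_def)
  qed
 qed
 from AE_cyl[OF this] have 1: "AE x in cellM. Gm (cyl x) = G (radius x) (x$3)"
  by (simp add: cyl_def radius_def)
 from 1 AE_Omega_Cell[OF G] have "AE x in cellM. X x = Gm (cyl x)" by eventually_elim simp
 with Gmm show thesis by (rule that)
qed

section \<open>From line derivatives to oscillation: Poincare's inequality and dyadic
  rectangles\<close>

lemma AC_oscillation:
 assumes AC: "AC a b phh phh'" and ab: "a < b"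
  and phh: "integrable lborel (%s. idc {a<..<b} s * phh s)"
  and phh': "integrable lborel (%s. idc {a<..<b} s * phh' s)"
 defines "m \<equiv> (LBINT s. idc {a<..<b} s * phh s) / (b - a)"
 shows "(LBINT s. idc {a<..<b} s * \<bar>phh s - m\<bar>) <= (b - a) * (LBINT s. idc {a<..<b} s * \<bar>phh' s\<bar>)"
proof -
 obtain k where "primitive_ae a b phh phh' k" using AC by (auto simp: AC_def)
 then have ai: "phh' absolutely_integrable_on {a..b}"
  and "AE s in lebesgue. s : {a<..<b} --> phh s = k + integral {a..s} phh'"
  by (auto simp: primitive_ae_def)
 then have ae: "AE s in lborel. s : {a<..<b} --> phh s = k + integral {a..s} phh'"
  by (intro AE_lebesgue_imp_lborel)
 define Ph where "Ph s = k + integral {a..s} phh'" for s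
 define V where "V = (LBINT s. idc {a<..<b} s * \<bar>phh' s\<bar>)"
 have Vi: "integrable lborel (%s. idc {a<..<b} s * \<bar>phh' s\<bar>)"
  using integrable_abs[OF phh'] by (simp add: abs_mult)
 have diff: "\<bar>Ph s - Ph t\<bar> <= V" if "s : {a<..<b}" "t : {a<..<b}" "s <= t" for s t
 proof -
  have "Ph t - Ph s = integral {s..t} phh'"
   using integral_diff_real[OF ai, of s t] that by (simp add: Ph_def)
  also have "... = integral {s..t} (%s. idc {a<..<b} s * phh' s)"
   using that by (intro integral_cong) auto
  also have "... = (LBINT sg. idc {s..t} sg * (idc {a<..<b} sg * phh' sg))"
   by (rule integral_lborel_eq_integral[OF phh', symmetric])
  finally have "\<bar>Ph t - Ph s\<bar> <= (LBINT sg. \<bar>indicator {s..t} sg * (idc {a<..<b} sg * phh' sg)\<bar>)"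
   by simp
  also have "... <= V"
   unfolding V_def
  proof (rule integral_mono)
   show "integrable lborel (%sg. \<bar>indicator {s..t} sg * (idc {a<..<b} sg * phh' sg)\<bar>)"
    using integrable_mult_indicator[OF _ phh', of "{s..t}"] by simp
  qed (use Vi in \<open>auto simp: indicator_def abs_mult\<close>)
  finally show ?thesis by (simp add: abs_minus_commute)
 qed
 have diff': "\<bar>Ph s - Ph t\<bar> <= V" if "s : {a<..<b}" "t : {a<..<b}" for s t
  using that diff[of s t] diff[of t s] by (cases "s <= t") (auto simp: abs_minus_commute)
 have I1: "integrable lborel (idc {a<..<b} :: real => real)" and I2: "(LBINT s. idc {a<..<b} s) = b - a"
  using ab by (auto intro!: integrable_real_indicator)
 have near: "\<bar>Ph s - m\<bar> <= V" if s: "s : {a<..<b}" for s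
 proof -
  have i: "integrable lborel (%t. idc {a<..<b} t * (Ph s - phh t))"
   using phh I1 by (simp add: right_diff_distrib)
  have "(b - a) * (Ph s - m) = (LBINT t. idc {a<..<b} t * (Ph s - phh t))"
   using phh I1 I2 ab by (simp add: right_diff_distrib m_def)
  also have "\<bar>...\<bar> <= (LBINT t. \<bar>indicator {a<..<b} t * (Ph s - phh t)\<bar>)" by simp
  also have "... <= (LBINT t. idc {a<..<b} t * V)"
  proof (rule integral_mono_AE)
   show "AE t in lborel. \<bar>indicator {a<..<b} t * (Ph s - phh t)\<bar> <= idc {a<..<b} t * V"
    using ae by eventually_elim (use diff' s in \<open>auto simp: indicator_def Ph_def\<close>)
  qed (use i I1 in auto)
  also have "... = (b - a) * V" using I2 by simp
  finally show ?thesis using ab by (simp add: abs_mult)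
 qed
 have "(LBINT s. idc {a<..<b} s * \<bar>phh s - m\<bar>) <= (LBINT s. idc {a<..<b} s * V)"
 proof (rule integral_mono_AE)
  have "integrable lborel (%s. \<bar>indicator {a<..<b} s * phh s - idc {a<..<b} s * m\<bar>)"
   using phh I1 by (intro integrable_abs Bochner_Integration.integrable_diff) auto
  moreover have "\<bar>indicator {a<..<b} s * phh s - idc {a<..<b} s * m\<bar> = idc {a<..<b} s * \<bar>phh s - m\<bar>" for s
   by (simp add: indicator_def)
  ultimately show "integrable lborel (%s. idc {a<..<b} s * \<bar>phh s - m\<bar>)" by simp
  show "AE s in lborel. idc {a<..<b} s * \<bar>phh s - m\<bar> <= idc {a<..<b} s * V"
   using ae by eventually_elim (use near in \<open>auto simp: indicator_def Ph_def\<close>)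
 qed (use I1 in auto)
 also have "... = (b - a) * V" using I2 by simp
 finally show ?thesis by (simp add: V_def)
qed

lemma AC_subinterval:
 assumes "AC a b f g" "a <= c" "c < d" "d <= b"
 shows "AC c d f g"
proof -
 obtain k where k: "g absolutely_integrable_on {a..b}" "AE s in lebesgue. s : {a<..<b} --> f s = k + integral {a..s} g"
  using assms(1) by (auto simp: AC_def primitive_ae_def)
 have "g absolutely_integrable_on {c..d}"
  by (rule absolutely_integrable_on_subinterval[OF k(1)]) (use assms in auto)
 moreover have "AE s in lebesgue. s : {c<..<d} --> f s = (k + integral {a..c} g) + integral {c..s} g"
  using k(2)
 proof eventually_elim
  case (elim s)
  then show ?case using integral_diff_real[OF k(1), of c s] assms by auto
 qed
 ultimately show ?thesis unfolding AC_def primitive_ae_def by blast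
qed

text \<open>\<open>f\<close> is compared with its mean \<open>g\<close> over R, and \<open>g\<close>
  with the total mean \<open>m\<close>. The first difference is the oscillation along R on each
  line; the second is bounded by the distance of \<open>f\<close> from its mean \<open>h\<close>
  over z, which is the oscillation along z.\<close>

lemma poincare_rectangle:
 fixes f fR fz :: "real \<times> real => real"
 assumes pos: "a < b" "c < d"
 defines "S \<equiv> {a<..<b} \<times> {c<..<d}"
 assumes f: "integrable lborel (%p. idc S p * f p)"
  and fR: "integrable lborel (%p. idc S p * fR p)"
  and fz: "integrable lborel (%p. idc S p * fz p)"
  and L1: "AE z in lborel. z : {c<..<d} --> AC a b (%R. f (R, z)) (%R. fR (R, z))"
  and L2: "AE R in lborel. R : {a<..<b} --> AC c d (%z. f (R, z)) (%z. fz (R, z))"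
 defines "m \<equiv> (LBINT p. idc S p * f p) / ((b - a) * (d - c))"
 shows "(LBINT p. idc S p * \<bar>f p - m\<bar>) \<le>
   (b - a) * (LBINT p. idc S p * \<bar>fR p\<bar>) + (d - c) * (LBINT p. idc S p * \<bar>fz p\<bar>)"
proof -
 let ?I = "idc {a<..<b} :: real => real" and ?J = "idc {c<..<d} :: real => real"
 have indS: "idc S (R, z) = ?I R * ?J z" for R z by (simp add: S_def indicator_times)
 have intI: "integrable lborel ?I" "(LBINT s. ?I s) = b - a" and intJ: "integrable lborel ?J" "(LBINT s. ?J s) = d - c"
  using pos by (auto intro!: integrable_real_indicator)
 define F where "F p = idc S p * f p" for p
 have F: "integrable lborel F" unfolding F_def[abs_def] by (rule f)
 define g where "g z = (LBINT R. F (R, z)) / (b - a)" for z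
 define h where "h R = (LBINT z. F (R, z)) / (d - c)" for R
 have gi: "integrable lborel g" unfolding g_def[abs_def] using lborel_Fubini_snd(2)[OF F] by simp
 have hi: "integrable lborel h" unfolding h_def[abs_def] using lborel_Fubini_fst(2)[OF F] by simp
 have prod: "integrable lborel (%p::real\<times>real. u (fst p) * v (snd p))" if "integrable lborel u" "integrable lborel v" for u v :: "real => real"
 proof -
  have [measurable]: "u : bmeas borel" "v : bmeas borel" using that by auto
  have "integrable (lborel \<Otimes>\<^sub>M lborel) (%p::real\<times>real. u (fst p) * v (snd p))"
   by (rule lborel_pair.Fubini_integrable) (use that in \<open>auto simp: abs_mult\<close>)
  then show ?thesis by (simp add: lborel_prod)
 qed
 have e1i: "integrable lborel (%p. F p - ?I (fst p) * g (snd p))"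
  using F prod[OF intI(1) gi] by simp
 have e2i: "integrable lborel (%p. F p - h (fst p) * ?J (snd p))"
  using F prod[OF hi intJ(1)] by simp
 have aR: "integrable lborel (%p. idc S p * \<bar>fR p\<bar>)" using integrable_abs[OF fR] by (simp add: abs_mult)
 have az: "integrable lborel (%p. idc S p * \<bar>fz p\<bar>)" using integrable_abs[OF fz] by (simp add: abs_mult)
 have g0: "g z = 0" if "z ~: {c<..<d}" for z using that by (simp add: g_def F_def indS)
 have h0: "h R = 0" if "R ~: {a<..<b}" for R using that by (simp add: h_def F_def indS)
 have E1: "(LBINT p. \<bar>F p - ?I (fst p) * g (snd p)\<bar>) <= (b - a) * (LBINT p. idc S p * \<bar>fR p\<bar>)"
 proof -
  have "(LBINT p. \<bar>F p - ?I (fst p) * g (snd p)\<bar>) = (LBINT z. (LBINT R. \<bar>F (R, z) - ?I R * g z\<bar>))"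
   using lborel_Fubini_snd(3)[OF integrable_abs[OF e1i]] by simp
  also have "... <= (LBINT z. (b - a) * (LBINT R. idc S (R, z) * \<bar>fR (R, z)\<bar>))"
  proof (rule integral_mono_AE)
   show "integrable lborel (%z. \<integral>R. \<bar>F (R, z) - ?I R * g z\<bar> \<partial>lborel)"
    using lborel_Fubini_snd(2)[OF integrable_abs[OF e1i]] by simp
   show "integrable lborel (%z. (b - a) * (LBINT R. idc S (R, z) * \<bar>fR (R, z)\<bar>))"
    using lborel_Fubini_snd(2)[OF aR] by simp
   show "AE z in lborel. (LBINT R. \<bar>F (R, z) - ?I R * g z\<bar>) <= (b - a) * (LBINT R. idc S (R, z) * \<bar>fR (R, z)\<bar>)"
    using L1 lborel_Fubini_snd(1)[OF f] lborel_Fubini_snd(1)[OF fR]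
   proof eventually_elim
    case (elim z)
    show ?case
    proof (cases "z : {c<..<d}")
     case True
     then have J1: "?J z = 1" by simp
     have Fz: "F (R, z) = ?I R * f (R, z)" for R by (simp add: F_def indS J1)
     have "(LBINT R. ?I R * \<bar>f (R, z) - g z\<bar>) <= (b - a) * (LBINT R. ?I R * \<bar>fR (R, z)\<bar>)"
      using AC_oscillation[OF _ pos(1), of "%R. f (R, z)" "%R. fR (R, z)"] elim True
      by (simp add: indS J1 g_def Fz)
     moreover have "\<bar>F (R, z) - ?I R * g z\<bar> = ?I R * \<bar>f (R, z) - g z\<bar>" for R
      by (simp add: Fz indicator_def)
     ultimately show ?thesis by (simp add: indS J1)
    next
     case False
     then show ?thesis by (simp add: F_def indS g0)
    qed
   qed
  qed
  also have "... = (b - a) * (LBINT p. idc S p * \<bar>fR p\<bar>)"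
   using lborel_Fubini_snd(3)[OF aR] by simp
  finally show ?thesis .
 qed
 have E2: "(LBINT p. \<bar>F p - h (fst p) * ?J (snd p)\<bar>) <= (d - c) * (LBINT p. idc S p * \<bar>fz p\<bar>)"
 proof -
  have "(LBINT p. \<bar>F p - h (fst p) * ?J (snd p)\<bar>) = (LBINT R. (LBINT z. \<bar>F (R, z) - h R * ?J z\<bar>))"
   using lborel_Fubini_fst(3)[OF integrable_abs[OF e2i]] by simp
  also have "... <= (LBINT R. (d - c) * (LBINT z. idc S (R, z) * \<bar>fz (R, z)\<bar>))"
  proof (rule integral_mono_AE)
   show "integrable lborel (%R. \<integral>z. \<bar>F (R, z) - h R * ?J z\<bar> \<partial>lborel)"
    using lborel_Fubini_fst(2)[OF integrable_abs[OF e2i]] by simp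
   show "integrable lborel (%R. (d - c) * (LBINT z. idc S (R, z) * \<bar>fz (R, z)\<bar>))"
    using lborel_Fubini_fst(2)[OF az] by simp
   show "AE R in lborel. (LBINT z. \<bar>F (R, z) - h R * ?J z\<bar>) <= (d - c) * (LBINT z. idc S (R, z) * \<bar>fz (R, z)\<bar>)"
    using L2 lborel_Fubini_fst(1)[OF f] lborel_Fubini_fst(1)[OF fz]
   proof eventually_elim
    case (elim R)
    show ?case
    proof (cases "R : {a<..<b}")
     case True
     then have J1: "?I R = 1" by simp
     have Fz: "F (R, z) = ?J z * f (R, z)" for z by (simp add: F_def indS J1)
     have "(LBINT z. ?J z * \<bar>f (R, z) - h R\<bar>) <= (d - c) * (LBINT z. ?J z * \<bar>fz (R, z)\<bar>)"
      using AC_oscillation[OF _ pos(2), of "%z. f (R, z)" "%z. fz (R, z)"] elim True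
      by (simp add: indS J1 h_def Fz)
     moreover have "\<bar>F (R, z) - h R * ?J z\<bar> = ?J z * \<bar>f (R, z) - h R\<bar>" for z
      by (simp add: Fz indicator_def)
     ultimately show ?thesis by (simp add: indS J1)
    next
     case False
     then show ?thesis by (simp add: F_def indS h0)
    qed
   qed
  qed
  also have "... = (d - c) * (LBINT p. idc S p * \<bar>fz p\<bar>)"
   using lborel_Fubini_fst(3)[OF az] by simp
  finally show ?thesis .
 qed
 have hm: "(LBINT R. h R) = (b - a) * m"
  using lborel_Fubini_fst(3)[OF F] pos by (simp add: h_def m_def F_def[abs_def])
 \<comment> \<open>The mean of \<open>h\<close> over R is \<open>m\<close>, so for each z the number
   (b - a) (g z - m) is the integral of F - h over the line; the difference of \<open>g\<close> and
   \<open>m\<close> is thus charged to the oscillation along z.\<close>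
 have E3: "(b - a) * (LBINT z. ?J z * \<bar>g z - m\<bar>) <= (LBINT p. \<bar>F p - h (fst p) * ?J (snd p)\<bar>)"
 proof -
  have "(b - a) * (LBINT z. ?J z * \<bar>g z - m\<bar>) = (LBINT z. (b - a) * (?J z * \<bar>g z - m\<bar>))" by simp
  also have "... <= (LBINT z. (LBINT R. \<bar>F (R, z) - h R * ?J z\<bar>))"
  proof (rule integral_mono_AE)
   have "integrable lborel (%z. \<bar>?J z * g z - ?J z * m\<bar>)"
    using gi intJ g0 integrable_mult_indicator[OF _ gi, of "{c<..<d}"] by (intro integrable_abs Bochner_Integration.integrable_diff) auto
   moreover have "\<bar>?J z * g z - ?J z * m\<bar> = ?J z * \<bar>g z - m\<bar>" for z by (simp add: indicator_def)
   ultimately show "integrable lborel (%z. (b - a) * (?J z * \<bar>g z - m\<bar>))" by simp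
   show "integrable lborel (%z. \<integral>R. \<bar>F (R, z) - h R * ?J z\<bar> \<partial>lborel)"
    using lborel_Fubini_snd(2)[OF integrable_abs[OF e2i]] by simp
   show "AE z in lborel. (b - a) * (?J z * \<bar>g z - m\<bar>) <= (LBINT R. \<bar>F (R, z) - h R * ?J z\<bar>)"
    using lborel_Fubini_snd(1)[OF F]
   proof eventually_elim
    case (elim z)
    show ?case
    proof (cases "z : {c<..<d}")
     case True
     then have J1: "?J z = 1" by simp
     have "(b - a) * (g z - m) = (LBINT R. F (R, z) - h R * ?J z)"
     proof -
      have "(b - a) * g z = (LBINT R. F (R, z))" using pos by (simp add: g_def)
      then show ?thesis using elim hi hm by (simp add: J1 right_diff_distrib)
     qed
     also have "\<bar>...\<bar> <= (LBINT R. \<bar>F (R, z) - h R * ?J z\<bar>)" by simp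
     finally show ?thesis using pos by (simp add: abs_mult J1)
    qed simp
   qed
  qed
  also have "... = (LBINT p. \<bar>F p - h (fst p) * ?J (snd p)\<bar>)"
   using lborel_Fubini_snd(3)[OF integrable_abs[OF e2i]] by simp
  finally show ?thesis .
 qed
 have gJ: "integrable lborel (%z. ?J z * \<bar>g z - m\<bar>)"
 proof -
  have "integrable lborel (%z. \<bar>?J z * g z - ?J z * m\<bar>)"
   using gi intJ integrable_mult_indicator[OF _ gi, of "{c<..<d}"] by (intro integrable_abs Bochner_Integration.integrable_diff) auto
  moreover have "\<bar>?J z * g z - ?J z * m\<bar> = ?J z * \<bar>g z - m\<bar>" for z by (simp add: indicator_def)
  ultimately show ?thesis by simp
 qed
 have pi: "integrable lborel (%p::real\<times>real. ?I (fst p) * (?J (snd p) * \<bar>g (snd p) - m\<bar>))"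
  by (rule prod[OF intI(1) gJ])
 have "(LBINT p. idc S p * \<bar>f p - m\<bar>) \<le>
   (LBINT p. \<bar>F p - ?I (fst p) * g (snd p)\<bar> + ?I (fst p) * (?J (snd p) * \<bar>g (snd p) - m\<bar>))"
 proof (rule integral_mono)
  show "integrable lborel (%p. \<bar>F p - ?I (fst p) * g (snd p)\<bar> + ?I (fst p) * (?J (snd p) * \<bar>g (snd p) - m\<bar>))"
   using e1i pi by simp
  have "integrable lborel (%p. \<bar>F p - ?I (fst p) * (?J (snd p) * m)\<bar>)"
   using F prod[OF intI(1), of "%z. ?J z * m"] intJ by simp
  moreover have "\<bar>F p - ?I (fst p) * (?J (snd p) * m)\<bar> = idc S p * \<bar>f p - m\<bar>" for p
   by (cases p) (auto simp: F_def S_def indicator_def)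
  ultimately show "integrable lborel (%p. idc S p * \<bar>f p - m\<bar>)" by simp
  show "idc S p * \<bar>f p - m\<bar> <= \<bar>F p - ?I (fst p) * g (snd p)\<bar> + ?I (fst p) * (?J (snd p) * \<bar>g (snd p) - m\<bar>)" for p
   by (cases p) (auto simp: F_def S_def indicator_def)
 qed
 also have "... = (LBINT p. \<bar>F p - ?I (fst p) * g (snd p)\<bar>) + (LBINT p. ?I (fst p) * (?J (snd p) * \<bar>g (snd p) - m\<bar>))"
  using e1i pi by simp
 also have "(LBINT p. ?I (fst p) * (?J (snd p) * \<bar>g (snd p) - m\<bar>)) = (b - a) * (LBINT z. ?J z * \<bar>g z - m\<bar>)"
  using lborel_Fubini_snd(3)[OF pi] intI by simp
 finally show ?thesis using E1 E2 E3 by linarith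
qed

text \<open>The sides have the ratio 3 : 1 of \<open>Rect\<close> itself, so repeated quartering of
  \<open>Rect\<close> stays within this family; the area at level \<open>k\<close> is three times
  (1/4)^k.\<close>

definition dy_rect :: "nat => real => real => (real \<times> real) set" where
 "dy_rect k a c = {a<..<a + 3 * (1/2)^k} \<times> {c<..<c + (1/2)^k}"

definition dy_mean :: "(real \<times> real => real) => nat => real => real => real" where
 "dy_mean f k a c = (LBINT p. idc (dy_rect k a c) p * f p) / (3 * (1/4)^k)"

lemma dy_rect_split:
 "AE p in lborel. idc (dy_rect k a c) p = 
   idc (dy_rect (Suc k) a c) p + idc (dy_rect (Suc k) (a + 3 * (1/2)^Suc k) c) p +
   idc (dy_rect (Suc k) a (c + (1/2)^Suc k)) p + (idc (dy_rect (Suc k) (a + 3 * (1/2)^Suc k) (c + (1/2)^Suc k)) p :: real)"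
proof -
 have n: "negligible {p :: real \<times> real. p \<bullet> (1,0) = a + 3 * (1/2)^Suc k}" "negligible {p :: real \<times> real. p \<bullet> (0,1) = c + (1/2)^Suc k}"
  by (rule negligible_standard_hyperplane, simp add: Basis_prod_def)+
 show ?thesis
  using AE_lborel_not_in_negligible[OF n(1)] AE_lborel_not_in_negligible[OF n(2)]
 proof eventually_elim
  case (elim p)
  define h :: real where "h = (1/2)^Suc k"
  have h: "h > 0" "(1/2::real)^k = 2 * h" by (auto simp: h_def)
  obtain x y where p: "p = (x, y)" by (cases p)
  have "x ~= a + 3 * h" "y ~= c + h" using elim by (auto simp: p h_def inner_prod_def)
  then show ?case
   unfolding dy_rect_def h(2) h_def[symmetric] p using h(1) by (auto simp: indicator_def)
 qed
qed

lemma dy_rect_measurable [measurable]: "dy_rect k a c : sets borel"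
 unfolding dy_rect_def by (intro borel_open open_Times) auto

lemma dy_rect_indicator:
 "integrable lborel (idc (dy_rect k a c) :: real \<times> real => real)"
 "(LBINT p. idc (dy_rect k a c) p) = (3 * (1/4)^k :: real)"
proof -
 have b: "bounded (dy_rect k a c)" unfolding dy_rect_def by (intro bounded_Times) auto
 show i: "integrable lborel (idc (dy_rect k a c) :: real \<times> real => real)"
  by (rule integrable_real_indicator[OF _ emeasure_bounded_finite[OF b]]) simp
 have "(LBINT p. idc (dy_rect k a c) p) = (\<integral>y. (LBINT x. idc (dy_rect k a c) (x, y)) \<partial>lborel :: real)"
  by (rule lborel_Fubini_snd(3)[OF i, symmetric])
 also have "... = 3 * (1/2)^k * (1/2)^k"
  by (simp add: dy_rect_def indicator_times)
 also have "... = (3 * (1/4)^k :: real)"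
  by (simp add: power_mult_distrib[symmetric])
 finally show "(LBINT p. idc (dy_rect k a c) p) = (3 * (1/4)^k :: real)" .
qed

lemma dy_rect_children:
 defines "h k \<equiv> (1/2::real)^Suc k"
 shows "dy_rect (Suc k) a c <= dy_rect k a c" "dy_rect (Suc k) (a + 3 * h k) c <= dy_rect k a c"
  "dy_rect (Suc k) a (c + h k) <= dy_rect k a c" "dy_rect (Suc k) (a + 3 * h k) (c + h k) <= dy_rect k a c"
proof -
 have "h k > 0" "(1/2::real)^k = 2 * h k" by (auto simp: h_def)
 then show "dy_rect (Suc k) a c <= dy_rect k a c" "dy_rect (Suc k) (a + 3 * h k) c <= dy_rect k a c"
  "dy_rect (Suc k) a (c + h k) <= dy_rect k a c" "dy_rect (Suc k) (a + 3 * h k) (c + h k) <= dy_rect k a c"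
  unfolding dy_rect_def h_def[symmetric] by auto
qed

text \<open>Campanato's argument: the excess of \<open>|f - mean|\<close> over the tail of the geometric series is
 passed on to the four quarters of a rectangle, and tends to zero along the dyadic levels.\<close>

lemma campanato:
 fixes f :: "real \<times> real => real"
 assumes f: "integrable lborel (%p. idc Rect p * f p)" and q: "0 < q" "q < 1" and B: "0 <= B"
  and osc: "!!k a c. dy_rect k a c <= Rect ==>
   (LBINT p. idc (dy_rect k a c) p * \<bar>f p - dy_mean f k a c\<bar>) <= 3 * (1/4)^k * (B * q^k)"
  and S: "dy_rect k a c <= Rect"
 shows "AE p in lborel. p : dy_rect k a c --> \<bar>f p - dy_mean f k a c\<bar> <= 4 * B * q^k / (1 - q)"
proof -
 \<comment> \<open>M k = 4 B q^k + M (Suc k): the threshold collects the possible drifts of the mean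
   over all finer levels. The 4 is the ratio between the areas of a rectangle and a quarter of
   it.\<close>
 define M where "M k = 4 * B * q^k / (1 - q)" for k
 have Mnn: "0 <= M k" for k using B q by (simp add: M_def)
 have Mrec: "M k = 4 * (B * q^k) + M (Suc k)" for k using q by (simp add: M_def field_simps)
 have fi: "integrable lborel (%p. idc A p * f p)" if "A <= Rect" "A : sets borel" for A
 proof -
  have "(%p. idc A p * f p) = (%p. idc A p *\<^sub>R (idc Rect p * f p))"
   using that(1) by (intro ext) (auto simp: indicator_def)
  then show ?thesis using integrable_mult_indicator[OF _ f, of A] that(2) by (simp only: sets_lborel)
 qed
 have fc: "integrable lborel (%p. idc (dy_rect k a c) p * (f p - v))" if "dy_rect k a c <= Rect" for k a c v
  using fi[OF that] dy_rect_indicator(1)[of k a c] by (simp add: right_diff_distrib)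
 have fa: "integrable lborel (%p. idc (dy_rect k a c) p * \<bar>f p - v\<bar>)" if "dy_rect k a c <= Rect" for k a c v
  using integrable_abs[OF fc[OF that, of v]] by (simp add: abs_mult)
 define u where "u v m p = max 0 (\<bar>f p - v\<bar> - m)" for v m p
 have um: "(%p. idc (dy_rect k a c) p * u v m p) = (%p. max 0 (idc (dy_rect k a c) p * \<bar>f p - v\<bar> - idc (dy_rect k a c) p * m))" for k a c v m
  by (auto simp: u_def indicator_def)
 have ui: "integrable lborel (%p. idc (dy_rect k a c) p * u v m p)" if "dy_rect k a c <= Rect" for k a c v m
  unfolding um using fa[OF that, of v] dy_rect_indicator(1)[of k a c] by simp
 \<comment> \<open>From a rectangle to a quarter the mean moves by at most M k - M (Suc k), so the
   excess over the old mean beyond M k is dominated by the excess over the new mean beyond M (Suc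
   k).\<close>
 have child: "(LBINT p. idc (dy_rect (Suc k) a' c') p * u (dy_mean f k a c) (M k) p) \<le>
   (LBINT p. idc (dy_rect (Suc k) a' c') p * u (dy_mean f (Suc k) a' c') (M (Suc k)) p)"
  if sub: "dy_rect (Suc k) a' c' <= dy_rect k a c" "dy_rect k a c <= Rect" for k a c a' c'
 proof (rule integral_mono)
  have R': "dy_rect (Suc k) a' c' <= Rect" using sub by blast
  show "integrable lborel (%p. idc (dy_rect (Suc k) a' c') p * u (dy_mean f k a c) (M k) p)"
   "integrable lborel (%p. idc (dy_rect (Suc k) a' c') p * u (dy_mean f (Suc k) a' c') (M (Suc k)) p)"
   by (rule ui[OF R'])+
  have "3 * (1/4)^Suc k * (dy_mean f (Suc k) a' c' - dy_mean f k a c) =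
   (LBINT p. idc (dy_rect (Suc k) a' c') p * (f p - dy_mean f k a c))"
   using fi[OF R'] dy_rect_indicator[of "Suc k" a' c'] 
   by (simp add: right_diff_distrib dy_mean_def[of f "Suc k"] del: power_Suc)
  also have "\<bar>...\<bar> <= (LBINT p. \<bar>indicator (dy_rect (Suc k) a' c') p * (f p - dy_mean f k a c)\<bar>)" by simp
  also have "... <= (LBINT p. idc (dy_rect k a c) p * \<bar>f p - dy_mean f k a c\<bar>)"
  proof (rule integral_mono)
   show "\<bar>indicator (dy_rect (Suc k) a' c') p * (f p - dy_mean f k a c)\<bar> <= idc (dy_rect k a c) p * \<bar>f p - dy_mean f k a c\<bar>" for p
    using sub(1) by (auto simp: indicator_def)
  qed (use fc[OF R'] fa[OF sub(2)] in auto)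
  also have "... <= 3 * (1/4)^k * (B * q^k)" by (rule osc[OF sub(2)])
  finally have "\<bar>dy_mean f (Suc k) a' c' - dy_mean f k a c\<bar> <= 4 * (B * q^k)"
   by (simp add: abs_mult)
  then show "idc (dy_rect (Suc k) a' c') p * u (dy_mean f k a c) (M k) p <= idc (dy_rect (Suc k) a' c') p * u (dy_mean f (Suc k) a' c') (M (Suc k)) p" for p
   using Mrec[of k] by (intro mult_left_mono) (auto simp: u_def)
 qed
 \<comment> \<open>The four quarters together have the area of the parent, so each generation costs
   nothing and raises the power of \<open>q\<close> by one.\<close>
 have main: "(LBINT p. idc (dy_rect k a c) p * u (dy_mean f k a c) (M k) p) <= 3 * (1/4)^k * (B * q^(k+n))"
  if "dy_rect k a c <= Rect" for k a c n
  using that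
 proof (induction n arbitrary: k a c)
  case 0
  have "(LBINT p. idc (dy_rect k a c) p * u (dy_mean f k a c) (M k) p) <= (LBINT p. idc (dy_rect k a c) p * \<bar>f p - dy_mean f k a c\<bar>)"
   using Mnn by (intro integral_mono ui fa 0 mult_left_mono) (auto simp: u_def)
  also have "... <= 3 * (1/4)^k * (B * q^(k+0))" using osc[OF 0] by simp
  finally show ?case .
 next
  case (Suc n)
  let ?u = "u (dy_mean f k a c) (M k)"
  define h where "h = (1/2::real)^Suc k"
  let ?S1 = "dy_rect (Suc k) a c" and ?S2 = "dy_rect (Suc k) (a + 3 * h) c" 
  let ?S3 = "dy_rect (Suc k) a (c + h)" and ?S4 = "dy_rect (Suc k) (a + 3 * h) (c + h)"
  note ch = dy_rect_children[of k a c, folded h_def]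
  have R: "?S1 <= Rect" "?S2 <= Rect" "?S3 <= Rect" "?S4 <= Rect" using ch Suc.prems by blast+
  have "(LBINT p. idc (dy_rect k a c) p * ?u p) =
    (LBINT p. idc ?S1 p * ?u p + idc ?S2 p * ?u p + idc ?S3 p * ?u p + idc ?S4 p * ?u p)"
  proof (rule integral_cong_AE)
   show "AE p in lborel. idc (dy_rect k a c) p * ?u p = idc ?S1 p * ?u p + idc ?S2 p * ?u p + idc ?S3 p * ?u p + idc ?S4 p * ?u p"
    using dy_rect_split[of k a c, folded h_def] by eventually_elim (simp add: distrib_right)
  qed (use ui[OF Suc.prems] ui[OF R(1)] ui[OF R(2)] ui[OF R(3)] ui[OF R(4)] in \<open>auto intro!: borel_measurable_add\<close>)
  also have "... = (LBINT p. idc ?S1 p * ?u p) + (LBINT p. idc ?S2 p * ?u p) + (LBINT p. idc ?S3 p * ?u p) + (LBINT p. idc ?S4 p * ?u p)"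
   using ui[OF R(1)] ui[OF R(2)] ui[OF R(3)] ui[OF R(4)] by simp
  also have "... <= 4 * (3 * (1/4)^Suc k * (B * q^(Suc k + n)))"
   using child[OF ch(1) Suc.prems] child[OF ch(2) Suc.prems] child[OF ch(3) Suc.prems] child[OF ch(4) Suc.prems]
    Suc.IH[OF R(1)] Suc.IH[OF R(2)] Suc.IH[OF R(3)] Suc.IH[OF R(4)] by linarith
  also have "... = 3 * (1/4)^k * (B * q^(k + Suc n))" by simp
  finally show ?case .
 qed
 let ?u = "u (dy_mean f k a c) (M k)"
 have "(%n. 3 * (1/4)^k * (B * q^(k+n))) \<longlonglongrightarrow> 3 * (1/4)^k * (B * (q^k * 0))"
  unfolding power_add using q by (intro tendsto_intros LIMSEQ_realpow_zero) auto
 then have "(LBINT p. idc (dy_rect k a c) p * ?u p) <= 3 * (1/4)^k * (B * (q^k * 0))"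
  by (rule LIMSEQ_le_const) (use main[OF S] in blast)
 then have "(LBINT p. idc (dy_rect k a c) p * ?u p) <= 0" by simp
 moreover have unn: "0 <= idc (dy_rect k a c) p * ?u p" for p by (simp add: u_def)
 ultimately have "(LBINT p. idc (dy_rect k a c) p * ?u p) = 0"
  by (intro antisym integral_nonneg_AE) auto
 then have "AE p in lborel. idc (dy_rect k a c) p * ?u p = 0"
  using integral_nonneg_eq_0_iff_AE[OF ui[OF S]] unn by auto
 then show ?thesis
  by eventually_elim (auto simp: u_def M_def max_def indicator_def split: if_splits)
qed

section \<open>Weak derivatives on the cell and the line derivatives of angular averages\<close>

definition Cell0 :: "(real^3) set" where
 "Cell0 = {x : Omega. 0 < x$3 & x$3 < 1}"


text \<open>Integrability is asked on the whole cell so that both sides can be pushed forward to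
  \<open>Rect\<close>. The test functions live in the open cell, so periodicity and boundary
  conditions enter separately.\<close>

definition cell_weak_deriv :: "3 => (real^3 => real) => (real^3 => real) => bool" where
 "cell_weak_deriv j f g \<longleftrightarrow> integrable (cellM) f & integrable (cellM) g \<and>
   (\<forall>phh. test_fun Cell0 phh -->
    (LINT x|cellM. frd phh (at x) (axis j 1) * f x) = - (LINT x|cellM. phh x * g x))"

lemma smooth_has_derivative:
 assumes "smooth UNIV phh"
 shows "(phh has_derivative frd phh (at x)) (at x)"
 using smooth_C_k[OF assms, of 1] by (simp add: frechet_derivative_works[symmetric])

lemma smooth_frechet_continuous:
 assumes "smooth UNIV phh" "b : Basis"
 shows "continuous_on UNIV (%x. frd phh (at x) b)"
 using smooth_C_k[OF assms(1), of 1] assms(2) by simp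

lemma frechet_derivative_eqI:
 assumes "(f has_derivative f') (at x)"
 shows "frd f (at x) h = f' h"
 unfolding frechet_derivative_at[OF assms] ..

lemma frechet_derivative_outside:
 fixes phh :: "'a::euclidean_space => real"
 assumes "closed K" "!!x. x ~: K ==> phh x = 0" "x ~: K"
 shows "frd phh (at x) b = 0"
proof -
 have "((%_. 0 :: real) has_derivative (%_. 0)) (at x)" by simp
 then have "(phh has_derivative (%_. 0)) (at x)"
  by (rule has_derivative_transform_within_open[of _ _ _ _ "- K"]) (use assms in auto)
 then show ?thesis by (rule frechet_derivative_eqI)
qed

lemma smooth_nth: "smooth UNIV (%x::real^3. x$j)"
 by (rule smooth_linear) (rule bounded_linear_vec_nth)

lemma smooth_radius_sq: "smooth UNIV (%x::real^3. (x$1)^2 + (x$2)^2)"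
 unfolding power2_eq_square by (intro smooth_add smooth_mult smooth_nth)

lemma smooth_cyl_product:
 fixes A B :: "real => real"
 assumes "smooth UNIV A" "smooth UNIV B"
 shows "smooth UNIV (%x::real^3. A ((x$1)^2 + (x$2)^2) * B (x$3))"
 by (intro smooth_mult smooth_compose[OF assms(1) smooth_radius_sq] smooth_compose[OF assms(2) smooth_nth])

lemma cyl_product_derivative:
 fixes A B :: "real => real"
 assumes "smooth UNIV A" "smooth UNIV B"
 shows "((%x::real^3. A ((x$1)^2 + (x$2)^2) * B (x$3)) has_derivative
   (%h. deriv A ((x$1)^2 + (x$2)^2) * (2 * x$1 * h$1 + 2 * x$2 * h$2) * B (x$3) +
     A ((x$1)^2 + (x$2)^2) * deriv B (x$3) * h$3)) (at x)"
proof -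
 have nth: "((%x::real^3. x$i) has_derivative (%h. h$i)) (at x)" for i
  by (rule bounded_linear_imp_has_derivative) (rule bounded_linear_vec_nth)
 have "((%x::real^3. (x$1)^2 + (x$2)^2) has_derivative (%h. 2 * x$1 * h$1 + 2 * x$2 * h$2)) (at x)"
  by (rule has_derivative_eq_rhs[OF has_derivative_add[OF has_derivative_power[OF nth] has_derivative_power[OF nth]]])
    (auto simp: algebra_simps)
 from has_derivative_compose[OF this smooth_imp_DERIV[OF assms(1), unfolded has_field_derivative_def]]
 have 1: "((%x::real^3. A ((x$1)^2 + (x$2)^2)) has_derivative
   (%h. deriv A ((x$1)^2 + (x$2)^2) * (2 * x$1 * h$1 + 2 * x$2 * h$2))) (at x)" .
 from has_derivative_compose[OF nth[of 3] smooth_imp_DERIV[OF assms(2), unfolded has_field_derivative_def]]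
 have 2: "((%x::real^3. B (x$3)) has_derivative (%h. deriv B (x$3) * h$3)) (at x)" .
 show ?thesis
  by (rule has_derivative_eq_rhs[OF has_derivative_mult[OF 1 2]]) (auto simp: algebra_simps)
qed

lemma frechet_cyl_product:
 fixes A B :: "real => real"
 assumes "smooth UNIV A" "smooth UNIV B"
 shows "frd (%x::real^3. A ((x$1)^2 + (x$2)^2) * B (x$3)) (at x) h =
   deriv A ((x$1)^2 + (x$2)^2) * (2 * x$1 * h$1 + 2 * x$2 * h$2) * B (x$3) + A ((x$1)^2 + (x$2)^2) * deriv B (x$3) * h$3"
 by (rule frechet_derivative_eqI[OF cyl_product_derivative[OF assms]])

lemma compact_cyl_preimage:
 assumes "compact K1" "compact K2"
 shows "compact {x::real^3. (x$1)^2 + (x$2)^2 : K1 & x$3 : K2}" (is "compact ?K")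
proof (rule compact_eq_bounded_closed[THEN iffD2], intro conjI)
 have e: "?K = cyl -` (K1 \<times> K2)" by (auto simp: cyl_def)
 show "closed ?K"
  unfolding e by (intro closed_vimage closed_Times compact_imp_closed assms continuous_cyl)
 obtain B1 B2 where B: "!!s. s : K1 ==> \<bar>s\<bar> <= B1" "!!s. s : K2 ==> \<bar>s\<bar> <= B2"
  using compact_imp_bounded[OF assms(1)] compact_imp_bounded[OF assms(2)] unfolding bounded_iff by auto
 show "bounded ?K"
 proof (rule boundedI)
  fix x assume x: "x : ?K"
  have "\<bar>x$i\<bar> <= \<bar>B1\<bar> + 1 + \<bar>B2\<bar>" for i
  proof -
   have s: "\<bar>t\<bar> <= \<bar>B1\<bar> + 1" if "t^2 <= B1" for t :: real
   proof (cases "\<bar>t\<bar> <= 1")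
    case False
    then have "\<bar>t\<bar> * 1 <= \<bar>t\<bar> * \<bar>t\<bar>" by (intro mult_left_mono) auto
    then show ?thesis using that by (simp add: power2_eq_square)
   qed simp
   have "(x$1)^2 + (x$2)^2 <= B1" using B(1) x by force
   then have "(x$1)^2 <= B1" "(x$2)^2 <= B1" using zero_le_power2[of "x$1"] zero_le_power2[of "x$2"] by linarith+
   then have "\<bar>x$1\<bar> <= \<bar>B1\<bar> + 1" "\<bar>x$2\<bar> <= \<bar>B1\<bar> + 1" using s by auto
   moreover have "\<bar>x$3\<bar> <= \<bar>B2\<bar>" using B(2)[of "x$3"] x by auto
   ultimately have "\<bar>x$1\<bar> <= \<bar>B1\<bar> + 1 + \<bar>B2\<bar> & \<bar>x$2\<bar> <= \<bar>B1\<bar> + 1 + \<bar>B2\<bar> & \<bar>x$3\<bar> <= \<bar>B1\<bar> + 1 + \<bar>B2\<bar>" by auto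
   then show ?thesis using exhaust_3[of i] by auto
  qed
  then have "(\<Sum>i\<in>UNIV. \<bar>x$i\<bar>) <= (\<Sum>i\<in>(UNIV::3 set). \<bar>B1\<bar> + 1 + \<bar>B2\<bar>)" by (intro sum_mono) auto
  then show "norm x <= 3 * (\<bar>B1\<bar> + 1 + \<bar>B2\<bar>)" using norm_le_l1_cart[of x] by simp
 qed
qed

lemma test_fun_cyl_product:
 assumes A: "test_fun {1<..<4} A" and B: "test_fun {0<..<1} B"
 shows "test_fun Cell0 (%x. A ((x$1)^2 + (x$2)^2) * B (x$3))"
proof -
 obtain K1 where K1: "compact K1" "K1 <= {1<..<4}" "!!x. x ~: K1 ==> A x = 0" using test_fun_support[OF A] by metis
 obtain K2 where K2: "compact K2" "K2 <= {0<..<1}" "!!x. x ~: K2 ==> B x = 0" using test_fun_support[OF B] by metis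
 show ?thesis
 proof (rule test_funI[OF smooth_cyl_product compact_cyl_preimage[OF K1(1) K2(1)]])
  show "{x::real^3. (x$1)^2 + (x$2)^2 : K1 & x$3 : K2} <= Cell0"
   using K1(2) K2(2) by (force simp: Cell0_def Omega_def)
 qed (use K1 K2 A B test_fun_smooth in auto)
qed

lemma test_fun_mult_smooth:
 assumes "test_fun U phh" "smooth UNIV (et :: 'a::euclidean_space => real)"
 shows "test_fun U (%x. et x * phh x)"
proof -
 obtain K where K: "compact K" "K <= U" "!!x. x ~: K ==> phh x = 0" using test_fun_support[OF assms(1)] by metis
 show ?thesis
  by (rule test_funI[OF smooth_mult[OF assms(2) test_fun_smooth[OF assms(1)]] K(1,2)]) (use K in auto)
qed

lemma test_fun_deriv:
 assumes "test_fun U (ps :: real => real)"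
 shows "test_fun U (deriv ps)"
proof -
 obtain K where K: "compact K" "K <= U" "!!x. x ~: K ==> ps x = 0" using test_fun_support[OF assms] by metis
 have "deriv ps s = 0" if "s ~: K" for s
 proof -
  have "((%s. 0) has_real_derivative 0) (at s)" by simp
  then have "(ps has_real_derivative 0) (at s)"
   by (rule has_field_derivative_transform_within_open[where S = "- K"])
     (use K compact_imp_closed that in auto)
  then show ?thesis by (rule DERIV_imp_deriv)
 qed
 then show ?thesis
  using test_funI[OF smooth_deriv[OF test_fun_smooth[OF assms]] K(1,2)] by blast
qed

lemma test_fun_continuous: "test_fun U (phh :: 'a::euclidean_space => real) ==> continuous_on UNIV phh"
 using smooth_C_k[OF test_fun_smooth, of U phh 0] by simp

lemma test_fun_measurable: "test_fun U (phh :: 'a::euclidean_space => real) ==> phh : bmeas borel"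
 by (intro bmeas_contI test_fun_continuous)

lemma test_fun_bounded:
 assumes "test_fun U (phh :: 'a::euclidean_space => real)"
 obtains B where "!!x. \<bar>phh x\<bar> <= B"
proof -
 obtain K where K: "compact K" "K <= U" "!!x. x ~: K ==> phh x = 0" using test_fun_support[OF assms(1)] by metis
 have "bounded (phh ` K)"
  using K(1) test_fun_continuous[OF assms] continuous_on_subset
  by (intro compact_imp_bounded compact_continuous_image) auto
 then obtain B where B: "\<forall>x\<in>K. \<bar>phh x\<bar> <= B" by (auto simp: bounded_iff)
 have "\<bar>phh x\<bar> <= \<bar>B\<bar>" for x using B K(3)[of x] by (cases "x : K") auto
 then show thesis using that by blast
qed

lemma cell_weak_derivD:
 assumes "cell_weak_deriv j f g" "test_fun Cell0 phh"
 shows "(LINT x|cellM. frd phh (at x) (axis j 1) * f x) = - (LINT x|cellM. phh x * g x)"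
 using assms by (simp add: cell_weak_deriv_def)

lemma integrable_Cell_mult:
 fixes et :: "real^3 => real"
 assumes f: "integrable (cellM) f" and et: "continuous_on UNIV et"
 shows "integrable (cellM) (%x. et x * f x)"
proof -
 have "bounded (et ` closure Cell)"
  using bounded_Cell et continuous_on_subset by (intro compact_imp_bounded compact_continuous_image) auto
 then obtain B where B: "\<forall>x\<in>closure Cell. \<bar>et x\<bar> <= B" by (auto simp: bounded_iff)
 have m: "et : bmeas (cellM)"
  using et by (intro bmeas_contI measurable_restrict_space1 measurable_completion) (simp add: bmeas_contI)
 show ?thesis
 proof (rule integrable_bd)
  show "integrable (cellM) (%x. B * f x)" using f by simp
  show "AE x in cellM. norm (et x * f x) <= norm (B * f x)"
  proof (rule AE_I2)
   fix x assume "x : space (cellM)"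
   then have "\<bar>et x\<bar> <= \<bar>B\<bar>" using B closure_subset[of Cell] by fastforce
   then show "norm (et x * f x) <= norm (B * f x)" by (simp add: abs_mult mult_right_mono)
  qed
 qed (use m f in measurable)
qed

lemma cell_weak_deriv_mult_nth:
 assumes w: "cell_weak_deriv j f g"
 shows "cell_weak_deriv j (%x. x$j * f x) (%x. f x + x$j * g x)"
proof -
 have fg: "integrable (cellM) f" "integrable (cellM) g" using w by (auto simp: cell_weak_deriv_def)
 have c: "continuous_on UNIV (%x::real^3. x$j)" by (intro continuous_intros)
 have i: "integrable (cellM) (%x. x$j * f x)" "integrable (cellM) (%x. x$j * g x)"
  using integrable_Cell_mult fg c by blast+
 show ?thesis
  unfolding cell_weak_deriv_def
 proof (intro conjI allI impI)
  fix phh assume phh: "test_fun Cell0 phh"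
  have t: "test_fun Cell0 (%x. x$j * phh x)" by (rule test_fun_mult_smooth[OF phh smooth_nth])
  have d: "frd (%x. x$j * phh x) (at x) (axis j 1) = x$j * frd phh (at x) (axis j 1) + phh x" for x
  proof -
   have nth: "((%x::real^3. x$j) has_derivative (%h. h$j)) (at x)"
    by (rule bounded_linear_imp_has_derivative) (rule bounded_linear_vec_nth)
   from frechet_derivative_eqI[OF has_derivative_mult[OF nth smooth_has_derivative[OF test_fun_smooth[OF phh]]]]
   show ?thesis by simp
  qed
  have c1: "continuous_on UNIV (%x. frd phh (at x) (axis j 1))"
   by (rule smooth_frechet_continuous[OF test_fun_smooth[OF phh]]) (simp add: axis_in_Basis_iff)
  have i1: "integrable (cellM) (%x. frd phh (at x) (axis j 1) * (x$j * f x))"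
   by (rule integrable_Cell_mult[OF i(1) c1])
  have i2: "integrable (cellM) (%x. phh x * f x)" "integrable (cellM) (%x. phh x * (x$j * g x))"
   using integrable_Cell_mult test_fun_continuous[OF phh] fg(1) i(2) by blast+
  have "(LINT x|cellM. frd phh (at x) (axis j 1) * (x$j * f x) + phh x * f x) = - (LINT x|cellM. phh x * (x$j * g x))"
   using cell_weak_derivD[OF w t] unfolding d by (simp add: algebra_simps)
  then show "(LINT x|cellM. frd phh (at x) (axis j 1) * (x$j * f x)) = - (LINT x|cellM. phh x * (f x + x$j * g x))"
   using i1 i2 by (simp add: distrib_left)
 qed (use fg i in auto)
qed

lemma integral_swap_real:
 fixes f :: "real \<times> real => real"
 shows "integrable lborel (%p. f (snd p, fst p)) \<longleftrightarrow> integrable lborel f"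
  and "f : bmeas borel ==> (LBINT p. f (snd p, fst p)) = (LBINT p. f p)"
proof -
 have "integrable (lborel \<Otimes>\<^sub>M lborel) (%(x, y). f (y, x)) \<longleftrightarrow> integrable (lborel \<Otimes>\<^sub>M lborel) f"
  by (rule lborel_pair.integrable_product_swap_iff)
 then show "integrable lborel (%p. f (snd p, fst p)) \<longleftrightarrow> integrable lborel f"
  unfolding lborel_prod case_prod_unfold .
 assume "f : bmeas borel"
 then have "f : bmeas (lborel \<Otimes>\<^sub>M lborel)" unfolding lborel_prod by simp
 from lborel_pair.integral_product_swap[OF this]
 show "(LBINT p. f (snd p, fst p)) = (LBINT p. f p)"
  unfolding lborel_prod case_prod_unfold .
qed

lemma cyl_const_cancel: "cyl_const * a = - (cyl_const * b) ==> a = - b"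
 using cyl_const_pos by (metis less_irrefl mult_left_cancel mult_minus_right)

lemma cyl_pairing_continuous:
 assumes F: "cyl_avg f F" and f: "integrable (cellM) f" and k: "continuous_on UNIV k"
 shows "integrable lborel (%p. idc Rect p * (k p * F p))"
  and "(LINT x|cellM. k (cyl x) * f x) = cyl_const * (LBINT p. idc Rect p * (k p * F p))"
proof -
 have "continuous_on UNIV (%x. k (cyl x))" by (rule continuous_on_compose2[OF k continuous_cyl]) auto
 from cyl_avgD[OF F _ integrable_Cell_mult[OF f this]] k
 show "integrable lborel (%p. idc Rect p * (k p * F p))"
  and "(LINT x|cellM. k (cyl x) * f x) = cyl_const * (LBINT p. idc Rect p * (k p * F p))"
  by (auto intro: bmeas_contI)
qed

lemma continuous_product_kernel:
 assumes "continuous_on UNIV A" "continuous_on UNIV B"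
 shows "continuous_on UNIV (%p::real\<times>real. A (fst p) * B (snd p) :: real)"
 by (intro continuous_on_mult continuous_on_compose2[OF assms(1)] continuous_on_compose2[OF assms(2)] continuous_intros) auto

lemma cyl_avg_cong_right:
 assumes F: "cyl_avg f F" and FF': "AE p in lborel. p : Rect --> F p = F' p" and [measurable]: "F' : bmeas borel"
 shows "cyl_avg f F'"
 unfolding cyl_avg_def
proof (intro conjI ballI impI assms(3))
 have [measurable]: "F : bmeas borel" using F by (rule cyl_avg_measurable)
 fix k :: "real \<times> real => real" assume k [measurable]: "k : bmeas borel"
  and int: "integrable (cellM) (%x. k (cyl x) * f x)"
 have ae: "AE p in lborel. idc Rect p * (k p * F p) = idc Rect p * (k p * F' p)"
  using FF' by eventually_elim (auto simp: indicator_def)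
 show "integrable lborel (%p. idc Rect p * (k p * F' p))"
  by (rule integrable_cong_AE_imp[OF cyl_avgD(1)[OF F k int]]) (use ae in \<open>auto elim: eventually_mono\<close>)
 have "(LBINT p. idc Rect p * (k p * F p)) = (LBINT p. idc Rect p * (k p * F' p))"
  by (rule integral_cong_AE) (use ae in auto)
 then show "(LINT x|cellM. k (cyl x) * f x) = cyl_const * (LBINT p. idc Rect p * (k p * F' p))"
  using cyl_avgD(2)[OF F k int] by simp
qed

text \<open>\<open>cyl_avg\<close> speaks of all Borel weights k with k f integrable, possibly
  unbounded ones, and integrability of k (f + g) does not split. Hence the average of the sum is
  taken from \<open>cyl_avg_ex\<close> and identified with \<open>F + G\<close> by means of bounded
  weights, the indicators of boxes.\<close>

lemma cyl_avg_add:
 assumes F: "cyl_avg f F" and G: "cyl_avg g G"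
  and i: "integrable (cellM) f" "integrable (cellM) g"
 shows "cyl_avg (%x. f x + g x) (%p. F p + G p)"
proof -
 have ifg: "integrable (cellM) (%x. f x + g x)" using i by simp
 obtain H where H: "cyl_avg (%x. f x + g x) H" using cyl_avg_ex[OF ifg] by blast
 have ii: "integrable lborel (%p. idc Rect p * F p)" "integrable lborel (%p. idc Rect p * G p)"
  "integrable lborel (%p. idc Rect p * H p)"
  using cyl_avg_integrable[OF F i(1)] cyl_avg_integrable[OF G i(2)] cyl_avg_integrable[OF H ifg] by auto
 have "AE p in lborel. idc Rect p * H p - idc Rect p * F p - idc Rect p * G p = 0"
 proof (rule AE_zero_of_box_integrals_UNIV)
  show "integrable lborel (%p. idc Rect p * H p - idc Rect p * F p - idc Rect p * G p)" using ii by simp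
  fix c d :: "real \<times> real"
  let ?k = "idc (box c d) :: real \<times> real => real"
  have k: "?k : bmeas borel" by simp
  have int: "integrable (cellM) (%x. ?k (cyl x) * h x)" if "integrable (cellM) h" for h
   by (rule integrable_bounded_mult[OF that measurable_compose[OF cyl_measurable_lebesgue k], of 1]) (auto simp: indicator_def)
  have "(LBINT p. idc (box c d) p * (idc Rect p * H p - idc Rect p * F p - idc Rect p * G p)) =
   (LBINT p. idc Rect p * (?k p * H p) - idc Rect p * (?k p * F p) - idc Rect p * (?k p * G p))"
   by (intro Bochner_Integration.integral_cong) (auto simp: algebra_simps)
  also have "... = (LBINT p. idc Rect p * (?k p * H p)) - (LBINT p. idc Rect p * (?k p * F p)) - (LBINT p. idc Rect p * (?k p * G p))"
   using cyl_avgD(1)[OF F k int[OF i(1)]] cyl_avgD(1)[OF G k int[OF i(2)]] cyl_avgD(1)[OF H k int[OF ifg]] by simp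
  also have "... = 0"
  proof -
   have "cyl_const * (LBINT p. idc Rect p * (?k p * H p)) = (LINT x|cellM. ?k (cyl x) * (f x + g x))"
    by (rule cyl_avgD(2)[OF H k int[OF ifg], symmetric])
   also have "... = (LINT x|cellM. ?k (cyl x) * f x) + (LINT x|cellM. ?k (cyl x) * g x)"
    using int[OF i(1)] int[OF i(2)] by (simp add: distrib_left)
   also have "... = cyl_const * ((LBINT p. idc Rect p * (?k p * F p)) + (LBINT p. idc Rect p * (?k p * G p)))"
    using cyl_avgD(2)[OF F k int[OF i(1)]] cyl_avgD(2)[OF G k int[OF i(2)]] by (simp add: distrib_left)
   finally show ?thesis using cyl_const_pos by simp
  qed
  finally show "(LBINT p. idc (box c d) p * (idc Rect p * H p - idc Rect p * F p - idc Rect p * G p)) = 0" .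
 qed
 then have "AE p in lborel. p : Rect --> H p = F p + G p" by eventually_elim auto
 moreover have "(%p. F p + G p) : bmeas borel"
  using cyl_avg_measurable[OF F] cyl_avg_measurable[OF G] by simp
 ultimately show ?thesis by (rule cyl_avg_cong_right[OF H])
qed

lemma AC_cyl_avg_z:
 assumes w: "cell_weak_deriv 3 f g" and F: "cyl_avg f F" and G: "cyl_avg g G"
 shows "AE R in lborel. R : {1<..<4} --> AC 0 1 (%z. F (R, z)) (%z. G (R, z))"
proof -
 have fg: "integrable (cellM) f" "integrable (cellM) g" using w by (auto simp: cell_weak_deriv_def)
 have Fm: "F : bmeas borel" "G : bmeas borel" using F G cyl_avg_measurable by auto
 \<comment> \<open>\<open>AC_on_lines\<close> differentiates in the first variable, so the two
   coordinates are exchanged.\<close>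
 let ?F = "%p. idc Rect (snd p, fst p) * F (snd p, fst p)" and ?G = "%p. idc Rect (snd p, fst p) * G (snd p, fst p)"
 have "AE R in lborel. R : {1<..<4} --> AC 0 1 (%z. ?F (z, R)) (%z. ?G (z, R))"
 proof (rule AC_on_lines)
  show "integrable lborel ?F" "integrable lborel ?G"
   using integral_swap_real(1)[of "%p. idc Rect p * F p"] cyl_avg_integrable[OF F fg(1)]
    integral_swap_real(1)[of "%p. idc Rect p * G p"] cyl_avg_integrable[OF G fg(2)] by auto
  fix ps :: "real => real" and n and c d :: real
  assume ps: "test_fun {0<..<1} ps" and cd: "cbox c d <= {1<..<4}"
  have bee: "test_fun {1<..<4} (bump n c d)" by (rule test_fun_bump[OF cd])
  note sm = test_fun_smooth[OF bee] test_fun_smooth[OF ps]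
  have k1: "continuous_on UNIV (%p. bump n c d (fst p) * deriv ps (snd p))" and k2: "continuous_on UNIV (%p. bump n c d (fst p) * ps (snd p))"
   using continuous_product_kernel test_fun_continuous bee ps test_fun_deriv by blast+
  from cell_weak_derivD[OF w test_fun_cyl_product[OF bee ps]]
  have "(LINT x|cellM. (bump n c d (fst (cyl x)) * deriv ps (snd (cyl x))) * f x) =
    - (LINT x|cellM. (bump n c d (fst (cyl x)) * ps (snd (cyl x))) * g x)"
   unfolding frechet_cyl_product[OF sm] by (simp add: axis_def cyl_def)
  then have "(LBINT p. idc Rect p * (bump n c d (fst p) * deriv ps (snd p) * F p)) =
    - (LBINT p. idc Rect p * (bump n c d (fst p) * ps (snd p) * G p))"
   unfolding cyl_pairing_continuous(2)[OF F fg(1) k1] cyl_pairing_continuous(2)[OF G fg(2) k2] by (rule cyl_const_cancel)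
  note main = this
  let ?h1 = "%p. idc Rect p * (bump n c d (fst p) * deriv ps (snd p) * F p)" and ?h2 = "%p. idc Rect p * (bump n c d (fst p) * ps (snd p) * G p)"
  have m: "?h1 : bmeas borel" "?h2 : bmeas borel"
   using cyl_pairing_continuous(1)[OF F fg(1) k1] cyl_pairing_continuous(1)[OF G fg(2) k2] by auto
  have e: "deriv ps (fst p) * bump n c d (snd p) * ?F p = ?h1 (snd p, fst p)" "ps (fst p) * bump n c d (snd p) * ?G p = ?h2 (snd p, fst p)" for p
   by (simp_all only: fst_conv snd_conv mult_ac)
  show "(LBINT p. deriv ps (fst p) * bump n c d (snd p) * ?F p) = - (LBINT p. ps (fst p) * bump n c d (snd p) * ?G p)"
   unfolding e integral_swap_real(2)[OF m(1)] integral_swap_real(2)[OF m(2)] by (rule main)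
 qed auto
 then show ?thesis
 proof eventually_elim
  case (elim R)
  show ?case
  proof
   assume r: "R : {1<..<4}"
   show "AC 0 1 (%z. F (R, z)) (%z. G (R, z))"
    by (rule AC_cong[OF mp[OF elim r]]) (use r in \<open>auto simp: Rect_def\<close>)
  qed
 qed
qed

text \<open>The horizontal partial derivatives of a test function A(R) B(z) are 2 x_j A'(R) B(z).
  Adding the two weak equations pairs A' with the flux 2 (x1 f1 + x2 f2) and A with the horizontal
  divergence, and no derivative in the angle is left.\<close>

lemma AC_cyl_avg_div:
 assumes w1: "cell_weak_deriv 1 f1 g1" and w2: "cell_weak_deriv 2 f2 g2"
  and F: "cyl_avg (%x. 2 * (x$1 * f1 x + x$2 * f2 x)) F" and G: "cyl_avg (%x. g1 x + g2 x) G"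
 shows "AE z in lborel. z : {0<..<1} --> AC 1 4 (%R. F (R, z)) (%R. G (R, z))"
proof -
 have i: "integrable (cellM) f1" "integrable (cellM) g1" "integrable (cellM) f2" "integrable (cellM) g2"
  using w1 w2 by (auto simp: cell_weak_deriv_def)
 have c: "continuous_on UNIV (%x::real^3. x$j)" for j by (intro continuous_intros)
 have fg: "integrable (cellM) (%x. 2 * (x$1 * f1 x + x$2 * f2 x))" "integrable (cellM) (%x. g1 x + g2 x)"
  using integrable_Cell_mult[OF i(1) c] integrable_Cell_mult[OF i(3) c] i by auto
 let ?F = "%p. idc Rect p * F p" and ?G = "%p. idc Rect p * G p"
 have "AE z in lborel. z : {0<..<1} --> AC 1 4 (%R. ?F (R, z)) (%R. ?G (R, z))"
 proof (rule AC_on_lines)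
  show "integrable lborel ?F" "integrable lborel ?G"
   using cyl_avg_integrable[OF F fg(1)] cyl_avg_integrable[OF G fg(2)] by auto
  fix ps :: "real => real" and n and c d :: real
  assume ps: "test_fun {1<..<4} ps" and cd: "cbox c d <= {0<..<1}"
  have bee: "test_fun {0<..<1} (bump n c d)" by (rule test_fun_bump[OF cd])
  note sm = test_fun_smooth[OF ps] test_fun_smooth[OF bee]
  note t = test_fun_cyl_product[OF ps bee]
  have k1: "continuous_on UNIV (%p. deriv ps (fst p) * bump n c d (snd p))" and k2: "continuous_on UNIV (%p. ps (fst p) * bump n c d (snd p))"
   using continuous_product_kernel test_fun_continuous bee ps test_fun_deriv by blast+
  have kc: "continuous_on UNIV (%x. deriv ps (fst (cyl x)) * bump n c d (snd (cyl x)))"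
   "continuous_on UNIV (%x. ps (fst (cyl x)) * bump n c d (snd (cyl x)))"
   by (rule continuous_on_compose2[OF k1 continuous_cyl], simp) (rule continuous_on_compose2[OF k2 continuous_cyl], simp)
  have ii: "integrable (cellM) (%x. deriv ps (fst (cyl x)) * bump n c d (snd (cyl x)) * (2 * (x$1 * f1 x)))"
   "integrable (cellM) (%x. deriv ps (fst (cyl x)) * bump n c d (snd (cyl x)) * (2 * (x$2 * f2 x)))"
   "integrable (cellM) (%x. ps (fst (cyl x)) * bump n c d (snd (cyl x)) * g1 x)"
   "integrable (cellM) (%x. ps (fst (cyl x)) * bump n c d (snd (cyl x)) * g2 x)"
   using integrable_Cell_mult[OF integrable_mult_right[OF integrable_Cell_mult[OF i(1) c]] kc(1)]
    integrable_Cell_mult[OF integrable_mult_right[OF integrable_Cell_mult[OF i(3) c]] kc(1)]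
    integrable_Cell_mult[OF i(2) kc(2)] integrable_Cell_mult[OF i(4) kc(2)] by auto
  have "(LINT x|cellM. deriv ps (fst (cyl x)) * bump n c d (snd (cyl x)) * (2 * (x$1 * f1 x))) =
    - (LINT x|cellM. ps (fst (cyl x)) * bump n c d (snd (cyl x)) * g1 x)"
   using cell_weak_derivD[OF w1 t] unfolding frechet_cyl_product[OF sm] by (simp add: axis_def cyl_def mult_ac)
  moreover have "(LINT x|cellM. deriv ps (fst (cyl x)) * bump n c d (snd (cyl x)) * (2 * (x$2 * f2 x))) =
    - (LINT x|cellM. ps (fst (cyl x)) * bump n c d (snd (cyl x)) * g2 x)"
   using cell_weak_derivD[OF w2 t] unfolding frechet_cyl_product[OF sm] by (simp add: axis_def cyl_def mult_ac)
  ultimately have "(LINT x|cellM. deriv ps (fst (cyl x)) * bump n c d (snd (cyl x)) * (2 * (x$1 * f1 x + x$2 * f2 x))) =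
    - (LINT x|cellM. ps (fst (cyl x)) * bump n c d (snd (cyl x)) * (g1 x + g2 x))"
   using ii by (simp add: distrib_left)
  then have "(LBINT p. idc Rect p * (deriv ps (fst p) * bump n c d (snd p) * F p)) =
    - (LBINT p. idc Rect p * (ps (fst p) * bump n c d (snd p) * G p))"
   unfolding cyl_pairing_continuous(2)[OF F fg(1) k1] cyl_pairing_continuous(2)[OF G fg(2) k2] by (rule cyl_const_cancel)
  note main = this
  have e: "deriv ps (fst p) * bump n c d (snd p) * ?F p = idc Rect p * (deriv ps (fst p) * bump n c d (snd p) * F p)"
   "ps (fst p) * bump n c d (snd p) * ?G p = idc Rect p * (ps (fst p) * bump n c d (snd p) * G p)" for p
   by (simp_all only: mult_ac)
  show "(LBINT p. deriv ps (fst p) * bump n c d (snd p) * ?F p) = - (LBINT p. ps (fst p) * bump n c d (snd p) * ?G p)"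
   unfolding e by (rule main)
 qed auto
 then show ?thesis
 proof eventually_elim
  case (elim z)
  show ?case
  proof
   assume r: "z : {0<..<1}"
   show "AC 1 4 (%R. F (R, z)) (%R. G (R, z))"
    by (rule AC_cong[OF mp[OF elim r]]) (use r in \<open>auto simp: Rect_def\<close>)
  qed
 qed
qed

text \<open>\<open>AC_cyl_avg_div\<close> for the fields x_j f has flux 2 R f and divergence 2 f +
  x1 g1 + x2 g2, so (2 R F)' = 2 F + G; multiplication by the absolutely continuous factor 1 / (2 R)
  leaves F' = G / (2 R).\<close>

lemma AC_cyl_avg_R:
 assumes w1: "cell_weak_deriv 1 f g1" and w2: "cell_weak_deriv 2 f g2"
  and F: "cyl_avg f F" and G: "cyl_avg (%x. x$1 * g1 x + x$2 * g2 x) G"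
 shows "AE z in lborel. z : {0<..<1} --> AC 1 4 (%R. F (R, z)) (%R. G (R, z) / (2 * R))"
proof -
 have i: "integrable (cellM) f" "integrable (cellM) g1" "integrable (cellM) g2"
  using w1 w2 by (auto simp: cell_weak_deriv_def)
 have c: "continuous_on UNIV (%x::real^3. x$j)" for j by (intro continuous_intros)
 have ig: "integrable (cellM) (%x. x$1 * g1 x + x$2 * g2 x)"
  using integrable_Cell_mult[OF i(2) c] integrable_Cell_mult[OF i(3) c] by auto
 have "cyl_avg (%x. 2 * fst (cyl x) * f x) (%p. 2 * fst p * F p)"
  by (rule cyl_avg_mult[OF F]) (intro bmeas_contI continuous_intros)
 moreover have "(%x. 2 * fst (cyl x) * f x) = (%x. 2 * (x$1 * (x$1 * f x) + x$2 * (x$2 * f x)))"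
  by (auto simp: cyl_def power2_eq_square algebra_simps)
 ultimately have F': "cyl_avg (%x. 2 * (x$1 * (x$1 * f x) + x$2 * (x$2 * f x))) (%p. 2 * fst p * F p)" by simp
 have ig': "integrable (cellM) (%x. (f x + x$1 * g1 x) + (f x + x$2 * g2 x))"
  using integrable_Cell_mult[OF i(2) c] integrable_Cell_mult[OF i(3) c] i by auto
 have G': "cyl_avg (%x. (f x + x$1 * g1 x) + (f x + x$2 * g2 x)) (%p. 2 * F p + G p)"
  by (rule cyl_avg_cong_AE[OF cyl_avg_add[OF cyl_avg_mult[OF F, of "%_. 2"] G]])
    (use i ig in auto)
 have inv: "AC 1 4 (%R. inverse (2 * R)) (%R. - inverse (2 * R^2))"
 proof -
  have "AC 1 4 (%R. R) (%R. 1)"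
   using AC_C1[of "%R. R" "%_. 1" 1 4] by (auto simp: AC_def)
  moreover have "((%R. inverse (2 * R)) has_real_derivative - inverse (2 * y^2)) (at y)" if "y : {1..4}" for y :: real
   using that by (auto intro!: derivative_eq_intros simp: field_simps power2_eq_square)
  moreover have "continuous_on {1..4} (%R::real. - inverse (2 * R^2))"
   by (intro continuous_intros) auto
  ultimately have "AC 1 4 (%R. inverse (2 * R)) (%R. - inverse (2 * R^2) * 1)"
   by (intro AC_chain[where J = "{1..4}"]) auto
  then show ?thesis by simp
 qed
 from AC_cyl_avg_div[OF cell_weak_deriv_mult_nth[OF w1] cell_weak_deriv_mult_nth[OF w2] F' G'] show ?thesis
 proof eventually_elim
  case (elim z)
  show ?case
  proof
   assume "z : {0<..<1}"
   then have "AC 1 4 (%R. 2 * R * F (R, z)) (%R. 2 * F (R, z) + G (R, z))" using elim by simp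
   from AC_mult[OF inv this]
   have "AC 1 4 (%R. inverse (2 * R) * (2 * R * F (R, z))) (%R. inverse (2 * R) * (2 * F (R, z) + G (R, z)) + - inverse (2 * R^2) * (2 * R * F (R, z)))"
    by simp
   then show "AC 1 4 (%R. F (R, z)) (%R. G (R, z) / (2 * R))"
    by (rule AC_cong) (auto simp: field_simps power2_eq_square)
  qed
 qed
qed

section \<open>Weak derivatives on the covering and their restriction to the cell\<close>

lemma test_fun_abs_integrable:
 fixes f :: "'a::euclidean_space => 'b::euclidean_space" and et :: "'a => real"
 assumes f: "locally_integrable U f" and et: "continuous_on UNIV et" and K: "compact K" "K <= U" "!!x. x ~: K ==> et x = 0"
 shows "integrable lebesgue (%x. et x *\<^sub>R f x)"
proof -
 have fK: "integrable lebesgue (%x. idc K x *\<^sub>R f x)"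
  using f K by (auto simp: locally_integrable_def set_integrable_def)
 have "bounded (et ` K)"
  using K(1) et continuous_on_subset by (intro compact_imp_bounded compact_continuous_image) auto
 then obtain B where B: "\<forall>x\<in>K. \<bar>et x\<bar> <= B" by (auto simp: bounded_iff)
 have eq: "et x *\<^sub>R f x = et x *\<^sub>R (idc K x *\<^sub>R f x)" for x using K(3)[of x] by (auto simp: indicator_def)
 show ?thesis
  unfolding eq
 proof (rule integrable_bd)
  show "integrable lebesgue (%x. B *\<^sub>R (idc K x *\<^sub>R f x))" by (rule integrable_scaleR_right[OF fK])
  have "et : bmeas lebesgue"
   using et by (intro measurable_completion) (simp add: bmeas_contI)
  then show "(%x. et x *\<^sub>R (idc K x *\<^sub>R f x)) : bmeas lebesgue"
   by (rule borel_measurable_scaleR[OF _ borel_measurable_integrable[OF fK]])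
  show "AE x in lebesgue. norm (et x *\<^sub>R (idc K x *\<^sub>R f x)) <= norm (B *\<^sub>R (idc K x *\<^sub>R f x))"
  proof (rule AE_I2)
   fix x
   have "x : K ==> \<bar>et x\<bar> <= \<bar>B\<bar>" using B by fastforce
   then show "norm (et x *\<^sub>R (idc K x *\<^sub>R f x)) <= norm (B *\<^sub>R (idc K x *\<^sub>R f x))"
    by (auto simp: indicator_def mult_right_mono)
  qed
 qed
qed

lemma weak_derivD:
 fixes f g :: "'a::euclidean_space => 'b::euclidean_space"
 assumes w: "weak_deriv U b f g" and phh: "test_fun U phh" and b: "b : Basis"
 shows "integrable lebesgue (%x. frd phh (at x) b *\<^sub>R f x)" "integrable lebesgue (%x. phh x *\<^sub>R g x)"
  "(LINT x|lebesgue. frd phh (at x) b *\<^sub>R f x) = - (LINT x|lebesgue. phh x *\<^sub>R g x)"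
proof -
 obtain K where K: "compact K" "K <= U" "!!x. x ~: K ==> phh x = 0" using test_fun_support[OF phh] by metis
 have d0: "frd phh (at x) b = 0" if "x ~: K" for x
  by (rule frechet_derivative_outside[OF compact_imp_closed[OF K(1)] K(3) that])
 have l: "locally_integrable U f" "locally_integrable U g" using w by (auto simp: weak_deriv_def)
 show "integrable lebesgue (%x. frd phh (at x) b *\<^sub>R f x)"
  by (rule test_fun_abs_integrable[OF l(1) smooth_frechet_continuous[OF test_fun_smooth[OF phh] b] K(1,2) d0])
 show "integrable lebesgue (%x. phh x *\<^sub>R g x)"
  by (rule test_fun_abs_integrable[OF l(2) test_fun_continuous[OF phh] K])
 have "(LINT x:U|lebesgue. frd phh (at x) b *\<^sub>R f x) = - (LINT x:U|lebesgue. phh x *\<^sub>R g x)"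
  using w phh by (auto simp: weak_deriv_def)
 moreover have "idc U x *\<^sub>R frd phh (at x) b *\<^sub>R f x = frd phh (at x) b *\<^sub>R f x" 
  "idc U x *\<^sub>R phh x *\<^sub>R g x = phh x *\<^sub>R g x" for x
  using d0[of x] K(2,3) by (auto simp: indicator_def)
 note this[abs_def]
 ultimately show "(LINT x|lebesgue. frd phh (at x) b *\<^sub>R f x) = - (LINT x|lebesgue. phh x *\<^sub>R g x)"
  unfolding set_lebesgue_integral_def by (simp only:)
qed

lemma weak_deriv_linear:
 fixes f g :: "'a::euclidean_space => 'b::euclidean_space" and T :: "'b => 'c::euclidean_space"
 assumes w: "weak_deriv U b f g" and T: "bounded_linear T" and b: "b : Basis"
 shows "weak_deriv U b (%x. T (f x)) (%x. T (g x))"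
 unfolding weak_deriv_def
proof (intro conjI allI impI)
 have loc: "locally_integrable U (%x. T (h x))" if "locally_integrable U h" for h
  unfolding locally_integrable_def
 proof (intro allI impI)
  fix S assume "compact S & S <= U"
  then have "h absolutely_integrable_on S" using that by (auto simp: locally_integrable_def)
  from absolutely_integrable_linear[OF this T] show "(%x. T (h x)) absolutely_integrable_on S" by (simp add: o_def)
 qed
 show "locally_integrable U (%x. T (f x))" "locally_integrable U (%x. T (g x))" using w loc by (auto simp: weak_deriv_def)
 fix phh :: "'a => real" assume phh: "test_fun U phh"
 obtain K where K: "compact K" "K <= U" "!!x. x ~: K ==> phh x = 0" using test_fun_support[OF phh] by metis
 have d0: "frd phh (at x) b = 0" if "x ~: K" for x
  by (rule frechet_derivative_outside[OF compact_imp_closed[OF K(1)] K(3) that])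
 note D = weak_derivD[OF w phh b]
 have "T (LINT x|lebesgue. frd phh (at x) b *\<^sub>R f x) = T (- (LINT x|lebesgue. phh x *\<^sub>R g x))" using D(3) by simp
 then have e: "(LINT x|lebesgue. T (frd phh (at x) b *\<^sub>R f x)) = - (LINT x|lebesgue. T (phh x *\<^sub>R g x))"
  using integral_bounded_linear[OF T D(1)] integral_bounded_linear[OF T D(2)] T by (simp add: linear_neg bounded_linear.linear)
 have "idc U x *\<^sub>R frd phh (at x) b *\<^sub>R T (f x) = T (frd phh (at x) b *\<^sub>R f x)" 
  "idc U x *\<^sub>R phh x *\<^sub>R T (g x) = T (phh x *\<^sub>R g x)" for x
  using d0[of x] K(2) K(3)[of x] T by (auto simp: indicator_def linear_cmul bounded_linear.linear linear_0)
 then show "(LINT x:U|lebesgue. frd phh (at x) b *\<^sub>R T (f x)) = - (LINT x:U|lebesgue. phh x *\<^sub>R T (g x))"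
  using e by (simp add: set_lebesgue_integral_def)
qed

lemma integral_lebesgue_on_Cell:
 fixes h :: "real^3 => real"
 assumes "!!x. x ~: Cell ==> h x = 0"
 shows "(LINT x|cellM. h x) = (LINT x|lebesgue. h x)"
proof -
 have "idc Cell x *\<^sub>R h x = h x" for x using assms[of x] by (auto simp: indicator_def)
 then have "(%x. idc Cell x *\<^sub>R h x) = h" by blast
 then show ?thesis using integral_restrict_space[of Cell lebesgue h] by simp
qed

lemma Cell0_subset: "Cell0 <= Cell" "Cell0 <= Omega"
 by (auto simp: Cell0_def Cell_def)

lemma test_fun_mono: "test_fun U phh ==> U <= V ==> test_fun V phh"
 by (auto simp: test_fun_def)

lemma axis_Basis [simp]: "axis j 1 : (Basis :: (real^3) set)"
 by (simp add: axis_in_Basis_iff)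

lemma weak_deriv_cell:
 fixes f g :: "real^3 => real"
 assumes w: "weak_deriv Omega (axis j 1) f g" and i: "integrable (cellM) f" "integrable (cellM) g"
 shows "cell_weak_deriv j f g"
 unfolding cell_weak_deriv_def
proof (intro conjI allI impI i)
 fix phh assume phh: "test_fun Cell0 phh"
 have phhO: "test_fun Omega phh" using test_fun_mono[OF phh Cell0_subset(2)] .
 obtain K where K: "compact K" "K <= Cell0" "!!x. x ~: K ==> phh x = 0" using test_fun_support[OF phh] by metis
 have KC: "K <= Cell" using K(2) Cell0_subset by blast
 have d0: "frd phh (at x) (axis j 1) = 0" if "x ~: K" for x
  by (rule frechet_derivative_outside[OF compact_imp_closed[OF K(1)] K(3) that])
 have e: "(LINT x|cellM. frd phh (at x) (axis j 1) * f x) = (LINT x|lebesgue. frd phh (at x) (axis j 1) * f x)"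
  "(LINT x|cellM. phh x * g x) = (LINT x|lebesgue. phh x * g x)"
  by (rule integral_lebesgue_on_Cell, use d0 K(3) KC in auto)+
 show "(LINT x|cellM. frd phh (at x) (axis j 1) * f x) = - (LINT x|cellM. phh x * g x)"
  unfolding e using weak_derivD(3)[OF w phhO] by simp
qed

section \<open>Vertical shifts and periodicity\<close>

lemma negligible_shift: "negligible N ==> negligible {x. x + c : N}" for c :: "'a::euclidean_space"
proof -
 assume "negligible N"
 then have "negligible ((+) (- c) ` N)" by (rule negligible_translation)
 moreover have "(+) (- c) ` N = {x. x + c : N}" by (force simp: image_iff)
 ultimately show ?thesis by simp
qed

lemma AE_lebesgue_shift:
 assumes "AE x in lebesgue. P (x :: 'a::euclidean_space)"
 shows "AE x in lebesgue. P (x + c)"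
proof -
 have "negligible {x. x + c : {x. ~ P x}}" by (rule negligible_shift[OF AE_lebesgue_negligible[OF assms]])
 then show ?thesis
  by (intro AE_I'[of "{x. ~ P (x + c)}"]) (auto simp: negligible_iff_null_sets)
qed

lemma integral_lebesgue_shift:
 fixes h :: "'a::euclidean_space => real"
 assumes h: "integrable lebesgue h"
 shows "integrable lebesgue (%x. h (x + c))" and "(LINT x|lebesgue. h (x + c)) = (LINT x|lebesgue. h x)"
proof -
 obtain h' where h': "h' : bmeas lborel" "AE x in lborel. h x = h' x"
  using completion_ex_borel_measurable_real[of h lborel] h by auto
 have ae: "AE x in lebesgue. h x = h' x" using h'(2) by (rule AE_completion)
 have ae': "AE x in lebesgue. h (x + c) = h' (x + c)" by (rule AE_lebesgue_shift[OF ae])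
 have h'b [measurable]: "h' : bmeas borel" using h'(1) by simp
 have h'L: "h' : bmeas lebesgue" using h'(1) by (rule measurable_completion)
 have i': "integrable lborel h'"
  using integrable_cong_AE_imp[OF h h'L] ae integrable_completion[OF h'(1)] by (auto elim: eventually_mono)
 have d: "distr lborel borel ((+) c) = (lborel :: 'a measure)" by (rule lborel_distr_plus)
 have i2: "integrable lborel (%x. h' (x + c))"
  using i' integrable_distr_eq[of "(+) c" lborel borel h'] unfolding d by (simp add: add.commute)
 have m2: "(%x. h' (x + c)) : bmeas lborel" by measurable
 have m2L: "(%x. h' (x + c)) : bmeas lebesgue" by (rule measurable_completion[OF m2])
 have i2L: "integrable lebesgue (%x. h' (x + c))" using integrable_completion[OF m2] i2 by simp
 have mh: "(%x. h (x + c)) : bmeas lebesgue"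
  using bmeas_cong_AE[of UNIV "%x. h' (x + c)" "%x. h (x + c)", unfolded lebesgue_on_UNIV_eq] m2L eventually_mono[OF ae', of "%x. h' (x + c) = h (x + c)"]
  by simp
 show "integrable lebesgue (%x. h (x + c))"
  by (rule integrable_cong_AE_imp[OF i2L mh]) (use ae' in auto)
 have "(LINT x|lebesgue. h (x + c)) = (LINT x|lebesgue. h' (x + c))"
  by (rule integral_cong_AE[OF mh m2L ae'])
 also have "... = (LBINT x. h' (x + c))" by (rule integral_completion[OF m2])
 also have "... = (LBINT x. h' x)"
  using integral_distr[of "(+) c" lborel borel h'] unfolding d by (simp add: add.commute)
 also have "... = (LINT x|lebesgue. h' x)" by (rule integral_completion[OF h'(1), symmetric])
 also have "... = (LINT x|lebesgue. h x)"
  by (rule integral_cong_AE) (use h h'L ae in \<open>auto elim: eventually_mono\<close>)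
 finally show "(LINT x|lebesgue. h (x + c)) = (LINT x|lebesgue. h x)" .
qed

lemma locally_integrable_zero:
 fixes d :: "'a::euclidean_space => real"
 assumes d: "locally_integrable U d" and U: "open U"
  and z: "!!phh. test_fun U phh ==> (LINT x|lebesgue. phh x * d x) = 0"
 shows "AE x in lebesgue. x : U --> d x = 0"
proof -
 let ?C = "{(c, e). rat_pt c & rat_pt e & cbox c e <= U}"
 have cC: "countable ?C"
  by (rule countable_subset[of _ "{c. rat_pt c} \<times> {c. rat_pt c}"])
    (auto intro: countable_rat_pts countable_SIGMA)
 have 1: "AE x in lebesgue. x : box a b --> d x = 0" if ab: "(a, b) : ?C" for a b
 proof -
  have "d absolutely_integrable_on cbox a b" using ab d by (auto simp: locally_integrable_def)
  then have i: "integrable lebesgue (%x. idc (cbox a b) x * d x)" by (simp add: set_integrable_def)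
  then obtain d' where d': "d' : bmeas lborel" "AE x in lborel. idc (cbox a b) x * d x = d' x"
   using completion_ex_borel_measurable_real[of "%x. idc (cbox a b) x * d x" lborel] by auto
  have ae: "AE x in lebesgue. idc (cbox a b) x * d x = d' x" using d'(2) by (rule AE_completion)
  have d'L: "d' : bmeas lebesgue" using d'(1) by (rule measurable_completion)
  have i': "integrable lborel d'"
   using integrable_cong_AE_imp[OF i d'L] ae integrable_completion[OF d'(1)] by (auto elim: eventually_mono)
  have "AE x in lborel. x : box a b --> d' x = 0"
  proof (rule AE_zero_of_bump_integrals[OF i' open_box])
   fix n and c e :: 'a assume ce: "cbox c e <= box a b"
   have sub: "box c e <= cbox a b" using ce box_subset_cbox[of a b] box_subset_cbox[of c e] by blast
   have "(LBINT x. bump n c e x * d' x) = (LINT x|lebesgue. bump n c e x * d' x)"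
    using d'(1) by (intro integral_completion[symmetric]) simp
   also have "... = (LINT x|lebesgue. bump n c e x * d x)"
   proof (rule integral_cong_AE)
    have bL: "bump n c e : bmeas lebesgue" by (intro measurable_completion) simp
    then show "(%x. bump n c e x * d' x) : bmeas lebesgue" using d'L by measurable
    have eq: "bump n c e x * d x = bump n c e x * (idc (cbox a b) x * d x)" for x
     using sub bump_outside[of x c e n] by (auto simp: indicator_def)
    have "(%x. idc (cbox a b) x * d x) : bmeas lebesgue" using i by auto
    then show "(%x. bump n c e x * d x) : bmeas lebesgue" unfolding eq using bL by measurable
    show "AE x in lebesgue. bump n c e x * d' x = bump n c e x * d x"
     using ae unfolding eq by eventually_elim simp
   qed
   also have "... = 0"
    by (rule z, rule test_fun_bump) (use ce ab box_subset_cbox[of a b] in blast)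
   finally show "(LBINT x. bump n c e x * d' x) = 0" .
  qed
  from AE_completion[OF this] ae show ?thesis
   by eventually_elim (use box_subset_cbox[of a b] in \<open>auto simp: indicator_def\<close>)
 qed
 have "AE x in lebesgue. \<forall>z\<in>?C. x : box (fst z) (snd z) --> d x = 0"
  unfolding AE_ball_countable[OF cC] using 1 by auto
 then show ?thesis
 proof eventually_elim
  case (elim x)
  show ?case
  proof
   assume "x : U"
   then obtain c e where "rat_pt c" "rat_pt e" "x : box c e" "cbox c e <= U"
    using open_rational_boxes[OF U] by metis
   then show "d x = 0" using bspec[OF elim, of "(c,e)"] by simp
  qed
 qed
qed

lemma Omega_shift: "x + axis 3 c : Omega \<longleftrightarrow> x : Omega"
 by (simp add: Omega_def axis_def)

text \<open>The weak derivative is an arbitrary representative, so periodicity can hold only almost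
  everywhere. Tested against g(x + e) - g(x), the shift moves to the test function, then through the
  integration by parts to \<open>f\<close>, where it disappears.\<close>

lemma periodic_weak_deriv:
 fixes f g :: "real^3 => real"
 assumes w: "weak_deriv Omega (axis 3 1) f g" and per: "periodic_z f"
 shows "AE x in lebesgue. x : Omega --> g (x + axis 3 1) = g x"
proof -
 let ?e = "axis 3 1 :: real^3"
 have l: "locally_integrable Omega g" using w by (auto simp: weak_deriv_def)
 have "AE x in lebesgue. x : Omega --> g (x + ?e) - g x = 0"
 proof (rule locally_integrable_zero[OF _ open_Omega])
  show "locally_integrable Omega (%x. g (x + ?e) - g x)"
   unfolding locally_integrable_def
  proof (intro allI impI)
   fix S :: "(real^3) set" assume S: "compact S & S <= Omega"
   let ?T = "(+) ?e ` S"
   have "compact ?T" using S by (intro compact_translation) auto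
   moreover have "?T <= Omega" using S Omega_shift by (auto simp: add.commute)
   ultimately have "integrable lebesgue (%x. idc ?T x * g x)" using l by (auto simp: locally_integrable_def set_integrable_def)
   from integral_lebesgue_shift(1)[OF this, of ?e]
   have "integrable lebesgue (%x. idc S x * g (x + ?e))"
    by (rule back_subst[of "integrable lebesgue"]) (auto simp: indicator_def fun_eq_iff image_iff add.commute)
   moreover have "integrable lebesgue (%x. idc S x * g x)" using l S by (auto simp: locally_integrable_def set_integrable_def)
   ultimately show "(%x. g (x + ?e) - g x) absolutely_integrable_on S"
    unfolding set_integrable_def by (simp add: right_diff_distrib)
  qed
  fix phh :: "real^3 => real" assume phh: "test_fun Omega phh"
  obtain K where K: "compact K" "K <= Omega" "!!x. x ~: K ==> phh x = 0" using test_fun_support[OF phh] by metis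
  define phh' where "phh' x = phh (x - ?e)" for x
  have der: "(phh' has_derivative frd phh (at (x - ?e))) (at x)" for x
  proof -
   have 1: "((%x. x - ?e) has_derivative (%h. h)) (at x)" by (auto intro!: derivative_eq_intros)
   show ?thesis
    unfolding phh'_def[abs_def] using has_derivative_compose[OF 1 smooth_has_derivative[OF test_fun_smooth[OF phh]]] by simp
  qed
  have C: "C_k k UNIV (%x. h (x - ?e))" if "C_k k UNIV h" for k and h :: "real^3 => real"
   using that
  proof (induction k arbitrary: h)
   case 0
   then have "continuous_on UNIV h" by simp
   then have "continuous_on UNIV (%x. h (x - ?e))"
    by (rule continuous_on_compose2) (auto intro: continuous_intros)
   then show ?case by simp
  next
   case (Suc k)
   have d: "((%x. h (x - ?e)) has_derivative frd h (at (x - ?e))) (at x)" for x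
   proof -
    have 1: "((%x. x - ?e) has_derivative (%h. h)) (at x)" by (auto intro!: derivative_eq_intros)
    have "(h has_derivative frd h (at (x - ?e))) (at (x - ?e))"
     using Suc.prems by (simp add: frechet_derivative_works[symmetric])
    from has_derivative_compose[OF 1 this] show ?thesis by simp
   qed
   then have "frd (%x. h (x - ?e)) (at x) = frd h (at (x - ?e))" for x
    by (rule frechet_derivative_at[symmetric])
   moreover have "C_k k UNIV (%x. frd h (at (x - ?e)) b)" if "b : Basis" for b
    using Suc.IH[of "%x. frd h (at x) b"] Suc.prems that by simp
   ultimately show ?case using d by (auto simp: differentiable_def)
  qed
  have phh': "test_fun Omega phh'"
  proof (rule test_funI)
   show "smooth UNIV phh'" using C smooth_C_k[OF test_fun_smooth[OF phh]] by (simp add: smooth_def phh'_def[abs_def])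
   show "compact ((+) ?e ` K)" using K(1) by (rule compact_translation)
   show "(+) ?e ` K <= Omega" using K(2) Omega_shift by (auto simp: add.commute)
   show "phh' x = 0" if "x ~: (+) ?e ` K" for x
   proof -
    have "x - ?e ~: K" using that by (metis diff_add_cancel add.commute image_eqI)
    then show ?thesis using K(3) by (simp add: phh'_def)
   qed
  qed
  note D = weak_derivD[OF w phh axis_Basis] and D' = weak_derivD[OF w phh' axis_Basis]
  have i2: "integrable lebesgue (%x. phh x * g (x + ?e))" and e2: "(LINT x|lebesgue. phh x * g (x + ?e)) = (LINT x|lebesgue. phh' x * g x)"
   using integral_lebesgue_shift[where h = "%x. phh' x * g x" and c = ?e] D'(2) by (simp_all add: phh'_def)
  have "(LINT x|lebesgue. phh' x * g x) = - (LINT x|lebesgue. frd phh' (at x) ?e * f x)" using D'(3) by simp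
  also have "(LINT x|lebesgue. frd phh' (at x) ?e * f x) = (LINT x|lebesgue. frd phh (at x) ?e * f (x + ?e))"
   using integral_lebesgue_shift(2)[where h = "%x. frd phh' (at x) ?e * f x" and c = ?e] D'(1)
   by (simp add: frechet_derivative_eqI[OF der])
  also have "... = (LINT x|lebesgue. frd phh (at x) ?e * f x)"
  proof (intro Bochner_Integration.integral_cong refl)
   fix x
   show "frd phh (at x) ?e * f (x + ?e) = frd phh (at x) ?e * f x"
   proof (cases "x : K")
    case True
    then show ?thesis using per K(2) by (auto simp: periodic_z_def)
   next
    case False
    then show ?thesis using frechet_derivative_outside[OF compact_imp_closed[OF K(1)] K(3) False] by simp
   qed
  qed
  finally have "(LINT x|lebesgue. phh' x * g x) = (LINT x|lebesgue. phh x * g x)" using D(3) by simp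
  then show "(LINT x|lebesgue. phh x * (g (x + ?e) - g x)) = 0"
   using e2 i2 D(2) by (simp add: right_diff_distrib)
 qed
 then show ?thesis by eventually_elim auto
qed

lemma smooth_antiderivative:
 fixes v :: "real => real"
 assumes v: "smooth UNIV v" and supp: "!!s. s ~: {c<..<d} ==> v s = 0" and pos: "!!s. s : {c<..<d} ==> v s > 0" and cd: "c < d"
 obtains F T where "smooth UNIV F" "!!s. (F has_real_derivative v s) (at s)" "!!s. s <= c ==> F s = 0" "!!s. s >= d ==> F s = T" "T > 0"
proof -
 have cont: "isCont v s" for s
  using smooth_C_k[OF v, of 0] by (simp add: continuous_on_eq_continuous_at)
 obtain F where F: "!!s. (F has_real_derivative v s) (at s)"
  using einterval_antiderivative[of "-\<infinity>" "\<infinity>" v] cont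
  by (auto simp: has_real_derivative_iff_has_vector_derivative)
 have 1: "F s = F c" if "s <= c" for s
 proof (cases "s < c")
  case True
  then obtain z where "s < z" "z < c" "F c - F s = (c - s) * v z"
   using MVT2[of s c F v] F by blast
  then show ?thesis using supp[of z] by auto
 qed (use that in auto)
 have 2: "F s = F d" if "s >= d" for s
 proof (cases "s > d")
  case True
  then obtain z where "d < z" "z < s" "F s - F d = (s - d) * v z"
   using MVT2[of d s F v] F by blast
  then show ?thesis using supp[of z] by auto
 qed (use that in auto)
 obtain z where "c < z" "z < d" "F d - F c = (d - c) * v z"
  using MVT2[of c d F v] F cd by blast
 then have T: "F d - F c > 0" using pos[of z] cd by simp
 have D: "((%s. F s - F c) has_real_derivative v s) (at s)" for s
  using F[of s] by (auto intro!: derivative_eq_intros)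
 have "C_k k UNIV (%s. F s - F c)" for k
  using C_k_real_Suc[OF D, of k] smooth_C_k[OF v] C_k_Suc_imp by blast
 then have "smooth UNIV (%s. F s - F c)" by (simp add: smooth_def)
 then show thesis
 proof (rule that[OF _ D])
  show "F s - F c = 0" if "s <= c" for s using 1[OF that] by simp
  show "F s - F c = F d - F c" if "s >= d" for s using 2[OF that] by simp
 qed (rule T)
qed

lemma C_k_shift_real:
 fixes h :: "real => real"
 assumes "smooth UNIV h"
 shows "smooth UNIV (%s. h (s + t))"
 by (rule smooth_compose[OF assms]) (intro smooth_add smooth_linear smooth_const bounded_linear_ident)

text \<open>A function of R alone has no compact support in the covering. It is multiplied by a
  cut-off in z such that \<open>cut s + cut (s + 1)\<close> is the constant \<open>T\<close> on one
  period: \<open>T\<close> times the integral over the cell then equals the integral over the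
  covering. After integration by parts the derivative of the cut-off is a bump minus its unit shift,
  and the periodic \<open>f\<close> gives 0.\<close>

lemma periodic_Cell_integral_zero:
 fixes f g :: "real^3 => real"
 assumes w: "weak_deriv Omega (axis 3 1) f g" and per: "periodic_z f" and cd: "{c..d} <= {1<..<4}"
 shows "(LINT x|cellM. bump n c d (fst (cyl x)) * g x) = 0"
proof -
 let ?e = "axis 3 1 :: real^3"
 define A where "A = bump n c d"
 define thh where "thh = bump 1 (0::real) 1"
 have smA: "smooth UNIV A" and smthh: "smooth UNIV thh" by (simp_all add: A_def thh_def smooth_bump_id)
 obtain \<Theta> T where \<Theta>: "smooth UNIV \<Theta>" "!!s. (\<Theta> has_real_derivative thh s) (at s)" "!!s. s <= 0 ==> \<Theta> s = 0" "!!s. s >= 1 ==> \<Theta> s = T" "T > 0"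
  by (rule smooth_antiderivative[OF smthh, of 0 1]) (auto simp: thh_def bump_outside bump_pos box_real)
 \<comment> \<open>A smooth step minus its unit shift: supported in [0, 2], rising on [0, 1] and
   falling on [1, 2] in such a way that the translates add up to \<open>T\<close>.\<close>
 define cut where "cut s = \<Theta> s + (-1) * \<Theta> (s + (-1))" for s
 have sm_cut: "smooth UNIV cut" unfolding cut_def by (intro smooth_add smooth_mult smooth_const \<Theta>(1) C_k_shift_real)
 have d_cut: "deriv cut s = thh s - thh (s - 1)" for s
 proof (rule DERIV_imp_deriv)
  have "((%s. \<Theta> (s - 1)) has_real_derivative thh (s - 1) * 1) (at s)"
   by (rule DERIV_chain2[OF \<Theta>(2)]) (auto intro!: derivative_eq_intros)
  then show "(cut has_real_derivative thh s - thh (s - 1)) (at s)"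
   unfolding cut_def[abs_def] using \<Theta>(2)[of s] by (auto intro!: derivative_eq_intros)
 qed
 have cut_0: "cut s = 0" if "s <= 0 | s >= 2" for s using that \<Theta>(3)[of s] \<Theta>(3)[of "s - 1"] \<Theta>(4)[of s] \<Theta>(4)[of "s - 1"] by (auto simp: cut_def)
 have cut_T: "cut s + cut (s + 1) = T" if "0 <= s" "s < 1" for s using that \<Theta>(3)[of "s - 1"] \<Theta>(4)[of "s + 1"] by (auto simp: cut_def)
 have thh0: "thh s = 0" if "s ~: {0..1}" for s using that bump_outside[of s 0 1 1] by (auto simp: thh_def box_real)
 have A0: "A R = 0" if "R ~: {c..d}" for R using that bump_outside[of R c d n] by (auto simp: A_def box_real)
 let ?K = "%a b. {x::real^3. (x$1)^2 + (x$2)^2 : {c..d} & x$3 : {a..b}}"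
 have K: "compact (?K a b)" "?K a b <= Omega" for a b
  using compact_cyl_preimage[of "{c..d}" "{a..b}"] cd by (auto simp: Omega_def subset_iff)
 let ?R = "%x::real^3. (x$1)^2 + (x$2)^2"
 have phh: "test_fun Omega (%x. A (?R x) * cut (x$3))"
  by (rule test_funI[OF smooth_cyl_product[OF smA sm_cut] K[of 0 2]]) (use A0 cut_0 in auto)
 have l: "locally_integrable Omega f" "locally_integrable Omega g" using w by (auto simp: weak_deriv_def)
 have cAthh: "continuous_on UNIV (%x::real^3. A (?R x) * thh (x$3))"
  using smooth_C_k[OF smooth_cyl_product[OF smA smthh], of 0] by simp
 have "integrable lebesgue (%x. (A (?R x) * thh (x$3)) *\<^sub>R f x)"
  by (rule test_fun_abs_integrable[OF l(1) cAthh K[of 0 1]])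
    (use A0 thh0 in auto)
 then have pi: "integrable lebesgue (%x. A (?R x) * thh (x$3) * f x)" by simp
 have sh: "?R (x + - ?e) = ?R x" "(x + - ?e)$3 = x$3 - 1" "?R (x + ?e) = ?R x" "(x + ?e)$3 = x$3 + 1" for x :: "real^3" by (auto simp: axis_def)
 have pe: "A (?R (x + - ?e)) * thh ((x + - ?e)$3) * f (x + - ?e) = A (?R x) * thh (x$3 - 1) * f x" for x
 proof (cases "?R x : {c..d}")
  case True
  then have "x + - ?e : Omega" using cd sh by (auto simp: Omega_def subset_iff)
  then have "f ((x + - ?e) + ?e) = f (x + - ?e)" using per unfolding periodic_z_def by blast
  then have "f (x + - ?e) = f x" by simp
  then show ?thesis unfolding sh by simp
 next
  case False
  then show ?thesis unfolding sh using A0 by simp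
 qed
 note S = integral_lebesgue_shift[OF pi, of "- ?e", unfolded pe]
 have "(LINT x|lebesgue. frd (%x. A (?R x) * cut (x$3)) (at x) ?e *\<^sub>R f x) = (LINT x|lebesgue. A (?R x) * thh (x$3) * f x - A (?R x) * thh (x$3 - 1) * f x)"
  unfolding frechet_cyl_product[OF smA sm_cut] d_cut by (intro Bochner_Integration.integral_cong) (auto simp: axis_def algebra_simps)
 also have "... = 0" using pi S by simp
 finally have q0: "(LINT x|lebesgue. A (?R x) * cut (x$3) * g x) = 0"
  using weak_derivD(3)[OF w phh axis_Basis] by simp
 have qi: "integrable lebesgue (%x. A (?R x) * cut (x$3) * g x)" using weak_derivD(2)[OF w phh axis_Basis] by simp
 define q where "q x = A (?R x) * cut (x$3) * g x" for x
 let ?C1 = "{x. x + - ?e : Cell}"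
 have C1: "?C1 : sets lebesgue"
 proof -
  have "?C1 = (+) ?e ` Cell" by (force simp: image_iff)
  then show ?thesis using measurable_translation[OF Cell_lmeasurable, of ?e] by (simp add: fmeasurableD)
 qed
 have qi1: "integrable lebesgue (%x. idc Cell x * q x)" and qi2: "integrable lebesgue (%x. idc ?C1 x * q x)"
  using integrable_mult_indicator[OF Cell_lebesgue qi] integrable_mult_indicator[OF C1 qi] by (simp_all add: q_def)
 have "q x = idc Cell x * q x + idc ?C1 x * q x" for x
 proof (cases "?R x : {c..d} & 0 < x$3 & x$3 < 2")
  case True
  then have "?R x : {1<..<4}" using cd by auto
  then have "x : Cell \<longleftrightarrow> x$3 < 1" "x : ?C1 \<longleftrightarrow> x$3 >= 1"
   using True by (auto simp: Cell_def Omega_def axis_def)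
  then show ?thesis by (cases "x$3 < 1") (auto simp: indicator_def)
 next
  case False
  then have "q x = 0" using A0[of "?R x"] cut_0[of "x$3"] by (auto simp: q_def)
  then show ?thesis by simp
 qed
 then have "(LINT x|lebesgue. q x) = (LINT x|lebesgue. idc Cell x * q x + idc ?C1 x * q x)" by simp
 also have "... = (LINT x|lebesgue. idc Cell x * q x) + (LINT x|lebesgue. idc ?C1 x * q x)"
  using qi1 qi2 by simp
 also have "(LINT x|lebesgue. idc ?C1 x * q x) = (LINT x|lebesgue. idc Cell x * q (x + ?e))"
  using integral_lebesgue_shift(2)[OF qi2, of ?e] by (simp add: indicator_def)
 also have "(LINT x|lebesgue. idc Cell x * q x) + ... = (LINT x|lebesgue. idc Cell x * q x + idc Cell x * q (x + ?e))"
  using integral_lebesgue_shift(1)[OF qi2, of ?e] qi1 by (simp add: indicator_def)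
 also have "... = (LINT x|lebesgue. T * (idc Cell x * (A (?R x) * g x)))"
 proof (rule integral_cong_AE)
  have i2: "integrable lebesgue (%x. idc Cell x * q (x + ?e))"
   using integral_lebesgue_shift(1)[OF qi2, of ?e] by (simp add: indicator_def)
  then show "(%x. idc Cell x * q x + idc Cell x * q (x + ?e)) : bmeas lebesgue" using qi1 by auto
  show ae: "AE x in lebesgue. idc Cell x * q x + idc Cell x * q (x + ?e) = T * (idc Cell x * (A (?R x) * g x))"
   using periodic_weak_deriv[OF w per]
  proof eventually_elim
   case (elim x)
   show ?case
   proof (cases "x : Cell")
    case True
    then have "g (x + ?e) = g x" using elim by (auto simp: Cell_def)
    moreover have "cut (x$3) + cut (x$3 + 1) = T" using True by (intro cut_T) (auto simp: Cell_def)
    then have "A (?R x) * cut (x$3) * g x + A (?R x) * cut (x$3 + 1) * g x = T * (A (?R x) * g x)"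
     by (metis (no_types, opaque_lifting) distrib_left distrib_right mult.assoc mult.left_commute)
    ultimately show ?thesis using True unfolding q_def sh by simp
   qed simp
  qed
  show "(%x. T * (idc Cell x * (A (?R x) * g x))) : bmeas lebesgue"
   using bmeas_cong_AE[of UNIV _ "%x. T * (idc Cell x * (A (?R x) * g x))", unfolded lebesgue_on_UNIV_eq, OF _ _ ae] i2 qi1 by auto
 qed
 also have "... = T * (LINT x|cellM. A (fst (cyl x)) * g x)"
  using integral_restrict_space[of Cell lebesgue "%x. A (fst (cyl x)) * g x"] by (simp add: cyl_def)
 finally show ?thesis using q0 \<open>T > 0\<close> by (simp add: q_def A_def)
qed

text \<open>In effect the continuous representative of the average takes equal values at z = 0 and z
  = 1 on almost every line.\<close>

lemma periodic_avg_integral_zero: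
 fixes f g :: "real^3 => real"
 assumes w: "weak_deriv Omega (axis 3 1) f g" and per: "periodic_z f"
  and g: "integrable (cellM) g" and G: "cyl_avg g G"
 shows "AE R in lborel. R : {1<..<4} --> (LBINT z. idc {0<..<1} z * G (R, z)) = 0"
proof -
 have iG: "integrable lborel (%p. idc Rect p * G p)" by (rule cyl_avg_integrable[OF G g])
 let ?J = "%R. \<integral>z. idc Rect (R, z) * G (R, z) \<partial>lborel"
 have "AE R in lborel. R : {1<..<4} --> ?J R = 0"
 proof (rule AE_zero_of_bump_integrals)
  show "integrable lborel ?J" by (rule lborel_Fubini_fst(2)[OF iG])
  fix n and c d :: real assume cd: "cbox c d <= {1<..<4}"
  have k: "continuous_on UNIV (%p::real\<times>real. bump n c d (fst p))"
   by (rule continuous_on_compose2[OF test_fun_continuous[OF test_fun_bump[OF cd]]]) (auto intro: continuous_intros)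
  note P = cyl_pairing_continuous[OF G g k]
  have "(LBINT R. bump n c d R * ?J R) = (LBINT p. idc Rect p * (bump n c d (fst p) * G p))"
   using lborel_Fubini_fst(3)[OF P(1)] by (simp add: mult.left_commute[of _ "bump n c d _"])
  also have "... = 0" using P(2) periodic_Cell_integral_zero[OF w per, of c d n] cd cyl_const_pos by simp
  finally show "(LBINT R. bump n c d R * ?J R) = 0" .
 qed auto
 then show ?thesis
  by eventually_elim (auto simp: Rect_def indicator_times)
qed

section \<open>Boundary values as limits of averages over thin strips\<close>

lemma primitive_strip_bound:
 assumes p: "primitive_ae 1 4 phh g k" and st: "1 <= al" "al < bee" "bee <= 4" "ga : {al..bee}"
  and phh: "integrable lborel (%s. idc {al<..<bee} s * phh s)" and g: "integrable lborel (%s. idc {al<..<bee} s * g s)"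
 shows "\<bar>k + integral {1..ga} g\<bar> <= (LBINT s. idc {al<..<bee} s * \<bar>phh s\<bar>) / (bee - al) + (LBINT s. idc {al<..<bee} s * \<bar>g s\<bar>)"
proof -
 let ?I = "idc {al<..<bee} :: real => real"
 have ai: "g absolutely_integrable_on {1..4}" and ae: "AE s in lborel. s : {1<..<4} --> phh s = k + integral {1..s} g"
  using p by (auto simp: primitive_ae_def intro: AE_lebesgue_imp_lborel)
 define V where "V = (LBINT s. ?I s * \<bar>g s\<bar>)"
 have Vi: "integrable lborel (%s. ?I s * \<bar>g s\<bar>)" using integrable_abs[OF g] by (simp add: abs_mult)
 have phhi: "integrable lborel (%s. ?I s * \<bar>phh s\<bar>)" using integrable_abs[OF phh] by (simp add: abs_mult)
 have diff: "\<bar>integral {1..s} g - integral {1..t} g\<bar> <= V" if "al <= t" "t <= s" "s <= bee" for s t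
 proof -
  have "integral {1..s} g - integral {1..t} g = integral {t..s} g"
   using integral_diff_real[OF ai, of t s] that st by simp
  also have "... = integral {t..s} (%s. ?I s * g s)"
   by (rule integral_spike[of "{al, bee}"]) (use that in auto)
  also have "... = (LBINT sg. idc {t..s} sg * (?I sg * g sg))"
   by (rule integral_lborel_eq_integral[OF g, symmetric])
  finally have "\<bar>integral {1..s} g - integral {1..t} g\<bar> <= (LBINT sg. \<bar>indicator {t..s} sg * (?I sg * g sg)\<bar>)"
   by simp
  also have "... <= V"
   unfolding V_def
  proof (rule integral_mono)
   show "integrable lborel (%sg. \<bar>indicator {t..s} sg * (?I sg * g sg)\<bar>)"
    using integrable_mult_indicator[OF _ g, of "{t..s}"] by simp
  qed (use Vi in \<open>auto simp: indicator_def abs_mult\<close>)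
  finally show ?thesis .
 qed
 let ?e = "k + integral {1..ga} g"
 have near: "\<bar>?e\<bar> <= \<bar>k + integral {1..s} g\<bar> + V" if "s : {al<..<bee}" for s
  using diff[of s ga] diff[of ga s] that st by (cases "s <= ga") auto
 have I: "integrable lborel ?I" "(LBINT s. ?I s) = bee - al" using st by (auto intro!: integrable_real_indicator)
 have "(bee - al) * \<bar>?e\<bar> = (LBINT s. ?I s * \<bar>?e\<bar>)" using I by simp
 also have "... <= (LBINT s. ?I s * \<bar>phh s\<bar> + ?I s * V)"
 proof (rule integral_mono_AE)
  show "AE s in lborel. ?I s * \<bar>?e\<bar> <= ?I s * \<bar>phh s\<bar> + ?I s * V"
   using ae by eventually_elim (use near st in \<open>auto simp: indicator_def\<close>)
 qed (use I phhi in auto)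
 also have "... = (LBINT s. ?I s * \<bar>phh s\<bar>) + (bee - al) * V" using I phhi by simp
 finally have "\<bar>?e\<bar> <= ((LBINT s. ?I s * \<bar>phh s\<bar>) + (bee - al) * V) / (bee - al)"
  using st by (simp add: pos_le_divide_eq mult.commute)
 also have "... = (LBINT s. ?I s * \<bar>phh s\<bar>) / (bee - al) + V"
  using st by (simp add: add_divide_distrib)
 finally show ?thesis by (simp only: V_def)
qed

text \<open>On almost every line the value at \<open>ga\<close> is at most the mean of |U| over the
  strip plus the integral of |G| over it. Integrated over z, both parts tend to 0, the first by
  hypothesis and the second by dominated convergence; Fatou's lemma then makes the lower limit 0 on
  almost every line.\<close>

lemma endpoint_zero:
 fixes U G :: "real \<times> real => real" and al bee :: "nat => real"
 assumes U: "integrable lborel (%p. idc Rect p * U p)" and G: "integrable lborel (%p. idc Rect p * G p)"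
  and st: "!!n. 1 <= al n" "!!n. al n < bee n" "!!n. bee n <= 4" "!!n. ga : {al n..bee n}"
  and len: "(%n. bee n - al n) \<longlonglongrightarrow> 0"
  and tr: "(%n. (LBINT p. idc Rect p * (idc ({al n<..<bee n} \<times> UNIV) p * \<bar>U p\<bar>)) / (bee n - al n)) \<longlonglongrightarrow> 0"
 shows "AE z in lborel. z : {0<..<1} --> (\<forall>k. primitive_ae 1 4 (%R. U (R, z)) (%R. G (R, z)) k --> k + integral {1..ga} (%R. G (R, z)) = 0)"
proof -
 let ?S = "%n. {al n<..<bee n} \<times> (UNIV :: real set)"
 have Sm: "?S n : sets borel" for n by (intro borel_open open_Times) auto
 have restrict: "integrable lborel (%p. idc Rect p * (idc (?S n) p * \<bar>H p\<bar>))" "integrable lborel (%p. idc Rect p * (idc (?S n) p * H p))"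
  if "integrable lborel (%p. idc Rect p * H p)" for H :: "real \<times> real => real" and n
 proof -
  show 1: "integrable lborel (%p. idc Rect p * (idc (?S n) p * H p))"
   using integrable_mult_indicator[of "?S n" lborel, OF _ that] Sm by (simp add: mult.left_commute)
  show "integrable lborel (%p. idc Rect p * (idc (?S n) p * \<bar>H p\<bar>))"
   using integrable_abs[OF 1] by (simp add: abs_mult)
 qed
 define u where "u n z = (LBINT R. idc Rect (R, z) * (idc (?S n) (R, z) * \<bar>U (R, z)\<bar>))" for n z
 define v where "v n z = (LBINT R. idc Rect (R, z) * (idc (?S n) (R, z) * \<bar>G (R, z)\<bar>))" for n z
 have ui: "integrable lborel (u n)" "integrable lborel (v n)" for n
  unfolding u_def[abs_def] v_def[abs_def] using lborel_Fubini_snd(2)[OF restrict(1)[OF U]] lborel_Fubini_snd(2)[OF restrict(1)[OF G]] by auto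
 have unn: "0 <= u n z" "0 <= v n z" for n z by (auto simp: u_def v_def)
 define a where "a n z = u n z / (bee n - al n) + v n z" for n z
 have ai: "integrable lborel (a n)" for n unfolding a_def[abs_def] using ui by auto
 have ann: "0 <= a n z" for n z using unn st(2)[of n] by (simp add: a_def)
 have Gto0: "(%n. \<integral>p. idc Rect p * (idc (?S n) p * \<bar>G p\<bar>) \<partial>lborel) \<longlonglongrightarrow> (\<integral>p. (0::real) \<partial>(lborel :: (real \<times> real) measure))"
 proof (rule integral_dominated_convergence[where w = "%p. \<bar>indicator Rect p * G p\<bar>"])
  have "negligible {p :: real \<times> real. p \<bullet> (1,0) = ga}"
   by (rule negligible_standard_hyperplane) (simp add: Basis_prod_def)
  from AE_lborel_not_in_negligible[OF this]
  show "AE p in lborel. (%n. idc Rect p * (idc (?S n) p * \<bar>G p\<bar>)) \<longlonglongrightarrow> 0"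
  proof eventually_elim
   case (elim p)
   then have "fst p ~= ga" by (simp add: inner_prod_def)
   then have "\<forall>\<^sub>F n in sequentially. bee n - al n < \<bar>fst p - ga\<bar>"
    by (intro order_tendstoD(2)[OF len]) auto
   then have "\<forall>\<^sub>F n in sequentially. idc Rect p * (idc (?S n) p * \<bar>G p\<bar>) = 0"
   proof eventually_elim
    case (elim n)
    then have "p ~: ?S n" using st(4)[of n] by (cases p) auto
    then show ?case by simp
   qed
   then show ?case by (rule tendsto_eventually)
  qed
 qed (use G restrict(1)[OF G] in \<open>auto simp: indicator_def\<close>)
 have "(LBINT z. a n z) = (LBINT p. idc Rect p * (idc (?S n) p * \<bar>U p\<bar>)) / (bee n - al n) + (LBINT p. idc Rect p * (idc (?S n) p * \<bar>G p\<bar>))" for n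
  using lborel_Fubini_snd(3)[OF restrict(1)[OF U]] lborel_Fubini_snd(3)[OF restrict(1)[OF G]] ui
  by (simp add: a_def u_def[symmetric] v_def[symmetric])
 then have "(%n. \<integral>z. a n z \<partial>lborel) \<longlonglongrightarrow> 0 + 0"
  using tendsto_add[OF tr Gto0] by simp
 then have lim: "(%n. ennreal (LBINT z. a n z)) \<longlonglongrightarrow> ennreal 0"
  by (intro tendsto_ennrealI) simp
 have "(\<integral>\<^sup>+z. liminf (%n. ennreal (a n z)) \<partial>lborel) <= liminf (%n. \<integral>\<^sup>+z. ennreal (a n z) \<partial>lborel)"
  by (rule nn_integral_liminf) (use ai in auto)
 also have "... = liminf (%n. ennreal (LBINT z. a n z))"
  using nn_integral_eq_integral[OF ai] ann by simp
 also have "... = 0" using lim_imp_Liminf[OF _ lim] by simp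
 finally have "(\<integral>\<^sup>+z. liminf (%n. ennreal (a n z)) \<partial>lborel) = 0" by simp
 moreover have "(%z. liminf (%n. ennreal (a n z))) : bmeas lborel"
  using ai by measurable
 ultimately have "AE z in lborel. liminf (%n. ennreal (a n z)) = 0"
  using nn_integral_0_iff_AE by blast
 moreover have "AE z in lborel. \<forall>n. integrable lborel (%R. idc Rect (R, z) * (idc (?S n) (R, z) * U (R, z)))"
  unfolding AE_all_countable using lborel_Fubini_snd(1)[OF restrict(2)[OF U]] by auto
 moreover have "AE z in lborel. \<forall>n. integrable lborel (%R. idc Rect (R, z) * (idc (?S n) (R, z) * G (R, z)))"
  unfolding AE_all_countable using lborel_Fubini_snd(1)[OF restrict(2)[OF G]] by auto
 ultimately show ?thesis
 proof eventually_elim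
  case (elim z)
  show ?case
  proof (intro impI allI)
   fix k assume z: "z : {0<..<1}" and p: "primitive_ae 1 4 (%R. U (R, z)) (%R. G (R, z)) k"
   have ind: "idc Rect (R, z) * (idc (?S n) (R, z) * y) = idc {al n<..<bee n} R * y" for R n and y :: real
    using z st(1)[of n] st(3)[of n] by (auto simp: Rect_def indicator_def)
   have "\<bar>k + integral {1..ga} (%R. G (R, z))\<bar> <= a n z" for n
    using primitive_strip_bound[OF p st(1)[of n] st(2)[of n] st(3)[of n] st(4)[of n]] elim(2,3)
    unfolding a_def u_def v_def ind by blast
   then have "ennreal \<bar>k + integral {1..ga} (%R. G (R, z))\<bar> <= liminf (%n. ennreal (a n z))"
    by (intro Liminf_bounded always_eventually allI ennreal_leI)
   then show "k + integral {1..ga} (%R. G (R, z)) = 0" using elim(1) by simp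
  qed
 qed
qed

text \<open>The layers are measured in the radius r, the strips in R = r^2. For 0 < s < 1 the strips
  1 < R < 1 + s and 4 - s < R < 4 both lie in the layer of width s, so the layer averages of |f|
  dominate the strip means of the angular average at both ends.\<close>

lemma trace_zero:
 assumes f: "integrable (cellM) f" and U: "cyl_avg f U" and G: "integrable lborel (%p. idc Rect p * G p)"
  and layer: "((%s. (\<integral>\<^sup>+ x. ennreal \<bar>f x\<bar> \<partial>lebesgue_on {x\<in>Cell. radius x < 1 + s | 2 - s < radius x}) / ennreal s) \<longlongrightarrow> 0) (at_right 0)"
 shows "AE z in lborel. z : {0<..<1} --> (\<forall>k. primitive_ae 1 4 (%R. U (R, z)) (%R. G (R, z)) k --> k = 0 & integral {1..4} (%R. G (R, z)) = 0)"
proof -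
 let ?L = "%s. {x\<in>Cell. radius x < 1 + s | 2 - s < radius x}"
 have radc: "continuous_on UNIV radius" unfolding radius_def by (intro continuous_intros)
 have Lm: "?L s : sets lebesgue" for s
 proof -
  have "open {x. radius x < 1 + s}" "open {x. 2 - s < radius x}"
   using radc by (auto intro!: open_Collect_less continuous_intros)
  moreover have "?L s = Cell \<inter> ({x. radius x < 1 + s} \<union> {x. 2 - s < radius x})" by auto
  ultimately show ?thesis by (metis (no_types, lifting) Cell_lebesgue borel_open open_Un sets.Int sets_completionI_sets sets_lborel)
 qed
 define s where "s n = 1 / real (n + 2)" for n
 have s: "0 < s n" "s n < 1" for n by (auto simp: s_def)
 have s3: "s n <= 3" for n using s(2)[of n] by linarith
 have s0: "s \<longlonglongrightarrow> 0" unfolding s_def using LIMSEQ_ignore_initial_segment[OF lim_1_over_n, of 2] by simp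
 have "filterlim s (at_right 0) sequentially"
  unfolding filterlim_at using s0 s by (auto simp: less_imp_neq[symmetric])
 from filterlim_compose[OF layer this]
 have lim: "(%n. (\<integral>\<^sup>+ x. ennreal \<bar>f x\<bar> \<partial>lebesgue_on (?L (s n))) / ennreal (s n)) \<longlonglongrightarrow> 0" .
 have bound: "(%n. (LBINT p. idc Rect p * (idc ({al n<..<bee n} \<times> UNIV) p * \<bar>U p\<bar>)) / (bee n - al n)) \<longlonglongrightarrow> 0"
  if ab: "!!n. bee n - al n = s n" and sub: "!!n x. x : Cell ==> fst (cyl x) : {al n<..<bee n} ==> x : ?L (s n)" for al bee :: "nat => real"
 proof -
  let ?S = "%n. {al n<..<bee n} \<times> (UNIV :: real set)"
  let ?I = "%n. \<integral>p. idc Rect p * (idc (?S n) p * \<bar>U p\<bar>) \<partial>lborel"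
  have Sm: "?S n : sets borel" for n by (intro borel_open open_Times) auto
  have fm: "f : bmeas (cellM)" using f by auto
  have key: "ennreal (cyl_const * (?I n / s n)) <= (\<integral>\<^sup>+ x. ennreal \<bar>f x\<bar> \<partial>lebesgue_on (?L (s n))) / ennreal (s n)" for n
  proof -
   have i: "integrable (cellM) (%x. idc (?S n) (cyl x) * \<bar>f x\<bar>)"
    by (rule integrable_bounded_mult[of _ _ _ 1])
      (use f measurable_compose[OF cyl_measurable_lebesgue borel_measurable_indicator[OF Sm]] in \<open>auto simp: indicator_def\<close>)
   have "ennreal (cyl_const * ?I n) <= ennreal (LINT x|cellM. idc (?S n) (cyl x) * \<bar>f x\<bar>)"
    by (rule ennreal_leI[OF cyl_avg_abs_le[OF U f Sm]])
   also have "... = (\<integral>\<^sup>+x. ennreal (idc (?S n) (cyl x) * \<bar>f x\<bar>) \<partial>cellM)"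
    by (rule nn_integral_eq_integral[OF i, symmetric]) auto
   also have "... = (\<integral>\<^sup>+x. ennreal (idc (?S n) (cyl x) * \<bar>f x\<bar>) * idc Cell x \<partial>lebesgue)"
    by (rule nn_integral_restrict_space) simp
   also have "... <= (\<integral>\<^sup>+x. ennreal \<bar>f x\<bar> * idc (?L (s n)) x \<partial>lebesgue)"
   proof (rule nn_integral_mono)
    fix x
    show "ennreal (idc (?S n) (cyl x) * \<bar>f x\<bar>) * idc Cell x <= ennreal \<bar>f x\<bar> * idc (?L (s n)) x"
     using sub[of x n] by (cases "x : Cell & cyl x : ?S n") (auto simp: indicator_def mem_Times_iff)
   qed
   also have "... = (\<integral>\<^sup>+ x. ennreal \<bar>f x\<bar> \<partial>lebesgue_on (?L (s n)))"
    by (rule nn_integral_restrict_space[symmetric]) (use Lm in simp)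
   finally have "ennreal (cyl_const * ?I n) / ennreal (s n) <= (\<integral>\<^sup>+ x. ennreal \<bar>f x\<bar> \<partial>lebesgue_on (?L (s n))) / ennreal (s n)"
    by (rule divide_right_mono_ennreal)
   moreover have "0 <= ?I n" by (intro integral_nonneg_AE) auto
   then have "ennreal (cyl_const * ?I n) / ennreal (s n) = ennreal (cyl_const * ?I n / s n)"
    using s[of n] cyl_const_pos by (intro divide_ennreal) auto
   ultimately show ?thesis by simp
  qed
  have "(%n. ennreal (cyl_const * (?I n / s n))) \<longlonglongrightarrow> 0"
   by (rule tendsto_sandwich[OF _ _ tendsto_const lim]) (use key in auto)
  then have "(%n. cyl_const * (?I n / s n)) \<longlonglongrightarrow> 0"
  proof -
   assume "(%n. ennreal (cyl_const * (?I n / s n))) \<longlonglongrightarrow> 0"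
   then have "(%n. ennreal (cyl_const * (?I n / s n))) \<longlonglongrightarrow> ennreal 0" by simp
   moreover have "\<forall>\<^sub>F n in sequentially. 0 <= cyl_const * (?I n / s n)"
    using s cyl_const_pos by (intro always_eventually allI mult_nonneg_nonneg divide_nonneg_pos integral_nonneg_AE) auto
   ultimately show ?thesis by (rule tendsto_ennrealD) simp
  qed
  then have "(%n. (1 / cyl_const) * (cyl_const * (?I n / s n))) \<longlonglongrightarrow> (1 / cyl_const) * 0"
   by (intro tendsto_intros)
  then show ?thesis using ab cyl_const_pos by simp
 qed
 have iU: "integrable lborel (%p. idc Rect p * U p)" by (rule cyl_avg_integrable[OF U f])
 have r2: "(radius x)^2 = fst (cyl x)" "0 <= radius x" for x by (auto simp: radius_def cyl_def)
 have "AE z in lborel. z : {0<..<1} --> (\<forall>k. primitive_ae 1 4 (%R. U (R, z)) (%R. G (R, z)) k --> k + integral {1..1} (%R. G (R, z)) = 0)"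
 proof (rule endpoint_zero[OF iU G, of "%_. 1" "%n. 1 + s n"])
  show "(%n. (LBINT p. idc Rect p * (idc ({1<..<1 + s n} \<times> UNIV) p * \<bar>U p\<bar>)) / (1 + s n - 1)) \<longlonglongrightarrow> 0"
  proof (rule bound)
   fix n x assume x: "x : Cell" "fst (cyl x) : {1<..<1 + s n}"
   have "radius x < 1 + s n"
   proof (rule power2_less_imp_less)
    have "0 <= s n" using s[of n] by simp
    then show "(radius x)^2 < (1 + s n)^2" using x(2) unfolding r2(1) by (simp add: power2_sum) (smt (verit) zero_le_power2)
   qed (use s[of n] in auto)
   then show "x : ?L (s n)" using x by simp
  qed simp
 qed (use s s0 s3 in \<open>auto simp: less_imp_le\<close>)
 moreover have "AE z in lborel. z : {0<..<1} --> (\<forall>k. primitive_ae 1 4 (%R. U (R, z)) (%R. G (R, z)) k --> k + integral {1..4} (%R. G (R, z)) = 0)"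
 proof (rule endpoint_zero[OF iU G, of "%n. 4 - s n" "%_. 4"])
  show "(%n. (LBINT p. idc Rect p * (idc ({4 - s n<..<4} \<times> UNIV) p * \<bar>U p\<bar>)) / (4 - (4 - s n))) \<longlonglongrightarrow> 0"
  proof (rule bound)
   fix n x assume x: "x : Cell" "fst (cyl x) : {4 - s n<..<4}"
   \<comment> \<open>For 0 < s < 1 one has (2 - s)^2 = 4 - 4 s + s^2 < 4 - s.\<close>
   have "2 - s n < radius x"
   proof (rule power2_less_imp_less[OF _ r2(2)])
    have "s n * s n <= 1 * s n" using s[of n] by (intro mult_right_mono) auto
    moreover have "(2 - s n)^2 = 4 - 4 * s n + s n * s n" by (simp add: power2_eq_square algebra_simps)
    moreover have "4 - s n < (radius x)^2" using x(2) unfolding r2(1) by simp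
    ultimately show "(2 - s n)^2 < (radius x)^2" using s(1)[of n] by linarith
   qed
   then show "x : ?L (s n)" using x by simp
  qed simp
 qed (use s s0 s3 in \<open>auto simp: less_imp_le\<close>)
 ultimately show ?thesis by eventually_elim auto
qed

section \<open>End values of products and compositions; square-integrable functions\<close>

lemma primitive_ae_end_eq:
 assumes p: "primitive_ae a b f g k" and ab: "a < b" and Ph: "continuous_on {a..b} Ph"
  and ae: "AE s in lebesgue. s : {a<..<b} --> f s = Ph s"
 shows "k + integral {a..b} g = Ph b"
proof -
 have g: "g absolutely_integrable_on {a..b}" and fe: "AE s in lebesgue. s : {a<..<b} --> f s = k + integral {a..s} g"
  using p by (auto simp: primitive_ae_def)
 have cont: "continuous_on {a..b} (%s. (k + integral {a..s} g) - Ph s)"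
  by (intro continuous_on_diff primitive_continuous[OF g] Ph)
 have "AE s in lebesgue. s : {a<..<b} --> (k + integral {a..s} g) - Ph s : {0}"
  using fe ae by eventually_elim auto
 from AE_interval_continuous_closed[OF this _ cont ab, of b] show ?thesis using ab by simp
qed

lemma primitive_ae_mult_end:
 assumes p1: "primitive_ae a b f1 g1 k1" and p2: "primitive_ae a b f2 g2 k2" and ab: "a < b"
 shows "k1 * k2 + integral {a..b} (%s. f1 s * g2 s + g1 s * f2 s) = (k1 + integral {a..b} g1) * (k2 + integral {a..b} g2)"
proof (rule primitive_ae_end_eq[OF primitive_ae_mult[OF p1 p2 ab] ab])
 have g: "g1 absolutely_integrable_on {a..b}" "g2 absolutely_integrable_on {a..b}"
  using p1 p2 by (auto simp: primitive_ae_def)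
 show "continuous_on {a..b} (%s. (k1 + integral {a..s} g1) * (k2 + integral {a..s} g2))"
  by (intro continuous_on_mult primitive_continuous g)
 have "AE s in lebesgue. s : {a<..<b} --> f1 s = k1 + integral {a..s} g1"
  "AE s in lebesgue. s : {a<..<b} --> f2 s = k2 + integral {a..s} g2"
  using p1 p2 by (auto simp: primitive_ae_def)
 then show "AE s in lebesgue. s : {a<..<b} --> f1 s * f2 s = (k1 + integral {a..s} g1) * (k2 + integral {a..s} g2)"
  by eventually_elim auto
qed

lemma primitive_ae_chain_end:
 assumes p: "primitive_ae a b f g k" and ab: "a < b"
  and fJ: "AE s in lebesgue. s : {a<..<b} --> f s : J" and J: "closed J"
  and H: "!!y. y : J ==> (H has_real_derivative H' y) (at y)" and H': "continuous_on J H'"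
 shows "H k + integral {a..b} (%s. H' (f s) * g s) = H (k + integral {a..b} g)"
proof (rule primitive_ae_end_eq[OF primitive_ae_chain[OF p ab fJ J H H'] ab])
 have g: "g absolutely_integrable_on {a..b}" and fe: "AE s in lebesgue. s : {a<..<b} --> f s = k + integral {a..s} g"
  using p by (auto simp: primitive_ae_def)
 have c: "continuous_on {a..b} (%s. k + integral {a..s} g)" by (rule primitive_continuous[OF g])
 have "AE s in lebesgue. s : {a<..<b} --> k + integral {a..s} g : J"
  using fe fJ by eventually_elim auto
 then have mem: "k + integral {a..s} g : J" if "s : {a..b}" for s
  using AE_interval_continuous_closed[OF _ J c ab that] by blast
 have "continuous_on J H"
  using H by (intro continuous_at_imp_continuous_on ballI DERIV_isCont) auto
 then show "continuous_on {a..b} (%s. H (k + integral {a..s} g))"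
  by (rule continuous_on_compose2[OF _ c]) (use mem in auto)
 show "AE s in lebesgue. s : {a<..<b} --> H (f s) = H (k + integral {a..s} g)"
  using fe by eventually_elim auto
qed

lemma integral_section_eq:
 fixes g :: "real => real"
 assumes i: "integrable lborel (%s. idc {a<..<b} s * g s)"
 shows "(LBINT s. idc {a<..<b} s * g s) = integral {a..b} g"
proof -
 have "(LBINT s. idc {a<..<b} s * g s) = (LBINT s. idc {a..b} s * (idc {a<..<b} s * g s))"
  by (intro Bochner_Integration.integral_cong) (auto simp: indicator_def)
 also have "... = integral {a..b} (%s. idc {a<..<b} s * g s)" by (rule integral_lborel_eq_integral[OF i])
 also have "... = integral {a..b} g" by (rule integral_spike[of "{a, b}"]) auto
 finally show ?thesis .
qed


text \<open>At a fixed time density, velocity and their first derivatives all lie in this class, and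
  products of two of its members are integrable.\<close>

definition sq_int :: "(real^3 => real) => bool" where
 "sq_int f \<longleftrightarrow> f : bmeas (cellM) & integrable (cellM) (%x. (f x)^2)"

definition sq_int_Rect :: "(real \<times> real => real) => bool" where
 "sq_int_Rect F \<longleftrightarrow> F : bmeas borel & integrable lborel (%p. idc Rect p * (F p)^2)"

lemma abs_mult_le_squares: "\<bar>a * b\<bar> <= \<bar>a^2 + b^2\<bar>" for a b :: real
proof -
 have "2 * (\<bar>a\<bar> * \<bar>b\<bar>) <= a^2 + b^2" using sum_squares_bound[of "\<bar>a\<bar>" "\<bar>b\<bar>"] by simp
 moreover have "0 <= \<bar>a\<bar> * \<bar>b\<bar>" by simp
 ultimately have "\<bar>a\<bar> * \<bar>b\<bar> <= a^2 + b^2" by linarith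
 then show ?thesis by (simp add: abs_mult)
qed

lemma sq_int_mult:
 assumes "sq_int f" "sq_int g"
 shows "integrable (cellM) (%x. f x * g x)"
proof (rule integrable_bd)
 show "integrable (cellM) (%x. (f x)^2 + (g x)^2)" using assms by (auto simp: sq_int_def)
 show "(%x. f x * g x) : bmeas (cellM)" using assms by (auto simp: sq_int_def)
qed (use abs_mult_le_squares in auto)

lemma sq_int_const: "sq_int (%x. c)"
 using finite_measure.integrable_const[OF finite_measure_Cell] by (auto simp: sq_int_def)

lemma sq_int_integrable: "sq_int f ==> integrable (cellM) f"
 using sq_int_mult[OF sq_int_const[of 1]] by simp

lemma sq_int_add:
 assumes "sq_int f" "sq_int g"
 shows "sq_int (%x. f x + g x)"
 unfolding sq_int_def
proof
 have m: "f : bmeas (cellM)" "g : bmeas (cellM)" using assms by (auto simp: sq_int_def)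
 then show "(%x. f x + g x) : bmeas (cellM)" by simp
 have "(%x. (f x + g x)^2) = (%x. (f x)^2 + (g x)^2 + 2 * (f x * g x))" by (auto simp: power2_sum)
 then show "integrable (cellM) (%x. (f x + g x)^2)"
  using assms sq_int_mult[OF assms] by (auto simp: sq_int_def)
qed

lemma sq_int_mult_continuous:
 assumes f: "sq_int f" and et: "continuous_on UNIV et"
 shows "sq_int (%x. et x * f x)"
 unfolding sq_int_def
proof
 have m: "et : bmeas (cellM)"
  using et by (intro measurable_restrict_space1 measurable_completion) (simp add: bmeas_contI)
 then show "(%x. et x * f x) : bmeas (cellM)" using f by (auto simp: sq_int_def)
 have "integrable (cellM) (%x. (et x)^2 * (f x)^2)"
  using f et by (intro integrable_Cell_mult continuous_intros) (auto simp: sq_int_def)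
 then show "integrable (cellM) (%x. (et x * f x)^2)" by (simp add: power_mult_distrib)
qed

lemma sq_int_cong_AE:
 assumes f: "sq_int f" and fg: "AE x in cellM. f x = g x"
 shows "sq_int g"
 unfolding sq_int_def
proof
 show m: "g : bmeas (cellM)"
  using bmeas_cong_AE[OF Cell_lebesgue _ fg] f by (auto simp: sq_int_def)
 show "integrable (cellM) (%x. (g x)^2)"
  by (rule integrable_cong_AE_imp[of _ "%x. (f x)^2"]) (use f m fg in \<open>auto simp: sq_int_def elim: eventually_mono\<close>)
qed

lemma sq_int_Rect_mult:
 assumes "sq_int_Rect F" "sq_int_Rect G"
 shows "integrable lborel (%p. idc Rect p * (F p * G p))"
proof (rule integrable_bd)
 show "integrable lborel (%p. idc Rect p * (F p)^2 + idc Rect p * (G p)^2)" using assms by (auto simp: sq_int_Rect_def)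
 have [measurable]: "F : bmeas borel" "G : bmeas borel" using assms by (auto simp: sq_int_Rect_def)
 show "(%p. idc Rect p * (F p * G p)) : bmeas lborel" by measurable
 show "AE p in lborel. norm (idc Rect p * (F p * G p)) <= norm (idc Rect p * (F p)^2 + idc Rect p * (G p)^2)"
  using abs_mult_le_squares by (auto simp: indicator_def)
qed

lemma sq_int_avg: "cyl_avg f F ==> sq_int f ==> sq_int_Rect F"
 using cyl_avg_square_integrable cyl_avg_measurable by (auto simp: sq_int_def sq_int_Rect_def)

lemma bounded_mult_Rect:
 fixes F k :: "real \<times> real => real"
 assumes i: "integrable lborel (%p. idc Rect p * F p)" and k: "k : bmeas borel" and b: "!!p. p : Rect ==> \<bar>k p\<bar> <= B"
 shows "integrable lborel (%p. idc Rect p * (k p * F p))"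
proof -
 have "integrable lborel (%p. (idc Rect p * k p) * (idc Rect p * F p))"
  by (rule integrable_bounded_mult[OF i, of _ "\<bar>B\<bar>"]) (use k b in \<open>auto simp: indicator_def intro: order_trans[OF _ abs_ge_self]\<close>)
 moreover have "(%p. (idc Rect p * k p) * (idc Rect p * F p)) = (%p. idc Rect p * (k p * F p))"
  by (auto simp: indicator_def)
 ultimately show ?thesis by simp
qed

lemma sq_int_Rect_bounded_mult:
 assumes F: "sq_int_Rect F" and k: "k : bmeas borel" and b: "!!p. p : Rect ==> \<bar>k p\<bar> <= B"
 shows "sq_int_Rect (%p. k p * F p)"
 unfolding sq_int_Rect_def
proof
 show "(%p. k p * F p) : bmeas borel" using F k by (auto simp: sq_int_Rect_def)
 have "integrable lborel (%p. idc Rect p * ((k p)^2 * (F p)^2))"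
  by (rule bounded_mult_Rect[of _ _ "B^2"]) (use F k b in \<open>auto simp: sq_int_Rect_def abs_le_square_iff[symmetric] intro: order_trans[OF _ abs_ge_self]\<close>)
 then show "integrable lborel (%p. idc Rect p * (k p * F p)^2)" by (simp add: power_mult_distrib)
qed

lemma sq_int_cyl:
 assumes "sq_int_Rect F"
 shows "sq_int (%x. F (cyl x))"
proof -
 have [measurable]: "F : bmeas borel" using assms by (auto simp: sq_int_Rect_def)
 have "(%p. (F p)^2) : bmeas borel" by measurable
 from integral_cyl(1)[OF this] show ?thesis
  using assms measurable_compose[OF cyl_measurable_lebesgue, of F borel] by (auto simp: sq_int_def sq_int_Rect_def)
qed

lemma Fubini_Rect_zero_R:
 fixes f :: "real \<times> real => real"
 assumes i: "integrable lborel (%p. idc Rect p * f p)"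
  and z: "AE z in lborel. z : {0<..<1} --> integral {1..4} (%R. f (R, z)) = 0"
 shows "(LBINT p. idc Rect p * f p) = 0"
proof -
 have "AE z in lborel. (LBINT R. idc Rect (R, z) * f (R, z)) = 0"
  using z lborel_Fubini_snd(1)[OF i]
 proof eventually_elim
  case (elim z)
  show ?case
  proof (cases "z : {0<..<1}")
   case True
   then have "idc Rect (R, z) = (idc {1<..<4} R :: real)" for R by (auto simp: Rect_def indicator_def)
   then show ?thesis using integral_section_eq[of 1 4 "%R. f (R, z)"] elim True by simp
  next
   case False
   then have "idc Rect (R, z) = (0::real)" for R by (auto simp: Rect_def indicator_def)
   then show ?thesis by simp
  qed
 qed
 then show ?thesis using lborel_Fubini_snd(3)[OF i] by (simp add: integral_eq_zero_AE)
qed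

lemma Fubini_Rect_zero_z:
 fixes f :: "real \<times> real => real"
 assumes i: "integrable lborel (%p. idc Rect p * f p)"
  and z: "AE R in lborel. R : {1<..<4} --> integral {0..1} (%z. f (R, z)) = 0"
 shows "(LBINT p. idc Rect p * f p) = 0"
proof -
 have "AE R in lborel. (LBINT z. idc Rect (R, z) * f (R, z)) = 0"
  using z lborel_Fubini_fst(1)[OF i]
 proof eventually_elim
  case (elim R)
  show ?case
  proof (cases "R : {1<..<4}")
   case True
   then have "idc Rect (R, z) = (idc {0<..<1} z :: real)" for z by (auto simp: Rect_def indicator_def)
   then show ?thesis using integral_section_eq[of 0 1 "%z. f (R, z)"] elim True by simp
  next
   case False
   then have "idc Rect (R, z) = (0::real)" for z by (auto simp: Rect_def indicator_def)
   then show ?thesis by simp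
  qed
 qed
 then show ?thesis using lborel_Fubini_fst(3)[OF i] by (simp add: integral_eq_zero_AE)
qed

lemma AC_ex_primitive: "AC a b f g ==> \<exists>k. primitive_ae a b f g k"
 by (simp add: AC_def)

lemma radius_sq_measurable_cyl: "(%p::real\<times>real. 1 / (2 * fst p)) : bmeas borel"
proof -
 have "(fst :: real \<times> real => real) : bmeas borel" by (intro bmeas_contI continuous_intros)
 then show ?thesis by measurable
qed

lemma cyl_const_cancel2: "cyl_const * a = cyl_const * b ==> a = b"
 using cyl_const_pos by simp

text \<open>The renormalized equation at one time, with \<open>X\<close> the density and
  \<open>h\<close> its time derivative. Tested with functions of (R, z), the weak equation says that
  the average of \<open>h\<close> is minus the divergence \<open>Y\<close> of X u in these
  variables. Since \<open>X\<close> and the averaged velocities are absolutely continuous on lines,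
  the integrals of the R-derivative of H(X) U and of the z-derivative of H(X) W reduce to end
  values; those vanish by the trace of u . n and cancel by periodicity, respectively. Subtracting
  both from the integral of H'(X) Y leaves X H'(X) - H(X) times the divergence. That
  \<open>X\<close> is a function of \<open>cyl x\<close> allows H'(X) to be paired with
  averages.\<close>

lemma slice_identity:
 fixes X h :: "real^3 => real" and u :: "real^3 => real^3" and Xd :: "3 => real^3 => real" and ud :: "3 => real^3 => real^3"
 assumes ax: "axisymmetric X" and Xnn: "AE x in cellM. 0 <= X x" and Xper: "periodic_z X"
  and Xw: "!!j. weak_deriv Omega (axis j 1) X (Xd j)" and X2: "sq_int X" and Xd2: "!!j. sq_int (Xd j)"
  and uper: "periodic_z u" and uw: "!!j. weak_deriv Omega (axis j 1) u (ud j)"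
  and u2: "!!i. sq_int (%x. u x $ i)" and ud2: "!!i j. sq_int (%x. ud j x $ i)"
  and layer: "((%s. (\<integral>\<^sup>+ x. ennreal \<bar>2 * (x$1 * u x $ 1 + x$2 * u x $ 2)\<bar> \<partial>lebesgue_on {x\<in>Cell. radius x < 1 + s | 2 - s < radius x}) / ennreal s) \<longlongrightarrow> 0) (at_right 0)"
  and hi: "integrable (cellM) h"
  and test: "!!n c d a b. rat_pt c ==> rat_pt d ==> rat_pt a ==> rat_pt b ==> {c..d} <= {1<..<4} ==> {a..b} <= {0<..<1} ==>
    (let phh = (%x. bump n c d ((x$1)^2 + (x$2)^2) * bump n a b (x$3)) in
    (LINT x|cellM. phh x * h x) = (LINT x|cellM. X x * (\<Sum>j\<in>UNIV. frd phh (at x) (axis j 1) * u x $ j)))"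
  and H: "!!y. 0 <= y ==> (H has_real_derivative H' y) (at y)" and H': "continuous_on {0..} H'" and HB: "!!y. 0 <= y ==> \<bar>H' y\<bar> <= B"
 shows "(LINT x|cellM. H' (X x) * h x) = (LINT x|cellM. (H (X x) - X x * H' (X x)) * (\<Sum>j\<in>UNIV. ud j x $ j))"
proof -
 let ?M = "cellM"
 obtain Gm0 where Gm0: "Gm0 : bmeas borel" "AE x in ?M. X x = Gm0 (cyl x)"
  by (rule axisymmetric_rep[OF ax]) (use X2 in \<open>simp_all add: sq_int_def\<close>)
 \<comment> \<open>Truncation makes the profile nonnegative at every point, so \<open>H\<close> and
   \<open>H'\<close> are evaluated on the half line only.\<close>
 define Gm where "Gm p = max 0 (Gm0 p)" for p
 have Gmm [measurable]: "Gm : bmeas borel" unfolding Gm_def[abs_def] using Gm0(1) by measurable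
 have Gmnn: "0 <= Gm p" for p by (simp add: Gm_def)
 have XGm: "AE x in ?M. X x = Gm (cyl x)" using Gm0(2) Xnn by eventually_elim (auto simp: Gm_def)
 have Gmcm: "(%x. Gm (cyl x)) : bmeas ?M" by (rule measurable_compose[OF cyl_measurable_lebesgue Gmm])
 have avX: "cyl_avg X Gm"
  by (rule cyl_avg_cong_AE[of "%x. Gm (cyl x) * 1"]) (use cyl_avg_mult[OF cyl_avg_one Gmm] XGm Gmcm in \<open>auto elim: eventually_mono\<close>)
 have c: "continuous_on UNIV (%x::real^3. x$j)" for j by (intro continuous_intros)
 have Xi: "integrable ?M X" "integrable ?M (Xd j)" for j using X2 Xd2 sq_int_integrable by auto
 have ui: "integrable ?M (%x. u x $ i)" "integrable ?M (%x. ud j x $ i)" for i j using u2 ud2 sq_int_integrable by auto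
 have Xc: "cell_weak_deriv j X (Xd j)" for j by (rule weak_deriv_cell[OF Xw Xi])
 have uwi: "weak_deriv Omega (axis j 1) (%x. u x $ i) (%x. ud j x $ i)" for i j
  by (rule weak_deriv_linear[OF uw bounded_linear_vec_nth axis_Basis])
 have uc: "cell_weak_deriv j (%x. u x $ i) (%x. ud j x $ i)" for i j by (rule weak_deriv_cell[OF uwi ui])
 have uperi: "periodic_z (%x. u x $ i)" for i using uper by (auto simp: periodic_z_def)
 \<comment> \<open>u . grad R, the velocity in the direction of R.\<close>
 define fU where "fU x = 2 * (x$1 * u x $ 1 + x$2 * u x $ 2)" for x
 have fU2: "sq_int fU"
  unfolding fU_def[abs_def]
  using sq_int_mult_continuous[OF sq_int_add[OF sq_int_mult_continuous[OF u2[of 1] c[of 1]] sq_int_mult_continuous[OF u2[of 2] c[of 2]]], of "%_. 2"] by simp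
 define f1 where "f1 x = x$1 * Xd 1 x + x$2 * Xd 2 x" for x
 have f12: "sq_int f1"
  unfolding f1_def[abs_def] by (intro sq_int_add sq_int_mult_continuous Xd2 c)
 define fG where "fG x = ud 1 x $ 1 + ud 2 x $ 2" for x
 have fG2: "sq_int fG" unfolding fG_def[abs_def] by (intro sq_int_add ud2)
 obtain U where U: "cyl_avg fU U" using cyl_avg_ex[OF sq_int_integrable[OF fU2]] by blast
 obtain GU where GU: "cyl_avg fG GU" using cyl_avg_ex[OF sq_int_integrable[OF fG2]] by blast
 obtain W where W: "cyl_avg (%x. u x $ 3) W" using cyl_avg_ex[OF ui(1)] by blast
 obtain GW where GW: "cyl_avg (%x. ud 3 x $ 3) GW" using cyl_avg_ex[OF ui(2)] by blast
 obtain G1 where G1: "cyl_avg f1 G1" using cyl_avg_ex[OF sq_int_integrable[OF f12]] by blast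
 obtain Gmz where Gmz: "cyl_avg (Xd 3) Gmz" using cyl_avg_ex[OF Xi(2)] by blast
 obtain hh where hh: "cyl_avg h hh" using cyl_avg_ex[OF hi] by blast
 define GmR where "GmR p = 1 / (2 * fst p) * G1 p" for p
 note meas [measurable] = cyl_avg_measurable[OF U] cyl_avg_measurable[OF GU] cyl_avg_measurable[OF W] cyl_avg_measurable[OF GW]
  cyl_avg_measurable[OF G1] cyl_avg_measurable[OF Gmz] cyl_avg_measurable[OF hh]
 have sGm: "sq_int_Rect Gm" by (rule sq_int_avg[OF avX X2])
 have sU: "sq_int_Rect U" by (rule sq_int_avg[OF U fU2])
 have sGU: "sq_int_Rect GU" by (rule sq_int_avg[OF GU fG2])
 have sW: "sq_int_Rect W" by (rule sq_int_avg[OF W u2])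
 have sGW: "sq_int_Rect GW" by (rule sq_int_avg[OF GW ud2])
 have sGmz: "sq_int_Rect Gmz" by (rule sq_int_avg[OF Gmz Xd2])
 have sGmR: "sq_int_Rect GmR"
  unfolding GmR_def[abs_def]
  by (rule sq_int_Rect_bounded_mult[OF sq_int_avg[OF G1 f12] radius_sq_measurable_cyl, of 1]) (auto simp: Rect_def)
 have A1: "AE z in lborel. z : {0<..<1} --> AC 1 4 (%R. Gm (R, z)) (%R. GmR (R, z))"
  using AC_cyl_avg_R[OF Xc Xc avX G1[unfolded f1_def[abs_def]]] by (simp add: GmR_def)
 have A2: "AE R in lborel. R : {1<..<4} --> AC 0 1 (%z. Gm (R, z)) (%z. Gmz (R, z))"
  by (rule AC_cyl_avg_z[OF Xc avX Gmz])
 have A3: "AE z in lborel. z : {0<..<1} --> AC 1 4 (%R. U (R, z)) (%R. GU (R, z))"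
  by (rule AC_cyl_avg_div[OF uc[of 1 1] uc[of 2 2] U[unfolded fU_def[abs_def]] GU[unfolded fG_def[abs_def]]])
 have A4: "AE R in lborel. R : {1<..<4} --> AC 0 1 (%z. W (R, z)) (%z. GW (R, z))"
  by (rule AC_cyl_avg_z[OF uc[of 3 3] W GW])
 have sect: "AE R in lborel. R : {1<..<4} --> integral {0..1} (%z. F (R, z)) = 0"
  if F: "integrable lborel (%p. idc Rect p * F p)" and z: "AE R in lborel. R : {1<..<4} --> (LBINT z. idc {0<..<1} z * F (R, z)) = 0" for F :: "real \<times> real => real"
  using lborel_Fubini_fst(1)[OF F] z
 proof eventually_elim
  case (elim R)
  show ?case
  proof
   assume R: "R : {1<..<4}"
   then have "idc Rect (R, z) = (idc {0<..<1} z :: real)" for z by (auto simp: Rect_def indicator_def)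
   then show "integral {0..1} (%z. F (R, z)) = 0" using integral_section_eq[of 0 1 "%z. F (R, z)"] elim R by simp
  qed
 qed
 have P1: "AE R in lborel. R : {1<..<4} --> integral {0..1} (%z. Gmz (R, z)) = 0"
  by (rule sect[OF cyl_avg_integrable[OF Gmz Xi(2)] periodic_avg_integral_zero[OF Xw Xper Xi(2) Gmz]])
 have P2: "AE R in lborel. R : {1<..<4} --> integral {0..1} (%z. GW (R, z)) = 0"
  by (rule sect[OF cyl_avg_integrable[OF GW ui(2)] periodic_avg_integral_zero[OF uwi uperi ui(2) GW]])
 have T: "AE z in lborel. z : {0<..<1} --> (\<forall>k. primitive_ae 1 4 (%R. U (R, z)) (%R. GU (R, z)) k --> k = 0 & integral {1..4} (%R. GU (R, z)) = 0)"
  using trace_zero[OF sq_int_integrable[OF fU2] U cyl_avg_integrable[OF GU sq_int_integrable[OF fG2]]] layer by (simp add: fU_def)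
 \<comment> \<open>\<open>H'\<close> is continuous and bounded on the half line only; this extension
   is continuous everywhere, so that \<open>K (Gm p)\<close> is Borel and bounded.\<close>
 define K where "K y = H' (max 0 y)" for y
 have "continuous_on UNIV K"
  unfolding K_def[abs_def] by (rule continuous_on_compose2[OF H']) (auto intro: continuous_intros)
 then have Km [measurable]: "K : bmeas borel" by (rule bmeas_contI)
 have KB: "\<bar>K y\<bar> <= B" for y unfolding K_def by (rule HB) simp
 have KGm: "H' (Gm p) = K (Gm p)" for p using Gmnn[of p] by (simp add: K_def)
 have Hcont: "continuous_on {0..} H" using H by (intro continuous_at_imp_continuous_on ballI DERIV_isCont) auto
 have "continuous_on UNIV (%y. H (max 0 y))" by (rule continuous_on_compose2[OF Hcont]) (auto intro: continuous_intros)
 then have "(%y. H (max 0 y)) : bmeas borel" by (rule bmeas_contI)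
 from measurable_compose[OF Gmm this] have HGmm [measurable]: "(%p. H (Gm p)) : bmeas borel"
  using Gmnn by (simp add: max_def)
 have Hgrow: "\<bar>H y\<bar> <= \<bar>H 0\<bar> + B * y" if "0 <= y" for y
 proof (cases "y = 0")
  case False
  then have "0 < y" using that by simp
  then obtain w where "0 < w" "w < y" "H y - H 0 = (y - 0) * H' w"
   using MVT2[of 0 y H H'] H by blast
  then have "H y = H 0 + y * H' w" by simp
  moreover have "\<bar>y * H' w\<bar> <= y * B" using HB[of w] \<open>0 < w\<close> that by (simp add: abs_mult mult_left_mono)
  ultimately show ?thesis by (simp add: mult.commute)
 qed simp
 have iRect: "integrable lborel (%p. idc Rect p * (1::real))"
  using cyl_avg_integrable[OF cyl_avg_one] finite_measure.integrable_const[OF finite_measure_Cell] by blast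
 have s1: "sq_int_Rect (%p. 1)" using iRect by (simp add: sq_int_Rect_def)
 have sH: "sq_int_Rect (%p. H (Gm p))"
  unfolding sq_int_Rect_def
 proof
  have i: "integrable lborel (%p. 2 * \<bar>H 0\<bar>^2 * (idc Rect p * 1) + 2 * B^2 * (idc Rect p * (Gm p)^2))"
   using iRect sGm by (intro integrable_plus integrable_mult_right) (auto simp: sq_int_Rect_def)
  show "integrable lborel (%p. idc Rect p * (H (Gm p))^2)"
  proof (rule integrable_bd[OF i])
   show "AE p in lborel. norm (idc Rect p * (H (Gm p))^2) <= norm (2 * \<bar>H 0\<bar>^2 * (idc Rect p * 1) + 2 * B^2 * (idc Rect p * (Gm p)^2))"
   proof (intro AE_I2)
    fix p
    have "(H (Gm p))^2 <= (\<bar>H 0\<bar> + B * Gm p)^2"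
     using Hgrow[OF Gmnn[of p]] by (intro iffD1[OF abs_le_square_iff]) linarith
    also have "... <= 2 * \<bar>H 0\<bar>^2 + 2 * (B * Gm p)^2"
     using sum_squares_bound[of "\<bar>H 0\<bar>" "B * Gm p"] by (simp add: power2_sum)
    finally have "(H (Gm p))^2 <= 2 * \<bar>H 0\<bar>^2 + 2 * B^2 * (Gm p)^2" by (simp add: power_mult_distrib)
    then show "norm (idc Rect p * (H (Gm p))^2) <= norm (2 * \<bar>H 0\<bar>^2 * (idc Rect p * 1) + 2 * B^2 * (idc Rect p * (Gm p)^2))"
     by (auto simp: indicator_def)
   qed
  qed measurable
 qed measurable
 have bK: "sq_int_Rect (%p. K (Gm p) * F p)" if "sq_int_Rect F" for F
  by (rule sq_int_Rect_bounded_mult[OF that, of _ B]) (use KB in auto)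
 have iUR: "integrable lborel (%p. idc Rect p * (H (Gm p) * GU p + (K (Gm p) * GmR p) * U p))"
  using integrable_plus[OF sq_int_Rect_mult[OF sH sGU] sq_int_Rect_mult[OF bK[OF sGmR] sU]]
  by (simp add: distrib_left)
 \<comment> \<open>The integrand is the R-derivative of H(Gm) U. By \<open>T\<close> both end values
   of \<open>U\<close>, at R = 1 and R = 4, are zero.\<close>
 have zUR: "(LBINT p. idc Rect p * (H (Gm p) * GU p + (K (Gm p) * GmR p) * U p)) = 0"
 proof (rule Fubini_Rect_zero_R[OF iUR])
  show "AE z in lborel. z : {0<..<1} --> integral {1..4} (%R. H (Gm (R, z)) * GU (R, z) + (K (Gm (R, z)) * GmR (R, z)) * U (R, z)) = 0"
   using A1 A3 T
  proof eventually_elim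
   case (elim z)
   show ?case
   proof
    assume z: "z : {0<..<1}"
    obtain k1 where k1: "primitive_ae 1 4 (%R. Gm (R, z)) (%R. GmR (R, z)) k1" using elim(1) z AC_ex_primitive by blast
    obtain k2 where k2: "primitive_ae 1 4 (%R. U (R, z)) (%R. GU (R, z)) k2" using elim(2) z AC_ex_primitive by blast
    have "primitive_ae 1 4 (%R. H (Gm (R, z))) (%R. H' (Gm (R, z)) * GmR (R, z)) (H k1)"
     by (rule primitive_ae_chain[OF k1, of "{0..}"]) (use Gmnn H H' in auto)
    note e = primitive_ae_mult_end[OF this k2, unfolded KGm]
    have "k2 = 0" "integral {1..4} (%R. GU (R, z)) = 0" using elim(3) z k2 by blast+
    with e show "integral {1..4} (%R. H (Gm (R, z)) * GU (R, z) + (K (Gm (R, z)) * GmR (R, z)) * U (R, z)) = 0"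
     by (simp add: KGm)
   qed
  qed
 qed
 have iWz: "integrable lborel (%p. idc Rect p * (H (Gm p) * GW p + (K (Gm p) * Gmz p) * W p))"
  using integrable_plus[OF sq_int_Rect_mult[OF sH sGW] sq_int_Rect_mult[OF bK[OF sGmz] sW]]
  by (simp add: distrib_left)
 \<comment> \<open>The integrand is the z-derivative of H(Gm) W. By \<open>P1\<close> and
   \<open>P2\<close> the end values of \<open>Gm\<close> and of \<open>W\<close> at z = 0 and z = 1
   agree, so the boundary terms cancel.\<close>
 have zWz: "(LBINT p. idc Rect p * (H (Gm p) * GW p + (K (Gm p) * Gmz p) * W p)) = 0"
 proof (rule Fubini_Rect_zero_z[OF iWz])
  show "AE R in lborel. R : {1<..<4} --> integral {0..1} (%z. H (Gm (R, z)) * GW (R, z) + (K (Gm (R, z)) * Gmz (R, z)) * W (R, z)) = 0"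
   using A2 A4 P1 P2
  proof eventually_elim
   case (elim R)
   show ?case
   proof
    assume R: "R : {1<..<4}"
    obtain k1 where k1: "primitive_ae 0 1 (%z. Gm (R, z)) (%z. Gmz (R, z)) k1" using elim(1) R AC_ex_primitive by blast
    obtain k2 where k2: "primitive_ae 0 1 (%z. W (R, z)) (%z. GW (R, z)) k2" using elim(2) R AC_ex_primitive by blast
    have p: "primitive_ae 0 1 (%z. H (Gm (R, z))) (%z. H' (Gm (R, z)) * Gmz (R, z)) (H k1)"
     by (rule primitive_ae_chain[OF k1, of "{0..}"]) (use Gmnn H H' in auto)
    have e: "H k1 + integral {0..1} (%z. H' (Gm (R, z)) * Gmz (R, z)) = H (k1 + integral {0..1} (%z. Gmz (R, z)))"
     by (rule primitive_ae_chain_end[OF k1, of "{0..}"]) (use Gmnn H H' in auto)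
    show "integral {0..1} (%z. H (Gm (R, z)) * GW (R, z) + (K (Gm (R, z)) * Gmz (R, z)) * W (R, z)) = 0"
     using primitive_ae_mult_end[OF p k2] elim(3,4) R e by (simp add: KGm)
   qed
  qed
 qed
 \<comment> \<open>The divergence of X u in the variables (R, z), expanded by the product
   rule.\<close>
 define Y where "Y p = (Gm p * GU p + GmR p * U p) + (Gm p * GW p + Gmz p * W p)" for p
 have iY1: "integrable lborel (%p. idc Rect p * (Gm p * GU p + GmR p * U p))"
  using integrable_plus[OF sq_int_Rect_mult[OF sGm sGU] sq_int_Rect_mult[OF sGmR sU]] by (simp add: distrib_left)
 have iY2: "integrable lborel (%p. idc Rect p * (Gm p * GW p + Gmz p * W p))"
  using integrable_plus[OF sq_int_Rect_mult[OF sGm sGW] sq_int_Rect_mult[OF sGmz sW]] by (simp add: distrib_left)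
 have iY: "integrable lborel (%p. idc Rect p * Y p)"
  using integrable_plus[OF iY1 iY2] by (simp add: Y_def distrib_left)
 have ih: "integrable lborel (%p. idc Rect p * hh p)" by (rule cyl_avg_integrable[OF hh hi])
 \<comment> \<open>Here the weak equation enters: against a bump b1(R) b2(z) it produces the
   derivatives of b1 and b2, and integration by parts along lines moves them onto Gm U and Gm W.
   This identifies the average of \<open>h\<close> with minus \<open>Y\<close>.\<close>
 have "AE p in lborel. p : {1<..<4} \<times> {0<..<1} --> idc Rect p * hh p + idc Rect p * Y p = 0"
 proof (rule AE_zero_of_bump_integrals)
  show "integrable lborel (%p. idc Rect p * hh p + idc Rect p * Y p)" using ih iY by simp
  show "open ({1<..<4} \<times> {0<..<1::real} :: (real \<times> real) set)" by (intro open_Times) auto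
  fix n and cc dd :: "real \<times> real" assume rat: "rat_pt cc" "rat_pt dd" and sub: "cbox cc dd <= {1<..<4} \<times> {0<..<1}"
  obtain c a d b where cd: "cc = (c, a)" "dd = (d, b)" by (cases cc; cases dd) auto
  show "(LBINT p. bump n cc dd p * (idc Rect p * hh p + idc Rect p * Y p)) = 0"
  proof (cases "cbox cc dd = {}")
   case True
   then have "bump n cc dd p = 0" for p using box_subset_cbox[of cc dd] by (intro bump_outside) blast
   then show ?thesis by simp
  next
   case False
   then have "{c..d} ~= {}" "{a..b} ~= {}" by (auto simp: cd cbox_Pair_eq)
   then have int: "{c..d} <= {1<..<4}" "{a..b} <= {0<..<1}"
   proof -
    have "cbox c d \<times> cbox a b <= {1<..<4} \<times> {0<..<1}" using sub unfolding cd cbox_Pair_eq .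
    then have "{c..d} \<times> {a..b} <= {1<..<4} \<times> {0<..<1}" unfolding cbox_interval[where 'a=real] .
    then show "{c..d} <= {1<..<4}" "{a..b} <= {0<..<1}"
     using \<open>{c..d} ~= {}\<close> \<open>{a..b} ~= {}\<close> unfolding times_subset_iff by blast+
   qed
   have rp: "rat_pt c" "rat_pt d" "rat_pt a" "rat_pt b"
    using rat unfolding cd by (auto simp: rat_pt_def Basis_prod_def)
   define b1 b2 where "b1 = bump n c d" and "b2 = bump n a b"
   have t1: "test_fun {1<..<4} b1" and t2: "test_fun {0<..<1} b2"
    unfolding b1_def b2_def using int by (auto intro!: test_fun_bump)
   note sm = test_fun_smooth[OF t1] test_fun_smooth[OF t2]
   note m [measurable] = test_fun_measurable[OF t1] test_fun_measurable[OF t2] test_fun_measurable[OF test_fun_deriv[OF t1]] test_fun_measurable[OF test_fun_deriv[OF t2]]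
   have [measurable]: "(fst :: real \<times> real => real) : bmeas borel" "(snd :: real \<times> real => real) : bmeas borel"
    by (auto intro!: bmeas_contI continuous_intros)
   obtain B1 where B1: "!!x. \<bar>b1 x\<bar> <= B1" using test_fun_bounded[OF t1] by metis
   obtain B2 where B2: "!!x. \<bar>b2 x\<bar> <= B2" using test_fun_bounded[OF t2] by metis
   obtain D1 where D1: "!!x. \<bar>deriv b1 x\<bar> <= D1" using test_fun_bounded[OF test_fun_deriv[OF t1]] by metis
   obtain D2 where D2: "!!x. \<bar>deriv b2 x\<bar> <= D2" using test_fun_bounded[OF test_fun_deriv[OF t2]] by metis
   have bp: "bump n cc dd p = b1 (fst p) * b2 (snd p)" for p by (cases p) (simp add: cd bump_Pair b1_def b2_def)
   have mb: "integrable lborel (%p. idc Rect p * ((v (fst p) * w (snd p)) * F p))"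
    if "integrable lborel (%p. idc Rect p * F p)" "v : bmeas borel" "w : bmeas borel" "!!x. \<bar>v x\<bar> <= E1" "!!x. \<bar>w x\<bar> <= E2" for v w E1 E2 and F :: "real \<times> real => real"
   proof (rule bounded_mult_Rect[OF that(1)])
    show "(%p. v (fst p) * w (snd p)) : bmeas borel" using that(2,3) by measurable
    show "\<bar>v (fst p) * w (snd p)\<bar> <= E1 * E2" for p
     unfolding abs_mult using that(4)[of "fst p"] that(5)[of "snd p"] by (intro mult_mono) (auto intro: order_trans[OF abs_ge_zero])
   qed
   have ipR: "integrable lborel (%p. idc Rect p * ((b1 (fst p) * b2 (snd p)) * (Gm p * GU p + GmR p * U p)))"
    "integrable lborel (%p. idc Rect p * ((deriv b1 (fst p) * b2 (snd p)) * (Gm p * U p)))"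
    by (rule mb[OF iY1 m(1) m(2) B1 B2]) (rule mb[OF sq_int_Rect_mult[OF sGm sU] m(3) m(2) D1 B2])
   have ipz: "integrable lborel (%p. idc Rect p * ((b1 (fst p) * b2 (snd p)) * (Gm p * GW p + Gmz p * W p)))"
    "integrable lborel (%p. idc Rect p * ((b1 (fst p) * deriv b2 (snd p)) * (Gm p * W p)))"
    by (rule mb[OF iY2 m(1) m(2) B1 B2]) (rule mb[OF sq_int_Rect_mult[OF sGm sW] m(1) m(4) B1 D2])
   have iSR: "integrable lborel (%p. idc Rect p * (b2 (snd p) * (b1 (fst p) * (Gm p * GU p + GmR p * U p) + deriv b1 (fst p) * (Gm p * U p))))"
    using integrable_plus[OF ipR] by (simp add: algebra_simps)
   have zR: "(LBINT p. idc Rect p * (b2 (snd p) * (b1 (fst p) * (Gm p * GU p + GmR p * U p) + deriv b1 (fst p) * (Gm p * U p)))) = 0"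
   proof (rule Fubini_Rect_zero_R[OF iSR])
    show "AE z in lborel. z : {0<..<1} --> integral {1..4} (%R. b2 (snd (R, z)) * (b1 (fst (R, z)) * (Gm (R, z) * GU (R, z) + GmR (R, z) * U (R, z)) + deriv b1 (fst (R, z)) * (Gm (R, z) * U (R, z)))) = 0"
     using A1 A3
    proof eventually_elim
     case (elim z)
     show ?case
     proof
      assume z: "z : {0<..<1}"
      have "AC 1 4 (%R. Gm (R, z) * U (R, z)) (%R. Gm (R, z) * GU (R, z) + GmR (R, z) * U (R, z))"
       by (rule AC_mult) (use elim z in auto)
      from integrate_by_parts_test[OF this t1]
      show "integral {1..4} (%R. b2 (snd (R, z)) * (b1 (fst (R, z)) * (Gm (R, z) * GU (R, z) + GmR (R, z) * U (R, z)) + deriv b1 (fst (R, z)) * (Gm (R, z) * U (R, z)))) = 0"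
       by simp
     qed
    qed
   qed
   have iSz: "integrable lborel (%p. idc Rect p * (b1 (fst p) * (b2 (snd p) * (Gm p * GW p + Gmz p * W p) + deriv b2 (snd p) * (Gm p * W p))))"
    using integrable_plus[OF ipz] by (simp add: algebra_simps)
   have zz: "(LBINT p. idc Rect p * (b1 (fst p) * (b2 (snd p) * (Gm p * GW p + Gmz p * W p) + deriv b2 (snd p) * (Gm p * W p)))) = 0"
   proof (rule Fubini_Rect_zero_z[OF iSz])
    show "AE R in lborel. R : {1<..<4} --> integral {0..1} (%z. b1 (fst (R, z)) * (b2 (snd (R, z)) * (Gm (R, z) * GW (R, z) + Gmz (R, z) * W (R, z)) + deriv b2 (snd (R, z)) * (Gm (R, z) * W (R, z)))) = 0"
     using A2 A4
    proof eventually_elim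
     case (elim R)
     show ?case
     proof
      assume R: "R : {1<..<4}"
      have "AC 0 1 (%z. Gm (R, z) * W (R, z)) (%z. Gm (R, z) * GW (R, z) + Gmz (R, z) * W (R, z))"
       by (rule AC_mult) (use elim R in auto)
      from integrate_by_parts_test[OF this t2]
      show "integral {0..1} (%z. b1 (fst (R, z)) * (b2 (snd (R, z)) * (Gm (R, z) * GW (R, z) + Gmz (R, z) * W (R, z)) + deriv b2 (snd (R, z)) * (Gm (R, z) * W (R, z)))) = 0"
       by simp
     qed
    qed
   qed
   have yR: "(LBINT p. idc Rect p * ((b1 (fst p) * b2 (snd p)) * (Gm p * GU p + GmR p * U p))) +
     (LBINT p. idc Rect p * ((deriv b1 (fst p) * b2 (snd p)) * (Gm p * U p))) = 0"
    using zR unfolding Bochner_Integration.integral_add[OF ipR, symmetric] by (simp add: algebra_simps)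
   have yz: "(LBINT p. idc Rect p * ((b1 (fst p) * b2 (snd p)) * (Gm p * GW p + Gmz p * W p))) +
     (LBINT p. idc Rect p * ((b1 (fst p) * deriv b2 (snd p)) * (Gm p * W p))) = 0"
    using zz unfolding Bochner_Integration.integral_add[OF ipz, symmetric] by (simp add: algebra_simps)
   have mh: "integrable ?M (%x. (v (fst (cyl x)) * w (snd (cyl x))) * F x)"
    if "integrable ?M F" "continuous_on UNIV v" "continuous_on UNIV w" for v w :: "real => real" and F
   proof (rule integrable_Cell_mult[OF that(1)])
    show "continuous_on UNIV (%x. v (fst (cyl x)) * w (snd (cyl x)))"
     by (rule continuous_on_compose2[OF continuous_product_kernel[OF that(2,3)] continuous_cyl]) auto
   qed
   have sX: "sq_int (%x. Gm (cyl x))" by (rule sq_int_cong_AE[OF X2 XGm])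
   have k1: "(%p. (deriv b1 (fst p) * b2 (snd p)) * Gm p) : bmeas borel" "(%p. (b1 (fst p) * deriv b2 (snd p)) * Gm p) : bmeas borel"
    by measurable
   have q1: "integrable ?M (%x. (deriv b1 (fst (cyl x)) * b2 (snd (cyl x)) * Gm (cyl x)) * fU x)"
    using mh[OF sq_int_mult[OF sX fU2] test_fun_continuous[OF test_fun_deriv[OF t1]] test_fun_continuous[OF t2]] by (simp add: mult.assoc)
   have q2: "integrable ?M (%x. (b1 (fst (cyl x)) * deriv b2 (snd (cyl x)) * Gm (cyl x)) * u x $ 3)"
    using mh[OF sq_int_mult[OF sX u2] test_fun_continuous[OF t1] test_fun_continuous[OF test_fun_deriv[OF t2]]] by (simp add: mult.assoc)
   let ?phh = "%x::real^3. b1 ((x$1)^2 + (x$2)^2) * b2 (x$3)"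
   have grad: "(\<Sum>j\<in>UNIV. frd ?phh (at x) (axis j 1) * u x $ j) =
     deriv b1 (fst (cyl x)) * b2 (snd (cyl x)) * fU x + b1 (fst (cyl x)) * deriv b2 (snd (cyl x)) * u x $ 3" for x
    unfolding sum_3 frechet_cyl_product[OF sm] by (simp add: axis_def cyl_def fU_def algebra_simps)
   have "(LINT x|?M. ?phh x * h x) = (LINT x|?M. X x * (\<Sum>j\<in>UNIV. frd ?phh (at x) (axis j 1) * u x $ j))"
    using test[OF rp int, of n] by (simp add: Let_def b1_def b2_def)
   also have "... = (LINT x|?M. (deriv b1 (fst (cyl x)) * b2 (snd (cyl x)) * Gm (cyl x)) * fU x + (b1 (fst (cyl x)) * deriv b2 (snd (cyl x)) * Gm (cyl x)) * u x $ 3)"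
   proof (rule integral_cong_AE)
    have e: "AE x in ?M. (deriv b1 (fst (cyl x)) * b2 (snd (cyl x)) * Gm (cyl x)) * fU x + (b1 (fst (cyl x)) * deriv b2 (snd (cyl x)) * Gm (cyl x)) * u x $ 3 = X x * (\<Sum>j\<in>UNIV. frd ?phh (at x) (axis j 1) * u x $ j)"
     using XGm unfolding grad by eventually_elim (simp add: algebra_simps)
    show mm: "(%x. (deriv b1 (fst (cyl x)) * b2 (snd (cyl x)) * Gm (cyl x)) * fU x + (b1 (fst (cyl x)) * deriv b2 (snd (cyl x)) * Gm (cyl x)) * u x $ 3) : bmeas ?M"
     using q1 q2 by auto
    show "(%x. X x * (\<Sum>j\<in>UNIV. frd ?phh (at x) (axis j 1) * u x $ j)) : bmeas ?M"
     by (rule bmeas_cong_AE[OF Cell_lebesgue mm e])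
    show "AE x in ?M. X x * (\<Sum>j\<in>UNIV. frd ?phh (at x) (axis j 1) * u x $ j) = (deriv b1 (fst (cyl x)) * b2 (snd (cyl x)) * Gm (cyl x)) * fU x + (b1 (fst (cyl x)) * deriv b2 (snd (cyl x)) * Gm (cyl x)) * u x $ 3"
     using e by eventually_elim simp
   qed
   also have "... = cyl_const * (LBINT p. idc Rect p * ((deriv b1 (fst p) * b2 (snd p) * Gm p) * U p)) + cyl_const * (LBINT p. idc Rect p * ((b1 (fst p) * deriv b2 (snd p) * Gm p) * W p))"
    using cyl_avgD(2)[OF U k1(1) q1] cyl_avgD(2)[OF W k1(2) q2] q1 q2 by simp
   finally have e1: "(LINT x|?M. (b1 (fst (cyl x)) * b2 (snd (cyl x))) * h x) = ..." by (simp add: cyl_def)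
   have kb: "continuous_on UNIV (%p. b1 (fst p) * b2 (snd p))"
    by (rule continuous_product_kernel[OF test_fun_continuous[OF t1] test_fun_continuous[OF t2]])
   note ph = cyl_pairing_continuous[OF hh hi kb]
   have "cyl_const * (LBINT p. idc Rect p * ((b1 (fst p) * b2 (snd p)) * hh p)) =
     cyl_const * ((LBINT p. idc Rect p * ((deriv b1 (fst p) * b2 (snd p)) * (Gm p * U p))) + (LBINT p. idc Rect p * ((b1 (fst p) * deriv b2 (snd p)) * (Gm p * W p))))"
    using e1 ph(2) by (simp add: distrib_left mult.assoc)
   then have e2: "(LBINT p. idc Rect p * ((b1 (fst p) * b2 (snd p)) * hh p)) =
     (LBINT p. idc Rect p * ((deriv b1 (fst p) * b2 (snd p)) * (Gm p * U p))) + (LBINT p. idc Rect p * ((b1 (fst p) * deriv b2 (snd p)) * (Gm p * W p)))"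
    by (rule cyl_const_cancel2)
   have "(LBINT p. bump n cc dd p * (idc Rect p * hh p + idc Rect p * Y p)) =
     (LBINT p. idc Rect p * ((b1 (fst p) * b2 (snd p)) * hh p) + (idc Rect p * ((b1 (fst p) * b2 (snd p)) * (Gm p * GU p + GmR p * U p)) +
      idc Rect p * ((b1 (fst p) * b2 (snd p)) * (Gm p * GW p + Gmz p * W p))))"
    by (intro Bochner_Integration.integral_cong refl) (simp add: bp Y_def distrib_left mult_ac)
   also have "... = 0" using ph(1) ipR(1) ipz(1) yR yz e2 by simp
   finally show ?thesis .
  qed
 qed
 then have hY: "AE p in lborel. idc Rect p * (K (Gm p) * hh p) = - (idc Rect p * (K (Gm p) * Y p))"
 proof eventually_elim
  case (elim p)
  show ?case
  proof (cases "p : Rect")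
   case True
   then have "hh p = - Y p" using elim by (auto simp: Rect_def)
   then show ?thesis by simp
  qed simp
 qed
 have KGmm: "(%p. K (Gm p)) : bmeas borel" by measurable
 have mGR [measurable]: "GmR : bmeas borel" using sGmR by (simp add: sq_int_Rect_def)
 have mGz [measurable]: "Gmz : bmeas borel" using sGmz by (simp add: sq_int_Rect_def)
 have measY [measurable]: "Y : bmeas borel" unfolding Y_def[abs_def] by measurable
 have KGmc: "(%x. K (Gm (cyl x))) : bmeas ?M" by (rule measurable_compose[OF cyl_measurable_lebesgue KGmm])
 have iKh: "integrable ?M (%x. K (Gm (cyl x)) * h x)" by (rule integrable_bounded_mult[OF hi KGmc KB])
 have cong: "(LINT x|?M. a x) = (LINT x|?M. b x)" if "b : bmeas ?M" "AE x in ?M. b x = a x" for a b :: "real^3 => real"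
 proof (rule integral_cong_AE)
  show "a : bmeas ?M" by (rule bmeas_cong_AE[OF Cell_lebesgue that])
  show "AE x in ?M. a x = b x" using that(2) by eventually_elim simp
 qed (rule that(1))
 have "(LINT x|?M. H' (X x) * h x) = (LINT x|?M. K (Gm (cyl x)) * h x)"
 proof (rule cong)
  show "(%x. K (Gm (cyl x)) * h x) : bmeas ?M" using iKh by auto
  show "AE x in ?M. K (Gm (cyl x)) * h x = H' (X x) * h x" using XGm by eventually_elim (simp add: KGm)
 qed
 also have "... = cyl_const * (LBINT p. idc Rect p * (K (Gm p) * hh p))" by (rule cyl_avgD(2)[OF hh KGmm iKh])
 also have "(LBINT p. idc Rect p * (K (Gm p) * hh p)) = (LBINT p. - (idc Rect p * (K (Gm p) * Y p)))"
  by (rule integral_cong_AE[OF _ _ hY]) (use measY in measurable)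
 \<comment> \<open>The derivatives of H(Gm) U and H(Gm) W are split off; their integrals are zero by
   \<open>zUR\<close> and \<open>zWz\<close>, and what remains contains no derivative of the
   density.\<close>
 also have "... = (LBINT p. (idc Rect p * ((H (Gm p) - Gm p * K (Gm p)) * GU p) + idc Rect p * ((H (Gm p) - Gm p * K (Gm p)) * GW p))
   - idc Rect p * (H (Gm p) * GU p + (K (Gm p) * GmR p) * U p) - idc Rect p * (H (Gm p) * GW p + (K (Gm p) * Gmz p) * W p))"
  by (intro Bochner_Integration.integral_cong refl) (simp add: Y_def algebra_simps)
 also have "... = (LBINT p. idc Rect p * ((H (Gm p) - Gm p * K (Gm p)) * GU p)) + (LBINT p. idc Rect p * ((H (Gm p) - Gm p * K (Gm p)) * GW p))"
 proof -
  have "integrable lborel (%p. idc Rect p * ((H (Gm p) - Gm p * K (Gm p)) * F p))" if "sq_int_Rect F" for F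
   using Bochner_Integration.integrable_diff[OF sq_int_Rect_mult[OF sH that] sq_int_Rect_mult[OF bK[OF sGm] that]]
   by (simp add: algebra_simps)
  note this[OF sGU] this[OF sGW]
  then show ?thesis using iUR iWz zUR zWz by simp
 qed
 finally have fin1: "(LINT x|?M. H' (X x) * h x) = cyl_const * ((LBINT p. idc Rect p * ((H (Gm p) - Gm p * K (Gm p)) * GU p)) + (LBINT p. idc Rect p * ((H (Gm p) - Gm p * K (Gm p)) * GW p)))" .
 let ?k = "%p. H (Gm p) - Gm p * K (Gm p)"
 have km: "?k : bmeas borel" by measurable
 have ki: "integrable ?M (%x. ?k (cyl x) * F x)" if "sq_int F" for F
 proof -
  have "integrable ?M (%x. H (Gm (cyl x)) * F x + (-1) * (K (Gm (cyl x)) * Gm (cyl x) * F x))"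
   using sq_int_mult[OF sq_int_cyl[OF sH] that] sq_int_mult[OF sq_int_cyl[OF bK[OF sGm]] that]
   by (intro integrable_plus integrable_mult_right)
  then show ?thesis by (simp add: algebra_simps)
 qed
 note ki1 = ki[OF fG2] and ki2 = ki[OF ud2[of 3 3]]
 have "(LINT x|?M. (H (X x) - X x * H' (X x)) * (\<Sum>j\<in>UNIV. ud j x $ j)) = (LINT x|?M. ?k (cyl x) * fG x + ?k (cyl x) * ud 3 x $ 3)"
 proof (rule cong)
  show "(%x. ?k (cyl x) * fG x + ?k (cyl x) * ud 3 x $ 3) : bmeas ?M"
   using ki1 ki2 by auto
  show "AE x in ?M. ?k (cyl x) * fG x + ?k (cyl x) * ud 3 x $ 3 = (H (X x) - X x * H' (X x)) * (\<Sum>j\<in>UNIV. ud j x $ j)"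
   using XGm by eventually_elim (simp add: KGm fG_def sum_3 distrib_left)
 qed
 also have "... = cyl_const * (LBINT p. idc Rect p * (?k p * GU p)) + cyl_const * (LBINT p. idc Rect p * (?k p * GW p))"
  using cyl_avgD(2)[OF GU km ki1] cyl_avgD(2)[OF GW km ki2] ki1 ki2 by simp
 also have "... = (LINT x|?M. H' (X x) * h x)" using fin1 by (simp add: distrib_left)
 finally show ?thesis by simp
qed

section \<open>Morrey's inequality for angular averages\<close>

lemma integral_on_set_le_Lr:
 fixes g T :: "'a => real"
 assumes T01: "!!x. T x = 0 | T x = 1" and gm: "g : bmeas M" and gi: "integrable M (%x. \<bar>g x\<bar> powr r)"
  and le: "(LINT x|M. \<bar>g x\<bar> powr r) <= A powr r" and A: "A > 0" and r: "r > 1"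
  and T: "integrable M T" and sg: "(LINT x|M. T x) = sg" "sg > (0::real)"
 shows "(LINT x|M. T x * \<bar>g x\<bar>) <= 2 * A * sg powr (1 - 1/r)"
proof -
 \<comment> \<open>The balancing threshold: both terms of the estimate become A sg^(1 - 1/r), hence
   the factor 2 compared with Hoelder's inequality.\<close>
 define nnn where nu_def: "nnn = A * sg powr (- 1/r)"
 have nnn: "nnn > 0" using A sg by (simp add: nu_def)
 \<comment> \<open>Below the threshold the first term suffices; above it y = y^r y^(1 - r), where
   y^(1 - r) is at most nnn^(1 - r) because r > 1.\<close>
 have young: "y <= nnn + nnn powr (1 - r) * y powr r" if "y >= 0" for y
 proof (cases "y <= nnn")
  case False
  then have y: "y > nnn" "y > 0" using nnn by auto
  have "y * nnn powr (r - 1) <= y * y powr (r - 1)"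
   using y nnn r by (intro mult_left_mono powr_mono2) auto
  also have "... = y powr r" using y powr_add[of y 1 "r - 1"] by simp
  finally have "y * (nnn powr (r - 1) * nnn powr (1 - r)) <= y powr r * nnn powr (1 - r)"
   using nnn by (simp add: mult.assoc[symmetric] mult_right_mono)
  then have "y <= nnn powr (1 - r) * y powr r" using nnn by (simp add: powr_add[symmetric] mult.commute)
  then show ?thesis using nnn by simp
 next
  case True
  then show ?thesis by (simp add: add_increasing2)
 qed
 have i: "integrable M (%x. T x * nnn + nnn powr (1 - r) * \<bar>g x\<bar> powr r)"
  by (intro integrable_plus integrable_mult_left integrable_mult_right T gi)
 have le': "T x * \<bar>g x\<bar> <= T x * nnn + nnn powr (1 - r) * \<bar>g x\<bar> powr r" for x
  using young[of "\<bar>g x\<bar>"] T01[of x] by auto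
 have Tm: "T : bmeas M" using T by auto
 have "(LINT x|M. T x * \<bar>g x\<bar>) <= (LINT x|M. T x * nnn + nnn powr (1 - r) * \<bar>g x\<bar> powr r)"
 proof (rule integral_mono[OF _ i le'])
  show "integrable M (%x. T x * \<bar>g x\<bar>)"
  proof (rule integrable_bd[OF i])
   show "(%x. T x * \<bar>g x\<bar>) : bmeas M" using Tm gm by measurable
   show "AE x in M. norm (T x * \<bar>g x\<bar>) <= norm (T x * nnn + nnn powr (1 - r) * \<bar>g x\<bar> powr r)"
   proof (rule AE_I2)
    fix x
    show "norm (T x * \<bar>g x\<bar>) <= norm (T x * nnn + nnn powr (1 - r) * \<bar>g x\<bar> powr r)"
     using le'[of x] T01[of x] by auto
   qed
  qed
 qed
 also have "... = nnn * sg + nnn powr (1 - r) * (LINT x|M. \<bar>g x\<bar> powr r)"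
  using T gi sg by (simp add: mult.commute)
 also have "... <= nnn * sg + nnn powr (1 - r) * A powr r"
  using le by (simp add: mult_left_mono)
 also have "nnn * sg = A * sg powr (1 - 1/r)"
 proof -
  have "sg powr (1 - 1/r) = sg powr 1 * sg powr (- 1/r)" by (subst powr_add[symmetric]) simp
  then show ?thesis using sg by (simp add: nu_def)
 qed
 also have "nnn powr (1 - r) * A powr r = A * sg powr (1 - 1/r)"
 proof -
  have e: "- 1/r * (1 - r) = 1 - 1/r" using r by (simp add: field_simps)
  have "nnn powr (1 - r) = A powr (1 - r) * sg powr (1 - 1/r)"
   unfolding nu_def using A by (subst powr_mult) (simp_all only: powr_powr e powr_gt_zero less_imp_le powr_ge_zero)
  moreover have "A powr (1 - r) * A powr r = A" using A by (simp add: powr_add[symmetric])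
  ultimately show ?thesis by (simp add: algebra_simps)
 qed
 finally show ?thesis by simp
qed

lemma dy_rect_lift:
 assumes "dy_rect k a c <= Rect"
 shows "integrable (cellM) (%x. idc (dy_rect k a c) (cyl x) :: real)"
  and "(LINT x|cellM. idc (dy_rect k a c) (cyl x)) = 3 * cyl_const * (1/4)^k"
proof -
 have e: "(%p. idc Rect p * idc (dy_rect k a c) p) = (idc (dy_rect k a c) :: real \<times> real => real)"
  using assms by (auto simp: indicator_def fun_eq_iff)
 have m: "(idc (dy_rect k a c) :: real \<times> real => real) : bmeas borel" by measurable
 show "integrable (cellM) (%x. idc (dy_rect k a c) (cyl x) :: real)"
  using integral_cyl(1)[OF m] dy_rect_indicator(1)[of k a c] by (simp add: e)
 show "(LINT x|cellM. idc (dy_rect k a c) (cyl x)) = 3 * cyl_const * (1/4)^k"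
  using integral_cyl(2)[OF m] dy_rect_indicator(2)[of k a c] by (simp add: e)
qed

lemma Cell_abs_nth_le:
 assumes "x : Cell" "j = 1 | j = 2"
 shows "\<bar>x $ j\<bar> <= 2"
proof -
 have "(x$1)^2 + (x$2)^2 < 4" using assms by (auto simp: Cell_def Omega_def)
 then have "(x$1)^2 <= 2^2" "(x$2)^2 <= 2^2" by (simp_all add: add_increasing2 add_increasing order_trans[of _ "(x$1)^2 + (x$2)^2" 4])
 then show ?thesis using assms(2) abs_le_square_iff[of "x$j" 2] by auto
qed

text \<open>The 14 is 3 * 4 + 2: the side of length 3 h times the bound 4 A for the R-derivative
  plus the side h times the bound 2 A for the z-derivative. The 3 in the denominator belongs to the
  area of a rectangle, and 4 / (1 - q) is the factor of \<open>campanato\<close>.\<close>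

definition Morrey_const :: "real => real" where
 "Morrey_const r = 4 * (14 / (3 * cyl_const) * (3 * cyl_const) powr (1 - 1/r)) / (1 - (1/2) powr (1 - 2/r))"

lemma dyadic_ratio_bounds:
 assumes "r > (2::real)"
 shows "0 < (1/2 :: real) powr (1 - 2/r)" "(1/2 :: real) powr (1 - 2/r) < 1"
proof -
 have "0 < 1 - 2/r" using assms by simp
 then have "(1/2::real) powr (1 - 2/r) < (1/2) powr 0" by (intro powr_less_mono') auto
 then show "(1/2 :: real) powr (1 - 2/r) < 1" by simp
qed simp

lemma Morrey_const_pos: "r > 2 ==> Morrey_const r > 0"
 using dyadic_ratio_bounds[of r] cyl_const_pos by (simp add: Morrey_const_def)

text \<open>Scaling: Poincare's inequality and an L^r bound give an integrated oscillation of order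
  h |S|^(1 - 1/r). With h = 2^-k and |S| of order h^2 this is h^2 h^(1 - 2/r), that is, the area
  times q^k with q = 2^-(1 - 2/r). \<open>campanato\<close> turns these integral bounds into a
  pointwise one; r > 2 is exactly q < 1.\<close>

lemma Morrey_dyadic:
 assumes w: "!!j. cell_weak_deriv j f (g j)" and F: "cyl_avg f F" and r: "r > 2" and A: "A > 0"
  and gi: "!!j. integrable (cellM) (%x. \<bar>g j x\<bar> powr r)"
  and le: "!!j. (LINT x|cellM. \<bar>g j x\<bar> powr r) <= A powr r"
  and S: "dy_rect k a c <= Rect"
 shows "AE p in lborel. p : dy_rect k a c --> \<bar>F p - dy_mean F k a c\<bar> <= Morrey_const r * A * ((1/2) powr (1 - 2/r)) ^ k"
proof -
 let ?M = "cellM"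
 define q :: real where "q = (1/2) powr (1 - 2/r)"
 define B where "B = A * (14 / (3 * cyl_const) * (3 * cyl_const) powr (1 - 1/r))"
 have fi: "integrable ?M f" and gint: "integrable ?M (g j)" for j using w[of j] by (auto simp: cell_weak_deriv_def)
 let ?g = "%x. x$1 * g 1 x + x$2 * g 2 x"
 have ci: "continuous_on UNIV (%x::real^3. x$j)" for j by (intro continuous_intros)
 have gg: "integrable ?M ?g"
  by (intro integrable_plus integrable_Cell_mult gint ci)
 obtain G where G: "cyl_avg ?g G" using cyl_avg_ex[OF gg] by blast
 obtain Gz where Gz: "cyl_avg (g 3) Gz" using cyl_avg_ex[OF gint] by blast
 have Fi: "integrable lborel (%p. idc Rect p * F p)" by (rule cyl_avg_integrable[OF F fi])
 have Gi: "integrable lborel (%p. idc Rect p * G p)" by (rule cyl_avg_integrable[OF G gg])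
 have Gzi: "integrable lborel (%p. idc Rect p * Gz p)" by (rule cyl_avg_integrable[OF Gz gint])
 have GRi: "integrable lborel (%p. idc Rect p * (1 / (2 * fst p) * G p))"
  by (rule bounded_mult_Rect[OF Gi radius_sq_measurable_cyl, of 1]) (auto simp: Rect_def)
 have A1: "AE z in lborel. z : {0<..<1} --> AC 1 4 (%R. F (R, z)) (%R. 1 / (2 * R) * G (R, z))"
  using AC_cyl_avg_R[OF w w F G] by simp
 have A2: "AE R in lborel. R : {1<..<4} --> AC 0 1 (%z. F (R, z)) (%z. Gz (R, z))"
  by (rule AC_cyl_avg_z[OF w F Gz])
 have "B >= 0" using A cyl_const_pos by (simp add: B_def)
 have osc: "(LBINT p. idc (dy_rect k a c) p * \<bar>F p - dy_mean F k a c\<bar>) <= 3 * (1/4)^k * (B * q^k)"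
  if S: "dy_rect k a c <= Rect" for k a c
 proof -
  define h :: real where "h = (1/2)^k"
  have h: "h > 0" "h * h = (1/4)^k" by (auto simp: h_def power_mult_distrib[symmetric])
  let ?S = "dy_rect k a c"
  have Se: "?S = {a<..<a + 3 * h} \<times> {c<..<c + h}" by (simp add: dy_rect_def h_def)
  have sub: "1 <= a" "a + 3 * h <= 4" "0 <= c" "c + h <= 1"
  proof -
   have "\<forall>s\<in>{a<..<a + 3 * h}. s : {1<..<4}" "\<forall>s\<in>{c<..<c + h}. s : {0<..<1}"
   proof safe
    fix s assume "s : {a<..<a + 3 * h}"
    then have "(s, c + h/2) : Rect" using h by (intro subsetD[OF S]) (simp add: Se)
    then show "s : {1<..<4}" by (simp add: Rect_def)
   next
    fix s assume "s : {c<..<c + h}"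
    then have "(a + h, s) : Rect" using h by (intro subsetD[OF S]) (simp add: Se)
    then show "s : {0<..<1}" by (simp add: Rect_def)
   qed
   then have "{a<..<a + 3 * h} <= {1<..<4}" "{c<..<c + h} <= {0<..<1}" by blast+
   then show "1 <= a" "a + 3 * h <= 4" "0 <= c" "c + h <= 1" using h by (auto simp: greaterThanLessThan_subseteq_greaterThanLessThan)
  qed
  have restr: "integrable lborel (%p. idc ?S p * K p)" if "integrable lborel (%p. idc Rect p * K p)" for K :: "real \<times> real => real"
  proof -
   have "integrable lborel (%p. idc ?S p * (idc Rect p * K p))"
    by (rule integrable_bounded_mult[OF that, of _ 1]) (auto simp: indicator_def dy_rect_measurable)
   moreover have "(%p. idc ?S p * (idc Rect p * K p)) = (%p. idc ?S p * K p)" using S by (auto simp: indicator_def fun_eq_iff)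
   ultimately show ?thesis by simp
  qed
  have L1: "AE z in lborel. z : {c<..<c + h} --> AC a (a + 3 * h) (%R. F (R, z)) (%R. 1 / (2 * R) * G (R, z))"
   using A1
  proof eventually_elim
   case (elim z)
   show ?case
   proof
    assume "z : {c<..<c + h}"
    then have "z : {0<..<1}" using sub by simp
    then show "AC a (a + 3 * h) (%R. F (R, z)) (%R. 1 / (2 * R) * G (R, z))"
     using AC_subinterval[OF elim[rule_format], of a "a + 3 * h"] sub h by simp
   qed
  qed
  have L2: "AE R in lborel. R : {a<..<a + 3 * h} --> AC c (c + h) (%z. F (R, z)) (%z. Gz (R, z))"
   using A2
  proof eventually_elim
   case (elim R)
   show ?case
   proof
    assume "R : {a<..<a + 3 * h}"
    then have "R : {1<..<4}" using sub by simp
    then show "AC c (c + h) (%z. F (R, z)) (%z. Gz (R, z))"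
     using AC_subinterval[OF elim[rule_format], of c "c + h"] sub h by simp
   qed
  qed
  define sg where "sg = 3 * cyl_const * (1/4)^k"
  have sg: "sg > 0" using cyl_const_pos by (simp add: sg_def)
  have ge: "(LINT x|?M. idc ?S (cyl x) * \<bar>g j x\<bar>) <= 2 * A * sg powr (1 - 1/r)" for j
  proof (rule integral_on_set_le_Lr[OF _ _ gi[of j] le[of j] A _ dy_rect_lift[OF S, folded sg_def] sg])
   show "g j : bmeas ?M" using gint[of j] by auto
  qed (use r in \<open>auto simp: indicator_def\<close>)
  have gS: "integrable ?M (%x. idc ?S (cyl x) * \<bar>g j x\<bar>)" for j
   by (rule integrable_bounded_mult[OF integrable_abs[OF gint], of _ 1])
    (auto simp: indicator_def intro!: measurable_compose[OF cyl_measurable_lebesgue])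
  have GSi: "integrable ?M (%x. idc ?S (cyl x) * \<bar>?g x\<bar>)"
   by (rule integrable_bounded_mult[OF integrable_abs[OF gg], of _ 1])
    (auto simp: indicator_def intro!: measurable_compose[OF cyl_measurable_lebesgue])
  have SR: "idc Rect p * (idc ?S p * K) = idc ?S p * (K::real)" for p K using S by (auto simp: indicator_def)
  have zb: "(LBINT p. idc ?S p * \<bar>Gz p\<bar>) <= 2 * A * sg powr (1 - 1/r) / cyl_const"
  proof -
   have "cyl_const * (LBINT p. idc ?S p * \<bar>Gz p\<bar>) <= 2 * A * sg powr (1 - 1/r)"
    using order_trans[OF cyl_avg_abs_le[OF Gz gint dy_rect_measurable[of k a c]] ge[of 3]] unfolding SR .
   then show ?thesis using cyl_const_pos by (simp add: pos_le_divide_eq mult.commute)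
  qed
  \<comment> \<open>On the cell |x1| and |x2| are at most 2, so the radial field costs 2 (2 A + 2 A)
    = 8 A; the factor 1 / (2 R) <= 1/2 then reduces it to 4 A.\<close>
  have "cyl_const * (LBINT p. idc ?S p * \<bar>G p\<bar>) <= (LINT x|?M. idc ?S (cyl x) * \<bar>?g x\<bar>)"
   using cyl_avg_abs_le[OF G gg dy_rect_measurable[of k a c]] by (simp add: SR)
  also have "... <= (LINT x|?M. 2 * (idc ?S (cyl x) * \<bar>g 1 x\<bar>) + 2 * (idc ?S (cyl x) * \<bar>g 2 x\<bar>))"
  proof (rule integral_mono[OF GSi])
   show "integrable ?M (%x. 2 * (idc ?S (cyl x) * \<bar>g 1 x\<bar>) + 2 * (idc ?S (cyl x) * \<bar>g 2 x\<bar>))"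
    by (intro integrable_plus integrable_mult_right gS)
   fix x assume "x : space ?M"
   then have "x : Cell" by simp
   then have "\<bar>x$1\<bar> * \<bar>g 1 x\<bar> <= 2 * \<bar>g 1 x\<bar>" "\<bar>x$2\<bar> * \<bar>g 2 x\<bar> <= 2 * \<bar>g 2 x\<bar>"
    using Cell_abs_nth_le by (auto intro!: mult_right_mono)
   then have "\<bar>?g x\<bar> <= 2 * \<bar>g 1 x\<bar> + 2 * \<bar>g 2 x\<bar>"
    by (metis (no_types, lifting) abs_mult abs_triangle_ineq add_mono order_trans)
   then show "idc ?S (cyl x) * \<bar>?g x\<bar> <= 2 * (idc ?S (cyl x) * \<bar>g 1 x\<bar>) + 2 * (idc ?S (cyl x) * \<bar>g 2 x\<bar>)"
    by (simp add: indicator_def)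
  qed
  also have "... <= 8 * A * sg powr (1 - 1/r)"
   using ge[of 1] ge[of 2] gS by simp
  finally have Gb: "(LBINT p. idc ?S p * \<bar>G p\<bar>) <= 8 * A * sg powr (1 - 1/r) / cyl_const"
   using cyl_const_pos by (simp add: pos_le_divide_eq mult.commute)
  have "(LBINT p. idc ?S p * \<bar>1 / (2 * fst p) * G p\<bar>) <= (LBINT p. 1/2 * (idc ?S p * \<bar>G p\<bar>))"
  proof (rule integral_mono)
   have ia: "integrable lborel (%p. idc ?S p * \<bar>K p\<bar>)" if "integrable lborel (%p. idc Rect p * K p)" for K :: "real \<times> real => real"
    using integrable_abs[OF restr[OF that]] by (simp add: abs_mult)
   show "integrable lborel (%p. idc ?S p * \<bar>1 / (2 * fst p) * G p\<bar>)" by (rule ia[OF GRi])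
   show "integrable lborel (%p. 1/2 * (idc ?S p * \<bar>G p\<bar>))" by (intro integrable_mult_right ia[OF Gi])
   fix p
   show "idc ?S p * \<bar>1 / (2 * fst p) * G p\<bar> <= 1/2 * (idc ?S p * \<bar>G p\<bar>)"
   proof (cases "p : ?S")
    case True
    then have "fst p > 1" using S by (auto simp: Rect_def)
    then have "\<bar>G p\<bar> / fst p <= \<bar>G p\<bar>" by (simp add: pos_divide_le_eq mult_le_cancel_left1)
    then show ?thesis using True \<open>fst p > 1\<close> by (simp add: abs_mult)
   qed simp
  qed
  also have "... <= 4 * A * sg powr (1 - 1/r) / cyl_const" using Gb by simp
  finally have Rb: "(LBINT p. idc ?S p * \<bar>1 / (2 * fst p) * G p\<bar>) <= 4 * A * sg powr (1 - 1/r) / cyl_const" .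
  have "(LBINT p. idc ?S p * \<bar>F p - dy_mean F k a c\<bar>) \<le>
    3 * h * (LBINT p. idc ?S p * \<bar>1 / (2 * fst p) * G p\<bar>) + h * (LBINT p. idc ?S p * \<bar>Gz p\<bar>)"
  proof -
   have m: "dy_mean F k a c = (LBINT p. idc ({a<..<a + 3 * h} \<times> {c<..<c + h}) p * F p) / ((a + 3 * h - a) * (c + h - c))"
    using h(2) by (simp add: dy_mean_def Se mult.assoc)
   show ?thesis
    using poincare_rectangle[of a "a + 3 * h" c "c + h" F "%p. 1 / (2 * fst p) * G p" Gz,
     OF _ _ restr[OF Fi, unfolded Se] restr[OF GRi, unfolded Se] restr[OF Gzi, unfolded Se]] L1 L2 h
    unfolding m Se by simp
  qed
  also have "... <= 3 * h * (4 * A * sg powr (1 - 1/r) / cyl_const) + h * (2 * A * sg powr (1 - 1/r) / cyl_const)"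
   using Rb zb h by (intro add_mono mult_left_mono) auto
  also have "... = 14 * A / cyl_const * (h * sg powr (1 - 1/r))" by (simp add: field_simps)
  \<comment> \<open>\<open>sg\<close> is proportional to h^2, so the power of h is 1 + 2 - 2/r = 2 +
    (1 - 2/r): the area and the factor q^k.\<close>
  also have "h * sg powr (1 - 1/r) = (3 * cyl_const) powr (1 - 1/r) * ((1/4)^k * q^k)"
  proof -
   have "sg powr (1 - 1/r) = (3 * cyl_const) powr (1 - 1/r) * ((1/4)^k) powr (1 - 1/r)"
    unfolding sg_def using cyl_const_pos by (subst powr_mult) auto
   also have "((1/4::real)^k) powr (1 - 1/r) = (h powr 2) powr (1 - 1/r)" using h by (simp add: power2_eq_square)
   also have "... = h powr (2 - 2/r)" by (simp add: powr_powr algebra_simps)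
   finally have "h * sg powr (1 - 1/r) = (3 * cyl_const) powr (1 - 1/r) * (h powr 1 * h powr (2 - 2/r))" using h by simp
   also have "h powr 1 * h powr (2 - 2/r) = h powr 2 * h powr (1 - 2/r)" by (simp only: powr_add[symmetric]) simp
   also have "h powr 2 = (1/4)^k" using h by (simp add: power2_eq_square)
   also have "h powr (1 - 2/r) = q^k" by (simp add: h_def q_def powr_powr powr_realpow[symmetric] mult.commute)
   finally show ?thesis .
  qed
  also have "14 * A / cyl_const * ((3 * cyl_const) powr (1 - 1/r) * ((1/4)^k * q^k)) = 3 * (1/4)^k * (B * q^k)"
   using cyl_const_pos by (simp add: B_def field_simps)
  finally show ?thesis .
 qed
 have "4 * B * q ^ k / (1 - q) = Morrey_const r * A * q ^ k" by (simp add: Morrey_const_def B_def q_def)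
 then show ?thesis
  using campanato[OF Fi dyadic_ratio_bounds[OF r, folded q_def] \<open>B >= 0\<close> osc S] by (simp add: q_def)
qed

lemma Rect_dy_rect: "Rect = dy_rect 0 1 0"
 by (simp add: Rect_def dy_rect_def)

text \<open>The first summand bounds the mean over \<open>Rect\<close> through
  \<open>integral_on_set_le_Lr\<close>, the second is the oscillation at level 0.\<close>

definition sup_const :: "real => real" where
 "sup_const r = 2 * (3 * cyl_const) powr (1 - 1/r) / (3 * cyl_const) + Morrey_const r"

lemma sup_const_pos: "r > 2 ==> sup_const r > 0"
 using Morrey_const_pos[of r] cyl_const_pos by (simp add: sup_const_def add_nonneg_pos)

text \<open>Applied to the divergence of the velocity, this turns the W^{2,q} norm at one time into
  a bound for the angular average of div u, which is the growth rate in Gronwall's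
  inequality.\<close>

lemma cyl_avg_sup_bound:
 assumes w: "!!j. cell_weak_deriv j f (g j)" and F: "cyl_avg f F" and r: "r > 2" and A: "A > 0"
  and gi: "!!j. integrable (cellM) (%x. \<bar>g j x\<bar> powr r)"
  and le: "!!j. (LINT x|cellM. \<bar>g j x\<bar> powr r) <= A powr r"
  and fi: "integrable (cellM) (%x. \<bar>f x\<bar> powr r)"
  and fle: "(LINT x|cellM. \<bar>f x\<bar> powr r) <= A powr r"
 shows "AE p in lborel. p : Rect --> \<bar>F p\<bar> <= sup_const r * A"
proof -
 let ?M = "cellM"
 have f: "integrable ?M f" using w[of 1] by (auto simp: cell_weak_deriv_def)
 have RR: "idc Rect p * (idc Rect p * K) = idc Rect p * (K::real)" for p K by (auto simp: indicator_def)
 note l = dy_rect_lift[of 0 1 0, folded Rect_dy_rect, OF subset_refl]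
 have "(LINT x|?M. idc Rect (cyl x) * \<bar>f x\<bar>) <= 2 * A * (3 * cyl_const) powr (1 - 1/r)"
 proof (rule integral_on_set_le_Lr[OF _ _ fi fle A _ l(1)])
  show "f : bmeas ?M" using f by auto
  show "(LINT x|?M. idc Rect (cyl x)) = 3 * cyl_const" using l(2) by simp
 qed (use r cyl_const_pos in \<open>auto simp: indicator_def\<close>)
 moreover have "cyl_const * (LBINT p. idc Rect p * \<bar>F p\<bar>) <= (LINT x|?M. idc Rect (cyl x) * \<bar>f x\<bar>)"
  using cyl_avg_abs_le[OF F f Rect_borel] by (simp only: RR)
 ultimately have 1: "cyl_const * (LBINT p. idc Rect p * \<bar>F p\<bar>) <= 2 * A * (3 * cyl_const) powr (1 - 1/r)" by linarith
 have "\<bar>dy_mean F 0 1 0\<bar> <= (LBINT p. idc Rect p * \<bar>F p\<bar>) / 3"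
  using integral_abs_bound[of lborel "%p. idc Rect p * F p"]
  by (simp add: dy_mean_def Rect_dy_rect[symmetric] abs_mult)
 also have "... <= 2 * A * (3 * cyl_const) powr (1 - 1/r) / (3 * cyl_const)"
  using 1 cyl_const_pos by (simp add: field_simps)
 finally have m: "\<bar>dy_mean F 0 1 0\<bar> <= 2 * A * (3 * cyl_const) powr (1 - 1/r) / (3 * cyl_const)" .
 show ?thesis
  using Morrey_dyadic[OF w F r A gi le, of 0 1 0, folded Rect_dy_rect, OF subset_refl]
 proof eventually_elim
  case (elim p)
  show ?case
  proof
   assume "p : Rect"
   then have "\<bar>F p - dy_mean F 0 1 0\<bar> <= Morrey_const r * A" using elim by simp
   then have "\<bar>F p\<bar> <= 2 * A * (3 * cyl_const) powr (1 - 1/r) / (3 * cyl_const) + Morrey_const r * A" using m by linarith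
   then show "\<bar>F p\<bar> <= sup_const r * A" by (simp add: sup_const_def algebra_simps)
  qed
 qed
qed

text \<open>Against a function of \<open>cyl x\<close>, \<open>f\<close> acts only through its
  average, so a bound of the average takes the place of a bound of \<open>f\<close>.\<close>

lemma integral_cyl_pairing_le:
 assumes F: "cyl_avg f F" and b: "AE p in lborel. p : Rect --> \<bar>F p\<bar> <= B"
  and k: "k : bmeas borel" and i: "integrable (cellM) (%x. k (cyl x) * f x)"
  and ki: "integrable (cellM) (%x. k (cyl x))"
 shows "\<bar>\<integral>x. k (cyl x) * f x \<partial>cellM\<bar> <= B * (LINT x|cellM. \<bar>k (cyl x)\<bar>)"
proof -
 have kp: "integrable lborel (%p. idc Rect p * \<bar>k p\<bar>)"
  using integrable_abs[OF integral_cyl(1)[OF k, THEN iffD1, OF ki]] by (simp add: abs_mult)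
 have "\<bar>\<integral>p. idc Rect p * (k p * F p) \<partial>lborel\<bar> <= (LBINT p. \<bar>indicator Rect p * (k p * F p)\<bar>)"
  by (rule integral_abs_bound)
 also have "... <= (LBINT p. B * (idc Rect p * \<bar>k p\<bar>))"
 proof (rule integral_mono_AE)
  show "integrable lborel (%p. \<bar>indicator Rect p * (k p * F p)\<bar>)" by (intro integrable_abs cyl_avgD(1)[OF F k i])
  show "integrable lborel (%p. B * (idc Rect p * \<bar>k p\<bar>))" by (intro integrable_mult_right kp)
  show "AE p in lborel. \<bar>indicator Rect p * (k p * F p)\<bar> <= B * (idc Rect p * \<bar>k p\<bar>)"
   using b
  proof eventually_elim
   case (elim p)
   then show ?case by (cases "p : Rect") (auto simp: abs_mult mult.commute[of B] mult_left_mono)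
  qed
 qed
 finally have "\<bar>\<integral>p. idc Rect p * (k p * F p) \<partial>lborel\<bar> <= B * (LBINT p. idc Rect p * \<bar>k p\<bar>)" by simp
 moreover have km: "(%p. \<bar>k p\<bar>) : bmeas borel" using k by measurable
 ultimately show ?thesis
  unfolding cyl_avgD(2)[OF F k i] integral_cyl(2)[OF km] using cyl_const_pos by (simp add: abs_mult mult.left_commute)
qed

section \<open>Consequences of finite Lebesgue and Sobolev norms\<close>

lemma epowr_le_iff:
 assumes "p > 0" "N >= 0"
 shows "epowr a p <= ennreal (N powr p) \<longleftrightarrow> a <= ennreal N"
proof (cases a)
 case (real x)
 have "x powr p <= N powr p \<longleftrightarrow> x <= N"
  using assms real(1) powr_mono2[of p x N] powr_less_mono2[of p N x] by linarith
 then show ?thesis using real assms by (simp add: epowr_def)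
qed (simp add: epowr_def top_unique)

lemma Lnorm_leD:
 fixes f :: "real^3 => 'b::euclidean_space"
 assumes "Lnorm p f <= ennreal N" "p > 0" "N >= 0"
 shows "f : bmeas (cellM)" "integrable (cellM) (%x. norm (f x) powr p)"
  "(LINT x|cellM. norm (f x) powr p) <= N powr p"
proof -
 let ?I = "\<integral>\<^sup>+ x. ennreal (norm (f x) powr p) \<partial>cellM"
 show m: "f : bmeas (cellM)"
  using assms(1) by (auto simp: Lnorm_def top_unique split: if_splits)
 then have "epowr ?I (1/p) <= ennreal N" using assms(1) by (simp add: Lnorm_def)
 also have "N = (N powr p) powr (1/p)" using assms by (simp add: powr_powr)
 finally have I: "?I <= ennreal (N powr p)" using assms by (subst (asm) epowr_le_iff) auto
 show i: "integrable (cellM) (%x. norm (f x) powr p)"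
 proof (rule integrableI_nonneg)
  show "(%x. norm (f x) powr p) : bmeas (cellM)" using m by measurable
  show "?I < \<infinity>" using I by (simp add: le_less_trans)
 qed auto
 show "(LINT x|cellM. norm (f x) powr p) <= N powr p"
  using I by (subst (asm) nn_integral_eq_integral[OF i]) auto
qed

lemma W_power_0_le: "epowr (Lnorm p f) p <= W_power k p f"
 by (cases k) (simp_all add: add_increasing2)

text \<open>A finite sum excludes the default value infinity in each summand, so the weak derivative
  exists and the choice behind \<open>wd\<close> returns one.\<close>

lemma W_power_pd:
 assumes "W_power (Suc k) p f <= a" "a < \<infinity>"
 shows "weak_deriv Omega (axis i 1) f (pd i f)" "W_power k p (pd i f) <= a"
proof -
 let ?g = "%i. if weakly_diff Omega (axis i 1) f then W_power k p (pd i f) else \<infinity>"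
 have "?g i <= (\<Sum>i\<in>UNIV. ?g i)" by (rule member_le_sum) auto
 also have "... <= W_power (Suc k) p f" by (simp add: add_increasing)
 finally have g: "?g i <= a" using assms(1) by (rule order_trans)
 then have wd: "weakly_diff Omega (axis i 1) f" using assms(2) by (auto split: if_splits simp: top_unique)
 then show "weak_deriv Omega (axis i 1) f (pd i f)" unfolding weakly_diff_def wd_def by (rule someI_ex)
 show "W_power k p (pd i f) <= a" using g wd by simp
qed

lemma Wnorm_W_power:
 assumes "Wnorm k p f <= ennreal N" "p > 0" "N >= 0"
 shows "W_power k p f <= ennreal (N powr p)"
proof -
 have "epowr (W_power k p f) (1/p) <= ennreal N" using assms(1) by (simp add: Wnorm_def)
 also have "N = (N powr p) powr (1/p)" using assms by (simp add: powr_powr)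
 finally show ?thesis using assms by (subst (asm) epowr_le_iff) auto
qed

lemma Wnorm_Lnorm:
 assumes "W_power k p f <= ennreal (N powr p)" "p > 0" "N >= 0"
 shows "Lnorm p f <= ennreal N"
 using order_trans[OF W_power_0_le assms(1)] assms(2,3) by (simp add: epowr_le_iff)

lemma Wnorm_finite_ex:
 assumes "Wnorm k p f < \<infinity>"
 obtains N where "N > 0" "Wnorm k p f <= ennreal N"
proof -
 obtain N where "Wnorm k p f = ennreal N" "N >= 0" using assms by (cases "Wnorm k p f") auto
 then have "N + 1 > 0" "Wnorm k p f <= ennreal (N + 1)" by (auto intro: ennreal_leI)
 then show thesis by (rule that)
qed

lemma powr_sq_le: "2 <= q ==> y^2 <= 1 + \<bar>y\<bar> powr q" for y q :: real
proof -
 assume q: "2 <= q"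
 show ?thesis
 proof (cases "\<bar>y\<bar> <= 1")
  case True
  then have "y^2 <= 1" by (simp add: abs_square_le_1)
  then show ?thesis by (simp add: add_increasing2)
 next
  case False
  then have "\<bar>y\<bar> powr 2 <= \<bar>y\<bar> powr q" using q by (intro powr_mono) auto
  then show ?thesis using False by simp
 qed
qed

lemma Lq_sq_int:
 fixes f :: "real^3 => real"
 assumes m: "f : bmeas (cellM)" and i: "integrable (cellM) (%x. \<bar>f x\<bar> powr q)" and q: "q >= 2"
 shows "sq_int f"
proof -
 interpret finite_measure "cellM" by (rule finite_measure_Cell)
 have "integrable (cellM) (%x. (f x)^2)"
 proof (rule integrable_bd)
  show "integrable (cellM) (%x. 1 + \<bar>f x\<bar> powr q)" by (intro integrable_plus i integrable_const)
  show "(%x. (f x)^2) : bmeas (cellM)" using m by measurable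
  show "AE x in cellM. norm ((f x)^2) <= norm (1 + \<bar>f x\<bar> powr q)"
   using powr_sq_le[OF q] by (intro AE_I2) (auto intro: order_trans[OF _ abs_ge_self])
 qed
 then show ?thesis using m by (simp add: sq_int_def)
qed

lemma Lnorm_component:
 fixes f :: "real^3 => real^3"
 assumes L: "Lnorm p f <= ennreal N" and p: "p > 0" "N >= 0"
 shows "(%x. f x $ i) : bmeas (cellM)" "integrable (cellM) (%x. \<bar>f x $ i\<bar> powr p)"
  "(LINT x|cellM. \<bar>f x $ i\<bar> powr p) <= N powr p"
proof -
 note l = Lnorm_leD[OF L p]
 show m: "(%x. f x $ i) : bmeas (cellM)"
  by (rule measurable_compose[OF l(1)]) (intro bmeas_contI continuous_intros)
 have le: "\<bar>f x $ i\<bar> powr p <= norm (f x) powr p" for x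
  using p component_le_norm_cart[of "f x" i] by (intro powr_mono2) auto
 show i: "integrable (cellM) (%x. \<bar>f x $ i\<bar> powr p)"
 proof (rule integrable_bd[OF l(2)])
  show "(%x. \<bar>f x $ i\<bar> powr p) : bmeas (cellM)" using m by measurable
 qed (use le in auto)
 show "(LINT x|cellM. \<bar>f x $ i\<bar> powr p) <= N powr p"
  using integral_mono[OF i l(2) le] l(3) by linarith
qed

lemma sq_int_Lnorm:
 fixes f :: "real^3 => real"
 assumes "Lnorm q f <= ennreal N" "q >= 2" "N >= 0"
 shows "sq_int f"
 using Lnorm_leD[OF assms(1)] assms by (intro Lq_sq_int) auto

lemma sq_int_Lnorm_component:
 fixes f :: "real^3 => real^3"
 assumes "Lnorm q f <= ennreal N" "q >= 2" "N >= 0"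
 shows "sq_int (%x. f x $ i)"
 using Lnorm_component[OF assms(1)] assms by (intro Lq_sq_int[of _ q]) auto

lemma cell_weak_deriv_add:
 assumes "cell_weak_deriv j f f'" "cell_weak_deriv j g g'"
 shows "cell_weak_deriv j (%x. f x + g x) (%x. f' x + g' x)"
proof -
 have i: "integrable (cellM) f" "integrable (cellM) f'" "integrable (cellM) g" "integrable (cellM) g'"
  using assms by (auto simp: cell_weak_deriv_def)
 have "(LINT x|cellM. frd phh (at x) (axis j 1) * (f x + g x)) = - (LINT x|cellM. phh x * (f' x + g' x))"
  if t: "test_fun Cell0 phh" for phh
 proof -
  have c: "continuous_on UNIV (%x. frd phh (at x) (axis j 1))"
   by (rule smooth_frechet_continuous[OF test_fun_smooth[OF t]])  simp
  note ii = integrable_Cell_mult[OF i(1) c] integrable_Cell_mult[OF i(3) c]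
   integrable_Cell_mult[OF i(2) test_fun_continuous[OF t]] integrable_Cell_mult[OF i(4) test_fun_continuous[OF t]]
  show ?thesis
   using ii cell_weak_derivD[OF assms(1) t] cell_weak_derivD[OF assms(2) t] by (simp add: distrib_left)
 qed
 then show ?thesis using i by (simp add: cell_weak_deriv_def)
qed

lemma abs_sum3_powr_le:
 fixes a b c q :: real
 assumes "q >= 0"
 shows "\<bar>a + b + c\<bar> powr q <= 3 powr q * (\<bar>a\<bar> powr q + \<bar>b\<bar> powr q + \<bar>c\<bar> powr q)"
proof -
 define m where "m = Max {\<bar>a\<bar>, \<bar>b\<bar>, \<bar>c\<bar>}"
 have "\<bar>a\<bar> <= m" "\<bar>b\<bar> <= m" "\<bar>c\<bar> <= m" by (auto simp: m_def)
 then have "\<bar>a + b + c\<bar> powr q <= (3 * m) powr q" using assms by (intro powr_mono2) auto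
 also have "... = 3 powr q * m powr q" using \<open>\<bar>a\<bar> <= m\<close> by (subst powr_mult) auto
 also have "m powr q <= \<bar>a\<bar> powr q + \<bar>b\<bar> powr q + \<bar>c\<bar> powr q"
 proof -
  have "m : {\<bar>a\<bar>, \<bar>b\<bar>, \<bar>c\<bar>}" unfolding m_def by (rule Max_in) auto
  then show ?thesis by auto
 qed
 finally show ?thesis by (simp add: mult_left_mono)
qed

text \<open>The 9 is 3 * 3: one factor from |a + b + c| <= 3 max, the other from bounding the number
  3 of summands by 3^q.\<close>

lemma Lq_sum3:
 fixes f :: "3 => real^3 => real"
 assumes m: "!!j. f j : bmeas (cellM)" and i: "!!j. integrable (cellM) (%x. \<bar>f j x\<bar> powr q)"
  and le: "!!j. (LINT x|cellM. \<bar>f j x\<bar> powr q) <= N powr q" and q: "q >= 1" and N: "N >= 0"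
 shows "integrable (cellM) (%x. \<bar>\<Sum>j\<in>UNIV. f j x\<bar> powr q)"
  "(LINT x|cellM. \<bar>\<Sum>j\<in>UNIV. f j x\<bar> powr q) <= (9 * N) powr q"
proof -
 let ?b = "%x. 3 powr q * (\<bar>f 1 x\<bar> powr q + \<bar>f 2 x\<bar> powr q + \<bar>f 3 x\<bar> powr q)"
 have bi: "integrable (cellM) ?b" by (intro integrable_mult_right integrable_plus i)
 have b: "\<bar>\<Sum>j\<in>UNIV. f j x\<bar> powr q <= ?b x" for x
  using abs_sum3_powr_le[of q "f 1 x" "f 2 x" "f 3 x"] q by (simp add: sum_3)
 show i': "integrable (cellM) (%x. \<bar>\<Sum>j\<in>UNIV. f j x\<bar> powr q)"
 proof (rule integrable_bd[OF bi])
  show "(%x. \<bar>\<Sum>j\<in>UNIV. f j x\<bar> powr q) : bmeas (cellM)" using m by measurable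
  show "AE x in cellM. norm (\<bar>\<Sum>j\<in>UNIV. f j x\<bar> powr q) <= norm (?b x)"
   using b by (intro AE_I2) (auto intro: order_trans[OF _ abs_ge_self])
 qed
 have "(LINT x|cellM. \<bar>\<Sum>j\<in>UNIV. f j x\<bar> powr q) <= (LINT x|cellM. ?b x)"
  by (rule integral_mono[OF i' bi b])
 also have "... = 3 powr q * ((LINT x|cellM. \<bar>f 1 x\<bar> powr q) + (LINT x|cellM. \<bar>f 2 x\<bar> powr q) + (LINT x|cellM. \<bar>f 3 x\<bar> powr q))"
  using i by simp
 also have "... <= 3 powr q * (3 * N powr q)" using le[of 1] le[of 2] le[of 3] by (intro mult_left_mono) auto
 also have "... <= 3 powr q * (3 powr q * N powr q)"
  using powr_mono[of 1 q 3] q by (intro mult_left_mono mult_right_mono) auto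
 also have "... = (9 * N) powr q" using N by (simp add: powr_mult[symmetric] mult.assoc[symmetric])
 finally show "(LINT x|cellM. \<bar>\<Sum>j\<in>UNIV. f j x\<bar> powr q) <= (9 * N) powr q" .
qed

lemma bounded_linear_nth: "bounded_linear (%v::real^3. v $ i)"
 by (rule bounded_linear_vec_nth)

text \<open>Each summand of the divergence and its first derivatives are components of first and
  second derivatives of \<open>u\<close>, all bounded in L^q by \<open>N\<close>; the 9 is that of
  \<open>Lq_sum3\<close>.\<close>

lemma divergence_avg_bound:
 fixes u :: "real^3 => real^3"
 assumes W: "Wnorm 2 q u <= ennreal N" and q: "q > 2" and N: "N > 0"
  and F: "cyl_avg (%x. \<Sum>j\<in>UNIV. pd j u x $ j) F"
 shows "AE p in lborel. p : Rect --> \<bar>F p\<bar> <= sup_const q * (9 * N)"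
proof -
 have W2: "W_power (Suc (Suc 0)) q u <= ennreal (N powr q)"
  using Wnorm_W_power[OF W] q N by (simp add: numeral_2_eq_2)
 have W1: "W_power (Suc 0) q (pd j u) <= ennreal (N powr q)" for j
  by (rule W_power_pd(2)[OF W2]) simp
 have L1: "Lnorm q (pd j u) <= ennreal N" for j
  using Wnorm_Lnorm[OF W1] q N by simp
 have L2: "Lnorm q (pd k (pd j u)) <= ennreal N" for j k
  using Wnorm_Lnorm[OF W_power_pd(2)[OF W1]] q N by simp
 have s1: "sq_int (%x. pd j u x $ i)" for i j using sq_int_Lnorm_component[OF L1] q N by simp
 have s2: "sq_int (%x. pd k (pd j u) x $ i)" for i j k using sq_int_Lnorm_component[OF L2] q N by simp
 have w: "cell_weak_deriv k (%x. pd j u x $ j) (%x. pd k (pd j u) x $ j)" for j k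
  by (rule weak_deriv_cell[OF weak_deriv_linear[OF W_power_pd(1)[OF W1] bounded_linear_nth axis_Basis]
     sq_int_integrable[OF s1] sq_int_integrable[OF s2]]) simp
 have wk: "cell_weak_deriv k (%x. \<Sum>j\<in>UNIV. pd j u x $ j) (%x. \<Sum>j\<in>UNIV. pd k (pd j u) x $ j)" for k
  unfolding sum_3 by (intro cell_weak_deriv_add w)
 have q': "q > 0" "N >= 0" "q >= 1" "9 * N > 0" using q N by auto
 note c1 = Lnorm_component[OF L1 q'(1,2)] and c2 = Lnorm_component[OF L2 q'(1,2)]
 show ?thesis
  by (rule cyl_avg_sup_bound[OF wk F q q'(4)])
   (rule Lq_sum3[of _ q N, OF c1 q'(3,2)] Lq_sum3[of _ q N, OF c2 q'(3,2)])+
qed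

text \<open>Whatever the sign of the extended normal, |x1 u1 + x2 u2| = r |u . n|, and r <= 2 on the
  cell; so the flux through R is at most 4 |u . n| and inherits the vanishing layer
  averages.\<close>

lemma normal_layer:
 fixes u :: "real^3 => real^3"
 assumes bd: "eq_on_bdry (%x. u x \<bullet> normal x) (%x. 0)" and um: "!!i. (%x. u x $ i) : bmeas (cellM)"
 shows "((%s. (\<integral>\<^sup>+ x. ennreal \<bar>2 * (x$1 * u x $ 1 + x$2 * u x $ 2)\<bar> \<partial>lebesgue_on {x\<in>Cell. radius x < 1 + s | 2 - s < radius x}) / ennreal s) \<longlongrightarrow> 0) (at_right 0)"
proof -
 let ?L = "%s::real. {x\<in>Cell. radius x < 1 + s | 2 - s < radius x}"
 let ?f = "%x. \<bar>2 * (x$1 * u x $ 1 + x$2 * u x $ 2)\<bar>"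
 let ?g = "%x. ennreal (norm (u x \<bullet> normal x - 0))"
 have rm: "radius : bmeas borel"
  unfolding radius_def[abs_def] by (intro bmeas_contI continuous_intros)
 have Lb: "?L s : sets borel" for s
 proof -
  have "{x. radius x < 1 + s | 2 - s < radius x} : sets borel" using rm by measurable
  moreover have "?L s = Cell \<inter> {x. radius x < 1 + s | 2 - s < radius x}" by auto
  ultimately show ?thesis using Cell_borel by auto
 qed
 have xm: "(%x. x $ i) : bmeas (cellM)" for i :: 3
  by (intro measurable_restrict_space1 measurable_completion) (simp add: bmeas_contI continuous_intros)
 have fm: "?f : bmeas (cellM)" using um xm by measurable
 have fL: "?f : bmeas (lebesgue_on (?L s))" for s
  by (rule measurable_restrict_mono[OF fm]) auto
 have le: "?f x <= 4 * \<bar>u x \<bullet> normal x\<bar>" if "x : Cell" for x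
 proof -
  have R: "0 < radius x" "radius x <= 2" "(radius x)^2 = (x$1)^2 + (x$2)^2"
   using that real_sqrt_le_mono[of "(x$1)^2 + (x$2)^2" 4] by (auto simp: Cell_def Omega_def radius_def)
  have "\<bar>u x \<bullet> normal x\<bar> = \<bar>u x \<bullet> e_r x\<bar>" by (simp add: normal_def)
  also have "u x \<bullet> e_r x = (x$1 * u x $ 1 + x$2 * u x $ 2) / radius x"
   by (simp add: e_r_def inner_vec_def sum_3 add_divide_distrib mult.commute)
  finally have e: "\<bar>x$1 * u x $ 1 + x$2 * u x $ 2\<bar> = radius x * \<bar>u x \<bullet> normal x\<bar>" using R by (simp add: abs_divide)
  show ?thesis unfolding abs_mult e using R by (auto intro!: mult_right_mono)
 qed
 have I: "(\<integral>\<^sup>+ x. ennreal (?f x) \<partial>lebesgue_on (?L s)) <= 4 * (\<integral>\<^sup>+ x. ?g x \<partial>lebesgue_on (?L s))" for s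
 proof -
  have "(\<integral>\<^sup>+ x. ennreal (1/4) * ennreal (?f x) \<partial>lebesgue_on (?L s)) <= (\<integral>\<^sup>+ x. ?g x \<partial>lebesgue_on (?L s))"
  proof (rule nn_integral_mono)
   fix x assume "x : space (lebesgue_on (?L s))"
   then have "x : Cell" by simp
   then show "ennreal (1/4) * ennreal (?f x) <= ?g x" using le[of x] by (simp add: ennreal_mult[symmetric] ennreal_leI)
  qed
  then have "ennreal (1/4) * (\<integral>\<^sup>+ x. ennreal (?f x) \<partial>lebesgue_on (?L s)) <= (\<integral>\<^sup>+ x. ?g x \<partial>lebesgue_on (?L s))"
   using fL[of s] by (subst (asm) nn_integral_cmult) auto
  then have "4 * (ennreal (1/4) * (\<integral>\<^sup>+ x. ennreal (?f x) \<partial>lebesgue_on (?L s))) <= 4 * (\<integral>\<^sup>+ x. ?g x \<partial>lebesgue_on (?L s))"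
   by (rule mult_left_mono) simp
  moreover have "4 * (ennreal (1/4) * y) = y" for y
  proof -
   have "ennreal 4 * ennreal (1/4) = 1" by (subst ennreal_mult[symmetric]) auto
   then show ?thesis by (simp add: mult.assoc[symmetric])
  qed
  ultimately show ?thesis by simp
 qed
 have lim: "((%s. 4 * ((\<integral>\<^sup>+ x. ?g x \<partial>lebesgue_on (?L s)) / ennreal s)) \<longlongrightarrow> 4 * 0) (at_right 0)"
  using bd unfolding eq_on_bdry_def by (intro ennreal_tendsto_cmult) auto
 show ?thesis
 proof (rule tendsto_sandwich[OF _ _ tendsto_const])
  show "((%s. 4 * ((\<integral>\<^sup>+ x. ?g x \<partial>lebesgue_on (?L s)) / ennreal s)) \<longlongrightarrow> 0) (at_right 0)" using lim by simp
  show "\<forall>\<^sub>F s in at_right 0. (\<integral>\<^sup>+ x. ennreal (?f x) \<partial>lebesgue_on (?L s)) / ennreal s <= 4 * ((\<integral>\<^sup>+ x. ?g x \<partial>lebesgue_on (?L s)) / ennreal s)"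
   using divide_right_mono_ennreal[OF I] by (simp add: ennreal_times_divide)
 qed simp
qed

section \<open>Continuity in time of integrals over the cell\<close>

lemma Cell_integral_one: "integrable (cellM) (%x. 1::real)" "(LINT x|cellM. 1) = 3 * cyl_const"
proof -
 interpret finite_measure "cellM" by (rule finite_measure_Cell)
 show "integrable (cellM) (%x. 1::real)" by simp
 have "(LBINT p. idc Rect p) = (3::real)" using dy_rect_indicator(2)[of 0 1 0] by (simp add: Rect_dy_rect)
 then show "(LINT x|cellM. 1) = 3 * cyl_const" using integral_cyl(2)[of "%_. 1"] by simp
qed

lemma L1_le_Lnorm:
 fixes f :: "real^3 => real"
 assumes L: "Lnorm q f <= ennreal N" and q: "q > 1" and N: "N > 0"
 shows "integrable (cellM) f" "(LINT x|cellM. \<bar>f x\<bar>) <= 2 * N * (3 * cyl_const) powr (1 - 1/q)"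
proof -
 have l: "f : bmeas (cellM)" "integrable (cellM) (%x. \<bar>f x\<bar> powr q)"
  "(LINT x|cellM. \<bar>f x\<bar> powr q) <= N powr q"
  using Lnorm_leD[OF L] q N by auto
 show "(LINT x|cellM. \<bar>f x\<bar>) <= 2 * N * (3 * cyl_const) powr (1 - 1/q)"
  using integral_on_set_le_Lr[OF _ l N q Cell_integral_one] cyl_const_pos by simp
 show "integrable (cellM) f"
 proof (rule integrable_bd[OF integrable_plus[OF Cell_integral_one(1) l(2)] l(1)])
  have "\<bar>y\<bar> <= 1 + \<bar>y\<bar> powr q" for y :: real
  proof (cases "\<bar>y\<bar> <= 1")
   case False
   then show ?thesis using powr_mono[of 1 q "\<bar>y\<bar>"] q by simp
  qed (simp add: add_increasing2)
  then show "AE x in cellM. norm (f x) <= norm (1 + \<bar>f x\<bar> powr q)" by (intro AE_I2) (auto intro: order_trans[OF _ abs_ge_self])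
 qed
qed

lemma in_C_L1:
 fixes rh :: "real => real^3 => real"
 assumes C: "in_C T (Wnorm k q) rh" and q: "q > 1" and t: "t : {0..T}"
 shows "integrable (cellM) (rh t)"
  and "((%s. \<integral>x. \<bar>rh s x - rh t x\<bar> \<partial>cellM) \<longlongrightarrow> 0) (at t within {0..T})"
proof -
 have "Wnorm k q (rh t) < \<infinity>" using C t by (auto simp: in_C_def)
 then obtain N where "N > 0" "Wnorm k q (rh t) <= ennreal N" by (rule Wnorm_finite_ex)
 then show "integrable (cellM) (rh t)"
  using L1_le_Lnorm(1)[OF Wnorm_Lnorm[OF Wnorm_W_power]] q by simp
 have lim: "((%s. Wnorm k q (%x. rh s x - rh t x)) \<longlongrightarrow> 0) (at t within {0..T})" using C t by (auto simp: in_C_def)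
 show "((%s. \<integral>x. \<bar>rh s x - rh t x\<bar> \<partial>cellM) \<longlongrightarrow> 0) (at t within {0..T})"
 proof (rule tendstoI)
  fix e :: real assume e: "e > 0"
  define c where "c = 2 * (3 * cyl_const) powr (1 - 1/q)"
  have c: "c > 0" using cyl_const_pos by (simp add: c_def)
  define N where "N = e / (2 * c)"
  have N: "N > 0" using e c by (simp add: N_def)
  have "\<forall>\<^sub>F s in at t within {0..T}. Wnorm k q (%x. rh s x - rh t x) < ennreal N"
   by (rule order_tendstoD(2)[OF lim]) (simp add: N)
  then show "\<forall>\<^sub>F s in at t within {0..T}. dist (LINT x|cellM. \<bar>rh s x - rh t x\<bar>) 0 < e"
  proof eventually_elim
   case (elim s)
   have "Lnorm q (%x. rh s x - rh t x) <= ennreal N"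
    using Wnorm_Lnorm[OF Wnorm_W_power[OF less_imp_le[OF elim]]] q N by simp
   from L1_le_Lnorm(2)[OF this q N] have "(LINT x|cellM. \<bar>rh s x - rh t x\<bar>) <= N * c" by (simp add: c_def mult_ac)
   also have "... < e" using e c by (simp add: N_def)
   finally show ?case by simp
  qed
 qed
qed

text \<open>The admissible renormalizing functions. The density is nonnegative only almost
  everywhere, so \<open>H\<close> is applied to \<open>max y 0\<close> throughout; the bounded
  derivative makes this a Lipschitz function. The instances used are the identity, for conservation
  of mass, and shifted inverse powers.\<close>

locale C1_halfline =
 fixes H H' :: "real => real" and B :: real
 assumes der: "!!y. 0 <= y ==> (H has_real_derivative H' y) (at y)"
  and cont: "continuous_on {0..} H'" and bound: "!!y. 0 <= y ==> \<bar>H' y\<bar> <= B"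
begin

lemma B_nonneg: "0 <= B"
 using bound[of 0] by simp

lemma lipschitz: "\<bar>H (max y 0) - H (max z 0)\<bar> <= B * \<bar>y - z\<bar>"
proof -
 have "norm (H (max y 0) - H (max z 0)) <= B * norm (max y 0 - max z 0)"
  by (rule field_differentiable_bound[of "{0..}" H H' B])
   (use der bound in \<open>auto intro: has_field_derivative_at_within\<close>)
 also have "... <= B * \<bar>y - z\<bar>" using B_nonneg by (intro mult_left_mono) auto
 finally show ?thesis by simp
qed

lemma growth: "\<bar>H (max y 0)\<bar> <= \<bar>H 0\<bar> + B * \<bar>y\<bar>"
 using lipschitz[of y 0] by simp

lemma measurable_max [measurable]: "(%y. H (max y 0)) : bmeas borel" "(%y. H' (max y 0)) : bmeas borel"
proof -
 have "continuous_on UNIV (%y. H' (max y 0))"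
  by (rule continuous_on_compose2[OF cont]) (auto intro!: continuous_intros)
 then show "(%y. H' (max y 0)) : bmeas borel" by (rule bmeas_contI)
 have "continuous_on {0..} H" by (rule continuous_at_imp_continuous_on) (use DERIV_isCont[OF der] in simp)
 then have "continuous_on UNIV (%y. H (max y 0))"
  by (rule continuous_on_compose2) (auto intro!: continuous_intros)
 then show "(%y. H (max y 0)) : bmeas borel" by (rule bmeas_contI)
qed

lemma integrable_H:
 assumes f: "integrable (cellM) f"
 shows "integrable (cellM) (%x. H (max (f x) 0))"
proof (rule integrable_bd)
 show "integrable (cellM) (%x. \<bar>H 0\<bar> * 1 + B * \<bar>f x\<bar>)"
  by (intro integrable_plus integrable_mult_right integrable_abs f Cell_integral_one)
 have fm: "f : bmeas (cellM)" using f by auto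
 show "(%x. H (max (f x) 0)) : bmeas (cellM)" using fm by measurable
 show "AE x in cellM. norm (H (max (f x) 0)) <= norm (\<bar>H 0\<bar> * 1 + B * \<bar>f x\<bar>)"
  using growth by (intro AE_I2) (auto intro: order_trans[OF _ abs_ge_self])
qed

lemma continuous_integral_H:
 assumes C: "in_C T (Wnorm k q) rh" and q: "q > 1"
 shows "continuous_on {0..T} (%t. \<integral>x. H (max (rh t x) 0) \<partial>cellM)"
 unfolding continuous_on
proof
 fix t assume t: "t : {0..T}"
 note i = in_C_L1(1)[OF C q]
 show "((%t. \<integral>x. H (max (rh t x) 0) \<partial>cellM) \<longlongrightarrow> (LINT x|cellM. H (max (rh t x) 0))) (at t within {0..T})"
 proof (rule LIM_zero_cancel, rule tendsto_0_le[where K = B])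
  show "((%s. \<integral>x. \<bar>rh s x - rh t x\<bar> \<partial>cellM) \<longlongrightarrow> 0) (at t within {0..T})" by (rule in_C_L1(2)[OF C q t])
  have "norm ((LINT x|cellM. H (max (rh s x) 0)) - (LINT x|cellM. H (max (rh t x) 0)))
    <= norm (LINT x|cellM. \<bar>rh s x - rh t x\<bar>) * B" if s: "s : {0..T}" for s
  proof -
   have "(LINT x|cellM. H (max (rh s x) 0)) - (LINT x|cellM. H (max (rh t x) 0))
     = (LINT x|cellM. H (max (rh s x) 0) - H (max (rh t x) 0))"
    using integrable_H[OF i[OF s]] integrable_H[OF i[OF t]] by simp
   also have "\<bar>...\<bar> <= (LINT x|cellM. \<bar>H (max (rh s x) 0) - H (max (rh t x) 0)\<bar>)" by (rule integral_abs_bound)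
   also have "... <= (LINT x|cellM. B * \<bar>rh s x - rh t x\<bar>)"
    using integrable_H[OF i[OF s]] integrable_H[OF i[OF t]] i[OF s] i[OF t] lipschitz by (intro integral_mono) auto
   finally show ?thesis by (simp add: mult.commute)
  qed
  then show "\<forall>\<^sub>F s in at t within {0..T}. norm ((LINT x|cellM. H (max (rh s x) 0)) - (LINT x|cellM. H (max (rh t x) 0)))
    <= norm (LINT x|cellM. \<bar>rh s x - rh t x\<bar>) * B"
   by (auto simp: eventually_at_filter)
 qed
qed

end

section \<open>Time slices of the continuity equation\<close>

lemma smooth_snd:
 fixes phh :: "'y::euclidean_space => real"
 assumes "smooth UNIV phh"
 shows "smooth UNIV (%z::'x::euclidean_space \<times> 'y. phh (snd z))"
proof -
 have "C_k k UNIV f ==> C_k k UNIV (%z::'x \<times> 'y. f (snd z))" for k and f :: "'y => real"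
 proof (induction k arbitrary: f)
  case 0
  then show ?case using continuous_on_compose2[OF _ continuous_on_snd[OF continuous_on_id], of UNIV f UNIV] by simp
 next
  case (Suc k)
  have d: "((%z::'x \<times> 'y. f (snd z)) has_derivative (%h. frd f (at (snd z)) (snd h))) (at z)" for z
  proof -
   have "(f has_derivative frd f (at (snd z))) (at (snd z))"
    using Suc.prems by (simp add: frechet_derivative_works[symmetric])
   from has_derivative_compose[OF has_derivative_snd[OF has_derivative_ident] this] show ?thesis .
  qed
  have e: "(%z. frd (%z::'x \<times> 'y. f (snd z)) (at z) b) = (%z. frd f (at (snd z)) (snd b))" for b
   using frechet_derivative_eqI[OF d] by blast
  have "C_k k UNIV (%z. frd (%z::'x \<times> 'y. f (snd z)) (at z) b)" if b: "b : Basis" for b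
  proof (cases "snd b : Basis")
   case True
   then show ?thesis unfolding e using Suc.prems by (intro Suc.IH) simp
  next
   case False
   then have "snd b = 0" using b by (auto simp: Basis_prod_def)
   then have "frd f (at y) (snd b) = 0" for y
   proof -
    have "f differentiable at y" using Suc.prems by simp
    from linear_0[OF linear_frechet_derivative[OF this]] \<open>snd b = 0\<close> show ?thesis by simp
   qed
   then show ?thesis unfolding e using smooth_C_k[OF smooth_const[of 0]] by simp
  qed
  moreover have "(%z::'x \<times> 'y. f (snd z)) differentiable at z" for z by (rule differentiableI[OF d])
  ultimately show ?case by simp
 qed
 then show ?thesis using assms by (auto simp: smooth_def)
qed

lemma smooth_fst_real: "smooth UNIV \<chi>' ==> smooth UNIV (%z::real \<times> 'y::euclidean_space. \<chi>' (fst z) :: real)"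
 by (rule smooth_compose[OF _ smooth_linear[OF bounded_linear_fst]])

lemma test_fun_tensor:
 fixes ps :: "real => real" and phh :: "'y::euclidean_space => real"
 assumes "test_fun I ps" "test_fun U phh"
 shows "test_fun (I \<times> U) (%z. ps (fst z) * phh (snd z))"
proof -
 obtain K1 where K1: "compact K1" "K1 <= I" "!!x. x ~: K1 ==> ps x = 0" using test_fun_support[OF assms(1)] by metis
 obtain K2 where K2: "compact K2" "K2 <= U" "!!x. x ~: K2 ==> phh x = 0" using test_fun_support[OF assms(2)] by metis
 show ?thesis
 proof (rule test_funI[of _ "K1 \<times> K2"])
  show "smooth UNIV (%z. ps (fst z) * phh (snd z))"
   by (intro smooth_mult smooth_fst_real smooth_snd test_fun_smooth[OF assms(1)] test_fun_smooth[OF assms(2)])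
  show "ps (fst z) * phh (snd z) = 0" if "z ~: K1 \<times> K2" for z
   using that K1(3)[of "fst z"] K2(3)[of "snd z"] by (cases z) auto
 qed (use K1 K2 in \<open>auto intro: compact_Times\<close>)
qed

lemma frechet_tensor:
 fixes ps :: "real => real" and phh :: "'y::euclidean_space => real"
 assumes "smooth UNIV ps" "smooth UNIV phh"
 shows "frd (%z. ps (fst z) * phh (snd z)) (at z) (1, 0) = deriv ps (fst z) * phh (snd z)"
  and "frd (%z. ps (fst z) * phh (snd z)) (at z) (0, b) = ps (fst z) * frd phh (at (snd z)) b"
proof -
 have 1: "((%z::real \<times> 'y. ps (fst z)) has_derivative (%h. deriv ps (fst z) * fst h)) (at z)"
  by (rule has_derivative_compose[OF has_derivative_fst[OF has_derivative_ident]
    smooth_imp_DERIV[OF assms(1), THEN has_field_derivative_imp_has_derivative]])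
 have 2: "((%z::real \<times> 'y. phh (snd z)) has_derivative (%h. frd phh (at (snd z)) (snd h))) (at z)"
  by (rule has_derivative_compose[OF has_derivative_snd[OF has_derivative_ident] smooth_has_derivative[OF assms(2)]])
 have l: "frd phh (at (snd z)) 0 = 0"
  by (rule linear_0[OF has_derivative_linear[OF smooth_has_derivative[OF assms(2)]]])
 note d = has_derivative_mult[OF 1 2]
 show "frd (%z. ps (fst z) * phh (snd z)) (at z) (1, 0) = deriv ps (fst z) * phh (snd z)"
  and "frd (%z. ps (fst z) * phh (snd z)) (at z) (0, b) = ps (fst z) * frd phh (at (snd z)) b"
  using frechet_derivative_eqI[OF d] l by auto
qed

text \<open>Fubini for the completed measure: a Borel function equal to \<open>h\<close> off a null
  set is equal to it on almost every slice off a null set, and \<open>E\<close> is the slice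
  integral of the Borel version, defined for every t.\<close>

lemma lebesgue_slices:
 fixes h :: "real \<times> 'y::euclidean_space => real"
 assumes h: "integrable lebesgue h"
 shows "\<exists>E. integrable lborel E \<and>
  (AE t in lborel. integrable lebesgue (%x. h (t, x)) & (LINT x|lebesgue. h (t, x)) = E t) \<and>
  (\<forall>ps\<in>borel_measurable borel. (\<exists>B. \<forall>t. \<bar>ps t\<bar> <= B) --> (LBINT t. ps t * E t) = (LINT z|lebesgue. ps (fst z) * h z))"
proof -
 have "h : bmeas lebesgue" using h by auto
 then obtain h' where h': "h' : bmeas lborel" "AE z in lborel. h z = h' z"
  using completion_ex_borel_measurable_real by blast
 have hm: "h' : bmeas borel" using h'(1) by simp
 have h'L: "h' : bmeas lebesgue" using h'(1) by (rule measurable_completion)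
 have i: "integrable lborel h'"
  using integrable_cong_AE_imp[OF h h'L] AE_completion[OF h'(2)] integrable_completion[OF h'(1)] by (auto elim: eventually_mono)
 define E where "E t = (LBINT x. h' (t, x))" for t
 show ?thesis
 proof (intro exI[of _ E] conjI ballI impI)
  show "integrable lborel E" unfolding E_def[abs_def] by (rule lborel_Fubini_fst(2)[OF i])
  have "AE z in (lborel \<Otimes>\<^sub>M lborel). h z = h' z" using h'(2) unfolding lborel_prod .
  from lborel_pair.AE_pair[OF this] have "AE t in lborel. AE x in lborel. h (t, x) = h' (t, x)" .
  with lborel_Fubini_fst(1)[OF i]
  show "AE t in lborel. integrable lebesgue (%x. h (t, x)) & (LINT x|lebesgue. h (t, x)) = E t"
  proof eventually_elim
   case (elim t)
   have m: "(%x. h' (t, x)) : bmeas lborel" using elim(1) by auto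
   have mL: "(%x. h' (t, x)) : bmeas lebesgue" using m by (rule measurable_completion)
   have ae: "AE x in lebesgue. h' (t, x) = h (t, x)" using AE_completion[OF elim(2)] by eventually_elim simp
   have iL: "integrable lebesgue (%x. h' (t, x))" using integrable_completion[OF m] elim(1) by simp
   have hL: "(%x. h (t, x)) : bmeas lebesgue"
    by (rule bmeas_cong_AE[of UNIV, unfolded lebesgue_on_UNIV_eq, OF _ mL ae]) simp
   have "(LINT x|lebesgue. h (t, x)) = (LINT x|lebesgue. h' (t, x))"
    by (rule integral_cong_AE[OF hL mL]) (use ae in \<open>auto elim: eventually_mono\<close>)
   also have "... = E t" unfolding E_def by (rule integral_completion[OF m])
   finally show ?case using integrable_cong_AE_imp[OF iL hL] ae by (auto elim: eventually_mono)
  qed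
  fix ps :: "real => real" assume "ps : bmeas borel" "\<exists>B. \<forall>t. \<bar>ps t\<bar> <= B"
  then obtain B where ps: "ps : bmeas borel" "!!t. \<bar>ps t\<bar> <= B" by auto
  have psf: "(%z::real \<times> 'y. ps (fst z)) : bmeas borel"
   by (rule measurable_compose[OF _ ps(1)]) (intro bmeas_contI continuous_intros)
  have i2: "integrable lborel (%z. ps (fst z) * h' z)"
   by (rule integrable_bounded_mult[OF i, of _ B]) (use psf ps(2) in auto)
  have "(LBINT t. ps t * E t) = (LBINT t. (LBINT x. ps (fst (t, x)) * h' (t, x)))" by (simp add: E_def)
  also have "... = (LBINT z. ps (fst z) * h' z)" by (rule lborel_Fubini_fst(3)[OF i2])
  also have "... = (LINT z|lebesgue. ps (fst z) * h' z)" by (rule integral_completion[symmetric]) (use i2 in auto)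
  also have "... = (LINT z|lebesgue. ps (fst z) * h z)"
  proof (rule integral_cong_AE)
   have psL: "(%z::real \<times> 'y. ps (fst z)) : bmeas lebesgue" using psf by (intro measurable_completion) simp
   show "(%z. ps (fst z) * h' z) : bmeas lebesgue" using psL h'L by measurable
   show "(%z. ps (fst z) * h z) : bmeas lebesgue" using psL h by measurable
   show "AE z in lebesgue. ps (fst z) * h' z = ps (fst z) * h z" using AE_completion[OF h'(2)] by eventually_elim simp
  qed
  finally show "(LBINT t. ps t * E t) = (LINT z|lebesgue. ps (fst z) * h z)" .
 qed
qed

text \<open>The equation is multiplied by a product of a time function and \<open>phh\<close>, the
  space derivatives are moved to \<open>phh\<close>, and the resulting function of t vanishes
  because the time function is arbitrary. The exceptional times depend on \<open>phh\<close>, so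
  later only countably many \<open>phh\<close> can be treated at once.\<close>

lemma continuity_equation_slice:
 fixes rh :: "real \<times> (real^3) => real" and u :: "real \<times> (real^3) => real^3"
 assumes ce: "continuity_equation rh u" and phh: "test_fun Omega phh"
 shows "AE t in lborel. 0 < t --> (LINT x|lebesgue. phh x * Dt rh (t, x)) =
   (LINT x|lebesgue. rh (t, x) * (\<Sum>j\<in>UNIV. frd phh (at x) (axis j 1) * u (t, x) $ j))"
proof -
 let ?m = "%j z. rh z * u z $ j"
 have w0: "weak_deriv SpaceTime e_t rh (Dt rh)"
 proof -
  have "weakly_diff SpaceTime e_t rh" using ce by (simp add: continuity_equation_def)
  then show ?thesis unfolding weakly_diff_def wd_def by (rule someI_ex)
 qed
 have wj: "weak_deriv SpaceTime (e_x j) (?m j) (Dx j (?m j))" for j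
 proof -
  have "weakly_diff SpaceTime (e_x j) (?m j)" using ce by (simp add: continuity_equation_def)
  then show ?thesis unfolding weakly_diff_def wd_def by (rule someI_ex)
 qed
 have ae: "AE z in lebesgue. z : SpaceTime --> Dt rh z + (\<Sum>j\<in>UNIV. Dx j (?m j) z) = 0"
  using ce open_Omega by (auto simp: continuity_equation_def AE_restrict_space_iff borel_open open_Times)
 have BB: "e_x j : Basis" for j by (simp add: Basis_prod_def)
 obtain K where K: "compact K" "K <= Omega" "!!x. x ~: K ==> phh x = 0" using test_fun_support[OF phh] by metis
 have fr0: "frd phh (at x) b = 0" if "x ~: K" for x b
  by (rule frechet_derivative_outside[OF compact_imp_closed[OF K(1)] K(3) that])
 have cphi: "continuous_on UNIV phh" by (rule test_fun_continuous[OF phh])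
 have cfr: "continuous_on UNIV (%x. frd phh (at x) (axis j 1))" for j
  by (rule smooth_frechet_continuous[OF test_fun_smooth[OF phh]]) simp
 have weak: "(LINT z|lebesgue. (\<chi>' (fst z) * phh (snd z)) * Dt rh z - (\<Sum>j\<in>UNIV. \<chi>' (fst z) * frd phh (at (snd z)) (axis j 1) * ?m j z)) = 0"
  if t: "test_fun {0<..} \<chi>'" for \<chi>' :: "real => real"
 proof -
  let ?Ps = "%z. \<chi>' (fst z) * phh (snd z)"
  have T: "test_fun SpaceTime ?Ps" by (rule test_fun_tensor[OF t phh])
  note fe = frechet_tensor(2)[OF test_fun_smooth[OF t] test_fun_smooth[OF phh]]
  note d = weak_derivD[OF wj T BB, unfolded fe, simplified]
  have i0: "integrable lebesgue (%z. ?Ps z * Dt rh z)"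
   using weak_derivD(2)[OF w0 T] by (simp add: Basis_prod_def)
  have "(LINT z|lebesgue. ?Ps z * Dt rh z) = (LINT z|lebesgue. - (\<Sum>j\<in>UNIV. ?Ps z * Dx j (?m j) z))"
  proof (rule integral_cong_AE)
   show "(%z. ?Ps z * Dt rh z) : bmeas lebesgue" using i0 by auto
   show "(%z. - (\<Sum>j\<in>UNIV. ?Ps z * Dx j (?m j) z)) : bmeas lebesgue"
    using d(2) by (intro borel_measurable_uminus borel_measurable_sum) auto
   show "AE z in lebesgue. ?Ps z * Dt rh z = - (\<Sum>j\<in>UNIV. ?Ps z * Dx j (?m j) z)"
    using ae
   proof eventually_elim
    case (elim z)
    show ?case
    proof (cases "z : SpaceTime")
     case True
     then have "Dt rh z = - (\<Sum>j\<in>UNIV. Dx j (?m j) z)" using elim by simp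
     then have "?Ps z * Dt rh z = - (?Ps z * (\<Sum>j\<in>UNIV. Dx j (?m j) z))" by simp
     then show ?thesis by (simp only: sum_distrib_left)
    next
     case False
     then have "?Ps z = 0" using test_fun_support[OF T] by (metis subsetD)
     then show ?thesis by (simp only: mult_zero_left sum.neutral_const minus_zero)
    qed
   qed
  qed
  also have "... = - (\<Sum>j\<in>UNIV. \<integral>z. ?Ps z * Dx j (?m j) z \<partial>lebesgue)"
   using d(2) by (simp add: Bochner_Integration.integral_sum)
  also have "... = (\<Sum>j\<in>UNIV. \<integral>z. \<chi>' (fst z) * frd phh (at (snd z)) (axis j 1) * ?m j z \<partial>lebesgue)"
   using d(3) by (simp add: sum_negf)
  finally show ?thesis using i0 d(1) by (simp add: Bochner_Integration.integral_sum Bochner_Integration.integral_diff)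
 qed
 have loc: "AE t in lborel. t : {a<..<b} --> (LINT x|lebesgue. phh x * Dt rh (t, x)) =
   (LINT x|lebesgue. rh (t, x) * (\<Sum>j\<in>UNIV. frd phh (at x) (axis j 1) * u (t, x) $ j))"
  if ab: "0 < a" "a < b" for a b :: real
 proof -
  \<comment> \<open>In space-time the weak derivatives are only locally integrable; a time cut-off
    that is positive on (a, b) makes all terms integrable and is divided out at the end.\<close>
  let ?thh = "bump 1 a b"
  define h where "h z = (?thh (fst z) * phh (snd z)) * Dt rh z - (\<Sum>j\<in>UNIV. ?thh (fst z) * frd phh (at (snd z)) (axis j 1) * ?m j z)" for z
  have tthh: "test_fun {0<..} ?thh" by (rule test_fun_bump) (use ab in auto)
  have T: "test_fun SpaceTime (%z. ?thh (fst z) * phh (snd z))" by (rule test_fun_tensor[OF tthh phh])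
  note fe = frechet_tensor(2)[OF test_fun_smooth[OF tthh] test_fun_smooth[OF phh]]
  have i0: "integrable lebesgue (%z. (?thh (fst z) * phh (snd z)) * Dt rh z)"
   using weak_derivD(2)[OF w0 T] by (simp add: Basis_prod_def)
  have ij: "integrable lebesgue (%z. ?thh (fst z) * frd phh (at (snd z)) (axis j 1) * ?m j z)" for j
   using weak_derivD(1)[OF wj T BB, of j, unfolded fe] by simp
  have hi: "integrable lebesgue h" unfolding h_def[abs_def]
   by (intro Bochner_Integration.integrable_diff i0 Bochner_Integration.integrable_sum ij)
  obtain E where E: "integrable lborel E"
   "AE t in lborel. integrable lebesgue (%x. h (t, x)) & (LINT x|lebesgue. h (t, x)) = E t"
   "\<forall>ps\<in>borel_measurable borel. (\<exists>B. \<forall>t. \<bar>ps t\<bar> <= B) --> (LBINT t. ps t * E t) = (LINT z|lebesgue. ps (fst z) * h z)"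
   using lebesgue_slices[OF hi] by (elim exE conjE)
  have "AE t in lborel. t : {a<..<b} --> E t = 0"
  proof (rule AE_zero_of_bump_integrals[OF E(1)])
   fix n and c d :: real assume cd: "cbox c d <= {a<..<b}"
   have "test_fun {0<..} (%s. bump n c d s * ?thh s)" by (rule test_fun_mult_smooth[OF tthh smooth_bump_id])
   note e = weak[OF this]
   have "(LBINT t. bump n c d t * E t) = (LINT z|lebesgue. bump n c d (fst z) * h z)"
    by (rule E(3)[rule_format]) (use bump_bounds[of n c d] in \<open>auto intro!: exI[of _ 1]\<close>)
   also have "... = 0"
    by (rule trans[OF Bochner_Integration.integral_cong e]) (simp_all add: h_def right_diff_distrib sum_distrib_left mult_ac)
   finally show "(LBINT t. bump n c d t * E t) = 0" .
  qed simp
  then have ev: "AE t in lborel. t : {a<..<b} --> integrable lebesgue (%x. h (t, x)) & (LINT x|lebesgue. h (t, x)) = 0"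
   using E(2) by eventually_elim simp
  \<comment> \<open>On almost every slice the first term is integrable by itself, which is what
    permits splitting the integral of the difference.\<close>
  obtain E0 where E0: "AE t in lborel. integrable lebesgue (%x. (?thh (fst (t, x)) * phh (snd (t, x))) * Dt rh (t, x)) & (LINT x|lebesgue. (?thh (fst (t, x)) * phh (snd (t, x))) * Dt rh (t, x)) = E0 t"
   using lebesgue_slices[OF i0] by (elim exE conjE)
  show ?thesis using ev E0
  proof eventually_elim
   case (elim t)
   show ?case
   proof
    assume t: "t : {a<..<b}"
    have th: "?thh t > 0" using t by (intro bump_pos) (auto simp: box_real)
    let ?A = "%x. phh x * Dt rh (t, x)"
    let ?S = "%x. rh (t, x) * (\<Sum>j\<in>UNIV. frd phh (at x) (axis j 1) * u (t, x) $ j)"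
    have h: "h (t, x) = ?thh t * (?A x - ?S x)" for x
     by (simp add: h_def right_diff_distrib sum_distrib_left mult_ac)
    have A: "integrable lebesgue ?A" using conjunct1[OF elim(2)] th by (simp add: mult.assoc)
    have hh: "integrable lebesgue (%x. ?A x - ?S x)" "(LINT x|lebesgue. ?A x - ?S x) = 0"
     using elim(1)[rule_format, OF t] th unfolding h by simp_all
    have S: "integrable lebesgue ?S" using Bochner_Integration.integrable_diff[OF A hh(1)] by simp
    show "(LINT x|lebesgue. ?A x) = (LINT x|lebesgue. ?S x)"
     using hh(2) Bochner_Integration.integral_diff[OF A S] by simp
   qed
  qed
 qed
 have "AE t in lborel. \<forall>n::nat. t : {1 / (real n + 1)<..<real n + 2} --> (LINT x|lebesgue. phh x * Dt rh (t, x)) =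
   (LINT x|lebesgue. rh (t, x) * (\<Sum>j\<in>UNIV. frd phh (at x) (axis j 1) * u (t, x) $ j))"
 proof (subst AE_all_countable, rule allI, rule loc)
  fix n :: nat
  show "0 < 1 / (real n + 1)" by simp
  have "1 / (real n + 1) <= 1" by simp
  then show "1 / (real n + 1) < real n + 2" by linarith
 qed
 then show ?thesis
 proof eventually_elim
  case (elim t)
  show ?case
  proof
   assume t: "0 < t"
   obtain n :: nat where n: "max (1/t) t < real n" using reals_Archimedean2 by blast
   then have "1 / t < real n + 1" by simp
   then have "1 / (real n + 1) < t" using t by (simp add: field_simps)
   then show "(LINT x|lebesgue. phh x * Dt rh (t, x)) =
     (LINT x|lebesgue. rh (t, x) * (\<Sum>j\<in>UNIV. frd phh (at x) (axis j 1) * u (t, x) $ j))"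
    using elim[rule_format, of n] n by simp
  qed
 qed
qed

lemma lborel_tensor:
 fixes f :: "real => real" and g :: "real => real"
 assumes f: "integrable lborel f" and g: "integrable lborel g"
 shows "integrable lborel (%p. f (fst p) * g (snd p))" "(LBINT p. f (fst p) * g (snd p)) = (LBINT s. f s) * (LBINT y. g y)"
proof -
 have fm: "f : bmeas lborel" "g : bmeas lborel" using f g by auto
 have m: "(%p. f (fst p) * g (snd p)) : bmeas (lborel \<Otimes>\<^sub>M lborel)" using fm by measurable
 have "integrable (lborel \<Otimes>\<^sub>M lborel) (%p. f (fst p) * g (snd p))"
  by (rule lborel_pair.Fubini_integrable[OF m]) (use f g in \<open>simp_all add: abs_mult\<close>)
 then show i: "integrable lborel (%p. f (fst p) * g (snd p))" unfolding lborel_prod .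
 show "(LBINT p. f (fst p) * g (snd p)) = (LBINT s. f s) * (LBINT y. g y)"
  using lborel_Fubini_fst(3)[OF i] by simp
qed

text \<open>\<open>AC_on_lines\<close> needs a transversal variable. A dummy variable y with weight
  \<open>idc {0<..<1}\<close> supplies one, and a single good y is selected at the end.\<close>

lemma AC_of_weak_derivative:
 fixes Ph phh :: "real => real"
 assumes i: "integrable lborel Ph" "integrable lborel phh" and ab: "a < b"
  and weak: "!!ps. test_fun {a<..<b} ps ==> (LBINT s. deriv ps s * Ph s) = - (LBINT s. ps s * phh s)"
 shows "AC a b Ph phh"
proof -
 let ?I = "idc {0<..<1} :: real => real"
 have I: "integrable lborel ?I" by (rule integrable_real_indicator) auto
 have bI: "integrable lborel (%y. bump n c d y * ?I y)" for n c d
  by (rule integrable_bounded_mult[OF I, of _ 1]) (use bump_bounds[of n c d] in auto)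
 have tI: "integrable lborel (%s. ps s * f s)" if t: "test_fun U ps" and f: "integrable lborel f" for ps f :: "real => real" and U
 proof -
  obtain C where "!!x. \<bar>ps x\<bar> <= C" using test_fun_bounded[OF t] by metis
  then show ?thesis by (intro integrable_bounded_mult[OF f, of _ C]) (use test_fun_measurable[OF t] in auto)
 qed
 have "AE y in lborel. y : {0<..<1::real} --> AC a b (%s. Ph (fst (s, y)) * ?I (snd (s, y))) (%s. phh (fst (s, y)) * ?I (snd (s, y)))"
 proof (rule AC_on_lines[OF lborel_tensor(1)[OF i(1) I] lborel_tensor(1)[OF i(2) I] _ ab])
  fix ps and n and c d :: real assume t: "test_fun {a<..<b} ps"
  have "(LBINT p. deriv ps (fst p) * bump n c d (snd p) * (Ph (fst p) * ?I (snd p))) =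
    (LBINT s. deriv ps s * Ph s) * (LBINT y. bump n c d y * ?I y)"
   using lborel_tensor(2)[OF tI[OF test_fun_deriv[OF t] i(1)] bI[of n c d]] by (simp add: mult_ac)
  moreover have "(LBINT p. ps (fst p) * bump n c d (snd p) * (phh (fst p) * ?I (snd p))) =
    (LBINT s. ps s * phh s) * (LBINT y. bump n c d y * ?I y)"
   using lborel_tensor(2)[OF tI[OF t i(2)] bI[of n c d]] by (simp add: mult_ac)
  ultimately show "(LBINT p. deriv ps (fst p) * bump n c d (snd p) * (Ph (fst p) * ?I (snd p))) =
    - (LBINT p. ps (fst p) * bump n c d (snd p) * (phh (fst p) * ?I (snd p)))"
   using weak[OF t] by simp
 qed simp
 then obtain y :: real where "y : {0<..<1}" "y : {0<..<1::real} --> AC a b (%s. Ph (fst (s, y)) * ?I (snd (s, y))) (%s. phh (fst (s, y)) * ?I (snd (s, y)))"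
  by (rule AE_lborel_ex_open[of _ "{0<..<1}"]) auto
 then show ?thesis by simp
qed

lemma integral_lebesgue_lborel:
 fixes f f' :: "'a::euclidean_space => real"
 assumes m: "f' : bmeas borel" and ae: "AE x in lborel. f x = f' x"
 shows "(LINT x|lebesgue. f x) = (LBINT x. f' x)"
proof -
 have mb: "f' : bmeas lborel" using m by simp
 have mL: "f' : bmeas lebesgue" using mb by (rule measurable_completion)
 have ae': "AE x in lebesgue. f' x = f x" using AE_completion[OF ae] by eventually_elim simp
 have fL: "f : bmeas lebesgue"
  by (rule bmeas_cong_AE[of UNIV, unfolded lebesgue_on_UNIV_eq, OF _ mL ae']) simp
 have "(LINT x|lebesgue. f x) = (LINT x|lebesgue. f' x)"
  by (rule integral_cong_AE[OF fL mL]) (use ae' in \<open>auto elim: eventually_mono\<close>)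
 also have "... = (LBINT x. f' x)" by (rule integral_completion[OF mb])
 finally show ?thesis .
qed

lemma integrable_lebesgue_borel_rep:
 fixes f :: "'a::euclidean_space => real"
 assumes f: "integrable lebesgue f"
 shows "\<exists>f'. f' : bmeas borel & integrable lborel f' & (AE x in lborel. f x = f' x)"
proof -
 have "f : bmeas lebesgue" using f by auto
 then obtain f' where f': "f' : bmeas lborel" "AE x in lborel. f x = f' x"
  using completion_ex_borel_measurable_real by blast
 have "integrable lborel f'"
  using integrable_cong_AE_imp[OF f measurable_completion[OF f'(1)]] AE_completion[OF f'(2)] integrable_completion[OF f'(1)]
  by (auto elim: eventually_mono)
 then show ?thesis using f' by (intro exI[of _ f'] conjI) simp_all
qed

lemma Cell0_borel: "open Cell0"
proof -
 have e: "Cell0 = Omega \<inter> {x. 0 < x$3} \<inter> {x. x$3 < 1}" by (auto simp: Cell0_def)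
 show ?thesis unfolding e by (intro open_Int open_Omega open_Collect_less continuous_intros)
qed

lemma AE_Cell_Cell0: "AE x in lborel. x : Cell --> x : Cell0"
proof -
 have "AE x in lborel. x ~: {x::real^3. x$3 = 0}"
  by (rule AE_lborel_not_in_negligible[OF hyperplane_negligible])
 then show ?thesis by eventually_elim (auto simp: Cell_def Cell0_def order.strict_iff_order)
qed

lemma AE_prod_fst:
 assumes "AE z in (lborel :: ('x::euclidean_space \<times> 'y::euclidean_space) measure). Q z"
 shows "AE t in lborel. AE x in lborel. Q (t, x)"
proof -
 have "AE z in (lborel \<Otimes>\<^sub>M lborel). Q z" using assms unfolding lborel_prod .
 from lborel_pair.AE_pair[OF this] show ?thesis .
qed

section \<open>Differentiating integrals of the renormalized density in time\<close>

context C1_halfline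
begin

text \<open>For almost every x the density is absolutely continuous in time, so the chain rule holds
  on its time line. Tested against a function of t and integrated over x, this gives the weak
  derivative of the integral, which \<open>AC_of_weak_derivative\<close> turns back into absolute
  continuity.\<close>

lemma time_AC:
 fixes rh sg :: "real \<times> (real^3) => real"
 assumes T: "T > 0"
  and irh: "integrable lebesgue (%z. idc ({0<..<T} \<times> Cell) z * rh z)"
  and isg: "integrable lebesgue (%z. idc ({0<..<T} \<times> Cell) z * sg z)"
  and w: "weak_deriv SpaceTime e_t rh sg"
  and nn: "AE z in lborel. z : {0<..<T} \<times> Cell --> 0 <= rh z"
 shows "AC 0 T (%t. \<integral>x. H (max (rh (t, x)) 0) \<partial>cellM) (%t. \<integral>x. H' (max (rh (t, x)) 0) * sg (t, x) \<partial>cellM)"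
proof -
 let ?P = "{0<..<T} \<times> Cell"
 obtain F where F: "F : bmeas borel" "integrable lborel F" "AE z in lborel. idc ?P z * rh z = F z"
  using integrable_lebesgue_borel_rep[OF irh] by auto
 obtain G where G: "G : bmeas borel" "integrable lborel G" "AE z in lborel. idc ?P z * sg z = G z"
  using integrable_lebesgue_borel_rep[OF isg] by auto
 note [measurable] = F(1) G(1)
 have Fnn: "AE z in lborel. F z >= 0" 
  using F(3) nn
 proof eventually_elim
  case (elim z)
  then show ?case by (cases "z : ?P") (simp_all add: indicator_def)
 qed
 have lines: "AE x in lborel. x : Cell0 --> AC 0 T (%s. F (s, x)) (%s. G (s, x))"
 proof (rule AC_on_lines[OF F(2) G(2) Cell0_borel T])
  fix ps and n and c d :: "real^3" assume t: "test_fun {0<..<T} ps" and cd: "cbox c d <= Cell0"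
  have tb: "test_fun Cell0 (bump n c d)" by (rule test_fun_bump[OF cd])
  have "test_fun ({0<..<T} \<times> Cell0) (%z. ps (fst z) * bump n c d (snd z))" by (rule test_fun_tensor[OF t tb])
  then have TT: "test_fun SpaceTime (%z. ps (fst z) * bump n c d (snd z))"
   by (rule test_fun_mono) (auto simp: Cell0_def)
  have b: "e_t : Basis" by (simp add: Basis_prod_def)
  note d = weak_derivD(3)[OF w TT b, unfolded frechet_tensor(1)[OF test_fun_smooth[OF t] smooth_bump_id] real_scaleR_def]
  have z: "et (fst z) * bump n c d (snd z) = 0" if "z ~: ?P" "!!s. s ~: {0<..<T} ==> et s = 0" for z and et :: "real => real"
  proof (cases "fst z : {0<..<T}")
   case True
   then have "snd z ~: cbox c d" using that(1) cd Cell0_subset(1) by (cases z) auto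
   then show ?thesis using bump_outside[of "snd z" c d n] box_subset_cbox[of c d] by auto
  qed (simp add: that)
  have zps: "ps s = 0" if "s ~: {0<..<T}" for s using test_fun_support[OF t] that by (metis subsetD)
  have zd: "deriv ps s = 0" if "s ~: {0<..<T}" for s using test_fun_support[OF test_fun_deriv[OF t]] that by (metis subsetD)
  have [measurable]: "ps : bmeas borel" "deriv ps : bmeas borel"
   by (rule test_fun_measurable[OF t] test_fun_measurable[OF test_fun_deriv[OF t]])+
  have [measurable]: "(fst :: real \<times> (real^3) => real) : bmeas borel" "(snd :: real \<times> (real^3) => real^3) : bmeas borel"
   by (intro bmeas_contI continuous_intros)+
  have 1: "(LINT z|lebesgue. deriv ps (fst z) * bump n c d (snd z) * rh z) = (LBINT z. deriv ps (fst z) * bump n c d (snd z) * F z)"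
  proof (rule integral_lebesgue_lborel)
   show "AE z in lborel. deriv ps (fst z) * bump n c d (snd z) * rh z = deriv ps (fst z) * bump n c d (snd z) * F z"
    using F(3)
   proof eventually_elim
    case (elim z)
    then show ?case using z[of z "deriv ps", OF _ zd] by (cases "z : ?P") auto
   qed
  qed measurable
  have 2: "(LINT z|lebesgue. ps (fst z) * bump n c d (snd z) * sg z) = (LBINT z. ps (fst z) * bump n c d (snd z) * G z)"
  proof (rule integral_lebesgue_lborel)
   show "AE z in lborel. ps (fst z) * bump n c d (snd z) * sg z = ps (fst z) * bump n c d (snd z) * G z"
    using G(3)
   proof eventually_elim
    case (elim z)
    then show ?case using z[of z ps, OF _ zps] by (cases "z : ?P") auto
   qed
  qed measurable
  show "(LBINT p. deriv ps (fst p) * bump n c d (snd p) * F p) = - (LBINT p. ps (fst p) * bump n c d (snd p) * G p)"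
   using d unfolding 1 2 .
 qed
 let ?K = "%y. H (max y 0)" and ?K' = "%y. H' (max y 0)"
 have Km: "(%z. ?K (F z)) : bmeas borel" "(%z. ?K' (F z)) : bmeas borel" by measurable
 have Pb: "?P : sets borel" by (intro borel_Times Cell_borel) auto
 have Pi: "integrable lborel (idc ?P :: real \<times> (real^3) => real)"
 proof (rule integrable_real_indicator)
  have "bounded ?P" by (intro bounded_Times bounded_Cell bounded_subset[OF bounded_closed_interval[of 0 T]]) auto
  then show "emeasure lborel ?P < \<infinity>" by (rule emeasure_bounded_finite)
 qed (use Pb in simp)
 define f where "f z = idc ?P z * ?K (F z)" for z
 define g where "g z = idc ?P z * (?K' (F z) * G z)" for z
 have fm: "f : bmeas borel" "g : bmeas borel"
  unfolding f_def[abs_def] g_def[abs_def] using Km Pb by measurable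
 have fi: "integrable lborel f"
 proof (rule integrable_bd)
  show "integrable lborel (%z. \<bar>H 0\<bar> * idc ?P z + B * \<bar>F z\<bar>)"
   by (intro integrable_plus integrable_mult_right integrable_abs F(2) Pi)
  show "f : bmeas lborel" using fm by simp
  have "\<bar>f z\<bar> <= \<bar>H 0\<bar> * idc ?P z + B * \<bar>F z\<bar>" for z
   using growth[of "F z"] B_nonneg by (cases "z : ?P") (auto simp: f_def)
  then show "AE z in lborel. norm (f z) <= norm (\<bar>H 0\<bar> * idc ?P z + B * \<bar>F z\<bar>)"
   by (intro AE_I2) (auto intro: order_trans[OF _ abs_ge_self])
 qed
 have gi: "integrable lborel g"
 proof -
  have "integrable lborel (%z. (idc ?P z * ?K' (F z)) * G z)"
  proof (rule integrable_bounded_mult[OF G(2), of _ B])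
   show "(%z. idc ?P z * ?K' (F z)) : bmeas lborel" using Km Pb by measurable
   show "\<bar>indicator ?P z * ?K' (F z)\<bar> <= B" for z using bound[of "max (F z) 0"] B_nonneg by (simp add: indicator_def)
  qed
  then show ?thesis by (simp add: g_def[abs_def] mult.assoc)
 qed
 define Ph where "Ph t = (LBINT x. f (t, x))" for t
 define phh where "phh t = (LBINT x. g (t, x))" for t
 have ac: "AC 0 T Ph phh"
 proof (rule AC_of_weak_derivative[OF _ _ T])
  show "integrable lborel Ph" "integrable lborel phh"
   unfolding Ph_def[abs_def] phh_def[abs_def] by (rule lborel_Fubini_fst(2)[OF fi] lborel_Fubini_fst(2)[OF gi])+
  fix ps assume t: "test_fun {0<..<T} ps"
  obtain C1 where C1: "!!x. \<bar>ps x\<bar> <= C1" using test_fun_bounded[OF t] by metis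
  obtain C2 where C2: "!!x. \<bar>deriv ps x\<bar> <= C2" using test_fun_bounded[OF test_fun_deriv[OF t]] by metis
  have [measurable]: "ps : bmeas borel" "deriv ps : bmeas borel"
   by (rule test_fun_measurable[OF t] test_fun_measurable[OF test_fun_deriv[OF t]])+
  have [measurable]: "(fst :: real \<times> (real^3) => real) : bmeas borel" by (intro bmeas_contI continuous_intros)
  have i1: "integrable lborel (%z. deriv ps (fst z) * f z)" by (rule integrable_bounded_mult[OF fi, of _ C2]) (use C2 in auto)
  have i2: "integrable lborel (%z. ps (fst z) * g z)" by (rule integrable_bounded_mult[OF gi, of _ C1]) (use C1 in auto)
  let ?s = "%z. ps (fst z) * g z + deriv ps (fst z) * f z"
  have isum: "integrable lborel ?s" by (intro integrable_plus i1 i2)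
  \<comment> \<open>On almost every time line \<open>f\<close> has derivative \<open>g\<close> by
    the chain rule, so integration by parts against \<open>ps\<close> gives 0; Fubini in the other
    order then yields the weak equation for \<open>Ph\<close> and \<open>phh\<close>.\<close>
  have "AE x in lborel. (LBINT s. ?s (s, x)) = 0"
   using lines AE_Cell_Cell0 AE_lborel_prod_snd[OF Fnn] lborel_Fubini_snd(1)[OF isum]
  proof eventually_elim
   case (elim x)
   show ?case
   proof (cases "x : Cell")
    case True
    then have acx: "AC 0 T (%s. F (s, x)) (%s. G (s, x))" using elim by simp
    have nnx: "AE s in lebesgue. s : {0<..<T} --> F (s, x) : {0..}" using AE_completion[OF elim(3)] by eventually_elim simp
    have c: "AC 0 T (%s. H (F (s, x))) (%s. H' (F (s, x)) * G (s, x))"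
     by (rule AC_chain[OF acx T nnx _ _ cont]) (use der in auto)
    have "AC 0 T (%s. f (s, x)) (%s. g (s, x))"
     by (rule AC_cong[OF c]) (use nnx True in \<open>auto simp: f_def g_def elim!: eventually_mono\<close>)
    note z = integrate_by_parts_test[OF this t T]
    have e: "(%s. idc {0<..<T} s * ?s (s, x)) = (%s. ?s (s, x))" by (rule ext) (simp add: f_def g_def indicator_def)
    have "integrable lborel (%s. idc {0<..<T} s * ?s (s, x))" unfolding e by (rule elim(4))
    from integral_section_eq[OF this, unfolded e] show ?thesis using z by simp
   qed (simp add: f_def g_def)
  qed
  then have "(LBINT x. (LBINT s. ?s (s, x))) = 0" by (rule integral_eq_zero_AE)
  then have 0: "(LBINT z. ?s z) = 0" using lborel_Fubini_snd(3)[OF isum] by simp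
  have "(LBINT s. ps s * phh s) = (LBINT z. ps (fst z) * g z)"
   using lborel_Fubini_fst(3)[OF i2] by (simp add: phh_def)
  moreover have "(LBINT s. deriv ps s * Ph s) = (LBINT z. deriv ps (fst z) * f z)"
   using lborel_Fubini_fst(3)[OF i1] by (simp add: Ph_def)
  ultimately show "(LBINT s. deriv ps s * Ph s) = - (LBINT s. ps s * phh s)"
   using 0 i1 i2 by simp
 qed
 have sl: "AE t in lborel. t : {0<..<T} -->
   Ph t = (LINT x|cellM. ?K (rh (t, x))) & phh t = (LINT x|cellM. ?K' (rh (t, x)) * sg (t, x))"
  using AE_prod_fst[OF F(3)] AE_prod_fst[OF G(3)]
 proof eventually_elim
  case (elim t)
  show ?case
  proof
   assume t: "t : {0<..<T}"
   have sm: "(%x. h (t, x)) : bmeas borel" if "h : bmeas borel" for h :: "real \<times> (real^3) => real"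
    by (rule measurable_compose[OF _ that]) (intro bmeas_contI continuous_intros)
   have r: "(LINT x|cellM. h x) = (LINT x|lebesgue. idc Cell x * h x)" for h :: "real^3 => real"
    using integral_restrict_space[of Cell lebesgue h] by simp
   have "(LINT x|lebesgue. idc Cell x * ?K (rh (t, x))) = Ph t" unfolding Ph_def
   proof (rule integral_lebesgue_lborel[OF sm[OF fm(1)]])
    show "AE x in lborel. idc Cell x * ?K (rh (t, x)) = f (t, x)"
     using elim(1) by eventually_elim (use t in \<open>auto simp: f_def indicator_def split: if_splits\<close>)
   qed
   moreover have "(LINT x|lebesgue. idc Cell x * (?K' (rh (t, x)) * sg (t, x))) = phh t" unfolding phh_def
   proof (rule integral_lebesgue_lborel[OF sm[OF fm(2)]])
    show "AE x in lborel. idc Cell x * (?K' (rh (t, x)) * sg (t, x)) = g (t, x)"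
     using elim by eventually_elim (use t in \<open>auto simp: g_def indicator_def split: if_splits\<close>)
   qed
   ultimately show "Ph t = (LINT x|cellM. ?K (rh (t, x))) & phh t = (LINT x|cellM. ?K' (rh (t, x)) * sg (t, x))"
    by (simp add: r)
  qed
 qed
 show ?thesis
  by (rule AC_cong[OF ac]) (use AE_completion[OF sl] in \<open>auto elim!: eventually_mono\<close>)
qed

end

text \<open>Local integrability gives measurability on compact sets; finite unions of rational boxes
  form an increasing sequence of compact sets exhausting \<open>U\<close>, and the restrictions
  converge pointwise.\<close>

lemma locally_integrable_measurable:
 fixes f :: "'a::euclidean_space => real"
 assumes f: "locally_integrable U f" and U: "open U"
 shows "(%x. idc U x * f x) : bmeas lebesgue"
proof (cases "U = {}")
 case False
 let ?C = "{(c, e). rat_pt c & rat_pt e & cbox c e <= U}"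
 have cC: "countable ?C"
  by (rule countable_subset[of _ "{c. rat_pt c} \<times> {c. rat_pt c}"])
    (auto intro: countable_rat_pts countable_SIGMA)
 have ex: "\<exists>z\<in>?C. x : cbox (fst z) (snd z)" if x: "x : U" for x
 proof -
  obtain c d where cd: "rat_pt c" "rat_pt d" "x : box c d" "cbox c d <= U"
   by (rule open_rational_boxes[OF U x])
  then show ?thesis using box_subset_cbox[of c d] by (intro bexI[of _ "(c, d)"]) auto
 qed
 then have ne: "?C ~= {}" using False by blast
 define b where "b n = from_nat_into ?C n" for n
 have b: "b n : ?C" for n unfolding b_def by (rule from_nat_into[OF ne])
 define A where "A n = (\<Union>i\<le>n. cbox (fst (b i)) (snd (b i)))" for n
 have A: "compact (A n)" "A n <= U" for n using b by (auto simp: A_def case_prod_beta intro!: compact_UN)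
 have m: "(%x. idc (A n) x * f x) : bmeas lebesgue" for n
 proof -
  have "f absolutely_integrable_on A n" using f A by (auto simp: locally_integrable_def)
  then have "integrable lebesgue (%x. idc (A n) x * f x)" by (simp add: set_integrable_def)
  then show ?thesis by auto
 qed
 show ?thesis
 proof (rule borel_measurable_LIMSEQ_real[OF _ m])
  fix x
  show "(%n. idc (A n) x * f x) \<longlonglongrightarrow> idc U x * f x"
  proof (rule tendsto_eventually)
   show "\<forall>\<^sub>F n in sequentially. idc (A n) x * f x = idc U x * f x"
   proof (cases "x : U")
    case True
    then obtain z where z: "z : ?C" "x : cbox (fst z) (snd z)" using ex by blast
    obtain i where i: "b i = z" using from_nat_into_surj[OF cC z(1)] by (auto simp: b_def)
    have "x : A n" if "n >= i" for n using z(2) i that by (auto simp: A_def)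
    then show ?thesis using True by (intro eventually_sequentiallyI[of i]) (simp add: indicator_def)
   next
    case False
    then have "x ~: A n" for n using A(2) by blast
    then show ?thesis using False by simp
   qed
  qed
 qed
qed simp

text \<open>Tonelli's theorem: the slice norms are bounded uniformly on a bounded time interval.
  Joint measurability is a separate hypothesis because it does not follow from measurable
  slices.\<close>

lemma integrable_of_slices:
 fixes h :: "real \<times> (real^3) => real"
 assumes m: "(%z. idc ({0<..<T} \<times> Cell) z * h z) : bmeas lebesgue"
  and s: "AE t in lborel. t : {0<..<T} --> integrable (cellM) (%x. h (t, x)) & (LINT x|cellM. \<bar>h (t, x)\<bar>) <= M"
 shows "integrable lebesgue (%z. idc ({0<..<T} \<times> Cell) z * h z)"
proof -
 let ?P = "{0<..<T} \<times> Cell"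
 obtain h' where h': "h' : bmeas lborel" "AE z in lborel. idc ?P z * h z = h' z"
  using completion_ex_borel_measurable_real[OF m] by auto
 have sl: "AE t in lborel. (\<integral>\<^sup>+ x. ennreal \<bar>h' (t, x)\<bar> \<partial>lborel) <= ennreal M * idc {0<..<T} t"
  using AE_prod_fst[OF h'(2)] s
 proof eventually_elim
  case (elim t)
  have sm: "(%x. h' (t, x)) : bmeas borel"
   using h'(1) by (intro measurable_compose[of "%x. (t, x)" borel borel h']) (auto intro!: bmeas_contI continuous_intros)
  show ?case
  proof (cases "t : {0<..<T}")
   case True
   then have i: "integrable (cellM) (%x. h (t, x))" "(LINT x|cellM. \<bar>h (t, x)\<bar>) <= M" using elim(2) by auto
   have e: "(\<integral>\<^sup>+ x. ennreal \<bar>h' (t, x)\<bar> \<partial>lborel) = (\<integral>\<^sup>+ x. ennreal \<bar>h' (t, x)\<bar> \<partial>lebesgue)"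
    by (rule nn_integral_completion[symmetric])
   also have "... = (\<integral>\<^sup>+ x. ennreal \<bar>h (t, x)\<bar> * idc Cell x \<partial>lebesgue)"
    by (rule nn_integral_cong_AE) (use AE_completion[OF elim(1)] True in \<open>auto elim!: eventually_mono simp: indicator_def split: if_splits\<close>)
   also have "... = (\<integral>\<^sup>+ x. ennreal \<bar>h (t, x)\<bar> \<partial>cellM)"
    by (rule nn_integral_restrict_space[symmetric]) simp
   also have "... = ennreal (LINT x|cellM. \<bar>h (t, x)\<bar>)"
    by (rule nn_integral_eq_integral) (use i in auto)
   also have "... <= ennreal M" using i(2) by (rule ennreal_leI)
   finally show ?thesis using True by simp
  next
   case False
   have "(\<integral>\<^sup>+ x. ennreal \<bar>h' (t, x)\<bar> \<partial>lborel) = (\<integral>\<^sup>+ x. 0 \<partial>(lborel :: (real^3) measure))"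
    by (rule nn_integral_cong_AE) (use elim(1) False in \<open>auto elim!: eventually_mono simp: indicator_def\<close>)
   then show ?thesis using False by simp
  qed
 qed
 have Ifin: "emeasure lborel {0<..<T} < \<infinity>"
  by (rule emeasure_bounded_finite, rule bounded_subset[OF bounded_closed_interval[of 0 T]]) auto
 have hm: "h' : bmeas (lborel \<Otimes>\<^sub>M lborel)" using h'(1) unfolding lborel_prod .
 have "(\<integral>\<^sup>+ z. ennreal \<bar>h' z\<bar> \<partial>(lborel \<Otimes>\<^sub>M lborel)) = (\<integral>\<^sup>+ t. (\<integral>\<^sup>+ x. ennreal \<bar>h' (t, x)\<bar> \<partial>lborel) \<partial>lborel)"
  by (rule lborel.nn_integral_fst[symmetric]) (use hm in measurable)
 also have "... <= (\<integral>\<^sup>+ t. ennreal M * idc {0<..<T} t \<partial>lborel)" by (rule nn_integral_mono_AE[OF sl])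
 also have "... < \<infinity>" using Ifin by (simp add: nn_integral_cmult ennreal_mult_less_top)
 finally have "integrable lborel h'" unfolding lborel_prod by (intro integrableI_bounded h'(1)) simp
 then have "integrable lebesgue h'" using integrable_completion[OF h'(1)] by simp
 then show ?thesis
  by (rule integrable_cong_AE_imp[OF _ m]) (use AE_completion[OF h'(2)] in \<open>auto elim: eventually_mono\<close>)
qed

text \<open>Going from slices to space-time requires a measurable exceptional set, so the sign is
  checked on a Borel version of \<open>h\<close>.\<close>

lemma AE_nonneg_slices:
 fixes h :: "real \<times> (real^3) => real"
 assumes m: "integrable lebesgue (%z. idc ({0<..<T} \<times> Cell) z * h z)"
  and s: "!!t. t : {0<..<T} ==> AE x in lborel. x : Cell --> 0 <= h (t, x)"
 shows "AE z in lborel. z : {0<..<T} \<times> Cell --> 0 <= h z"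
proof -
 let ?P = "{0<..<T} \<times> Cell"
 obtain h' where h': "h' : bmeas borel" "AE z in lborel. idc ?P z * h z = h' z"
  using integrable_lebesgue_borel_rep[OF m] by auto
 have "AE t in lborel. AE x in lborel. 0 <= h' (t, x)"
  using AE_prod_fst[OF h'(2)]
 proof eventually_elim
  case (elim t)
  show ?case
  proof (cases "t : {0<..<T}")
   case True
   show ?thesis using elim s[OF True]
   proof eventually_elim
    case (elim x)
    then show ?case using True by (cases "x : Cell") auto
   qed
  next
   case False
   show ?thesis using elim by eventually_elim (use False in \<open>auto simp: indicator_def\<close>)
  qed
 qed
 then have "AE z in (lborel \<Otimes>\<^sub>M lborel). 0 <= h' z"
 proof (rule lborel_pair.AE_pair_measure[rotated])
  have "{z. 0 <= h' z} : sets borel" using h'(1) by measurable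
  then have "{z. 0 <= h' z} : sets lborel" by simp
  then show "{z : space (lborel \<Otimes>\<^sub>M lborel). 0 <= h' z} : sets (lborel \<Otimes>\<^sub>M lborel)" unfolding lborel_prod by simp
 qed
 then have "AE z in lborel. 0 <= h' z" unfolding lborel_prod .
 with h'(2) show ?thesis by eventually_elim auto
qed

section \<open>The renormalized equation at one time\<close>

lemma (in C1_halfline) defect_growth:
 "\<bar>H (max y 0) - max y 0 * H' (max y 0)\<bar> <= \<bar>H 0\<bar> + 2 * B * \<bar>y\<bar>"
proof -
 have "\<bar>max y 0 * H' (max y 0)\<bar> <= \<bar>y\<bar> * B" unfolding abs_mult using bound[of "max y 0"] B_nonneg by (intro mult_mono) auto
 then show ?thesis using growth[of y] abs_triangle_ineq4[of "H (max y 0)" "max y 0 * H' (max y 0)"] by (simp add: mult_ac)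
qed

text \<open>All renormalizing functions are quantified inside, so this is a property of one time
  slice and its exceptional times depend on no particular \<open>H\<close>. The second clause is the
  inequality used for Gronwall's argument.\<close>

definition renormalized_slice :: "real => (real^3 => real) => (real^3 => real^3) => (real^3 => real) => bool" where
 "renormalized_slice q X u h \<longleftrightarrow> (\<forall>H H' B. C1_halfline H H' B -->
   (let R = %x. H (max (X x) 0) - max (X x) 0 * H' (max (X x) 0) in
    (LINT x|cellM. H' (max (X x) 0) * h x) = (LINT x|cellM. R x * (\<Sum>j\<in>UNIV. pd j u x $ j)) \<and>
    (\<forall>N>0. Wnorm 2 q u <= ennreal N -->
     \<bar>\<integral>x. H' (max (X x) 0) * h x \<partial>cellM\<bar> <= sup_const q * (9 * N) * (LINT x|cellM. \<bar>R x\<bar>))))"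

text \<open>The regularity of a solution at one time is translated into the hypotheses of
  \<open>slice_identity\<close>. In the second clause the factor of div u is a function of
  \<open>cyl x\<close>, so div u may be replaced by its bounded angular average.\<close>

lemma renormalized_slice:
 fixes X h :: "real^3 => real" and u :: "real^3 => real^3"
 assumes q: "q > 3"
  and ax: "axisymmetric X" and Xnn: "AE x in lebesgue_on Omega. 0 <= X x" and Xper: "periodic_z X"
  and X: "Wnorm 1 q X < \<infinity>" and uper: "periodic_z u" and u: "Wnorm 1 2 u < \<infinity>"
  and bd: "eq_on_bdry (%x. u x \<bullet> normal x) (%x. 0)"
  and hi: "integrable (cellM) h"
  and test: "!!n c d a b. rat_pt c ==> rat_pt d ==> rat_pt a ==> rat_pt b ==> {c..d} <= {1<..<4} ==> {a..b} <= {0<..<1} ==>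
    (let phh = (%x. bump n c d ((x$1)^2 + (x$2)^2) * bump n a b (x$3)) in
    (LINT x|lebesgue. phh x * h x) = (LINT x|lebesgue. X x * (\<Sum>j\<in>UNIV. frd phh (at x) (axis j 1) * u x $ j)))"
 shows "renormalized_slice q X u h"
proof -
 have q0: "q > 0" "q >= 2" using q by auto
 obtain N1 where N1: "N1 > 0" "Wnorm 1 q X <= ennreal N1" by (rule Wnorm_finite_ex[OF X])
 obtain N2 where N2: "N2 > 0" "Wnorm 1 2 u <= ennreal N2" by (rule Wnorm_finite_ex[OF u])
 have WX: "W_power (Suc 0) q X <= ennreal (N1 powr q)" using Wnorm_W_power[OF N1(2)] q0 N1 by simp
 have Wu: "W_power (Suc 0) 2 u <= ennreal (N2 powr 2)" using Wnorm_W_power[OF N2(2)] N2 by simp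
 have X2: "sq_int X" by (rule sq_int_Lnorm[OF Wnorm_Lnorm[OF WX]]) (use q0 N1 in auto)
 have Xd2: "sq_int (pd j X)" for j
  by (rule sq_int_Lnorm[OF Wnorm_Lnorm[OF W_power_pd(2)[OF WX]]]) (use q0 N1 in auto)
 have Xw: "weak_deriv Omega (axis j 1) X (pd j X)" for j by (rule W_power_pd(1)[OF WX]) simp
 have uw: "weak_deriv Omega (axis j 1) u (pd j u)" for j by (rule W_power_pd(1)[OF Wu]) simp
 have u2: "sq_int (%x. u x $ i)" for i by (rule sq_int_Lnorm_component[OF Wnorm_Lnorm[OF Wu]]) (use N2 in auto)
 have ud2: "sq_int (%x. pd j u x $ i)" for i j
  by (rule sq_int_Lnorm_component[OF Wnorm_Lnorm[OF W_power_pd(2)[OF Wu]]]) (use N2 in auto)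
 have XnnC: "AE x in cellM. 0 <= X x" by (rule AE_Omega_Cell[OF Xnn])
 have um: "(%x. u x $ i) : bmeas (cellM)" for i using u2[of i] by (simp add: sq_int_def)
 have Xm: "X : bmeas (cellM)" using X2 by (simp add: sq_int_def)
 have test': "let phh = (%x. bump n c d ((x$1)^2 + (x$2)^2) * bump n a b (x$3)) in
    (LINT x|cellM. phh x * h x) = (LINT x|cellM. X x * (\<Sum>j\<in>UNIV. frd phh (at x) (axis j 1) * u x $ j))"
  if r: "rat_pt c" "rat_pt d" "rat_pt a" "rat_pt b" "{c..d} <= {1<..<4}" "{a..b} <= {0<..<1}" for n c d a b
 proof -
  let ?phh = "%x::real^3. bump n c d ((x$1)^2 + (x$2)^2) * bump n a b (x$3)"
  have t: "test_fun Cell0 ?phh"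
   by (rule test_fun_cyl_product; rule test_fun_bump) (use r in simp_all)
  define K where "K = closure {x. ?phh x ~= 0}"
  have K: "compact K" "K <= Cell0" using t by (simp_all only: test_fun_def K_def)
  have K0: "?phh x = 0" if "x ~: K" for x
  proof (rule ccontr)
   assume "?phh x ~= 0"
   then have "x : {x. ?phh x ~= 0}" by simp
   then show False using that closure_subset[of "{x. ?phh x ~= 0}"] unfolding K_def by (meson subsetD)
  qed
  have fr0: "frd ?phh (at x) b = 0" if "x ~: Cell" for x b
   by (rule frechet_derivative_outside[OF compact_imp_closed[OF K(1)] K0]) (use that K(2) Cell0_subset in auto)
  have p0: "?phh x = 0" if "x ~: Cell" for x by (rule K0) (use that K(2) Cell0_subset in auto)
  have "(LINT x|cellM. ?phh x * h x) = (LINT x|lebesgue. ?phh x * h x)"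
   by (rule integral_lebesgue_on_Cell) (drule p0, simp only: mult_zero_left)
  also have "... = (LINT x|lebesgue. X x * (\<Sum>j\<in>UNIV. frd ?phh (at x) (axis j 1) * u x $ j))"
   using test[OF r, of n] by (simp only: Let_def)
  also have "... = (LINT x|cellM. X x * (\<Sum>j\<in>UNIV. frd ?phh (at x) (axis j 1) * u x $ j))"
   by (rule integral_lebesgue_on_Cell[symmetric]) (simp only: fr0 mult_zero_left mult_zero_right sum.neutral_const not_False_eq_True)
  finally show ?thesis by (simp only: Let_def)
 qed
 let ?D = "%x. \<Sum>j\<in>UNIV. pd j u x $ j"
 have D2: "sq_int ?D" unfolding sum_3 by (intro sq_int_add ud2)
 obtain Gm where Gm: "Gm : bmeas borel" "AE x in cellM. X x = Gm (cyl x)"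
  by (rule axisymmetric_rep[OF ax Xm])
 obtain F where F: "cyl_avg ?D F" using cyl_avg_ex[OF sq_int_integrable[OF D2]] by blast
 show ?thesis
  unfolding renormalized_slice_def Let_def
 proof (intro allI impI conjI)
  fix H H' B assume "C1_halfline H H' B"
  then interpret C1_halfline H H' B .
  let ?R = "%x. H (max (X x) 0) - max (X x) 0 * H' (max (X x) 0)"
  have "(LINT x|cellM. H' (X x) * h x) = (LINT x|cellM. (H (X x) - X x * H' (X x)) * ?D x)"
   by (rule slice_identity[OF ax XnnC Xper Xw X2 Xd2 uper uw u2 ud2 normal_layer[OF bd um] hi test' der cont bound])
  moreover have "(LINT x|cellM. H' (X x) * h x) = (LINT x|cellM. H' (max (X x) 0) * h x)"
   and "(LINT x|cellM. (H (X x) - X x * H' (X x)) * ?D x) = (LINT x|cellM. ?R x * ?D x)"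
  proof -
   have m: "(%x. H' (max (X x) 0) * h x) : bmeas (cellM)" "(%x. ?R x * ?D x) : bmeas (cellM)"
   proof -
    have hm: "h : bmeas (cellM)" and Dm: "?D : bmeas (cellM)"
     using hi D2 by (auto simp only: sq_int_def dest: borel_measurable_integrable)
    have Rm: "?R : bmeas (cellM)" using Xm by measurable
    show "(%x. H' (max (X x) 0) * h x) : bmeas (cellM)" using Xm hm by measurable
    show "(%x. ?R x * ?D x) : bmeas (cellM)" by (rule borel_measurable_times[OF Rm Dm])
   qed
   have ae: "AE x in cellM. H' (max (X x) 0) * h x = H' (X x) * h x"
    "AE x in cellM. ?R x * ?D x = (H (X x) - X x * H' (X x)) * ?D x"
    using XnnC by (eventually_elim, simp)+
   have ae': "AE x in cellM. H' (X x) * h x = H' (max (X x) 0) * h x"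
    "AE x in cellM. (H (X x) - X x * H' (X x)) * ?D x = ?R x * ?D x"
    using XnnC by (eventually_elim, simp)+
   show "(LINT x|cellM. H' (X x) * h x) = (LINT x|cellM. H' (max (X x) 0) * h x)"
    by (rule integral_cong_AE[OF bmeas_cong_AE[OF Cell_lebesgue m(1) ae(1)] m(1) ae'(1)])
   show "(LINT x|cellM. (H (X x) - X x * H' (X x)) * ?D x) = (LINT x|cellM. ?R x * ?D x)"
    by (rule integral_cong_AE[OF bmeas_cong_AE[OF Cell_lebesgue m(2) ae(2)] m(2) ae'(2)])
  qed
  ultimately show 1: "(LINT x|cellM. H' (max (X x) 0) * h x) = (LINT x|cellM. ?R x * ?D x)" by simp
  fix N :: real assume N: "0 < N" "Wnorm 2 q u <= ennreal N"
  let ?k = "%p. H (max (Gm p) 0) - max (Gm p) 0 * H' (max (Gm p) 0)"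
  note [measurable] = Gm(1)
  have km: "?k : bmeas borel" by measurable
  have R2: "sq_int ?R"
  proof -
   have b2: "sq_int (%x. \<bar>H 0\<bar> + (2 * B) * \<bar>X x\<bar>)"
   proof (rule sq_int_add[OF sq_int_const])
    show "sq_int (%x. (2 * B) * \<bar>X x\<bar>)" using X2 by (auto simp: sq_int_def power_mult_distrib)
   qed
   have m: "?R : bmeas (cellM)" using Xm by measurable
   have "integrable (cellM) (%x. (?R x)^2)"
   proof (rule integrable_bd)
    show "integrable (cellM) (%x. (\<bar>H 0\<bar> + (2 * B) * \<bar>X x\<bar>)^2)" using b2 by (simp add: sq_int_def)
    show "(%x. (?R x)^2) : bmeas (cellM)" using m by measurable
    show "AE x in cellM. norm ((?R x)^2) <= norm ((\<bar>H 0\<bar> + (2 * B) * \<bar>X x\<bar>)^2)"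
    proof (rule AE_I2)
     fix x
     have "\<bar>?R x\<bar>^2 <= (\<bar>H 0\<bar> + (2 * B) * \<bar>X x\<bar>)^2" by (rule power_mono[OF defect_growth]) simp
     then show "norm ((?R x)^2) <= norm ((\<bar>H 0\<bar> + (2 * B) * \<bar>X x\<bar>)^2)" by simp
    qed
   qed
   then show ?thesis using m by (simp add: sq_int_def)
  qed
  have Rk: "AE x in cellM. ?R x = ?k (cyl x)" using Gm(2) by eventually_elim simp
  have k2: "sq_int (%x. ?k (cyl x))" by (rule sq_int_cong_AE[OF R2 Rk])
  have e1: "(LINT x|cellM. ?R x * ?D x) = (LINT x|cellM. ?k (cyl x) * ?D x)"
   by (rule integral_cong_AE) (use Rk sq_int_mult[OF R2 D2] sq_int_mult[OF k2 D2] in \<open>auto elim!: eventually_mono\<close>)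
  have e2: "(LINT x|cellM. \<bar>?R x\<bar>) = (LINT x|cellM. \<bar>?k (cyl x)\<bar>)"
  proof (rule integral_cong_AE)
   show "(%x. \<bar>?R x\<bar>) : bmeas (cellM)" "(%x. \<bar>?k (cyl x)\<bar>) : bmeas (cellM)"
    using sq_int_integrable[OF R2] sq_int_integrable[OF k2] by (auto intro!: borel_measurable_abs)
   show "AE x in cellM. \<bar>?R x\<bar> = \<bar>?k (cyl x)\<bar>" using Rk by eventually_elim simp
  qed
  have Fb: "AE p in lborel. p : Rect --> \<bar>F p\<bar> <= sup_const q * (9 * N)"
   by (rule divergence_avg_bound[OF N(2) _ N(1) F]) (use q in simp)
  show "\<bar>\<integral>x. H' (max (X x) 0) * h x \<partial>cellM\<bar> <= sup_const q * (9 * N) * (LINT x|cellM. \<bar>?R x\<bar>)"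
   unfolding 1 e1 e2
   by (rule integral_cyl_pairing_le[OF F Fb km sq_int_mult[OF k2 D2] sq_int_integrable[OF k2]])
 qed
qed

lemma AE_lebesgue_on_imp_lborel:
 assumes "AE t in lebesgue_on S. P t" "S : sets lebesgue"
 shows "AE t in lborel. t : S --> P t"
 by (rule AE_lebesgue_imp_lborel) (use assms in \<open>simp add: AE_restrict_space_iff\<close>)

lemma AC_continuous_eq:
 assumes ac: "AC a b f g" and c: "continuous_on {a..b} f" and ab: "a < b"
 shows "g absolutely_integrable_on {a..b}" "!!s. s : {a..b} ==> f s = f a + integral {a..s} g"
proof -
 obtain k where k: "primitive_ae a b f g k" using AC_ex_primitive[OF ac] by blast
 show g: "g absolutely_integrable_on {a..b}" using k by (simp add: primitive_ae_def)
 have cc: "continuous_on {a..b} (%s. f s - (k + integral {a..s} g))"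
  by (intro continuous_on_diff c primitive_continuous[OF g])
 have e: "f s = k + integral {a..s} g" if "s : {a..b}" for s
 proof -
  have "AE s in lebesgue. s : {a<..<b} --> f s - (k + integral {a..s} g) : {0}"
   using k by (auto simp: primitive_ae_def elim: eventually_mono)
  from AE_interval_continuous_closed[OF this _ cc ab that] show ?thesis by simp
 qed
 have "f a = k" using e[of a] ab by simp
 then show "f s = f a + integral {a..s} g" if "s : {a..b}" for s using e[OF that] by simp
qed

lemma C1_halfline_id: "C1_halfline (%y. y) (%_. 1) 1"
 by unfold_locales (auto intro!: derivative_eq_intros)

text \<open>The shift \<open>ep\<close> keeps the inverse power and its derivative bounded up to
  vacuum, so negative powers of the density become admissible.\<close>

lemma C1_halfline_inverse_power:
 assumes "ep > 0"
 shows "C1_halfline (%y. 1 / (y + ep) ^ p) (%y. - real p / (y + ep) ^ (p + 1)) (real p / ep ^ (p + 1))"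
proof
 fix y :: real assume y: "0 <= y"
 have y0: "y + ep > 0" using y assms by simp
 have "((%y. inverse ((y + ep) ^ p)) has_real_derivative - (inverse ((y + ep) ^ p) * (real p * (y + ep) ^ (p - 1)) * inverse ((y + ep) ^ p))) (at y)"
  using y0 by (auto intro!: derivative_eq_intros)
 moreover have "- (inverse ((y + ep) ^ p) * (real p * (y + ep) ^ (p - 1)) * inverse ((y + ep) ^ p)) = - real p / (y + ep) ^ (p + 1)"
 proof -
  have "inverse (w ^ p) * (real p * w ^ (p - 1)) * inverse (w ^ p) = real p / w ^ (p + 1)" if "w > 0" for w :: real
   using that by (cases p) (auto simp: field_simps)
  from this[OF y0] show ?thesis by simp
 qed
 ultimately show "((%y. 1 / (y + ep) ^ p) has_real_derivative - real p / (y + ep) ^ (p + 1)) (at y)"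
  by (simp add: inverse_eq_divide)
 have "ep ^ (p + 1) <= (y + ep) ^ (p + 1)" using y assms by (intro power_mono) auto
 then show "\<bar>- real p / (y + ep) ^ (p + 1)\<bar> <= real p / ep ^ (p + 1)"
  using assms y0 by (simp add: abs_divide divide_left_mono)
next
 show "continuous_on {0..} (%y. - real p / (y + ep) ^ (p + 1))"
  using assms by (intro continuous_intros) auto
qed

lemma Cell_AE_not_False: "~ (AE x in cellM. False)"
proof
 assume a: "AE x in cellM. False"
 have "(LINT x|cellM. (1::real)) = (LINT x|cellM. 0)" by (rule integral_cong_AE) (use a in auto)
 then show False using Cell_integral_one(2) cyl_const_pos by simp
qed

section \<open>Strong solutions: renormalization at almost every time and conservation of
  mass\<close>

locale strong_sol =
 fixes ga bee mmm q :: real and K rh0 m0 and rh :: "real => real^3 => real" and u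
 assumes q: "q > 3" and sol: "strong_solution ga bee mmm K q rh0 m0 rh u"
begin

abbreviation sg :: "real \<times> (real^3) => real" where
 "sg \<equiv> Dt (%(t, x). rh t x)"

lemma basic:
 "!!t. t >= 0 ==> periodic_z (rh t)" "!!t. t >= 0 ==> axisymmetric (rh t)" "!!t. t >= 0 ==> AE x in lebesgue_on Omega. 0 <= rh t x"
 "!!t. t > 0 ==> periodic_z (u t)" "continuity_equation (%(t, x). rh t x) (%(t, x). u t x)"
 "AE x in lebesgue_on Omega. rh 0 x = rh0 x" "AE t in lebesgue_on {0<..}. slip_conditions K (u t)"
 using sol by (auto simp: strong_solution_def)

lemma regularity:
 assumes "T > 0"
 shows "in_C T (Wnorm 1 q) rh" "in_Linf T (Lnorm 2) (%t x. sg (t, x))" "in_Linf T (Wnorm 1 2) u" "in_L ((q + 1) / q) T (Wnorm 2 q) u"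
 using sol assms by (auto simp: strong_solution_def regularity_class_def Let_def)

lemma nonneg_Cell: "t >= 0 ==> AE x in cellM. 0 <= rh t x"
 by (rule AE_Omega_Cell[OF basic(3)])

lemma density_integrable: "t >= 0 ==> integrable (cellM) (rh t)"
 using in_C_L1(1)[OF regularity(1)[of "t + 1"], of t] q by simp

lemma time_weak_deriv: "weak_deriv SpaceTime e_t (%(t, x). rh t x) sg"
proof -
 have "weakly_diff SpaceTime e_t (%(t, x). rh t x)" using basic(5) by (simp add: continuity_equation_def)
 then show ?thesis unfolding weakly_diff_def wd_def by (rule someI_ex)
qed

lemma max_density_integral: "t >= 0 ==> (LINT x|cellM. max (rh t x) 0) = (LINT x|cellM. rh t x)"
proof -
 assume t: "t >= 0"
 have m: "rh t : bmeas (cellM)" using density_integrable[OF t] by auto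
 show ?thesis
  by (rule integral_cong_AE) (use m nonneg_Cell[OF t] in \<open>auto elim!: eventually_mono\<close>)
qed

lemma restrict_measurable:
 fixes f :: "real \<times> (real^3) => real"
 assumes "locally_integrable SpaceTime f"
 shows "(%z. idc ({0<..<T} \<times> Cell) z * f z) : bmeas lebesgue"
proof -
 have m: "(%z. idc SpaceTime z * f z) : bmeas lebesgue"
  by (rule locally_integrable_measurable[OF assms]) (simp add: open_Times open_Omega)
 have "{0<..<T} \<times> Cell : sets borel" by (intro borel_Times Cell_borel) auto
 then have "{0<..<T} \<times> Cell : sets lebesgue" by (intro sets_completionI_sets) simp
 then have "(%z. idc ({0<..<T} \<times> Cell) z * (idc SpaceTime z * f z)) : bmeas lebesgue"
  using m by measurable
 moreover have "idc ({0<..<T} \<times> Cell) z * (idc SpaceTime z * f z) = idc ({0<..<T} \<times> Cell) z * f z" for z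
  by (auto simp: indicator_def Cell_def)
 ultimately show ?thesis by simp
qed

lemma sigma_slices:
 assumes T: "T > 0"
 shows "\<exists>M. AE t in lborel. t : {0<..<T} --> integrable (cellM) (%x. sg (t, x)) & (LINT x|cellM. \<bar>sg (t, x)\<bar>) <= M"
proof -
 obtain M where M: "AE t in lebesgue_on {0<..<T}. Lnorm 2 (%x. sg (t, x)) <= ennreal M"
  using regularity(2)[OF T] by (auto simp: in_Linf_def)
 \<comment> \<open>\<open>L1_le_Lnorm\<close> asks for a positive bound, hence the maximum with
   1.\<close>
 define N where "N = max M 1"
 have "AE t in lborel. t : {0<..<T} --> Lnorm 2 (%x. sg (t, x)) <= ennreal M"
  by (rule AE_lebesgue_on_imp_lborel[OF M]) simp
 then have "AE t in lborel. t : {0<..<T} --> integrable (cellM) (%x. sg (t, x)) \<and>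
   (LINT x|cellM. \<bar>sg (t, x)\<bar>) <= 2 * N * (3 * cyl_const) powr (1 - 1/2)"
 proof eventually_elim
  case (elim t)
  show ?case
  proof
   assume "t : {0<..<T}"
   then have "Lnorm 2 (%x. sg (t, x)) <= ennreal N"
    using elim ennreal_leI[of M N] by (auto simp: N_def intro: order_trans)
   from L1_le_Lnorm[OF this] show "integrable (cellM) (%x. sg (t, x)) \<and>
     (LINT x|cellM. \<bar>sg (t, x)\<bar>) <= 2 * N * (3 * cyl_const) powr (1 - 1/2)" by (simp add: N_def)
  qed
 qed
 then show ?thesis by (rule exI)
qed

lemma sigma_integrable:
 assumes T: "T > 0"
 shows "integrable lebesgue (%z. idc ({0<..<T} \<times> Cell) z * sg z)"
proof -
 obtain M where M: "AE t in lborel. t : {0<..<T} --> integrable (cellM) (%x. sg (t, x)) & (LINT x|cellM. \<bar>sg (t, x)\<bar>) <= M"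
  using sigma_slices[OF T] by (elim exE)
 show ?thesis
  by (rule integrable_of_slices[OF restrict_measurable M]) (use time_weak_deriv in \<open>simp add: weak_deriv_def\<close>)
qed

lemma rho_integrable:
 assumes T: "T > 0"
 shows "integrable lebesgue (%z. idc ({0<..<T} \<times> Cell) z * (%(t, x). rh t x) z)"
proof -
 interpret C1_halfline "%y. y" "%_. 1" 1 by (rule C1_halfline_id)
 have q1: "q > 1" using q by simp
 have c: "continuous_on {0..T} (%t. \<integral>x. max (rh t x) 0 \<partial>cellM)"
  by (rule continuous_integral_H[OF regularity(1)[OF T] q1])
 have "bounded ((%t. \<integral>x. max (rh t x) 0 \<partial>cellM) ` {0..T})"
  by (intro compact_imp_bounded compact_continuous_image c) simp
 then obtain C where C: "\<forall>t\<in>{0..T}. \<bar>\<integral>x. max (rh t x) 0 \<partial>cellM\<bar> <= C" by (auto simp: bounded_iff)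
 show ?thesis
 proof (rule integrable_of_slices[OF restrict_measurable])
  show "locally_integrable SpaceTime (%(t, x). rh t x)" using time_weak_deriv by (simp add: weak_deriv_def)
  show "AE t in lborel. t : {0<..<T} --> integrable (cellM) (%x. (%(t, x). rh t x) (t, x)) \<and>
    (LINT x|cellM. \<bar>(%(t, x). rh t x) (t, x)\<bar>) <= C"
  proof (rule AE_I2, rule impI)
   fix t assume t: "t : {0<..<T}"
   then have t0: "t >= 0" by simp
   have m: "rh t : bmeas (cellM)" using density_integrable[OF t0] by auto
   have "(LINT x|cellM. \<bar>rh t x\<bar>) = (LINT x|cellM. max (rh t x) 0)"
    by (rule integral_cong_AE) (use m nonneg_Cell[OF t0] in \<open>auto elim!: eventually_mono\<close>)
   also have "... <= C" using bspec[OF C, of t] t by auto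
   finally show "integrable (cellM) (%x. (%(t, x). rh t x) (t, x)) & (LINT x|cellM. \<bar>(%(t, x). rh t x) (t, x)\<bar>) <= C"
    using density_integrable[OF t0] by simp
  qed
 qed
qed

lemma time_AC_density:
 assumes T: "T > 0" and H: "C1_halfline H H' B"
 shows "AC 0 T (%t. \<integral>x. H (max (rh t x) 0) \<partial>cellM) (%t. \<integral>x. H' (max (rh t x) 0) * sg (t, x) \<partial>cellM)"
proof -
 interpret C1_halfline H H' B by (rule H)
 have "AE z in lborel. z : {0<..<T} \<times> Cell --> 0 <= (%(t, x). rh t x) z"
 proof (rule AE_nonneg_slices[OF rho_integrable[OF T]])
  fix t assume "t : {0<..<T}"
  then have "AE x in cellM. 0 <= rh t x" by (intro nonneg_Cell) simp
  from AE_lebesgue_on_imp_lborel[OF this] show "AE x in lborel. x : Cell --> 0 <= (%(t, x). rh t x) (t, x)" by simp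
 qed
 from time_AC[OF T rho_integrable[OF T] sigma_integrable[OF T] time_weak_deriv this] show ?thesis by simp
qed

text \<open>Rational corners leave countably many cylindrical bumps, so one null set of times serves
  them all; these are precisely the test functions asked for by
  \<open>slice_identity\<close>.\<close>

lemma test_slices:
 "AE t in lborel. 0 < t --> (\<forall>n. \<forall>c\<in>Collect rat_pt. \<forall>d\<in>Collect rat_pt. \<forall>a\<in>Collect rat_pt. \<forall>b\<in>Collect rat_pt.
   {c..d} <= {1<..<4} --> {a..b} <= {0<..<1} -->
   (let phh = (%x::real^3. bump n c d ((x$1)^2 + (x$2)^2) * bump n a b (x$3)) in
    (LINT x|lebesgue. phh x * sg (t, x)) = (LINT x|lebesgue. rh t x * (\<Sum>j\<in>UNIV. frd phh (at x) (axis j 1) * u t x $ j))))"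
proof -
 let ?Q = "Collect rat_pt :: real set"
 let ?phh = "%n c d a b. %x::real^3. bump n c d ((x$1)^2 + (x$2)^2) * bump n a b (x$3)"
 have cQ: "countable ?Q" by (rule countable_rat_pts)
 let ?P = "%t n c d a b. {c..d} <= {1<..<4} --> {a..b} <= {0<..<1} --> 0 < t -->
    (LINT x|lebesgue. ?phh n c d a b x * sg (t, x)) = (LINT x|lebesgue. rh t x * (\<Sum>j\<in>UNIV. frd (?phh n c d a b) (at x) (axis j 1) * u t x $ j))"
 have one: "AE t in lborel. ?P t n c d a b" for n c d a b
 proof (cases "{c..d} <= {1<..<4} & {a..b} <= {0<..<1}")
  case True
  have "test_fun Cell0 (?phh n c d a b)"
   by (rule test_fun_cyl_product; rule test_fun_bump) (use True in simp_all)
  then have "test_fun Omega (?phh n c d a b)" by (rule test_fun_mono) (rule Cell0_subset)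
  from continuity_equation_slice[OF basic(5) this] show ?thesis by eventually_elim simp
 qed (auto intro!: AE_I2)
 have "AE t in lborel. \<forall>n. \<forall>c\<in>?Q. \<forall>d\<in>?Q. \<forall>a\<in>?Q. \<forall>b\<in>?Q. ?P t n c d a b"
  unfolding AE_all_countable AE_ball_countable[OF cQ] using one by (intro allI ballI)
 then show ?thesis unfolding Let_def
 proof eventually_elim
  case (elim t)
  show ?case
  proof (intro impI allI ballI)
   fix n c d a b
   assume "0 < t" "c : ?Q" "d : ?Q" "a : ?Q" "b : ?Q" "{c..d} <= {1<..<4}" "{a..b} <= {0<..<1}"
   then show "(LINT x|lebesgue. ?phh n c d a b x * sg (t, x)) = (LINT x|lebesgue. rh t x * (\<Sum>j\<in>UNIV. frd (?phh n c d a b) (at x) (axis j 1) * u t x $ j))"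
    by (rule elim[rule_format, rotated -1])
  qed
 qed
qed

lemma renormalized_slices:
 assumes T: "T > 0"
 shows "AE t in lborel. t : {0<..<T} --> renormalized_slice q (rh t) (u t) (%x. sg (t, x))"
proof -
 obtain M where M: "AE t in lborel. t : {0<..<T} --> integrable (cellM) (%x. sg (t, x)) & (LINT x|cellM. \<bar>sg (t, x)\<bar>) <= M"
  using sigma_slices[OF T] by (elim exE)
 obtain M' where "AE t in lebesgue_on {0<..<T}. Wnorm 1 2 (u t) <= ennreal M'"
  using regularity(3)[OF T] by (auto simp: in_Linf_def)
 from AE_lebesgue_on_imp_lborel[OF this]
 have M': "AE t in lborel. t : {0<..<T} --> Wnorm 1 2 (u t) <= ennreal M'" by simp
 from AE_lebesgue_on_imp_lborel[OF basic(7)]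
 have sl: "AE t in lborel. t : {0<..} --> slip_conditions K (u t)" by simp
 show ?thesis using M M' sl test_slices
 proof eventually_elim
  case (elim t)
  show ?case
  proof
   assume t: "t : {0<..<T}"
   then have t0: "t >= 0" "t > 0" by auto
   show "renormalized_slice q (rh t) (u t) (%x. sg (t, x))"
   proof (rule renormalized_slice[OF q basic(2)[OF t0(1)] basic(3)[OF t0(1)] basic(1)[OF t0(1)] _ basic(4)[OF t0(2)]])
    show "Wnorm 1 q (rh t) < \<infinity>" using regularity(1)[OF T] t by (auto simp: in_C_def)
    show "Wnorm 1 2 (u t) < \<infinity>" using elim(2) t by (auto intro: le_less_trans)
    show "eq_on_bdry (%x. u t x \<bullet> normal x) (%x. 0)" using elim(3) t by (simp add: slip_conditions_def)
    show "integrable (cellM) (%x. sg (t, x))" using elim(1) t by simp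
    fix n c d a b :: real
   qed (use elim(4) t0 in blast)
  qed
 qed
qed

lemma mass_conservation:
 assumes "t >= 0"
 shows "(LINT x|cellM. rh t x) = (LINT x|cellM. rh 0 x)"
proof (cases "t = 0")
 case False
 then have t: "t > 0" using assms by simp
 interpret C1_halfline "%y. y" "%_. 1" 1 by (rule C1_halfline_id)
 have q1: "q > 1" using q by simp
 note e = AC_continuous_eq(2)[OF time_AC_density[OF t C1_halfline_id] continuous_integral_H[OF regularity(1)[OF t] q1] t, of t]
 have "AE s in lborel. s : {0<..<t} --> (LINT x|cellM. 1 * sg (s, x)) = 0"
  using renormalized_slices[OF t]
 proof eventually_elim
  case (elim s)
  show ?case
  proof
   assume "s : {0<..<t}"
   then have "renormalized_slice q (rh s) (u s) (%x. sg (s, x))" using elim by simp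
   \<comment> \<open>For H(y) = y the defect H(y) - y H'(y) is zero, so the total mass has
     derivative zero.\<close>
   from this[unfolded renormalized_slice_def Let_def, rule_format, THEN conjunct1, OF C1_halfline_id]
   show "(LINT x|cellM. 1 * sg (s, x)) = 0" by simp
  qed
 qed
 from integral_cong_AE_real[OF AE_completion[OF this], of t]
 have "integral {0..t} (%s. \<integral>x. 1 * sg (s, x) \<partial>cellM) = 0" by simp
 then show ?thesis using e t max_density_integral[of t] max_density_integral[of 0] by simp
qed simp

end

section \<open>Gronwall's inequality for inverse powers of the density\<close>

lemma (in C1_halfline) integral_pos:
 assumes f: "integrable (cellM) f" and pos: "!!y. 0 <= y ==> 0 < H y"
 shows "0 < (LINT x|cellM. H (max (f x) 0))"
proof -
 have nn: "0 <= H (max (f x) 0)" for x using pos[of "max (f x) 0"] by simp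
 have "(LINT x|cellM. H (max (f x) 0)) ~= 0"
 proof
  assume "(LINT x|cellM. H (max (f x) 0)) = 0"
  then have "AE x in cellM. H (max (f x) 0) = 0"
   using integral_nonneg_eq_0_iff_AE[OF integrable_H[OF f]] nn by auto
  then have "AE x in cellM. False"
  proof eventually_elim
   case (elim x)
   then show ?case using pos[of "max (f x) 0"] by simp
  qed
  then show False using Cell_AE_not_False by blast
 qed
 moreover have "0 <= (LINT x|cellM. H (max (f x) 0))" by (rule Bochner_Integration.integral_nonneg) (rule nn)
 ultimately show ?thesis by simp
qed

text \<open>The function \<open>g\<close> need not be measurable: for such \<open>g\<close> the integral is the lower integral, which suffices here.\<close>

lemma integral_le_of_epowr:
 fixes b :: "real => real" and g :: "real => ennreal"
 assumes b: "integrable (lebesgue_on {0<..<t}) b" and bnn: "!!s. 0 <= b s" and t: "t > 0" and p: "p >= 1"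
  and le: "AE s in lebesgue_on {0<..<t}. ennreal (b s) <= g s"
  and fin: "(\<integral>\<^sup>+ s. epowr (g s) p \<partial>lebesgue_on {0<..<t}) < \<infinity>"
 shows "(\<integral>s. b s \<partial>lebesgue_on {0<..<t}) <= t + enn2real (\<integral>\<^sup>+ s. epowr (g s) p \<partial>lebesgue_on {0<..<t})"
proof -
 let ?M = "lebesgue_on {0<..<t}"
 let ?J = "\<integral>\<^sup>+ s. epowr (g s) p \<partial>?M"
 have bm: "b : bmeas ?M" using b by auto
 \<comment> \<open>Only the part of \<open>b\<close> above 1 is compared with the power of
   \<open>g\<close>, since n <= n^p holds for n >= 1; the part below 1 contributes at most
   \<open>t\<close>.\<close>
 have pt: "ennreal (max (b s - 1) 0) <= epowr (g s) p" if "ennreal (b s) <= g s" for s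
 proof (cases "g s")
  case (real n)
  then have bn: "b s <= n" using that by simp
  show ?thesis
  proof (cases "n <= 1")
   case True
   then show ?thesis using bn by simp
  next
   case False
   then have "n <= n powr p" using powr_mono[of 1 p n] p by simp
   then have "max (b s - 1) 0 <= n powr p" using bn by simp
   then show ?thesis using real by (simp add: epowr_def ennreal_leI)
  qed
 qed (simp add: epowr_def)
 have "(\<integral>\<^sup>+ s. ennreal (b s) \<partial>?M) <= (\<integral>\<^sup>+ s. 1 + ennreal (max (b s - 1) 0) \<partial>?M)"
 proof (rule nn_integral_mono)
  fix s
  have "ennreal (b s) <= ennreal (1 + max (b s - 1) 0)" by (rule ennreal_leI) simp
  then show "ennreal (b s) <= 1 + ennreal (max (b s - 1) 0)" by (simp add: ennreal_plus)
 qed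
 also have "... = (\<integral>\<^sup>+ s. 1 \<partial>?M) + (\<integral>\<^sup>+ s. ennreal (max (b s - 1) 0) \<partial>?M)"
  by (rule nn_integral_add) (use bm in auto)
 also have "(\<integral>\<^sup>+ s. 1 \<partial>?M) = ennreal t" using t by (simp add: emeasure_restrict_space)
 also have "(\<integral>\<^sup>+ s. ennreal (max (b s - 1) 0) \<partial>?M) <= ?J"
  by (rule nn_integral_mono_AE) (use le pt in \<open>auto elim!: eventually_mono\<close>)
 finally have "(\<integral>\<^sup>+ s. ennreal (b s) \<partial>?M) <= ennreal t + ?J" by (simp add: add_left_mono)
 also have "... = ennreal (t + enn2real ?J)" using fin t by (simp add: ennreal_plus)
 finally have "ennreal (LINT s|?M. b s) <= ennreal (t + enn2real ?J)"
  using nn_integral_eq_integral[OF b] bnn by simp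
 then show ?thesis using t by (subst (asm) ennreal_le_iff) auto
qed

context strong_sol
begin

text \<open>With H(y) = (y + ep)^-p the slice bound makes |d/ds ln Ph(s)| at most (p + 1) C0 times
  the W^{2,q} norm of u(s). The rate is linear in \<open>p\<close> and free of \<open>ep\<close>, so
  the same \<open>L\<close> serves all of them.\<close>

lemma inverse_power_gronwall:
 assumes t: "t > 0"
 shows "\<exists>L\<ge>0. \<forall>ep>0. \<forall>p::nat. (LINT x|cellM. 1 / (max (rh 0 x) 0 + ep) ^ p)
   <= exp ((real p + 1) * L) * (LINT x|cellM. 1 / (max (rh t x) 0 + ep) ^ p)"
proof -
 define C0 where "C0 = sup_const q * 9"
 have C0: "C0 > 0" using sup_const_pos[of q] q by (simp add: C0_def)
 let ?N = "%s. Wnorm 2 q (u s)" and ?r = "(q + 1) / q"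
 have fin: "(\<integral>\<^sup>+ s. epowr (?N s) ?r \<partial>lebesgue_on {0<..<t}) < \<infinity>" using regularity(4)[OF t] by (simp add: in_L_def)
 \<comment> \<open>The norm of u is controlled in the power (q + 1)/q > 1 over (0, t); the summand
   \<open>t\<close> accounts for times at which the norm is below 1.\<close>
 define L0 where "L0 = t + enn2real (\<integral>\<^sup>+ s. epowr (?N s) ?r \<partial>lebesgue_on {0<..<t})"
 have L0: "L0 >= 0" using t by (simp add: L0_def)
 have "(LINT x|cellM. 1 / (max (rh 0 x) 0 + ep) ^ p) <= exp ((real p + 1) * (C0 * L0)) * (LINT x|cellM. 1 / (max (rh t x) 0 + ep) ^ p)"
  if ep: "ep > 0" for ep :: real and p :: nat
 proof -
  let ?H = "%y. 1 / (y + ep) ^ p" and ?H' = "%y. - real p / (y + ep) ^ (p + 1)" and ?B = "real p / ep ^ (p + 1)"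
  note C1 = C1_halfline_inverse_power[OF ep, of p]
  interpret C1_halfline ?H ?H' ?B by (rule C1)
  define Ph where "Ph s = (LINT x|cellM. ?H (max (rh s x) 0))" for s
  define phh where "phh s = (LINT x|cellM. ?H' (max (rh s x) 0) * sg (s, x))" for s
  have q1: "q > 1" using q by simp
  have ac: "AC 0 t Ph phh" unfolding Ph_def[abs_def] phh_def[abs_def] by (rule time_AC_density[OF t C1])
  have c: "continuous_on {0..t} Ph" unfolding Ph_def[abs_def] by (rule continuous_integral_H[OF regularity(1)[OF t] q1])
  have pos: "Ph s > 0" if "s >= 0" for s
   unfolding Ph_def by (rule integral_pos[OF density_integrable[OF that]]) (use ep in auto)
  \<comment> \<open>On the compact interval the positive continuous \<open>Ph\<close> stays above
    its minimum, so \<open>ln\<close> is continuously differentiable on the range that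
    matters.\<close>
  obtain s0 where s0: "s0 : {0..t}" "\<forall>s\<in>{0..t}. Ph s0 <= Ph s"
   using continuous_attains_inf[of "{0..t}" Ph] c t by auto
  define m where "m = Ph s0"
  have m: "m > 0" using pos[of s0] s0 by (simp add: m_def)
  have acl: "AC 0 t (%s. ln (Ph s)) (%s. 1 / Ph s * phh s)"
  proof (rule AC_chain[OF ac t, of "{m..}"])
   show "AE s in lebesgue. s : {0<..<t} --> Ph s : {m..}" using s0(2) by (intro AE_I2) (auto simp: m_def)
   show "(ln has_real_derivative 1 / y) (at y)" if "y : {m..}" for y using that m by (intro DERIV_ln_divide) auto
   show "continuous_on {m..} (%y. 1 / y)" using m by (intro continuous_intros) auto
  qed simp
  have cl: "continuous_on {0..t} (%s. ln (Ph s))"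
   by (intro continuous_on_ln c) (use pos in force)
  let ?f = "%s. 1 / Ph s * phh s"
  note abs_i = AC_continuous_eq(1)[OF acl cl t]
  have eq: "ln (Ph t) = ln (Ph 0) + integral {0..t} ?f" using AC_continuous_eq(2)[OF acl cl t, of t] t by simp
  \<comment> \<open>The rate of change of ln Ph divided by its expected factor. This function is
    integrable in s and can be compared pointwise with the norm of u(s), of which no measurability
    in s is assumed.\<close>
  define b where "b s = \<bar>?f s\<bar> / ((real p + 1) * C0)" for s
  have cp: "(real p + 1) * C0 > 0" using C0 by (intro mult_pos_pos) auto
  have "?f absolutely_integrable_on {0<..<t}" by (rule set_integrable_subset[OF abs_i]) auto
  then have fi: "integrable (lebesgue_on {0<..<t}) ?f" by (simp add: integrable_restrict_space set_integrable_def)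
  have bi: "integrable (lebesgue_on {0<..<t}) b" unfolding b_def[abs_def] by (rule integrable_divide[OF integrable_abs[OF fi]])
  have "AE s in lborel. s : {0<..<t} --> ennreal (b s) <= ?N s"
   using renormalized_slices[OF t]
  proof eventually_elim
   case (elim s)
   show ?case
   proof
    assume s: "s : {0<..<t}"
    then have rs: "renormalized_slice q (rh s) (u s) (%x. sg (s, x))" using elim by simp
    let ?R = "%x. ?H (max (rh s x) 0) - max (rh s x) 0 * ?H' (max (rh s x) 0)"
    have s0: "s >= 0" using s by simp
    note iH = integrable_H[OF density_integrable[OF s0]]
    \<comment> \<open>H(y) - y H'(y) = H(y) (1 + p y / (y + ep)), and y / (y + ep) lies between 0
      and 1.\<close>
    have R: "\<bar>?R x\<bar> <= (real p + 1) * ?H (max (rh s x) 0)" for x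
    proof -
     define y where "y = max (rh s x) 0"
     have y: "y >= 0" "y + ep > 0" using ep by (auto simp: y_def)
     have e: "?H y - y * ?H' y = ?H y * (1 + real p * (y / (y + ep)))" by (simp add: distrib_left mult_ac)
     have "0 <= y / (y + ep)" "y / (y + ep) <= 1" using y ep by auto
     then have "real p * (y / (y + ep)) <= real p * 1" "0 <= real p * (y / (y + ep))"
      using mult_left_mono[of "y / (y + ep)" 1 "real p"] mult_nonneg_nonneg[of "real p" "y / (y + ep)"] by linarith+
     then have "\<bar>1 + real p * (y / (y + ep))\<bar> <= real p + 1" by simp
     moreover have "?H y >= 0" using y by simp
     ultimately have "\<bar>?H y * (1 + real p * (y / (y + ep)))\<bar> <= ?H y * (real p + 1)"
      unfolding abs_mult by (simp add: mult_left_mono del: times_divide_eq_left times_divide_eq_right)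
     then show ?thesis using e unfolding y_def by (simp add: mult.commute)
    qed
    have Ri: "(LINT x|cellM. \<bar>?R x\<bar>) <= (real p + 1) * Ph s"
    proof -
     have iK: "integrable (cellM) (%x. (real p + 1) * ?H (max (rh s x) 0))" by (rule integrable_mult_right[OF iH])
     have rm: "rh s : bmeas (cellM)" using density_integrable[OF s0] by auto
     have "(LINT x|cellM. \<bar>?R x\<bar>) <= (LINT x|cellM. (real p + 1) * ?H (max (rh s x) 0))"
     proof (rule integral_mono[OF _ iK R])
      show "integrable (cellM) (%x. \<bar>?R x\<bar>)"
      proof (rule integrable_bd[OF iK])
       show "(%x. \<bar>?R x\<bar>) : bmeas (cellM)" using rm by measurable
       show "AE x in cellM. norm \<bar>?R x\<bar> <= norm ((real p + 1) * ?H (max (rh s x) 0))"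
        by (rule AE_I2) (simp only: real_norm_def abs_idempotent, rule order_trans[OF R abs_ge_self])
      qed
     qed
     then show ?thesis unfolding Ph_def by (simp only: integral_mult_right_zero)
    qed
    \<comment> \<open>Stated for positive real bounds of the norm, which itself could be 0; the
      slack is removed by \<open>field_le_epsilon\<close>.\<close>
    have key: "b s <= N" if N: "N > 0" "?N s <= ennreal N" for N
    proof -
     have "\<bar>phh s\<bar> <= sup_const q * (9 * N) * (LINT x|cellM. \<bar>?R x\<bar>)"
      unfolding phh_def
      by (rule rs[unfolded renormalized_slice_def Let_def, rule_format, THEN conjunct2, rule_format, OF C1 N])
     also have "... <= C0 * N * ((real p + 1) * Ph s)"
      unfolding C0_def using Ri sup_const_pos[of q] q N by (simp add: mult.assoc mult_left_mono)
     finally have "\<bar>phh s\<bar> / Ph s <= C0 * N * (real p + 1)" using pos[OF s0] by (simp add: pos_divide_le_eq mult_ac)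
     then have "\<bar>?f s\<bar> <= N * ((real p + 1) * C0)" using pos[OF s0] by (simp add: abs_mult mult_ac)
     then show ?thesis using cp unfolding b_def by (simp only: pos_divide_le_eq)
    qed
    show "ennreal (b s) <= ?N s"
    proof (cases "?N s")
     case (real n)
     have "b s <= n"
     proof (rule field_le_epsilon)
      fix e :: real assume e: "e > 0"
      show "b s <= n + e" by (rule key) (use real e in \<open>auto intro: ennreal_leI\<close>)
     qed
     then show ?thesis using real by (simp add: ennreal_leI)
    qed simp
   qed
  qed
  then have ble: "AE s in lebesgue_on {0<..<t}. ennreal (b s) <= ?N s"
   by (simp add: AE_restrict_space_iff AE_completion)
  have r1: "?r >= 1" using q by simp
  have bl: "(\<integral>s. b s \<partial>lebesgue_on {0<..<t}) <= L0"
   unfolding L0_def by (rule integral_le_of_epowr[OF bi _ t r1 ble fin]) (use cp in \<open>auto simp: b_def\<close>)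
  have "\<bar>integral {0..t} ?f\<bar> = \<bar>\<integral>s. ?f s \<partial>lebesgue_on {0<..<t}\<bar>"
   using lebesgue_integral_eq_integral[OF fi] by (simp add: integral_open_interval_real)
  also have "... <= (\<integral>s. \<bar>?f s\<bar> \<partial>lebesgue_on {0<..<t})" by (rule integral_abs_bound)
  also have "... = (\<integral>s. (real p + 1) * C0 * b s \<partial>lebesgue_on {0<..<t})"
   by (intro Bochner_Integration.integral_cong refl) (use cp in \<open>simp only: b_def times_divide_eq_right nonzero_mult_div_cancel_left less_imp_neq[symmetric] not_False_eq_True\<close>)
  also have "... <= (real p + 1) * C0 * L0" using bl cp by (simp add: mult_left_mono)
  finally have "ln (Ph 0) <= (real p + 1) * (C0 * L0) + ln (Ph t)" using eq by (simp add: mult.assoc)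
  then have "exp (ln (Ph 0)) <= exp ((real p + 1) * (C0 * L0) + ln (Ph t))" by simp
  then have "Ph 0 <= exp ((real p + 1) * (C0 * L0)) * Ph t" using pos[of 0] pos[of t] t by (simp add: exp_add)
  then show ?thesis by (simp add: Ph_def)
 qed
 then show ?thesis using C0 L0 by (intro exI[of _ "C0 * L0"]) auto
qed

text \<open>Chebyshev's inequality with exponent p and \<open>ep\<close> equal to \<open>et\<close>:
  where \<open>rh 0\<close> is below \<open>et\<close> the integrand is at least (2 et)^-p, while
  Gronwall bounds its integral by e^((p + 1) L) |Cell| de^-p. The choice of \<open>et\<close> makes
  e^L (2 et) / de equal to 1/2, so the measure of the set is at most a constant times 2^-p for every
  p.\<close>

lemma positive_lower_bound_backwards:
 assumes t: "t > 0" and de: "de > 0" and lb: "AE x in cellM. de <= rh t x"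
 shows "\<exists>et>0. AE x in cellM. et <= rh 0 x"
proof -
 obtain L where L: "L >= 0" "!!ep p. ep > 0 ==> (LINT x|cellM. 1 / (max (rh 0 x) 0 + ep) ^ p)
   <= exp ((real p + 1) * L) * (LINT x|cellM. 1 / (max (rh t x) 0 + ep) ^ p)"
  using inverse_power_gronwall[OF t] by auto
 define et where "et = de * exp (- L) / 4"
 have et: "et > 0" using de by (simp add: et_def)
 let ?M = "cellM"
 let ?V = "%x. idc {x. rh 0 x < et} x :: real"
 have rh0m: "rh 0 : bmeas ?M" using density_integrable[of 0] by auto
 have Vm: "?V : bmeas ?M"
 proof -
  have "(%x. if rh 0 x < et then 1 else 0 :: real) : bmeas ?M" using rh0m by measurable
  then show ?thesis by (simp add: indicator_def of_bool_def)
 qed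
 have Vi: "integrable ?M ?V"
  by (rule integrable_bd[OF Cell_integral_one(1) Vm]) (auto simp: indicator_def)
 define V where "V = (LINT x|?M. ?V x)"
 have le: "V <= 3 * cyl_const * exp L * (1/2) ^ p" for p
 proof -
  interpret C1_halfline "%y. 1 / (y + et) ^ p" "%y. - real p / (y + et) ^ (p + 1)" "real p / et ^ (p + 1)"
   by (rule C1_halfline_inverse_power[OF et])
  have i0: "integrable ?M (%x. 1 / (max (rh 0 x) 0 + et) ^ p)" by (rule integrable_H[OF density_integrable]) simp
  have it: "integrable ?M (%x. 1 / (max (rh t x) 0 + et) ^ p)" by (rule integrable_H[OF density_integrable]) (use t in simp)
  have "V / (2 * et) ^ p = (LINT x|?M. ?V x / (2 * et) ^ p)" by (simp add: V_def)
  also have "... <= (LINT x|?M. 1 / (max (rh 0 x) 0 + et) ^ p)"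
  proof (rule integral_mono[OF _ i0])
   show "integrable ?M (%x. ?V x / (2 * et) ^ p)" using Vi by simp
   fix x
   show "?V x / (2 * et) ^ p <= 1 / (max (rh 0 x) 0 + et) ^ p"
   proof (cases "rh 0 x < et")
    case True
    then have "(max (rh 0 x) 0 + et) ^ p <= (2 * et) ^ p" using et by (intro power_mono) auto
    moreover have "(max (rh 0 x) 0 + et) ^ p > 0" using et by simp
    ultimately show ?thesis using True by (simp add: frac_le)
   qed (use et in simp)
  qed
  also have "... <= exp ((real p + 1) * L) * (LINT x|?M. 1 / (max (rh t x) 0 + et) ^ p)" by (rule L(2)[OF et])
  also have "(LINT x|?M. 1 / (max (rh t x) 0 + et) ^ p) <= (LINT x|?M. 1 / de ^ p * 1)"
  proof (rule integral_mono_AE[OF it])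
   show "integrable ?M (%x. 1 / de ^ p * 1)" by (intro integrable_mult_right Cell_integral_one)
   show "AE x in ?M. 1 / (max (rh t x) 0 + et) ^ p <= 1 / de ^ p * 1"
    using lb
   proof eventually_elim
    case (elim x)
    then have "de ^ p <= (max (rh t x) 0 + et) ^ p" using et de by (intro power_mono) auto
    then show ?case using de by (simp add: frac_le)
   qed
  qed
  also have "(LINT x|?M. 1 / de ^ p * 1) = 3 * cyl_const / de ^ p" using Cell_integral_one by simp
  finally have "V / (2 * et) ^ p <= exp ((real p + 1) * L) * (3 * cyl_const / de ^ p)" by (simp add: mult_left_mono)
  then have "V <= exp ((real p + 1) * L) * (3 * cyl_const / de ^ p) * (2 * et) ^ p" using et by (simp add: pos_divide_le_eq)
  also have "... = 3 * cyl_const * exp L * (exp L * (2 * et) / de) ^ p"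
   by (simp add: power_mult_distrib power_divide exp_of_nat_mult[symmetric] distrib_right exp_add)
  also have "exp L * (2 * et) / de = 1/2" using de by (simp add: et_def exp_minus field_simps)
  finally show ?thesis .
 qed
 have "V <= 3 * cyl_const * exp L * 0"
 proof (rule LIMSEQ_le_const)
  show "(%p. 3 * cyl_const * exp L * (1/2) ^ p) \<longlonglongrightarrow> 3 * cyl_const * exp L * 0"
   by (intro tendsto_mult tendsto_const LIMSEQ_power_zero) simp
 qed (use le in auto)
 moreover have "0 <= V" unfolding V_def by (rule Bochner_Integration.integral_nonneg) simp
 ultimately have "V = 0" by simp
 then have "AE x in ?M. ?V x = 0" using integral_nonneg_eq_0_iff_AE[OF Vi] by (auto simp: V_def)
 then have "AE x in ?M. et <= rh 0 x" by eventually_elim (auto simp: indicator_def split: if_splits)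
 then show ?thesis using et by blast
qed

end

section \<open>Vacuum at every scale and the lower bound on the gradient\<close>

lemma not_AE_dy_rect:
 assumes "~ (AE p in lborel. p : Rect --> Q p)"
 shows "\<exists>a c. dy_rect k a c <= Rect & ~ (AE p in lborel. p : dy_rect k a c --> Q p)"
proof (induction k)
 case 0
 show ?case using assms by (intro exI[of _ 1] exI[of _ 0]) (simp add: Rect_dy_rect)
next
 case (Suc k)
 then obtain a c where ac: "dy_rect k a c <= Rect" "~ (AE p in lborel. p : dy_rect k a c --> Q p)" by blast
 let ?h = "(1/2::real)^Suc k"
 let ?S = "dy_rect (Suc k)"
 \<comment> \<open>The dividing lines are null, so a property valid almost everywhere on all four
   quarters is valid on the parent; failure therefore descends to some quarter.\<close>
 have "~ (AE p in lborel. p : ?S a c --> Q p) | ~ (AE p in lborel. p : ?S (a + 3 * ?h) c --> Q p) \<or>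
   ~ (AE p in lborel. p : ?S a (c + ?h) --> Q p) | ~ (AE p in lborel. p : ?S (a + 3 * ?h) (c + ?h) --> Q p)"
 proof (rule ccontr)
  assume "~ ?thesis"
  then have "AE p in lborel. p : ?S a c --> Q p" "AE p in lborel. p : ?S (a + 3 * ?h) c --> Q p"
   "AE p in lborel. p : ?S a (c + ?h) --> Q p" "AE p in lborel. p : ?S (a + 3 * ?h) (c + ?h) --> Q p" by blast+
  with dy_rect_split[of k a c] have "AE p in lborel. p : dy_rect k a c --> Q p"
  proof eventually_elim
   case (elim p)
   show ?case
   proof
    assume "p : dy_rect k a c"
    then have "p : ?S a c | p : ?S (a + 3 * ?h) c | p : ?S a (c + ?h) | p : ?S (a + 3 * ?h) (c + ?h)"
     using elim(1) by (auto simp: indicator_def simp del: power_Suc split: if_splits)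
    then show "Q p" using elim by blast
   qed
  qed
  then show False using ac(2) by blast
 qed
 then show ?case using dy_rect_children[where k = k and a = a and c = c] ac(1) by (meson order_trans)
qed

lemma periodic_z_int:
 assumes per: "periodic_z f" and x: "x : Omega"
 shows "f (x + axis 3 (of_int k)) = f x"
proof -
 have shift_nat: "f (x + axis 3 (real n)) = f x" if "x : Omega" for x n
 proof (induction n)
  case 0
  have z: "axis 3 (0::real) = (0 :: real^3)" by (simp add: axis_def vec_eq_iff)
  show ?case by (simp only: of_nat_0 z add_0_right)
 next
  case (Suc n)
  have "x + axis 3 (real n) : Omega" using that by (simp add: Omega_shift)
  then have "f (x + axis 3 (real n) + axis 3 1) = f (x + axis 3 (real n))" using per by (simp add: periodic_z_def)
  moreover have "x + axis 3 (real n) + axis 3 1 = x + axis 3 (real (Suc n))" by (simp add: axis_def vec_eq_iff)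
  ultimately show ?case using Suc by simp
 qed
 show ?thesis
 proof (cases "k >= 0")
  case True
  then show ?thesis using shift_nat[OF x, of "nat k"] by simp
 next
  case False
  have "x + axis 3 (of_int k) : Omega" using x by (simp add: Omega_shift)
  from shift_nat[OF this, of "nat (- k)"] False
  have "f (x + axis 3 (of_int k) + axis 3 (- of_int k)) = f (x + axis 3 (of_int k))" by simp
  moreover have "x + axis 3 (of_int k) + axis 3 (- of_int k) = x" by (simp add: axis_def vec_eq_iff)
  ultimately show ?thesis by simp
 qed
qed

text \<open>A point of the covering is brought into the cell by an integer shift, where the
  information on \<open>f\<close> is available; periodicity carries it back, and an open set cannot
  avoid a property that holds almost everywhere.\<close>

lemma Cell_shift_AE:
 assumes per: "periodic_z f" and ae: "AE x in cellM. P (f x)" and g: "AE x in lebesgue_on Omega. g x = f x"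
  and W: "open W" "W <= Omega" "x0 : W"
 shows "\<exists>x\<in>W. P (g x)"
proof -
 define k where "k = \<lfloor>x0 $ 3\<rfloor>"
 have shift: "f (x + axis 3 (of_int k)) = f x" if "x : Omega" for x by (rule periodic_z_int[OF per that])
 let ?s = "axis 3 (of_int k) :: real^3"
 define W' where "W' = {x. x + ?s : W} \<inter> Cell0"
 have "open {x. x + ?s : W}"
 proof -
  have "open ((%x. x + ?s) -` W)" by (rule open_vimage[OF W(1)]) (intro continuous_intros)
  then show ?thesis by (simp add: vimage_def)
 qed
 then have oW: "open W'" unfolding W'_def by (intro open_Int Cell0_borel)
 have "W' ~= {}"
 proof -
  define y where "y = x0 - ?s"
  have y: "y + ?s : W" "0 <= y $ 3" "y $ 3 < 1" using W(3) by (auto simp: y_def k_def axis_def) linarith+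
  obtain e where e: "e > 0" "ball y e <= {x. x + ?s : W}"
   using \<open>open {x. x + ?s : W}\<close> y(1) by (auto simp: open_contains_ball)
  \<comment> \<open>A small push upwards, shorter than the distance to the top face: a point with x3
    = 0 lies in \<open>Cell\<close> but not in the open \<open>Cell0\<close>.\<close>
  define d where "d = min (e/2) ((1 - y $ 3)/2)"
  have d: "d > 0" "d < e" "y $ 3 + d < 1" using e y by (auto simp: d_def min_def field_simps)
  have ad: "axis 3 d = d *\<^sub>R (axis 3 1 :: real^3)" by (simp add: vec_eq_iff axis_def)
  have "dist y (y + axis 3 d) = d" using d unfolding ad by (simp add: dist_norm norm_Basis)
  then have inW: "y + axis 3 d : {x. x + ?s : W}" using e d by (intro subsetD[OF e(2)]) simp
  have "y : Omega" using y(1) W(2) Omega_shift[of y "of_int k"] by blast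
  then have "y + axis 3 d : Omega" by (simp only: Omega_shift)
  moreover have "(y + axis 3 d) $ 3 = y $ 3 + d" by (simp add: axis_def)
  ultimately have "y + axis 3 d : Cell0" using y d by (simp add: Cell0_def)
  then show ?thesis using inW by (auto simp: W'_def)
 qed
 have 1: "AE x in lborel. x : Cell --> P (f x)" by (rule AE_lebesgue_on_imp_lborel[OF ae]) simp
 have "AE x in lebesgue. x : Omega --> g x = f x" using g open_Omega by (simp add: AE_restrict_space_iff borel_open)
 from AE_lebesgue_imp_lborel[OF AE_lebesgue_shift[OF this, of ?s]]
 have 2: "AE x in lborel. x + ?s : Omega --> g (x + ?s) = f (x + ?s)" .
 have "AE x in lborel. x : W' --> P (g (x + ?s))"
  using 1 2
 proof eventually_elim
  case (elim x)
  show ?case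
  proof
   assume "x : W'"
   then have "x : Cell" "x : Omega" "x + ?s : Omega" using W(2) Cell0_subset by (auto simp: W'_def)
   then show "P (g (x + ?s))" using elim shift[of x] by simp
  qed
 qed
 then obtain x where "x : W'" "x : W' --> P (g (x + ?s))"
  by (rule AE_lborel_ex_open[OF _ oW \<open>W' ~= {}\<close>])
 then show ?thesis by (auto simp: W'_def)
qed

context strong_sol
begin

text \<open>A continuous representative of \<open>rh0\<close> is below any positive
  \<open>et\<close> near \<open>x0\<close>, whereas a positive lower bound at time t would propagate
  back to one at time 0.\<close>

lemma vacuum_persists:
 assumes per: "periodic_z rh0" and van: "vanishes_at rh0 x0" and x0: "x0 : Omega" and t: "t > 0" and de: "de > 0"
 shows "~ (AE x in cellM. de <= rh t x)"
proof
 assume "AE x in cellM. de <= rh t x"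
 from positive_lower_bound_backwards[OF t de this]
 obtain et where et: "et > 0" "AE x in cellM. et <= rh 0 x" by blast
 have ae: "AE x in cellM. et <= rh0 x" using AE_Omega_Cell[OF basic(6)] et(2) by eventually_elim simp
 obtain g where g: "continuous_on Omega g" "AE x in lebesgue_on Omega. g x = rh0 x" "g x0 = 0"
  using van by (auto simp: vanishes_at_def)
 define W where "W = Omega \<inter> g -` {..<et}"
 have "open W" unfolding W_def by (rule continuous_open_preimage[OF g(1) open_Omega]) simp
 then have "\<exists>x\<in>W. et <= g x"
  by (rule Cell_shift_AE[OF per ae g(2)]) (use x0 g(3) et(1) in \<open>auto simp: W_def\<close>)
 then show False by (auto simp: W_def)
qed

text \<open>At each scale some rectangle contains a non-null set where the profile is below
  \<open>de\<close>, so its mean there is at most \<open>de\<close> plus the Morrey oscillation. At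
  scale 0 the rectangle is \<open>Rect\<close> and its mean determines the total mass; at scale k
  the mean is compared with \<open>c\<close> through the assumed L^1 bound. The first conclusion is
  for the case in which the desired scale would be coarser than \<open>Rect\<close>.\<close>

lemma gradient_lower_bound:
 assumes t: "t > 0" and r: "r > 2" and G: "G > 0" "Lnorm r (grad (rh t)) <= ennreal G"
  and vac: "!!de. de > 0 ==> ~ (AE x in cellM. de <= rh t x)"
 shows "(LINT x|cellM. rh t x) <= 3 * cyl_const * (Morrey_const r * G)"
  and "!!D. (!!k a b. dy_rect k a b <= Rect ==> (LINT x|cellM. idc (dy_rect k a b) (cyl x) * \<bar>rh t x - c\<bar>) <= 2 * D * (3 * cyl_const * (1/4)^k) powr (1/2)) ==>
   c <= Morrey_const r * G * ((1/2) powr (1 - 2/r)) ^ k + 2 * (3 * cyl_const) powr (- 1/2) * 2 ^ k * D"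
proof -
 let ?M = "cellM"
 let ?q = "(1/2) powr (1 - 2/r) :: real"
 have t0: "t >= 0" using t by simp
 have i: "integrable ?M (rh t)" by (rule density_integrable[OF t0])
 then have m: "rh t : bmeas ?M" by auto
 have Wt: "Wnorm 1 q (rh t) < \<infinity>" using regularity(1)[OF t] t by (auto simp: in_C_def)
 obtain N where N: "N > 0" "Wnorm 1 q (rh t) <= ennreal N" by (rule Wnorm_finite_ex[OF Wt])
 have WX: "W_power (Suc 0) q (rh t) <= ennreal (N powr q)" using Wnorm_W_power[OF N(2)] q N by simp
 have dw: "weak_deriv Omega (axis j 1) (rh t) (pd j (rh t))" for j by (rule W_power_pd(1)[OF WX]) simp
 have d2: "sq_int (pd j (rh t))" for j
  by (rule sq_int_Lnorm[OF Wnorm_Lnorm[OF W_power_pd(2)[OF WX]]]) (use q N in auto)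
 have w: "cell_weak_deriv j (rh t) (pd j (rh t))" for j
  by (rule weak_deriv_cell[OF dw i sq_int_integrable[OF d2]])
 obtain Gm where Gm: "Gm : bmeas borel" "AE x in ?M. rh t x = Gm (cyl x)"
  by (rule axisymmetric_rep[OF basic(2)[OF t0] m])
 have av: "cyl_avg (rh t) Gm"
 proof -
  have 1: "cyl_avg (%x. Gm (cyl x) * 1) (%p. Gm p * 1)" by (rule cyl_avg_mult[OF cyl_avg_one Gm(1)])
  have gm: "(%x. Gm (cyl x)) : bmeas ?M" by (rule measurable_compose[OF cyl_measurable_lebesgue Gm(1)])
  have ae: "AE x in ?M. Gm (cyl x) = rh t x" using Gm(2) by eventually_elim simp
  show ?thesis by (rule cyl_avg_cong_AE[OF _ ae gm]) (use 1 in simp)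
 qed
 have r0: "r > 0" "G >= 0" using r G by auto
 note gc = Lnorm_component[OF G(2) r0]
 have gi: "integrable ?M (%x. \<bar>pd j (rh t) x\<bar> powr r)" for j using gc(2)[of j] by (simp add: grad_def)
 have gle: "(LINT x|?M. \<bar>pd j (rh t) x\<bar> powr r) <= G powr r" for j using gc(3)[of j] by (simp add: grad_def)
 note morrey = Morrey_dyadic[OF w av r G(1) gi gle]
 have low: "\<exists>a b. dy_rect k a b <= Rect & dy_mean Gm k a b <= de + Morrey_const r * G * ?q ^ k" if de: "de > 0" for k de
 proof -
  have "~ (AE p in lborel. p : Rect --> de <= Gm p)"
  proof
   assume "AE p in lborel. p : Rect --> de <= Gm p"
   from AE_cyl[OF this] have "AE x in ?M. de <= Gm (cyl x)" .
   with Gm(2) have "AE x in ?M. de <= rh t x" by eventually_elim simp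
   then show False using vac[OF de] by simp
  qed
  from not_AE_dy_rect[OF this, of k] obtain a b where ab: "dy_rect k a b <= Rect" "~ (AE p in lborel. p : dy_rect k a b --> de <= Gm p)"
   by blast
  have "dy_mean Gm k a b <= de + Morrey_const r * G * ?q ^ k"
  proof (rule ccontr)
   assume n: "~ ?thesis"
   have "AE p in lborel. p : dy_rect k a b --> de <= Gm p"
    using morrey[OF ab(1)] by eventually_elim (use n in \<open>auto simp: abs_le_iff\<close>)
   then show False using ab(2) by simp
  qed
  then show ?thesis using ab(1) by blast
 qed
 have Gmi: "integrable lborel (%p. idc Rect p * Gm p)" by (rule cyl_avg_integrable[OF av i])
 have tot: "(LINT x|?M. rh t x) = cyl_const * (LBINT p. idc Rect p * Gm p)"
  using cyl_avgD(2)[OF av, of "%_. 1"] i by simp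
 show "(LINT x|?M. rh t x) <= 3 * cyl_const * (Morrey_const r * G)"
 proof (rule field_le_epsilon)
  fix e :: real assume e: "e > 0"
  define de where "de = e / (3 * cyl_const)"
  have de: "de > 0" using e cyl_const_pos by (simp add: de_def)
  obtain a b where ab: "dy_rect 0 a b <= Rect" "dy_mean Gm 0 a b <= de + Morrey_const r * G" using low[OF de, of 0] by auto
  \<comment> \<open>At level 0 only \<open>Rect\<close> itself fits into
    \<open>Rect\<close>.\<close>
  have "a = 1 & b = 0"
  proof -
   have "{a<..<a+3} \<times> {b<..<b+1} <= {1<..<4} \<times> {0<..<1}" using ab(1) by (simp add: dy_rect_def Rect_def)
   then have "{a<..<a+3} <= {1<..<4}" "{b<..<b+1} <= {0<..<1}" by (auto simp: times_subset_iff)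
   then show ?thesis by (auto simp: greaterThanLessThan_subseteq_greaterThanLessThan)
  qed
  then have "dy_mean Gm 0 a b = (LINT x|?M. rh t x) / (3 * cyl_const)"
   unfolding tot using cyl_const_pos by (simp add: dy_mean_def Rect_dy_rect)
  then show "(LINT x|?M. rh t x) <= 3 * cyl_const * (Morrey_const r * G) + e"
   using ab(2) cyl_const_pos by (simp add: de_def field_simps)
 qed
 show "c <= Morrey_const r * G * ?q ^ k + 2 * (3 * cyl_const) powr (- 1/2) * 2 ^ k * D"
  if D: "!!k a b. dy_rect k a b <= Rect ==> (LINT x|?M. idc (dy_rect k a b) (cyl x) * \<bar>rh t x - c\<bar>) <= 2 * D * (3 * cyl_const * (1/4)^k) powr (1/2)" for D
 proof (rule field_le_epsilon)
  fix de :: real assume de: "de > 0"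
  obtain a b where ab: "dy_rect k a b <= Rect" "dy_mean Gm k a b <= de + Morrey_const r * G * ?q ^ k" using low[OF de] by blast
  let ?S = "dy_rect k a b"
  define s :: real where "s = (LINT x|?M. idc ?S (cyl x))"
  have s: "s = 3 * cyl_const * (1/4)^k" "s > 0" using dy_rect_lift(2)[OF ab(1)] cyl_const_pos by (auto simp: s_def)
  have Sm: "(idc ?S :: real \<times> real => real) : bmeas borel" by measurable
  have SmC: "(%x. idc ?S (cyl x) :: real) : bmeas ?M" by (rule measurable_compose[OF cyl_measurable_lebesgue Sm])
  have iS: "integrable ?M (%x. idc ?S (cyl x) * rh t x)"
   by (rule integrable_bounded_mult[OF i SmC, of 1]) (simp add: indicator_def)
  have mean: "dy_mean Gm k a b * s = (LINT x|?M. idc ?S (cyl x) * rh t x)"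
  proof -
   have "(%p. idc Rect p * (idc ?S p * Gm p)) = (%p. idc ?S p * Gm p)" using ab(1) by (auto simp: indicator_def fun_eq_iff)
   then show ?thesis using cyl_avgD(2)[OF av Sm iS] by (simp add: dy_mean_def s)
  qed
  have iSc: "integrable ?M (%x. idc ?S (cyl x) * c)" using dy_rect_lift(1)[OF ab(1)] by simp
  have "(c - dy_mean Gm k a b) * s = (LINT x|?M. idc ?S (cyl x) * c - idc ?S (cyl x) * rh t x)"
   using iS iSc mean by (simp add: s_def left_diff_distrib mult.commute)
  also have "... <= (LINT x|?M. idc ?S (cyl x) * \<bar>rh t x - c\<bar>)"
  proof (rule integral_mono)
   show "integrable ?M (%x. idc ?S (cyl x) * c - idc ?S (cyl x) * rh t x)" by (intro Bochner_Integration.integrable_diff iS iSc)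
   then have "integrable ?M (%x. \<bar>indicator ?S (cyl x) * c - idc ?S (cyl x) * rh t x\<bar>)" by (rule integrable_abs)
   moreover have "\<bar>indicator ?S (cyl x) * c - idc ?S (cyl x) * rh t x\<bar> = idc ?S (cyl x) * \<bar>rh t x - c\<bar>" for x
    by (simp add: indicator_def, linarith)
   ultimately show "integrable ?M (%x. idc ?S (cyl x) * \<bar>rh t x - c\<bar>)" by simp
  qed (simp add: indicator_def, linarith)
  also have "... <= 2 * D * s powr (1/2)" using D[OF ab(1)] s by simp
  also have "... = 2 * D * s powr (- 1/2) * s"
  proof -
   have "s powr (1/2) = s powr (- 1/2 + 1)" by simp
   also have "... = s powr (- 1/2) * s" using s(2) by (subst powr_add) simp
   finally show ?thesis by simp
  qed
  finally have "c - dy_mean Gm k a b <= 2 * D * s powr (- 1/2)" using s(2) by simp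
  \<comment> \<open>The area \<open>s\<close> is proportional to 4^-k; a bound of order s^(1/2)
    divided by the area costs s^(-1/2), that is, the factor 2^k.\<close>
  moreover have "s powr (- 1/2) = (3 * cyl_const) powr (- 1/2) * 2 ^ k"
  proof -
   have "((1/4::real)^k) powr (- 1/2) = ((2 powr (- 2)) powr real k) powr (- 1/2)" by (simp add: powr_realpow powr_minus)
   also have "... = 2 powr real k" by (simp only: powr_powr) simp
   also have "... = 2 ^ k" by (simp add: powr_realpow)
   finally show ?thesis unfolding s using cyl_const_pos by (subst powr_mult) auto
  qed
  ultimately show "c <= Morrey_const r * G * ?q ^ k + 2 * (3 * cyl_const) powr (- 1/2) * 2 ^ k * D + de"
   using ab(2) by (simp add: mult_ac)
 qed
qed

text \<open>The decay estimate is available at almost every time only. A good time s slightly after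
  t exists; continuity of the density in L^1 makes the error smaller than \<open>e\<close>, and s >
  t gives exp(- al s) <= exp(- al t). The power 1/2 of the area is 1 - 1/r for r = 2.\<close>

lemma decay_on_rectangles:
 assumes dec: "AE t in lebesgue_on {1..}. Lnorm 2 (%x. rh t x - c) <= ennreal (A * exp (- al * t))" and A: "A > 0" and al: "al > 0"
  and t: "t >= 1" and S: "dy_rect k a b <= Rect"
 shows "(LINT x|cellM. idc (dy_rect k a b) (cyl x) * \<bar>rh t x - c\<bar>) <= 2 * (A * exp (- al * t)) * (3 * cyl_const * (1/4)^k) powr (1/2)"
proof (rule field_le_epsilon)
 let ?M = "cellM" and ?S = "dy_rect k a b"
 fix e :: real assume e: "e > 0"
 have T: "t + 1 > 0" "t : {0..t+1}" "q > 1" using t q by auto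
 have "\<forall>\<^sub>F s in at t within {0..t+1}. dist (LINT x|?M. \<bar>rh s x - rh t x\<bar>) 0 < e"
  by (rule tendstoD[OF in_C_L1(2)[OF regularity(1)[OF T(1)] T(3,2)] e])
 then obtain d where d: "d > 0" "!!s. s : {0..t+1} ==> s ~= t ==> dist s t < d ==> dist (LINT x|?M. \<bar>rh s x - rh t x\<bar>) 0 < e"
  unfolding eventually_at by blast
 have "AE s in lborel. s : {1..} --> Lnorm 2 (%x. rh s x - c) <= ennreal (A * exp (- al * s))"
  by (rule AE_lebesgue_on_imp_lborel[OF dec]) simp
 then obtain s where s: "s : {t<..<t + min d 1}" "s : {1..} --> Lnorm 2 (%x. rh s x - c) <= ennreal (A * exp (- al * s))"
  by (rule AE_lborel_ex_open[of _ "{t<..<t + min d 1}"]) (use d in auto)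
 have s0: "s >= 0" "t >= 0" and L: "Lnorm 2 (%x. rh s x - c) <= ennreal (A * exp (- al * s))" using s t by auto
 have As: "A * exp (- al * s) > 0" using A by simp
 have l: "(%x. rh s x - c) : bmeas ?M" "integrable ?M (%x. \<bar>rh s x - c\<bar> powr 2)"
  "(LINT x|?M. \<bar>rh s x - c\<bar> powr 2) <= (A * exp (- al * s)) powr 2"
  using Lnorm_leD[OF L] As by auto
 have i: "integrable ?M (rh s)" "integrable ?M (rh t)" by (rule density_integrable[OF s0(1)] density_integrable[OF s0(2)])+
 have ic: "integrable ?M (%x. \<bar>rh s x - c\<bar>)" "integrable ?M (%x. \<bar>rh t x - c\<bar>)"
  using Cell_integral_one(1) i by (auto intro!: integrable_abs Bochner_Integration.integrable_diff integrable_mult_right[where c = c, of _ "%_. 1", simplified])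
 have Sm: "(idc ?S :: real \<times> real => real) : bmeas borel" by measurable
 have SmC: "(%x. idc ?S (cyl x) :: real) : bmeas ?M" by (rule measurable_compose[OF cyl_measurable_lebesgue Sm])
 have iS: "integrable ?M (%x. idc ?S (cyl x) * \<bar>rh s x - c\<bar>)" "integrable ?M (%x. idc ?S (cyl x) * \<bar>rh t x - c\<bar>)"
  by (rule integrable_bounded_mult[OF ic(1) SmC, of 1] integrable_bounded_mult[OF ic(2) SmC, of 1], simp add: indicator_def)+
 have id: "integrable ?M (%x. \<bar>rh s x - rh t x\<bar>)" by (intro integrable_abs Bochner_Integration.integrable_diff i)
 have "(LINT x|?M. idc ?S (cyl x) * \<bar>rh t x - c\<bar>) <= (LINT x|?M. idc ?S (cyl x) * \<bar>rh s x - c\<bar> + \<bar>rh s x - rh t x\<bar>)"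
  by (rule integral_mono[OF iS(2) integrable_plus[OF iS(1) id]]) (simp add: indicator_def, linarith)
 also have "... = (LINT x|?M. idc ?S (cyl x) * \<bar>rh s x - c\<bar>) + (LINT x|?M. \<bar>rh s x - rh t x\<bar>)" using iS(1) id by simp
 also have "(LINT x|?M. \<bar>rh s x - rh t x\<bar>) <= e"
 proof -
  have "s : {0..t+1}" "s ~= t" "dist s t < d" using s t by (auto simp: dist_real_def min_def split: if_splits)
  from d(2)[OF this] show ?thesis by (simp add: dist_real_def)
 qed
 also have "(LINT x|?M. idc ?S (cyl x) * \<bar>rh s x - c\<bar>) <= 2 * (A * exp (- al * s)) * (3 * cyl_const * (1/4)^k) powr (1 - 1/2)"
  by (rule integral_on_set_le_Lr[OF _ l As _ dy_rect_lift[OF S]]) (use cyl_const_pos in \<open>auto simp: indicator_def\<close>)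
 also have "... <= 2 * (A * exp (- al * t)) * (3 * cyl_const * (1/4)^k) powr (1/2)"
  using A s al by (auto intro!: mult_right_mono mult_left_mono)
 finally show "(LINT x|?M. idc ?S (cyl x) * \<bar>rh t x - c\<bar>) <= 2 * (A * exp (- al * t)) * (3 * cyl_const * (1/4)^k) powr (1/2) + e" by simp
qed

end

text \<open>The real scale \<open>x\<close> makes the error C2 x A exp(- al t) equal to c / 2. The
  largest power 2^k <= x keeps the error below c / 2 and is at least x / 2, which costs a factor 2
  in the scale and makes the constant 2 E = 4 C2 A / c. For x < 1 there is no such k, but then (x /
  2)^s <= 1 and \<open>h0\<close> suffices.\<close>

lemma dyadic_scale_choice:
 fixes c M C2 A al s G t :: real
 assumes pos: "c > 0" "M > 0" "C2 > 0" "A > 0" "s > 0"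
  and h0: "c <= M * G" and hk: "!!k::nat. c <= M * G * ((1/2) powr s) ^ k + C2 * 2 ^ k * (A * exp (- al * t))"
 shows "c / (2 * M) * (4 * C2 * A / c) powr (- s) * exp (al * s * t) <= G"
proof -
 define E where "E = 2 * C2 * A / c"
 have E: "E > 0" using pos by (simp add: E_def)
 define x where "x = exp (al * t) / E"
 have x: "x > 0" using E by (simp add: x_def)
 have ex: "exp (al * s * t) = (x * E) powr s" using E by (simp add: x_def powr_def mult_ac)
 have main: "(x / 2) powr s * (c / (2 * M)) <= G"
 proof (cases "x < 1")
  case True
  then have "(x / 2) powr s <= 1" using x pos by (intro powr_le1) auto
  then have "(x / 2) powr s * (c / (2 * M)) <= 1 * (c / M)" using pos by (intro mult_mono) (auto simp: field_simps)
  also have "... <= G" using h0 pos by (simp add: field_simps)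
  finally show ?thesis .
 next
  case False
  define k where "k = nat \<lfloor>log 2 x\<rfloor>"
  have l0: "log 2 x >= 0" using False by simp
  have kb: "real k <= log 2 x" "log 2 x < real k + 1" using l0 by (auto simp: k_def)
  have k1: "2 ^ k <= x"
  proof -
   have "2 powr real k <= 2 powr (log 2 x)" using kb(1) by simp
   then show ?thesis using x by (simp add: powr_realpow)
  qed
  have k2: "x / 2 <= 2 ^ k"
  proof -
   have "2 powr (log 2 x) <= 2 powr (real k + 1)" using kb(2) by simp
   then show ?thesis using x by (simp add: powr_add powr_realpow)
  qed
  have "C2 * 2 ^ k * (A * exp (- al * t)) <= C2 * x * (A * exp (- al * t))"
   using k1 pos by (intro mult_right_mono mult_left_mono) auto
  also have "... = c / 2" using pos E by (simp add: x_def E_def exp_minus field_simps)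
  finally have "c / 2 <= M * G * ((1/2) powr s) ^ k" using hk[of k] by linarith
  also have "((1/2) powr s) ^ k = 1 / (2 ^ k) powr s"
  proof -
   have "((1/2::real) powr s) ^ k = (1/2) powr (s * real k)" by (simp add: powr_realpow[symmetric] powr_powr)
   also have "... = 1 / (2 powr (real k * s))" by (simp add: powr_divide mult.commute)
   also have "2 powr (real k * s) = (2 ^ k) powr s" by (simp add: powr_powr[symmetric] powr_realpow)
   finally show ?thesis .
  qed
  finally have "c / 2 * (2 ^ k) powr s <= M * G" by (simp add: field_simps)
  moreover have "(x / 2) powr s <= (2 ^ k) powr s" using k2 x pos by (intro powr_mono2) auto
  ultimately have "c / 2 * (x / 2) powr s <= M * G" using pos by (auto intro: order_trans[OF mult_left_mono])
  then show ?thesis using pos by (simp add: field_simps)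
 qed
 have h: "4 * C2 * A / c = 2 * E" by (simp add: E_def)
 have h2: "2 * E * (x / 2) = x * E" by simp
 have "c / (2 * M) * (4 * C2 * A / c) powr (- s) * exp (al * s * t) = c / (2 * M) * ((2 * E) powr (- s) * ((2 * E) * (x / 2)) powr s)"
  unfolding h ex h2 by (simp only: mult.assoc)
 also have "(2 * E) powr (- s) * ((2 * E) * (x / 2)) powr s = (x / 2) powr s"
  using E x by (subst powr_mult) (auto simp: powr_minus field_simps)
 finally have eq: "c / (2 * M) * (4 * C2 * A / c) powr (- s) * exp (al * s * t) = c / (2 * M) * (x / 2) powr s" .
 show ?thesis unfolding eq using main by (simp only: mult.commute)
qed

section \<open>Growth of the gradient\<close>

lemma measure_Cell: "measure lebesgue Cell = 3 * cyl_const"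
 using Cell_integral_one(2) by (simp add: measure_restrict_space)

lemma integral_eq_Lnorm_1:
 fixes f :: "real^3 => real"
 assumes i: "integrable (cellM) f" and nn: "AE x in cellM. 0 <= f x"
 shows "(LINT x|cellM. f x) = enn2real (Lnorm 1 f)"
proof -
 have m: "f : bmeas (cellM)" using i by auto
 have "(\<integral>\<^sup>+ x. ennreal (norm (f x) powr 1) \<partial>cellM) = (\<integral>\<^sup>+ x. ennreal (f x) \<partial>cellM)"
  by (rule nn_integral_cong_AE) (use nn in \<open>auto elim!: eventually_mono\<close>)
 also have "... = ennreal (LINT x|cellM. f x)" by (rule nn_integral_eq_integral[OF i nn])
 finally have "Lnorm 1 f = ennreal (LINT x|cellM. f x)"
  using m integral_nonneg_AE[OF nn] by (simp add: Lnorm_def epowr_def)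
 then show ?thesis using integral_nonneg_AE[OF nn] by simp
qed

theorem theorem1p3:
  fixes \<beta> \<gamma> \<mu> \<alpha>0 r :: real
    and K :: "real^3 \<Rightarrow> real^3^3"
    and Nu Ninf N1 :: ennreal
  assumes "\<beta> > 4/3" and "\<gamma> > 1" and "\<mu> > 0"
    and "friction_matrix K"
    and "decay_rate 2 \<gamma> \<beta> \<mu> K Ninf Nu \<alpha>0"
    and "r > 2"
  shows "\<exists>C::real. C > 0 \<and>
    (\<forall>q \<rho>0 u0 m0 \<rho> u.
       q > 3 \<and> initial_data K q \<rho>0 u0 \<and> m0 = (\<lambda>x. \<rho>0 x *\<^sub>R u0 x) \<and>
       Wnorm 1 2 u0 = Nu \<and> Linf_norm \<rho>0 = Ninf \<and> Lnorm 1 \<rho>0 = N1 \<and>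
       \<not> (AE x in lebesgue_on Omega. \<rho>0 x = 0) \<and>
       (\<exists>x0\<in>Omega. vanishes_at \<rho>0 x0) \<and>
       strong_solution \<gamma> \<beta> \<mu> K q \<rho>0 m0 \<rho> u \<longrightarrow>
       (\<forall>t\<ge>1. ennreal (C * exp (\<alpha>0 * ((r - 2) / r) * t)) \<le> Lnorm r (grad (\<rho> t))))"
proof -
  note r = \<open>r > 2\<close>
  obtain A where A: "A > 0" "\<And>q \<rho>0 u0 \<rho> u. q > 3 \<and> initial_data K q \<rho>0 u0 \<and> Linf_norm \<rho>0 = Ninf \<and> Wnorm 1 2 u0 = Nu \<and>
        strong_solution \<gamma> \<beta> \<mu> K q \<rho>0 (\<lambda>x. \<rho>0 x *\<^sub>R u0 x) \<rho> u \<longrightarrow>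
        (AE t in lebesgue_on {1..}. Lnorm 2 (\<lambda>x. \<rho> t x - mean \<rho>0) + Lnorm 2 (jacobian (u t)) \<le> ennreal (A * exp (- \<alpha>0 * t)))"
    and \<alpha>: "\<alpha>0 > 0"
    using assms(5) unfolding decay_rate_def by blast
  \<comment> \<open>The mean density, which has to be fixed from \<open>N1\<close> before any
    solution is given. The value 1 keeps the constant positive when \<open>enn2real N1\<close> is 0;
    \<open>Np\<close> shows that no admissible data belong to that case.\<close>
  define c where "c = (if enn2real N1 > 0 then enn2real N1 / (3 * cyl_const) else 1)"
  define M where "M = Morrey_const r"
  define C2 where "C2 = 2 * (3 * cyl_const) powr (- 1/2)"
  define s where "s = 1 - 2 / r"
  have pos: "c > 0" "M > 0" "C2 > 0" "s > 0" using cyl_const_pos Morrey_const_pos[OF r] r by (auto simp: c_def M_def C2_def s_def)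
  define C where "C = c / (2 * M) * (4 * C2 * A / c) powr (- s)"
  have Cpos: "C > 0" using pos A by (simp add: C_def)
  show ?thesis
  proof (intro exI[of _ C] conjI Cpos allI impI)
    fix q \<rho>0 u0 m0 \<rho> u t
    assume hyp: "q > 3 \<and> initial_data K q \<rho>0 u0 \<and> m0 = (\<lambda>x. \<rho>0 x *\<^sub>R u0 x) \<and>
       Wnorm 1 2 u0 = Nu \<and> Linf_norm \<rho>0 = Ninf \<and> Lnorm 1 \<rho>0 = N1 \<and>
       \<not> (AE x in lebesgue_on Omega. \<rho>0 x = 0) \<and>
       (\<exists>x0\<in>Omega. vanishes_at \<rho>0 x0) \<and>
       strong_solution \<gamma> \<beta> \<mu> K q \<rho>0 m0 \<rho> u" and t: "1 \<le> (t::real)"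
    interpret strong_sol \<gamma> \<beta> \<mu> q K \<rho>0 m0 \<rho> u by unfold_locales (use hyp in auto)
    obtain x0 where x0: "x0 \<in> Omega" "vanishes_at \<rho>0 x0" using hyp by blast
    have per: "periodic_z \<rho>0" using hyp by (simp add: initial_data_def)
    have ae0: "AE x in lebesgue_on Cell. \<rho> 0 x = \<rho>0 x" by (rule AE_Omega_Cell[OF basic(6)])
    have i0: "integrable (lebesgue_on Cell) (\<rho> 0)" by (rule density_integrable) simp
    have m0m: "\<rho> 0 \<in> borel_measurable (lebesgue_on Cell)" using i0 by auto
    have \<rho>0m: "\<rho>0 \<in> borel_measurable (lebesgue_on Cell)" by (rule bmeas_cong_AE[OF Cell_lebesgue m0m ae0])
    have i\<rho>0: "integrable (lebesgue_on Cell) \<rho>0"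
      by (rule integrable_cong_AE_imp[OF i0 \<rho>0m]) (use ae0 in \<open>auto elim: eventually_mono\<close>)
    have nn0: "AE x in lebesgue_on Cell. 0 \<le> \<rho>0 x" using nonneg_Cell[OF order_refl] ae0 by eventually_elim simp
    have I0: "(\<integral>x. \<rho> 0 x \<partial>lebesgue_on Cell) = (\<integral>x. \<rho>0 x \<partial>lebesgue_on Cell)" by (rule integral_cong_AE[OF m0m \<rho>0m ae0])
    have IN: "(\<integral>x. \<rho>0 x \<partial>lebesgue_on Cell) = enn2real N1" using integral_eq_Lnorm_1[OF i\<rho>0 nn0] hyp by simp
    \<comment> \<open>Zero mass would make the initial density vanish on the cell and, by integer
      shifts, on all of \<open>Omega\<close>, against the assumed nontriviality.\<close>
    have Np: "enn2real N1 > 0"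
    proof (rule ccontr)
      assume "\<not> enn2real N1 > 0"
      then have "(\<integral>x. \<rho>0 x \<partial>lebesgue_on Cell) = 0" using IN enn2real_nonneg[of N1] by simp
      then have z: "AE x in lebesgue_on Cell. \<rho>0 x = 0" using integral_nonneg_eq_0_iff_AE[OF i\<rho>0 nn0] by simp
      have "AE x in lebesgue. x \<in> Omega \<longrightarrow> \<rho>0 x = 0"
      proof -
        have C0: "AE x in lebesgue. x \<in> Cell \<longrightarrow> \<rho>0 x = 0" using z by (simp add: AE_restrict_space_iff)
        have "AE x in lebesgue. \<forall>k::int. x + axis 3 (of_int k) \<in> Cell \<longrightarrow> \<rho>0 (x + axis 3 (of_int k)) = 0"
          unfolding AE_all_countable using AE_lebesgue_shift[OF C0] by blast
        then show ?thesis
        proof eventually_elim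
          case (elim x)
          show ?case
          proof
            assume x: "x \<in> Omega"
            have "x + axis 3 (of_int (- \<lfloor>x $ 3\<rfloor>)) \<in> Cell"
              using x by (auto simp: Cell_def Omega_def axis_def) linarith+
            then have "\<rho>0 (x + axis 3 (of_int (- \<lfloor>x $ 3\<rfloor>))) = 0" using elim by blast
            then show "\<rho>0 x = 0" using periodic_z_int[OF per x] by metis
          qed
        qed
      qed
      then have "AE x in lebesgue_on Omega. \<rho>0 x = 0" using open_Omega by (simp add: AE_restrict_space_iff borel_open)
      then show False using hyp by blast
    qed
    have cm: "mean \<rho>0 = c" using Np IN by (simp add: mean_def c_def measure_Cell)
    have mass: "(\<integral>x. \<rho> t x \<partial>lebesgue_on Cell) = 3 * cyl_const * c"
      using mass_conservation[of t] t I0 IN Np cyl_const_pos by (simp add: c_def)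
    have "AE t in lebesgue_on {1..}. Lnorm 2 (\<lambda>x. \<rho> t x - mean \<rho>0) + Lnorm 2 (jacobian (u t)) \<le> ennreal (A * exp (- \<alpha>0 * t))"
      using A(2)[of q \<rho>0 u0 \<rho> u] hyp by blast
    then have dec: "AE t in lebesgue_on {1..}. Lnorm 2 (\<lambda>x. \<rho> t x - c) \<le> ennreal (A * exp (- \<alpha>0 * t))"
      unfolding cm by eventually_elim (auto intro: order_trans[rotated] simp: add_increasing2)
    have t0: "t > 0" using t by simp
    \<comment> \<open>The estimates are run with a positive real bound \<open>G\<close>, while the
      norm could a priori be 0; at the end \<open>G\<close> is taken as the norm plus an arbitrary
      positive number.\<close>
    have main: "C * exp (\<alpha>0 * s * t) \<le> G" if G: "G > 0" "Lnorm r (grad (\<rho> t)) \<le> ennreal G" for G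
    proof -
      have vac: "\<not> (AE x in lebesgue_on Cell. \<delta> \<le> \<rho> t x)" if "\<delta> > 0" for \<delta>
        by (rule vacuum_persists[OF per x0(2,1) t0 that])
      have h0: "c \<le> M * G"
        using gradient_lower_bound(1)[OF t0 r G vac] cyl_const_pos unfolding mass M_def by simp
      have hk: "c \<le> M * G * ((1/2) powr s) ^ k + C2 * 2 ^ k * (A * exp (- \<alpha>0 * t))" for k
        unfolding M_def s_def C2_def
        by (rule gradient_lower_bound(2)[OF t0 r G vac], assumption, rule decay_on_rectangles[OF dec A(1) \<alpha> t])
      show ?thesis unfolding C_def by (rule dyadic_scale_choice[OF pos(1-3) A(1) pos(4) h0 hk])
    qed
    have sr: "(r - 2) / r = s" using r by (simp add: s_def field_simps)
    show "ennreal (C * exp (\<alpha>0 * ((r - 2) / r) * t)) \<le> Lnorm r (grad (\<rho> t))"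
    proof (cases "Lnorm r (grad (\<rho> t))")
      case (real n)
      have "C * exp (\<alpha>0 * s * t) \<le> n"
      proof (rule field_le_epsilon)
        fix e :: real assume "e > 0"
        then show "C * exp (\<alpha>0 * s * t) \<le> n + e" by (intro main) (use real in \<open>auto intro: ennreal_leI\<close>)
      qed
      then show ?thesis unfolding sr real(2) by (rule ennreal_leI)
    qed simp
  qed
qed

end
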